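(* Let $\mathbb K\in\{\mathbb R,\mathbb C\}$ and let $X$ be a $\mathbb K$-Banach space with $\dim_{\mathbb K}X>1$. Let $\mathcal I(X)$ be the set of idempotents in $\mathcal L(X)\setminus\{0,I\}$, let $\mathscr G(X)$ be the Grassmann manifold of $X$, and let $\kappa:\mathcal I(X)\to\mathscr G(X)$ be given by $\kappa(Q):=Q(X)$. (a) Under the $\mathbb K$-analytic Banach submanifold structure on $\mathcal I(X)$ induced from $\mathcal L(X)$, the triple $(\mathcal I(X),\mathscr G(X),\kappa)$ is a locally trivial $\mathbb K$-analytic affine-Banach bundle, such that the affine-Banach space structures on the fibers $\kappa^{-1}(E)$ ($E\in\mathscr G(X)$) are the ones induced from $\mathcal L(X)$ (in particular each fiber is a $\mathbb K$-affine-Banach subspace of $\mathcal L(X)$). (b) There exist equivalent $\mathbb K$-Banach space structures on the fibers of $\kappa$ under which $(\mathcal I(X),\mathscr G(X),\kappa)$ becomes a locally trivial continuous $\mathbb K$-Banach bundle. (c) If $\mathbb K=\mathbb C$, there do not exist Banach space structures on the fibers of $\kappa$ such that $(\mathcal I(X),\mathscr G(X),\kappa)$ becomes a locally trivial complex analytic Banach bundle.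
   Context: **Grassmann manifold and idempotents.** $\mathcal L(X,Y)$ is the Banach space of bounded $\mathbb K$-linear operators, $\mathcal L(X)=\mathcal L(X,X)$, $I$ is the identity. $\mathscr G(X)$ is the set of all non-zero proper closed complemented subspaces of $X$. For $E\in\mathscr G(X)$, $\mathcal C_E$ is the set of all closed complements of $E$ in $X$. For $E\in\mathscr G(X)$, $F\in\mathcal C_E$, the map $q_{E,F}:\mathcal L(E,F)\to\mathcal C_F$, $q_{E,F}(T)=(I+T)(E)=\{x+Tx:x\in E\}$, is a bijection; put $p_{E,F}=q_{E,F}^{-1}$. $\mathscr G(X)$ carries a Hausdorff metrizable topology in which each $\mathcal C_F$ is open and each $p_{E,F}:\mathcal C_F\to\mathcal L(E,F)$ is a homeomorphism, and the charts $(\mathcal C_F,p_{E,F},\mathcal L(E,F))$ form a $\mathbb K$-analytic atlas; with this structure $\mathscr G(X)$ is the Grassmann manifold. $\mathcal I(X)=\{Q\in\mathcal L(X)\setminus\{0,I\}:Q^2=Q\}$ with the norm topology. It is a $\mathbb K$-analytic Banach submanifold of $\mathcal L(X)$ (i.e. locally given, in suitable analytic charts of $\mathcal L(X)$, by a complemented closed subspace). Analytic means having local power series expansions. **Affine notions.** A subset $A$ of a $\mathbb K$-Banach space is a $\mathbb K$-affine-Banach subspace if $A-a_0$ is a closed linear subspace for one (equivalently every) $a_0\in A$. A map $S$ from $A$ to a Banach space $Y$ is $\mathbb K$-affine if $S^{a_0}:a-a_0\mapsto S(a)-S(a_0)$ is $\mathbb K$-linear on $A-a_0$. For an affine-Banach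 subspace $B\subseteq Y$, $\mathcal A(A,B)$ is the set of continuous $\mathbb K$-affine maps $A\to B$, regarded as an affine-Banach subspace of the Banach space of continuous affine maps $A\to Y$ with norm $\|T\|_{a_0}=\|T^{a_0}\|+\|T(a_0)\|$ (different $a_0$ give equivalent norms). **Bundles.** Let $\kappa:\Upsilon\to\Omega$ be a continuous surjection between Hausdorff spaces. $(\Upsilon,\Omega,\kappa)$ is a locally trivial continuous $\mathbb K$-affine-Banach bundle (respectively, $\mathbb K$-Banach bundle) if: (B1) each fiber $\Upsilon_\omega=\kappa^{-1}(\omega)$ is homeomorphic to (and carries the structure of) a $\mathbb K$-affine-Banach subspace of a $\mathbb K$-Banach space (respectively, a $\mathbb K$-Banach space); (B2) for each $\omega_0\in\Omega$ there are an open neighborhood $V_{\omega_0}$ of $\omega_0$ and a bi-continuous bijection $\Theta_{\omega_0}:V_{\omega_0}\times\Upsilon_{\omega_0}\to\kappa^{-1}(V_{\omega_0})$ such that for every $\omega\in V_{\omega_0}$, $\Theta_{\omega_0}|_{\{\omega\}\times\Upsilon_{\omega_0}}$ is a $\mathbb K$-affine (respectively, $\mathbb K$-linear) map onto $\Upsilon_\omega$; (B3) whenever $V_{\omega_1}\cap V_{\omega_2}\neq\emptyset$, the map $\varphi:V_{\omega_1}\cap V_{\omega_2}\to\mathcal A(\Upsilon_{\omega_1},\Upsilon_{\omega_2})$, $\varphi(\omega)(x)=\Pi_2(\Theta_{\omega_2}^{-1}\circ\Theta_{\omega_1}(\omega,x))$, is continuous, where $\Pi_2$ is the projection onto the second coordinate.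 If $\Omega,\Upsilon$ are $\mathbb K$-analytic Banach manifolds, the bundle is a locally trivial $\mathbb K$-analytic (affine-)Banach bundle if $\kappa$ is $\mathbb K$-analytic and (B1)–(B3) hold with "bi-continuous", "continuous" in (B2), (B3) replaced by "$\mathbb K$-bi-analytic", "$\mathbb K$-analytic". In (b), "equivalent Banach space structures" means Banach space structures on the fibers that are isometrically affine isomorphic, via the identity map of the fiber, to the affine-Banach space structures induced from $\mathcal L(X)$ (i.e. a choice of origin in each fiber). *)

theory Defs
  imports "HOL-Analysis.Analysis"
begin

section \<open>Banach spaces with explicit carrier\<close>

text \<open>
  Model spaces of charts and fibres of bundles are families of Banach spaces over the scalar
  field \<open>'k\<close> (which is instantiated to \<^typ>\<open>real\<close> and \<^typ>\<open>complex\<close>), so they are represented by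
  records rather than by types.
\<close>

record ('k, 'v) bspace =
  bcarrier :: "'v set"
  bzero :: 'v
  badd :: "'v \<Rightarrow> 'v \<Rightarrow> 'v"
  bscale :: "'k \<Rightarrow> 'v \<Rightarrow> 'v"
  bnorm :: "'v \<Rightarrow> real"

definition bdiff :: "('k::real_normed_field, 'v) bspace \<Rightarrow> 'v \<Rightarrow> 'v \<Rightarrow> 'v" where
  "bdiff V x y = badd V x (bscale V (- 1) y)"

text \<open>
  The locale \<^locale>\<open>Metric_space\<close> requires non-negativity and symmetry outside the carrier as well,
  hence the default value.
\<close>

definition bdist :: "('k::real_normed_field, 'v) bspace \<Rightarrow> 'v \<Rightarrow> 'v \<Rightarrow> real" where
  "bdist V x y = (if x \<in> bcarrier V \<and> y \<in> bcarrier V then bnorm V (bdiff V x y) else 0)"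

definition btop :: "('k::real_normed_field, 'v) bspace \<Rightarrow> 'v topology" where
  "btop V = Metric_space.mtopology (bcarrier V) (bdist V)"

locale banach_space =
  fixes V :: "('k::real_normed_field, 'v) bspace"
  assumes zero_closed: "bzero V \<in> bcarrier V"
    and add_closed: "\<lbrakk>x \<in> bcarrier V; y \<in> bcarrier V\<rbrakk> \<Longrightarrow> badd V x y \<in> bcarrier V"
    and scale_closed: "x \<in> bcarrier V \<Longrightarrow> bscale V c x \<in> bcarrier V"
    and add_assoc: "\<lbrakk>x \<in> bcarrier V; y \<in> bcarrier V; z \<in> bcarrier V\<rbrakk>
          \<Longrightarrow> badd V (badd V x y) z = badd V x (badd V y z)"
    and add_commute: "\<lbrakk>x \<in> bcarrier V; y \<in> bcarrier V\<rbrakk> \<Longrightarrow> badd V x y = badd V y x"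
    and add_zero: "x \<in> bcarrier V \<Longrightarrow> badd V x (bzero V) = x"
    and diff_self: "x \<in> bcarrier V \<Longrightarrow> bdiff V x x = bzero V"
    and scale_add: "\<lbrakk>x \<in> bcarrier V; y \<in> bcarrier V\<rbrakk>
          \<Longrightarrow> bscale V c (badd V x y) = badd V (bscale V c x) (bscale V c y)"
    and add_scale: "x \<in> bcarrier V \<Longrightarrow> bscale V (c + d) x = badd V (bscale V c x) (bscale V d x)"
    and scale_scale: "x \<in> bcarrier V \<Longrightarrow> bscale V c (bscale V d x) = bscale V (c * d) x"
    and scale_one: "x \<in> bcarrier V \<Longrightarrow> bscale V 1 x = x"
    and norm_nonneg: "x \<in> bcarrier V \<Longrightarrow> 0 \<le> bnorm V x"
    and norm_eq_zero: "x \<in> bcarrier V \<Longrightarrow> bnorm V x = 0 \<longleftrightarrow> x = bzero V"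
    and norm_scale: "x \<in> bcarrier V \<Longrightarrow> bnorm V (bscale V c x) = norm c * bnorm V x"
    and norm_triangle: "\<lbrakk>x \<in> bcarrier V; y \<in> bcarrier V\<rbrakk>
          \<Longrightarrow> bnorm V (badd V x y) \<le> bnorm V x + bnorm V y"
    and complete: "Metric_space.mcomplete (bcarrier V) (bdist V)"

text \<open>The space \<open>V\<close> restricted to a linear subspace \<open>S\<close>.\<close>

definition bsub :: "('k, 'v) bspace \<Rightarrow> 'v set \<Rightarrow> ('k, 'v) bspace" where
  "bsub V S = V\<lparr>bcarrier := S\<rparr>"

definition prod_bspace :: "('k, 'v) bspace \<Rightarrow> ('k, 'w) bspace \<Rightarrow> ('k, 'v \<times> 'w) bspace" where
  "prod_bspace V W =
     \<lparr>bcarrier = bcarrier V \<times> bcarrier W,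
      bzero = (bzero V, bzero W),
      badd = (\<lambda>(x, y) (x', y'). (badd V x x', badd W y y')),
      bscale = (\<lambda>c (x, y). (bscale V c x, bscale W c y)),
      bnorm = (\<lambda>(x, y). max (bnorm V x) (bnorm W y))\<rparr>"

definition closed_lin_subspace :: "('k::real_normed_field, 'v) bspace \<Rightarrow> 'v set \<Rightarrow> bool" where
  "closed_lin_subspace V S \<longleftrightarrow>
     S \<subseteq> bcarrier V \<and> bzero V \<in> S \<and> (\<forall>x\<in>S. \<forall>y\<in>S. badd V x y \<in> S) \<and>
     (\<forall>c. \<forall>x\<in>S. bscale V c x \<in> S) \<and> closedin (btop V) S"

definition closed_complements :: "('k::real_normed_field, 'v) bspace \<Rightarrow> 'v set \<Rightarrow> 'v set set" where
  "closed_complements V E =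
     {F. closed_lin_subspace V F \<and> E \<inter> F = {bzero V} \<and>
         {badd V x y | x y. x \<in> E \<and> y \<in> F} = bcarrier V}"

definition is_linear ::
    "('k, 'v) bspace \<Rightarrow> ('k, 'w) bspace \<Rightarrow> ('v \<Rightarrow> 'w) \<Rightarrow> bool" where
  "is_linear V W T \<longleftrightarrow>
     T ` bcarrier V \<subseteq> bcarrier W \<and>
     (\<forall>x\<in>bcarrier V. \<forall>y\<in>bcarrier V. T (badd V x y) = badd W (T x) (T y)) \<and>
     (\<forall>c. \<forall>x\<in>bcarrier V. T (bscale V c x) = bscale W c (T x))"

text \<open>Bounded linear operators from \<open>V\<close> to \<open>W\<close> with the operator norm.\<close>

definition blin :: "('k, 'v) bspace \<Rightarrow> ('k, 'w) bspace \<Rightarrow> ('k, 'v \<Rightarrow> 'w) bspace" where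
  "blin V W =
     \<lparr>bcarrier = {T \<in> extensional (bcarrier V).
                    is_linear V W T \<and> (\<exists>C. \<forall>x\<in>bcarrier V. bnorm W (T x) \<le> C * bnorm V x)},
      bzero = (\<lambda>x\<in>bcarrier V. bzero W),
      badd = (\<lambda>S T. \<lambda>x\<in>bcarrier V. badd W (S x) (T x)),
      bscale = (\<lambda>c T. \<lambda>x\<in>bcarrier V. bscale W c (T x)),
      bnorm = (\<lambda>T. Sup {bnorm W (T x) | x. x \<in> bcarrier V \<and> bnorm V x \<le> 1})\<rparr>"


section \<open>Affine-Banach subspaces and affine maps\<close>

definition translate :: "('k::real_normed_field, 'v) bspace \<Rightarrow> 'v set \<Rightarrow> 'v \<Rightarrow> 'v set" where
  "translate V A a0 = (\<lambda>a. bdiff V a a0) ` A"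

definition affine_subspace :: "('k::real_normed_field, 'v) bspace \<Rightarrow> 'v set \<Rightarrow> bool" where
  "affine_subspace V A \<longleftrightarrow>
     A \<subseteq> bcarrier V \<and> (\<exists>a0\<in>A. closed_lin_subspace V (translate V A a0))"

text \<open>The map \<open>a - a0 \<mapsto> S a - S a0\<close>.\<close>

definition lin_part ::
    "('k::real_normed_field, 'v) bspace \<Rightarrow> ('k, 'w) bspace \<Rightarrow> 'v \<Rightarrow> ('v \<Rightarrow> 'w) \<Rightarrow> 'v \<Rightarrow> 'w" where
  "lin_part V W a0 S h = bdiff W (S (badd V h a0)) (S a0)"

definition affine_map ::
    "('k::real_normed_field, 'v) bspace \<Rightarrow> 'v set \<Rightarrow> ('k, 'w) bspace \<Rightarrow> 'w set \<Rightarrow> ('v \<Rightarrow> 'w) \<Rightarrow> bool"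
  where
  "affine_map V A W B S \<longleftrightarrow>
     S ` A \<subseteq> B \<and> (\<forall>a0\<in>A. is_linear (bsub V (translate V A a0)) W (lin_part V W a0 S))"

text \<open>Continuous affine maps \<open>A \<rightarrow> W\<close> with the norm determined by the base point \<open>a0 \<in> A\<close>.\<close>

definition baff ::
    "('k::real_normed_field, 'v) bspace \<Rightarrow> 'v set \<Rightarrow> 'v \<Rightarrow> ('k, 'w) bspace \<Rightarrow> ('k, 'v \<Rightarrow> 'w) bspace"
  where
  "baff V A a0 W =
     \<lparr>bcarrier = {S \<in> extensional A. affine_map V A W (bcarrier W) S \<and>
                    continuous_map (subtopology (btop V) A) (btop W) S},
      bzero = (\<lambda>x\<in>A. bzero W),
      badd = (\<lambda>S T. \<lambda>x\<in>A. badd W (S x) (T x)),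
      bscale = (\<lambda>c T. \<lambda>x\<in>A. bscale W c (T x)),
      bnorm = (\<lambda>T. bnorm (blin (bsub V (translate V A a0)) W) (lin_part V W a0 T) + bnorm W (T a0))\<rparr>"

definition affine_maps ::
    "('k::real_normed_field, 'v) bspace \<Rightarrow> 'v set \<Rightarrow> ('k, 'w) bspace \<Rightarrow> 'w set \<Rightarrow> ('v \<Rightarrow> 'w) set" where
  "affine_maps V A W B =
     {S \<in> extensional A. affine_map V A W B S \<and>
        continuous_map (subtopology (btop V) A) (btop W) S}"


section \<open>Analytic maps and analytic Banach manifolds\<close>

text \<open>\<open>n\<close>-linear maps are given on argument lists of length \<open>n\<close>.\<close>

definition multilinear_on ::
    "('k, 'v) bspace \<Rightarrow> ('k, 'w) bspace \<Rightarrow> nat \<Rightarrow> ('v list \<Rightarrow> 'w) \<Rightarrow> bool" where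
  "multilinear_on V W n m \<longleftrightarrow>
     (\<forall>xs. length xs = n \<and> set xs \<subseteq> bcarrier V \<longrightarrow>
        m xs \<in> bcarrier W \<and> (\<forall>i<n. is_linear V W (\<lambda>x. m (xs[i := x]))))"

primrec partial_sum :: "('k, 'v) bspace \<Rightarrow> (nat \<Rightarrow> 'v) \<Rightarrow> nat \<Rightarrow> 'v" where
  "partial_sum V f 0 = bzero V"
| "partial_sum V f (Suc n) = badd V (partial_sum V f n) (f n)"

text \<open>
  Local expansions \<open>f (x + h) = (\<Sum>n. m n (h, \<dots>, h))\<close> into bounded \<open>n\<close>-linear terms with positive
  radius of convergence. The set \<open>U\<close> is forced to be open.
\<close>

definition banach_analytic_on ::
    "('k::real_normed_field, 'v) bspace \<Rightarrow> ('k, 'w) bspace \<Rightarrow> 'v set \<Rightarrow> ('v \<Rightarrow> 'w) \<Rightarrow> bool" where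
  "banach_analytic_on V W U f \<longleftrightarrow>
     U \<subseteq> bcarrier V \<and>
     (\<forall>x\<in>U. \<exists>r>0. \<exists>C m.
        (\<forall>n. multilinear_on V W n (m n) \<and>
             (\<forall>xs. length xs = n \<and> set xs \<subseteq> bcarrier V \<longrightarrow>
                bnorm W (m n xs) * r ^ n \<le> C * prod_list (map (bnorm V) xs))) \<and>
        (\<forall>h\<in>bcarrier V. bnorm V h < r \<longrightarrow>
             badd V x h \<in> U \<and>
             limitin (btop W) (partial_sum W (\<lambda>n. m n (replicate n h))) (f (badd V x h)) sequentially))"

type_synonym ('k, 'm, 'v) chart = "'m set \<times> ('m \<Rightarrow> 'v) \<times> ('k, 'v) bspace"

record ('k, 'm, 'v) manifold =
  mtop :: "'m topology"
  atlas :: "('k, 'm, 'v) chart set"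

fun is_chart :: "'m topology \<Rightarrow> ('k::real_normed_field, 'm, 'v) chart \<Rightarrow> bool" where
  "is_chart T (U, \<phi>, V) \<longleftrightarrow>
     openin T U \<and> banach_space V \<and> openin (btop V) (\<phi> ` U) \<and>
     homeomorphic_map (subtopology T U) (subtopology (btop V) (\<phi> ` U)) \<phi>"

fun compatible ::
    "('k::real_normed_field, 'm, 'v) chart \<Rightarrow> ('k, 'm, 'w) chart \<Rightarrow> bool" where
  "compatible (U, \<phi>, V) (U', \<phi>', V') \<longleftrightarrow>
     banach_analytic_on V V' (\<phi> ` (U \<inter> U')) (\<phi>' \<circ> inv_into U \<phi>) \<and>
     banach_analytic_on V' V (\<phi>' ` (U \<inter> U')) (\<phi> \<circ> inv_into U' \<phi>')"

definition banach_manifold :: "('k::real_normed_field, 'm, 'v) manifold \<Rightarrow> bool" where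
  "banach_manifold M \<longleftrightarrow>
     Hausdorff_space (mtop M) \<and>
     (\<forall>c\<in>atlas M. is_chart (mtop M) c) \<and>
     (\<forall>c\<in>atlas M. \<forall>c'\<in>atlas M. compatible c c') \<and>
     \<Union> (fst ` atlas M) = topspace (mtop M)"

definition analytic_map ::
    "('k::real_normed_field, 'm, 'v) manifold \<Rightarrow> ('k, 'n, 'w) manifold \<Rightarrow> ('m \<Rightarrow> 'n) \<Rightarrow> bool" where
  "analytic_map M N f \<longleftrightarrow>
     continuous_map (mtop M) (mtop N) f \<and>
     (\<forall>(U, \<phi>, V)\<in>atlas M. \<forall>(U', \<phi>', V')\<in>atlas N.
        banach_analytic_on V V' (\<phi> ` (U \<inter> f -` U')) (\<phi>' \<circ> f \<circ> inv_into U \<phi>))"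

definition bianalytic_map ::
    "('k::real_normed_field, 'm, 'v) manifold \<Rightarrow> ('k, 'n, 'w) manifold \<Rightarrow> ('m \<Rightarrow> 'n) \<Rightarrow> bool" where
  "bianalytic_map M N f \<longleftrightarrow>
     bij_betw f (topspace (mtop M)) (topspace (mtop N)) \<and>
     analytic_map M N f \<and> analytic_map N M (inv_into (topspace (mtop M)) f)"

definition open_submanifold :: "('k, 'm, 'v) manifold \<Rightarrow> 'm set \<Rightarrow> ('k, 'm, 'v) manifold" where
  "open_submanifold M S =
     \<lparr>mtop = subtopology (mtop M) S, atlas = {(U \<inter> S, \<phi>, V) | U \<phi> V. (U, \<phi>, V) \<in> atlas M}\<rparr>"

definition prod_manifold ::
    "('k, 'm, 'v) manifold \<Rightarrow> ('k, 'n, 'w) manifold \<Rightarrow> ('k, 'm \<times> 'n, 'v \<times> 'w) manifold" where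
  "prod_manifold M N =
     \<lparr>mtop = prod_topology (mtop M) (mtop N),
      atlas = {(U \<times> U', map_prod \<phi> \<phi>', prod_bspace V V') | U \<phi> V U' \<phi>' V'.
                 (U, \<phi>, V) \<in> atlas M \<and> (U', \<phi>', V') \<in> atlas N}\<rparr>"

definition affine_manifold ::
    "('k::real_normed_field, 'v) bspace \<Rightarrow> 'v set \<Rightarrow> ('k, 'v, 'v) manifold" where
  "affine_manifold V A =
     \<lparr>mtop = subtopology (btop V) A,
      atlas = {(A, \<lambda>a. bdiff V a a0, bsub V (translate V A a0)) | a0. a0 \<in> A}\<rparr>"

text \<open>
  The structure induced on a subset \<open>S\<close> of \<open>M\<close> consists of all restrictions of charts of \<open>M\<close>
  (from the maximal atlas) that carry \<open>S\<close> to a complemented closed subspace \<open>W\<close>; \<open>S\<close> is a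
  submanifold iff these charts cover \<open>S\<close>, i.e. iff the result is a \<^const>\<open>banach_manifold\<close>.
\<close>

definition induced_submanifold ::
    "('k::real_normed_field, 'm, 'v) manifold \<Rightarrow> 'm set \<Rightarrow> ('k, 'm, 'v) manifold" where
  "induced_submanifold M S =
     \<lparr>mtop = subtopology (mtop M) S,
      atlas = {(U \<inter> S, \<phi>, bsub V W) | U \<phi> V W.
                 is_chart (mtop M) (U, \<phi>, V) \<and> (\<forall>c\<in>atlas M. compatible (U, \<phi>, V) c) \<and>
                 closed_lin_subspace V W \<and> closed_complements V W \<noteq> {} \<and>
                 \<phi> ` (U \<inter> S) = \<phi> ` U \<inter> W}\<rparr>"


section \<open>Locally trivial bundles\<close>

definition fiber :: "'e topology \<Rightarrow> ('e \<Rightarrow> 'o) \<Rightarrow> 'o \<Rightarrow> 'e set" where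
  "fiber T \<kappa> \<omega> = {u \<in> topspace T. \<kappa> u = \<omega>}"

text \<open>
  The structure of the fibre over \<open>\<omega>\<close> is given by a Banach space \<open>Y \<omega>\<close>: in the affine case the fibre
  is an affine-Banach subspace of \<open>Y \<omega>\<close>, in the linear case it is the carrier of \<open>Y \<omega>\<close>.
\<close>

definition affine_fibers ::
    "'e topology \<Rightarrow> 'o topology \<Rightarrow> ('e \<Rightarrow> 'o) \<Rightarrow> ('o \<Rightarrow> ('k::real_normed_field, 'e) bspace) \<Rightarrow> bool" where
  "affine_fibers T B \<kappa> Y \<longleftrightarrow>
     (\<forall>\<omega>\<in>topspace B. banach_space (Y \<omega>) \<and> affine_subspace (Y \<omega>) (fiber T \<kappa> \<omega>) \<and>
        subtopology T (fiber T \<kappa> \<omega>) = subtopology (btop (Y \<omega>)) (fiber T \<kappa> \<omega>))"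

definition banach_fibers ::
    "'e topology \<Rightarrow> 'o topology \<Rightarrow> ('e \<Rightarrow> 'o) \<Rightarrow> ('o \<Rightarrow> ('k::real_normed_field, 'e) bspace) \<Rightarrow> bool" where
  "banach_fibers T B \<kappa> Y \<longleftrightarrow>
     (\<forall>\<omega>\<in>topspace B. banach_space (Y \<omega>) \<and> bcarrier (Y \<omega>) = fiber T \<kappa> \<omega> \<and>
        subtopology T (fiber T \<kappa> \<omega>) = btop (Y \<omega>))"

definition fiberwise_affine ::
    "'e topology \<Rightarrow> ('e \<Rightarrow> 'o) \<Rightarrow> ('o \<Rightarrow> ('k::real_normed_field, 'e) bspace)
       \<Rightarrow> 'o \<Rightarrow> 'o set \<Rightarrow> ('o \<times> 'e \<Rightarrow> 'e) \<Rightarrow> bool" where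
  "fiberwise_affine T \<kappa> Y \<omega>0 V \<Theta> \<longleftrightarrow>
     (\<forall>\<omega>\<in>V. affine_map (Y \<omega>0) (fiber T \<kappa> \<omega>0) (Y \<omega>) (fiber T \<kappa> \<omega>) (\<lambda>x. \<Theta> (\<omega>, x)) \<and>
             (\<lambda>x. \<Theta> (\<omega>, x)) ` fiber T \<kappa> \<omega>0 = fiber T \<kappa> \<omega>)"

definition fiberwise_linear ::
    "'e topology \<Rightarrow> ('e \<Rightarrow> 'o) \<Rightarrow> ('o \<Rightarrow> ('k::real_normed_field, 'e) bspace)
       \<Rightarrow> 'o \<Rightarrow> 'o set \<Rightarrow> ('o \<times> 'e \<Rightarrow> 'e) \<Rightarrow> bool" where
  "fiberwise_linear T \<kappa> Y \<omega>0 V \<Theta> \<longleftrightarrow>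
     (\<forall>\<omega>\<in>V. is_linear (Y \<omega>0) (Y \<omega>) (\<lambda>x. \<Theta> (\<omega>, x)) \<and>
             (\<lambda>x. \<Theta> (\<omega>, x)) ` fiber T \<kappa> \<omega>0 = fiber T \<kappa> \<omega>)"

definition continuous_trivialization ::
    "'e topology \<Rightarrow> 'o topology \<Rightarrow> ('e \<Rightarrow> 'o) \<Rightarrow> ('o \<Rightarrow> ('k::real_normed_field, 'e) bspace)
       \<Rightarrow> 'o \<Rightarrow> 'o set \<Rightarrow> ('o \<times> 'e \<Rightarrow> 'e) \<Rightarrow> bool" where
  "continuous_trivialization T B \<kappa> Y \<omega>0 V \<Theta> \<longleftrightarrow>
     openin B V \<and> \<omega>0 \<in> V \<and>
     homeomorphic_map
       (prod_topology (subtopology B V) (subtopology (btop (Y \<omega>0)) (fiber T \<kappa> \<omega>0)))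
       (subtopology T (\<kappa> -` V)) \<Theta>"

definition analytic_trivialization ::
    "('k::real_normed_field, 'e, 'v) manifold \<Rightarrow> ('k, 'o, 'w) manifold \<Rightarrow> ('e \<Rightarrow> 'o)
       \<Rightarrow> ('o \<Rightarrow> ('k, 'e) bspace) \<Rightarrow> 'o \<Rightarrow> 'o set \<Rightarrow> ('o \<times> 'e \<Rightarrow> 'e) \<Rightarrow> bool" where
  "analytic_trivialization M N \<kappa> Y \<omega>0 V \<Theta> \<longleftrightarrow>
     openin (mtop N) V \<and> \<omega>0 \<in> V \<and>
     bianalytic_map
       (prod_manifold (open_submanifold N V) (affine_manifold (Y \<omega>0) (fiber (mtop M) \<kappa> \<omega>0)))
       (open_submanifold M (\<kappa> -` V)) \<Theta>"

definition transition ::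
    "'e topology \<Rightarrow> ('e \<Rightarrow> 'o) \<Rightarrow> ('o \<Rightarrow> 'o set) \<Rightarrow> ('o \<Rightarrow> 'o \<times> 'e \<Rightarrow> 'e)
       \<Rightarrow> 'o \<Rightarrow> 'o \<Rightarrow> 'o \<Rightarrow> 'e \<Rightarrow> 'e" where
  "transition T \<kappa> V \<Theta> \<omega>1 \<omega>2 \<omega> =
     (\<lambda>x\<in>fiber T \<kappa> \<omega>1. snd (inv_into (V \<omega>2 \<times> fiber T \<kappa> \<omega>2) (\<Theta> \<omega>2) (\<Theta> \<omega>1 (\<omega>, x))))"

text \<open>
  The norms of \<^const>\<open>baff\<close> for different base points are equivalent; the conditions on transition
  functions are stated for each of them.
\<close>

definition continuous_transitions ::
    "'e topology \<Rightarrow> 'o topology \<Rightarrow> ('e \<Rightarrow> 'o) \<Rightarrow> ('o \<Rightarrow> ('k::real_normed_field, 'e) bspace)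
       \<Rightarrow> ('o \<Rightarrow> 'o set) \<Rightarrow> ('o \<Rightarrow> 'o \<times> 'e \<Rightarrow> 'e) \<Rightarrow> bool" where
  "continuous_transitions T B \<kappa> Y V \<Theta> \<longleftrightarrow>
     (\<forall>\<omega>1\<in>topspace B. \<forall>\<omega>2\<in>topspace B. V \<omega>1 \<inter> V \<omega>2 \<noteq> {} \<longrightarrow>
        (\<forall>a0\<in>fiber T \<kappa> \<omega>1.
           continuous_map
             (subtopology B (V \<omega>1 \<inter> V \<omega>2))
             (subtopology (btop (baff (Y \<omega>1) (fiber T \<kappa> \<omega>1) a0 (Y \<omega>2)))
                (affine_maps (Y \<omega>1) (fiber T \<kappa> \<omega>1) (Y \<omega>2) (fiber T \<kappa> \<omega>2)))
             (transition T \<kappa> V \<Theta> \<omega>1 \<omega>2)))"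

definition analytic_transitions ::
    "('k::real_normed_field, 'e, 'v) manifold \<Rightarrow> ('k, 'o, 'w) manifold \<Rightarrow> ('e \<Rightarrow> 'o)
       \<Rightarrow> ('o \<Rightarrow> ('k, 'e) bspace) \<Rightarrow> ('o \<Rightarrow> 'o set) \<Rightarrow> ('o \<Rightarrow> 'o \<times> 'e \<Rightarrow> 'e) \<Rightarrow> bool" where
  "analytic_transitions M N \<kappa> Y V \<Theta> \<longleftrightarrow>
     (\<forall>\<omega>1\<in>topspace (mtop N). \<forall>\<omega>2\<in>topspace (mtop N). V \<omega>1 \<inter> V \<omega>2 \<noteq> {} \<longrightarrow>
        (\<forall>a0\<in>fiber (mtop M) \<kappa> \<omega>1.
           analytic_map
             (open_submanifold N (V \<omega>1 \<inter> V \<omega>2))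
             (affine_manifold (baff (Y \<omega>1) (fiber (mtop M) \<kappa> \<omega>1) a0 (Y \<omega>2))
                (affine_maps (Y \<omega>1) (fiber (mtop M) \<kappa> \<omega>1) (Y \<omega>2) (fiber (mtop M) \<kappa> \<omega>2)))
             (transition (mtop M) \<kappa> V \<Theta> \<omega>1 \<omega>2)))"

definition continuous_banach_bundle ::
    "'e topology \<Rightarrow> 'o topology \<Rightarrow> ('e \<Rightarrow> 'o) \<Rightarrow> ('o \<Rightarrow> ('k::real_normed_field, 'e) bspace) \<Rightarrow> bool"
  where
  "continuous_banach_bundle T B \<kappa> Y \<longleftrightarrow>
     Hausdorff_space T \<and> Hausdorff_space B \<and>
     continuous_map T B \<kappa> \<and> \<kappa> ` topspace T = topspace B \<and>
     banach_fibers T B \<kappa> Y \<and>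
     (\<exists>V \<Theta>. (\<forall>\<omega>0\<in>topspace B. continuous_trivialization T B \<kappa> Y \<omega>0 (V \<omega>0) (\<Theta> \<omega>0) \<and>
                               fiberwise_linear T \<kappa> Y \<omega>0 (V \<omega>0) (\<Theta> \<omega>0)) \<and>
            continuous_transitions T B \<kappa> Y V \<Theta>)"

definition analytic_affine_banach_bundle ::
    "('k::real_normed_field, 'e, 'v) manifold \<Rightarrow> ('k, 'o, 'w) manifold \<Rightarrow> ('e \<Rightarrow> 'o)
       \<Rightarrow> ('o \<Rightarrow> ('k, 'e) bspace) \<Rightarrow> bool" where
  "analytic_affine_banach_bundle M N \<kappa> Y \<longleftrightarrow>
     banach_manifold M \<and> banach_manifold N \<and>
     analytic_map M N \<kappa> \<and> \<kappa> ` topspace (mtop M) = topspace (mtop N) \<and>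
     affine_fibers (mtop M) (mtop N) \<kappa> Y \<and>
     (\<exists>V \<Theta>. (\<forall>\<omega>0\<in>topspace (mtop N). analytic_trivialization M N \<kappa> Y \<omega>0 (V \<omega>0) (\<Theta> \<omega>0) \<and>
                                       fiberwise_affine (mtop M) \<kappa> Y \<omega>0 (V \<omega>0) (\<Theta> \<omega>0)) \<and>
            analytic_transitions M N \<kappa> Y V \<Theta>)"

definition analytic_banach_bundle ::
    "('k::real_normed_field, 'e, 'v) manifold \<Rightarrow> ('k, 'o, 'w) manifold \<Rightarrow> ('e \<Rightarrow> 'o)
       \<Rightarrow> ('o \<Rightarrow> ('k, 'e) bspace) \<Rightarrow> bool" where
  "analytic_banach_bundle M N \<kappa> Y \<longleftrightarrow>
     banach_manifold M \<and> banach_manifold N \<and>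
     analytic_map M N \<kappa> \<and> \<kappa> ` topspace (mtop M) = topspace (mtop N) \<and>
     banach_fibers (mtop M) (mtop N) \<kappa> Y \<and>
     (\<exists>V \<Theta>. (\<forall>\<omega>0\<in>topspace (mtop N). analytic_trivialization M N \<kappa> Y \<omega>0 (V \<omega>0) (\<Theta> \<omega>0) \<and>
                                       fiberwise_linear (mtop M) \<kappa> Y \<omega>0 (V \<omega>0) (\<Theta> \<omega>0)) \<and>
            analytic_transitions M N \<kappa> Y V \<Theta>)"

text \<open>
  \<open>Z\<close> is a Banach space structure on the affine-Banach subspace \<open>A\<close> of \<open>Y\<close> for which the identity
  is an isometric affine isomorphism.
\<close>

definition equivalent_banach_structure ::
    "('k::real_normed_field, 'v) bspace \<Rightarrow> ('k, 'v) bspace \<Rightarrow> 'v set \<Rightarrow> bool" where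
  "equivalent_banach_structure Z Y A \<longleftrightarrow>
     banach_space Z \<and> bcarrier Z = A \<and> affine_subspace Y A \<and>
     affine_map Z A Y A (\<lambda>x. x) \<and> (\<forall>x\<in>A. \<forall>y\<in>A. bdist Z x y = bdist Y x y)"


section \<open>The Grassmann manifold and the idempotents\<close>

text \<open>
  A Banach space over \<open>'k\<close> is a real Banach space \<open>'a\<close> together with a compatible scalar
  multiplication; for \<^typ>\<open>real\<close> this is necessarily \<^const>\<open>scaleR\<close>.
\<close>

locale K_banach = vector_space sc
  for sc :: "'k::real_normed_field \<Rightarrow> 'a::banach \<Rightarrow> 'a" +
  assumes scale_of_real: "sc (of_real r) x = r *\<^sub>R x"
    and norm_scale: "norm (sc c x) = norm c * norm x"

definition dim_gt_one :: "('k::real_normed_field \<Rightarrow> 'a::banach \<Rightarrow> 'a) \<Rightarrow> bool" where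
  "dim_gt_one sc \<longleftrightarrow>
     (\<exists>B. \<not> module.dependent sc B \<and> module.span sc B = UNIV \<and> (infinite B \<or> card B > 1))"

definition whole_space :: "('k \<Rightarrow> 'a::banach \<Rightarrow> 'a) \<Rightarrow> ('k, 'a) bspace" where
  "whole_space sc = \<lparr>bcarrier = UNIV, bzero = 0, badd = (+), bscale = sc, bnorm = norm\<rparr>"

text \<open>The \<open>'k\<close>-linear bounded operators on \<open>'a\<close>.\<close>

definition op_space :: "('k \<Rightarrow> 'a::banach \<Rightarrow> 'a) \<Rightarrow> ('k, 'a \<Rightarrow>\<^sub>L 'a) bspace" where
  "op_space sc =
     \<lparr>bcarrier = {T. \<forall>c x. blinfun_apply T (sc c x) = sc c (blinfun_apply T x)},
      bzero = 0,
      badd = (+),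
      bscale = (\<lambda>c T. Blinfun (\<lambda>x. sc c (blinfun_apply T x))),
      bnorm = norm\<rparr>"

definition idempotents :: "('k \<Rightarrow> 'a::banach \<Rightarrow> 'a) \<Rightarrow> ('a \<Rightarrow>\<^sub>L 'a) set" where
  "idempotents sc =
     {Q \<in> bcarrier (op_space sc). Q \<noteq> 0 \<and> Q \<noteq> id_blinfun \<and> Q o\<^sub>L Q = Q}"

definition idempotent_manifold ::
    "('k::real_normed_field \<Rightarrow> 'a::banach \<Rightarrow> 'a) \<Rightarrow> ('k, 'a \<Rightarrow>\<^sub>L 'a, 'a \<Rightarrow>\<^sub>L 'a) manifold" where
  "idempotent_manifold sc =
     induced_submanifold (affine_manifold (op_space sc) (bcarrier (op_space sc)))
       (idempotents sc)"

definition complements_of :: "('k::real_normed_field \<Rightarrow> 'a::banach \<Rightarrow> 'a) \<Rightarrow> 'a set \<Rightarrow> 'a set set" where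
  "complements_of sc E = closed_complements (whole_space sc) E"

definition grassmannian :: "('k::real_normed_field \<Rightarrow> 'a::banach \<Rightarrow> 'a) \<Rightarrow> 'a set set" where
  "grassmannian sc =
     {E. closed_lin_subspace (whole_space sc) E \<and> E \<noteq> {0} \<and> E \<noteq> UNIV \<and>
         complements_of sc E \<noteq> {}}"

definition sub_ops ::
    "('k \<Rightarrow> 'a::banach \<Rightarrow> 'a) \<Rightarrow> 'a set \<Rightarrow> 'a set \<Rightarrow> ('k, 'a \<Rightarrow> 'a) bspace" where
  "sub_ops sc E F = blin (bsub (whole_space sc) E) (bsub (whole_space sc) F)"

definition graph_of :: "'a::banach set \<Rightarrow> ('a \<Rightarrow> 'a) \<Rightarrow> 'a set" where
  "graph_of E T = {x + T x | x. x \<in> E}"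

text \<open>
  The topology is the one for which the graph maps \<open>L(E, F) \<rightarrow> C\<^sub>F\<close> are homeomorphisms onto open sets;
  it is generated by the graph-map images of open sets of operators.
\<close>

definition grassmann_manifold ::
    "('k::real_normed_field \<Rightarrow> 'a::banach \<Rightarrow> 'a) \<Rightarrow> ('k, 'a set, 'a \<Rightarrow> 'a) manifold" where
  "grassmann_manifold sc =
     \<lparr>mtop = topology_generated_by
        {graph_of E ` D | E F D. E \<in> grassmannian sc \<and> F \<in> complements_of sc E \<and>
                                 openin (btop (sub_ops sc E F)) D},
      atlas =
        {(complements_of sc F, inv_into (bcarrier (sub_ops sc E F)) (graph_of E),
          sub_ops sc E F) | E F. E \<in> grassmannian sc \<and> F \<in> complements_of sc E}\<rparr>"

definition range_map :: "('a::banach \<Rightarrow>\<^sub>L 'a) \<Rightarrow> 'a set" where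
  "range_map Q = range (blinfun_apply Q)"

end

theory Submission
  imports Defs "HOL-Complex_Analysis.Cauchy_Integral_Formula"
begin

text \<open>
  (a) Fix \<open>E\<close> with complement \<open>F\<close>. For \<open>w\<close> in the chart domain of \<open>F\<close> let \<open>N w\<close> be the difference of the projections onto \<open>w\<close>
  and \<open>E\<close> along \<open>F\<close>; it is square-zero, and \<open>Q \<mapsto> (I + N w) Q (I - N w)\<close> trivialises the bundle. Everything is a rational
  expression in operators once the charts are; near an idempotent \<open>P\<close> the set of idempotents is straightened by its off-diagonal blocks.

  (b) A continuous section \<open>s\<close> transports the linear structure of the direction spaces \<open>{H. H X \<subseteq> E \<subseteq> ker H}\<close> to the fibres, and
  \<open>Q \<mapsto> (I + N w) (Q - s E) (I - N w) + s w\<close> is then fibrewise linear. Since fibres are affine, \<open>s\<close> can be glued from local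
  sections by a partition of unity on the metrizable space of subspaces.

  (c) The zero section \<open>s\<close> of an analytic linear structure would be analytic. With \<open>f\<^sub>1, f\<^sub>2\<close> biorthogonal to \<open>e, u\<close>, the function
  \<open>z \<mapsto> f\<^sub>1 (s (span (e + z u)) e)\<close> is entire and tends to \<open>0\<close> at infinity, because it is \<open>1 / z\<close> times
  \<open>f\<^sub>2 (s (span (u + e / z)) e)\<close>. By Liouville it vanishes, but at \<open>z = 0\<close> its value is \<open>f\<^sub>1 e = 1\<close>.
\<close>

text \<open>Subspaces \<open>W\<close> are handled through the operators \<open>proj W F\<close>: a
  graph chart is a bounded linear restriction of this operator, so every claim of analyticity
  becomes one about expansions in the operator algebra, where sums, products and inverses suffice.
  Two things have to be built for this: expansions between carrier-based spaces must be closed under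
  composition, and projections along closed complements must be bounded, which is the open mapping
  theorem for a direct sum. The obstacle at the start of (a) is that an idempotent \<open>R\<close>
  near \<open>R0\<close> comes with its own kernel, whereas charts need the projection onto its
  range along a fixed \<open>F\<close>; \<open>nproj\<close> produces it as a rational expression in
  \<open>R\<close>. In (b) bump functions need a metric; the gap is used, and the point is that
  chart domains are open for it. In (c) the vector space operations and norms on the fibres are
  arbitrary. What survives is that fibrewise linear trivialisations carry origins to origins, so
  that the origins form an analytic section; over the projective line of one-dimensional subspaces
  of a plane no such section exists.\<close>

abbreviation (input) "car \<equiv> bcarrier"

section \<open>Normed spaces with an explicit carrier and their topology\<close>

text \<open>These are the axioms of \<open>banach_space\<close> with completeness left out.
  Expansions, operator norms and spaces of affine maps are treated at this level, and completeness
  is established separately for the model spaces of the two atlases.\<close>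

locale nspace =
 fixes V :: "('k::real_normed_field, 'v) bspace"
 assumes zero_closed [simp, intro]: "bzero V \<in> car V"
  and add_closed [simp, intro]: "[|x \<in> car V; y \<in> car V|] ==> badd V x y \<in> car V"
  and scale_closed [simp, intro]: "x \<in> car V ==> bscale V c x \<in> car V"
  and add_assoc: "[|x \<in> car V; y \<in> car V; z \<in> car V|]
     ==> badd V (badd V x y) z = badd V x (badd V y z)"
  and add_commute: "[|x \<in> car V; y \<in> car V|] ==> badd V x y = badd V y x"
  and add_zero [simp]: "x \<in> car V ==> badd V x (bzero V) = x"
  and diff_self [simp]: "x \<in> car V ==> bdiff V x x = bzero V"
  and scale_add: "[|x \<in> car V; y \<in> car V|]
     ==> bscale V c (badd V x y) = badd V (bscale V c x) (bscale V c y)"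
  and add_scale: "x \<in> car V ==> bscale V (c + d) x = badd V (bscale V c x) (bscale V d x)"
  and scale_scale [simp]: "x \<in> car V ==> bscale V c (bscale V d x) = bscale V (c * d) x"
  and scale_one [simp]: "x \<in> car V ==> bscale V 1 x = x"
  and norm_nonneg [simp]: "x \<in> car V ==> 0 \<le> bnorm V x"
  and norm_eq_zero: "x \<in> car V ==> bnorm V x = 0 \<longleftrightarrow> x = bzero V"
  and norm_scale [simp]: "x \<in> car V ==> bnorm V (bscale V c x) = norm c * bnorm V x"
  and norm_triangle: "[|x \<in> car V; y \<in> car V|]
     ==> bnorm V (badd V x y) \<le> bnorm V x + bnorm V y"

lemma banach_space_imp_normed: "banach_space V ==> nspace V"
 unfolding banach_space_def nspace_def by (elim conjE, intro conjI; assumption)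

lemma banach_spaceI:
 "nspace V ==> Metric_space.mcomplete (car V) (bdist V) ==> banach_space V"
 unfolding banach_space_def nspace_def by (elim conjE, intro conjI; assumption)

context nspace
begin

lemma norm_zero [simp]: "bnorm V (bzero V) = 0"
 by (simp add: norm_eq_zero)

lemma scale_zero_left [simp]: "x \<in> car V ==> bscale V 0 x = bzero V"
 using norm_eq_zero[of "bscale V 0 x"] by simp

lemma scale_zero_right [simp]: "bscale V c (bzero V) = bzero V"
 using norm_eq_zero[of "bscale V c (bzero V)"] by simp

lemma zero_add [simp]: "x \<in> car V ==> badd V (bzero V) x = x"
 by (simp add: add_commute)

lemma add_left_commute:
 "[|x \<in> car V; y \<in> car V; z \<in> car V|] ==> badd V x (badd V y z) = badd V y (badd V x z)"
 by (metis add_assoc add_commute)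

lemma diff_closed [simp, intro]: "[|x \<in> car V; y \<in> car V|] ==> bdiff V x y \<in> car V"
 by (simp add: bdiff_def)

lemma add_neg [simp]: "x \<in> car V ==> badd V x (bscale V (- 1) x) = bzero V"
 using diff_self[of x] by (simp add: bdiff_def)

lemma add_neg_left [simp]:
 "[|x \<in> car V; y \<in> car V|] ==> badd V x (badd V (bscale V (- 1) x) y) = y"
 by (simp flip: add_assoc)

lemma neg_add [simp]: "x \<in> car V ==> badd V (bscale V (- 1) x) x = bzero V"
 by (simp add: add_commute)

lemma neg_add_left [simp]:
 "[|x \<in> car V; y \<in> car V|] ==> badd V (bscale V (- 1) x) (badd V x y) = y"
 by (simp flip: add_assoc)

lemmas add_ac = add_assoc add_commute add_left_commute

lemma diff_zero [simp]: "x \<in> car V ==> bdiff V x (bzero V) = x"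
 by (simp add: bdiff_def)

lemma diff_add_cancel [simp]: "[|x \<in> car V; y \<in> car V|] ==> badd V (bdiff V x y) y = x"
 by (simp add: bdiff_def add_assoc)

lemma add_diff_cancel [simp]: "[|x \<in> car V; y \<in> car V|] ==> badd V y (bdiff V x y) = x"
 by (simp add: add_commute[of y])

lemma add_diff_cancel_right [simp]: "[|x \<in> car V; y \<in> car V|] ==> bdiff V (badd V x y) y = x"
 by (simp add: bdiff_def add_assoc)

lemma add_diff_cancel_left [simp]: "[|x \<in> car V; y \<in> car V|] ==> bdiff V (badd V y x) y = x"
 by (simp add: add_commute[of y])

lemma diff_eq_zero_iff: "[|x \<in> car V; y \<in> car V|] ==> bdiff V x y = bzero V \<longleftrightarrow> x = y"
 by (metis diff_add_cancel diff_self zero_add)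

lemma diff_add_diff:
 "[|x \<in> car V; y \<in> car V; z \<in> car V|] ==> badd V (bdiff V x y) (bdiff V y z) = bdiff V x z"
 by (simp add: bdiff_def add_assoc)

lemma add_diff_add:
 "[|a \<in> car V; b \<in> car V; c \<in> car V; d \<in> car V|]
  ==> bdiff V (badd V a b) (badd V c d) = badd V (bdiff V a c) (bdiff V b d)"
 by (simp add: bdiff_def add_ac scale_add)

lemma add_right_cancel:
 "[|x \<in> car V; y \<in> car V; z \<in> car V|] ==> badd V x z = badd V y z \<longleftrightarrow> x = y"
 by (metis add_diff_cancel_right)

lemma neg_diff: "[|x \<in> car V; y \<in> car V|] ==> bscale V (- 1) (bdiff V x y) = bdiff V y x"
 by (simp add: bdiff_def scale_add add_commute)

lemma scale_diff:
 "[|x \<in> car V; y \<in> car V|] ==> bscale V c (bdiff V x y) = bdiff V (bscale V c x) (bscale V c y)"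
 by (simp add: bdiff_def scale_add)

lemma norm_diff_commute: "[|x \<in> car V; y \<in> car V|] ==> bnorm V (bdiff V x y) = bnorm V (bdiff V y x)"
 using norm_scale[of "bdiff V y x" "- 1"] by (simp add: neg_diff)

lemma norm_diff_triangle:
 "[|x \<in> car V; y \<in> car V; z \<in> car V|]
  ==> bnorm V (bdiff V x z) \<le> bnorm V (bdiff V x y) + bnorm V (bdiff V y z)"
 using norm_triangle[of "bdiff V x y" "bdiff V y z"] by (simp add: diff_add_diff)

lemma norm_diff_le: "[|x \<in> car V; y \<in> car V|] ==> bnorm V (bdiff V x y) \<le> bnorm V x + bnorm V y"
 using norm_triangle[of x "bscale V (- 1) y"] by (simp add: bdiff_def)

sublocale M: Metric_space "car V" "bdist V"
proof
 show "0 \<le> bdist V x y" for x y by (simp add: bdist_def)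
 show "bdist V x y = bdist V y x" for x y by (simp add: bdist_def norm_diff_commute)
 show "x \<in> car V ==> y \<in> car V ==> (bdist V x y = 0) = (x = y)" for x y
  by (simp add: bdist_def norm_eq_zero diff_eq_zero_iff)
 show "[|x \<in> car V; y \<in> car V; z \<in> car V|] ==> bdist V x z \<le> bdist V x y + bdist V y z" for x y z
  by (simp add: bdist_def norm_diff_triangle)
qed

lemma bdist_eq: "[|x \<in> car V; y \<in> car V|] ==> bdist V x y = bnorm V (bdiff V x y)"
 by (simp add: bdist_def)

lemma topspace_btop [simp]: "topspace (btop V) = car V"
 by (simp add: btop_def)

text \<open>Neighbourhoods are written with increments \<open>h\<close> because
  \<open>banach_analytic_on\<close> is; \<open>openin_btop_dist\<close> is the same with the moving
  point instead.\<close>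

lemma openin_btop:
 "openin (btop V) S \<longleftrightarrow> S \<subseteq> car V \<and>
   (\<forall>x\<in>S. \<exists>r>0. \<forall>h\<in>car V. bnorm V h < r --> badd V x h \<in> S)"
proof -
 have "(M.mball x r \<subseteq> S) \<longleftrightarrow> (\<forall>h\<in>car V. bnorm V h < r --> badd V x h \<in> S)"
  if "x \<in> car V" for x r
 proof safe
  fix h assume "M.mball x r \<subseteq> S" "h \<in> car V" "bnorm V h < r"
  then show "badd V x h \<in> S"
   using that by (auto simp: M.commute[of x] bdist_eq subset_iff)
 next
  fix y assume *: "\<forall>h\<in>car V. bnorm V h < r --> badd V x h \<in> S" and y: "y \<in> M.mball x r"
  have "badd V x (bdiff V y x) \<in> S"
   using y by (intro *[rule_format]) (auto simp: bdist_eq norm_diff_commute[of y x])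
  with y show "y \<in> S" by auto
 qed
 then show ?thesis
  unfolding btop_def M.openin_mtopology by blast
qed

lemma openin_btop_dist:
 "openin (btop V) S \<longleftrightarrow> S \<subseteq> car V \<and>
   (\<forall>x\<in>S. \<exists>r>0. \<forall>y\<in>car V. bnorm V (bdiff V y x) < r --> y \<in> S)"
proof -
 have "(\<forall>h\<in>car V. bnorm V h < r --> badd V x h \<in> S) \<longleftrightarrow>
    (\<forall>y\<in>car V. bnorm V (bdiff V y x) < r --> y \<in> S)" if "x \<in> car V" for x r
  using that by (metis add_diff_cancel add_diff_cancel_left add_closed diff_closed)
 then show ?thesis unfolding openin_btop by blast
qed

lemma openin_ball:
 assumes "x \<in> car V"
 shows "openin (btop V) {y \<in> car V. bnorm V (bdiff V y x) < r}"
proof -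
 have "{y \<in> car V. bnorm V (bdiff V y x) < r} = M.mball x r"
  using assms by (auto simp: bdist_eq norm_diff_commute[of _ x])
 then show ?thesis by (simp add: btop_def)
qed

lemma limitin_btop:
 "limitin (btop V) f l F \<longleftrightarrow> l \<in> car V \<and> (\<forall>\<^sub>F n in F. f n \<in> car V) \<and>
   ((\<lambda>n. bnorm V (bdiff V (f n) l)) \<longlongrightarrow> 0) F"
proof
 assume L: "limitin (btop V) f l F"
 then have l: "l \<in> car V"
  and ev: "\<And>d. d > 0 ==> \<forall>\<^sub>F n in F. f n \<in> car V \<and> bdist V (f n) l < d"
  by (auto simp: btop_def M.limitin_metric)
 have c: "\<forall>\<^sub>F n in F. f n \<in> car V" using ev[of 1] by (auto elim: eventually_mono)
 have "((\<lambda>n. bnorm V (bdiff V (f n) l)) \<longlongrightarrow> 0) F"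
  unfolding tendsto_iff
 proof safe
  fix e :: real assume "e > 0"
  show "\<forall>\<^sub>F n in F. dist (bnorm V (bdiff V (f n) l)) 0 < e"
   using ev[OF \<open>e > 0\<close>] by eventually_elim (use l in \<open>auto simp: bdist_eq\<close>)
 qed
 then show "l \<in> car V \<and> (\<forall>\<^sub>F n in F. f n \<in> car V) \<and>
   ((\<lambda>n. bnorm V (bdiff V (f n) l)) \<longlongrightarrow> 0) F" using l c by blast
next
 assume R: "l \<in> car V \<and> (\<forall>\<^sub>F n in F. f n \<in> car V) \<and>
   ((\<lambda>n. bnorm V (bdiff V (f n) l)) \<longlongrightarrow> 0) F"
 have "\<forall>\<^sub>F n in F. f n \<in> car V \<and> bdist V (f n) l < e" if "e > 0" for e
 proof -
  have "\<forall>\<^sub>F n in F. dist (bnorm V (bdiff V (f n) l)) 0 < e" "\<forall>\<^sub>F n in F. f n \<in> car V"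
   using R that by (auto simp: tendsto_iff)
  then show ?thesis by eventually_elim (use R in \<open>auto simp: bdist_eq\<close>)
 qed
 then show "limitin (btop V) f l F" using R by (auto simp: btop_def M.limitin_metric)
qed

lemma continuous_map_into_btop:
 "continuous_map X (btop V) f \<longleftrightarrow> f ` topspace X \<subseteq> car V \<and>
   (\<forall>x\<in>topspace X. \<forall>d>0. \<exists>U. openin X U \<and> x \<in> U \<and> (\<forall>y\<in>U. bnorm V (bdiff V (f y) (f x)) < d))"
proof -
 have *: "f y \<in> M.mball (f x) e \<longleftrightarrow> bnorm V (bdiff V (f y) (f x)) < e"
  if "f ` topspace X \<subseteq> car V" "x \<in> topspace X" "y \<in> topspace X" for x y e
  using that by (auto simp: bdist_eq image_subset_iff norm_diff_commute[of "f y"])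
 show ?thesis
 proof
  assume L: "continuous_map X (btop V) f"
  then have s: "f ` topspace X \<subseteq> car V" using continuous_map_image_subset_topspace by fastforce
  show "f ` topspace X \<subseteq> car V \<and>
   (\<forall>x\<in>topspace X. \<forall>d>0. \<exists>U. openin X U \<and> x \<in> U \<and> (\<forall>y\<in>U. bnorm V (bdiff V (f y) (f x)) < d))"
   using L *[OF s] s unfolding btop_def M.continuous_map_to_metric
   by (meson openin_subset subset_iff)
 next
  assume R: "f ` topspace X \<subseteq> car V \<and>
   (\<forall>x\<in>topspace X. \<forall>d>0. \<exists>U. openin X U \<and> x \<in> U \<and> (\<forall>y\<in>U. bnorm V (bdiff V (f y) (f x)) < d))"
  then show "continuous_map X (btop V) f"
   using * unfolding btop_def M.continuous_map_to_metric
   by (meson openin_subset subset_iff)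
 qed
qed

end

section \<open>Linear subspaces and their topology\<close>

lemma bsub_simps [simp]:
 "car (bsub V S) = S" "bzero (bsub V S) = bzero V" "badd (bsub V S) = badd V"
 "bscale (bsub V S) = bscale V" "bnorm (bsub V S) = bnorm V"
 by (auto simp: bsub_def)

lemma bdiff_bsub [simp]: "bdiff (bsub V S) = bdiff V"
 by (simp add: bdiff_def fun_eq_iff)

lemma bsub_carrier [simp]: "bsub V (car V) = V" "bsub (bsub V S) S' = bsub V S'"
 by (simp_all add: bsub_def)

text \<open>The algebraic half of \<open>closed_lin_subspace\<close>. It is what restricting the
  operations and the norm to a subset requires; the direction space of a space of affine maps is
  used in this form as the model of a chart.\<close>

definition lin_subspace :: "('k::real_normed_field, 'v) bspace => 'v set => bool" where
 "lin_subspace V S \<longleftrightarrow> S \<subseteq> car V \<and> bzero V \<in> S \<and> (\<forall>x\<in>S. \<forall>y\<in>S. badd V x y \<in> S) \<and>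
   (\<forall>c. \<forall>x\<in>S. bscale V c x \<in> S)"

lemma closed_lin_subspace_iff:
 "closed_lin_subspace V S \<longleftrightarrow> lin_subspace V S \<and> closedin (btop V) S"
 by (auto simp: closed_lin_subspace_def lin_subspace_def)

context nspace
begin

lemma normed_bsub:
 assumes "lin_subspace V S" shows "nspace (bsub V S)"
proof -
 have S: "\<And>x. x \<in> S ==> x \<in> car V" using assms by (auto simp: lin_subspace_def)
 show ?thesis
  using assms
  by unfold_locales
    (auto simp: lin_subspace_def S add_ac scale_add add_scale norm_eq_zero norm_triangle)
qed

lemma lin_subspace_diff: "lin_subspace V S ==> x \<in> S ==> y \<in> S ==> bdiff V x y \<in> S"
 by (simp add: lin_subspace_def bdiff_def)

text \<open>A ball of the restricted metric is the trace of the ambient ball with the same centre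
  and radius. For an open set of the subspace, the union of all ambient balls with centre in
  \<open>S\<close> and trace inside the set is an open extension.\<close>

lemma btop_bsub:
 assumes "lin_subspace V S" shows "btop (bsub V S) = subtopology (btop V) S"
proof -
 interpret S: nspace "bsub V S" by (rule normed_bsub[OF assms])
 have sub: "S \<subseteq> car V" using assms by (auto simp: lin_subspace_def)
 have d: "bdist V x y = bdist (bsub V S) x y" if "x \<in> S" "y \<in> S" for x y
  using that sub by (auto simp: bdist_def)
 show ?thesis
  unfolding topology_eq
 proof (intro allI iffI)
  fix T assume T: "openin (btop (bsub V S)) T"
  define T' where "T' = \<Union>{M.mball x r | x r. x \<in> S \<and> M.mball x r \<inter> S \<subseteq> T}"
  have "openin (btop V) T'" unfolding T'_def btop_def by (auto intro!: openin_Union)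
  moreover have "T = T' \<inter> S"
  proof safe
   fix x assume x: "x \<in> T"
   then obtain r where r: "r > 0" "S.M.mball x r \<subseteq> T"
    using T unfolding btop_def S.M.openin_mtopology by blast
   have xS: "x \<in> S" using x T unfolding btop_def S.M.openin_mtopology by auto
   show "x \<in> S" by fact
   have "M.mball x r \<inter> S \<subseteq> S.M.mball x r"
    unfolding M.mball_def S.M.mball_def using xS d by auto
   then have "M.mball x r \<inter> S \<subseteq> T" using r by blast
   moreover have "x \<in> M.mball x r" using r xS sub by auto
   ultimately show "x \<in> T'" unfolding T'_def using xS by blast
  qed (auto simp: T'_def)
  ultimately show "openin (subtopology (btop V) S) T" unfolding openin_subtopology by blast
 next
  fix T assume "openin (subtopology (btop V) S) T"
  then obtain T' where T': "openin (btop V) T'" "T = T' \<inter> S" unfolding openin_subtopology by blast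
  have "\<exists>r>0. S.M.mball x r \<subseteq> T" if "x \<in> T" for x
  proof -
   obtain r where r: "r > 0" "M.mball x r \<subseteq> T'" using T' \<open>x \<in> T\<close> unfolding btop_def M.openin_mtopology by blast
   have "S.M.mball x r \<subseteq> M.mball x r"
    unfolding M.mball_def S.M.mball_def using d sub by auto
   moreover have "S.M.mball x r \<subseteq> S" unfolding S.M.mball_def by auto
   ultimately show ?thesis using r T' by blast
  qed
  then show "openin (btop (bsub V S)) T"
   using T' unfolding btop_def S.M.openin_mtopology by auto
 qed
qed

end

lemma banach_bsub:
 assumes "banach_space V" "closed_lin_subspace V S" shows "banach_space (bsub V S)"
proof -
 interpret nspace V by (rule banach_space_imp_normed[OF assms(1)])
 have lin: "lin_subspace V S" and cl: "closedin (btop V) S" using assms(2) by (auto simp: closed_lin_subspace_iff)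
 interpret S: nspace "bsub V S" by (rule normed_bsub[OF lin])
 have sub: "S \<subseteq> car V" using lin by (auto simp: lin_subspace_def)
 have d: "bdist (bsub V S) x y = bdist V x y" if "x \<in> S" "y \<in> S" for x y
  using that sub by (auto simp: bdist_def)
 have "S.M.mcomplete"
  unfolding S.M.mcomplete_def
 proof (intro allI impI)
  fix s assume C: "S.M.MCauchy s"
  then have r: "\<And>n. s n \<in> S" unfolding S.M.MCauchy_def by auto
  have "M.MCauchy s"
   using C sub r unfolding M.MCauchy_def S.M.MCauchy_def by (auto simp: d)
  then obtain x where x: "limitin M.mtopology s x sequentially"
   using banach_space.complete[OF assms(1)] by (auto simp: M.mcomplete_def)
  have "x \<in> S"
   using limitin_closedin[OF x, of S] cl r by (auto simp: btop_def)
  have "limitin (subtopology (btop V) S) s x sequentially"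
   using x r \<open>x \<in> S\<close> by (simp add: limitin_subtopology btop_def)
  then have "limitin S.M.mtopology s x sequentially"
   using btop_bsub[OF lin] by (simp add: btop_def)
  then show "\<exists>x. limitin S.M.mtopology s x sequentially" by blast
 qed
 then show ?thesis by (intro banach_spaceI S.nspace_axioms) simp
qed

section \<open>Convergent series and rearrangement by total degree\<close>

abbreviation (input) "psum \<equiv> partial_sum"

definition bsums :: "('k::real_normed_field, 'v) bspace => (nat => 'v) => 'v => bool" where
 "bsums V f s \<longleftrightarrow> limitin (btop V) (psum V f) s sequentially"

text \<open>The antidiagonal \<open>i + l = N\<close> of a double family, i.e. the degree
  \<open>N\<close> part when a double series is rearranged by total degree.\<close>

definition diag :: "('k, 'v) bspace => (nat => nat => 'v) => nat => 'v" where
 "diag V u N = psum V (\<lambda>i. u i (N - i)) (Suc N)"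

lemma partial_sum_cong: "(\<And>i. i < n ==> f i = g i) ==> psum V f n = psum V g n"
 by (induction n) auto

lemma nonneg_le_tendsto_zero:
 fixes f g :: "nat => real"
 assumes "\<And>n. 0 \<le> f n" "\<And>n. f n \<le> g n" "g \<longlonglongrightarrow> 0"
 shows "f \<longlonglongrightarrow> 0"
 by (rule tendsto_sandwich[OF always_eventually always_eventually tendsto_const assms(3)]) (use assms in auto)

context nspace
begin

lemma partial_sum_closed [simp, intro]:
 "(\<And>i. i < n ==> f i \<in> car V) ==> psum V f n \<in> car V"
 by (induction n) auto

lemma diag_closed: "(\<And>i. i \<le> N ==> u i (N - i) \<in> car V) ==> diag V u N \<in> car V"
 unfolding diag_def by (rule partial_sum_closed) auto

lemma partial_sum_add:
 "(\<And>i. i < n ==> f i \<in> car V) ==> (\<And>i. i < n ==> g i \<in> car V) ==>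
  psum V (\<lambda>i. badd V (f i) (g i)) n = badd V (psum V f n) (psum V g n)"
 by (induction n) (auto simp: add_ac)

lemma partial_sum_scale:
 "(\<And>i. i < n ==> f i \<in> car V) ==>
  psum V (\<lambda>i. bscale V c (f i)) n = bscale V c (psum V f n)"
 by (induction n) (auto simp: scale_add)

lemma partial_sum_diff:
 "(\<And>i. i < n ==> f i \<in> car V) ==> (\<And>i. i < n ==> g i \<in> car V) ==>
  psum V (\<lambda>i. bdiff V (f i) (g i)) n = bdiff V (psum V f n) (psum V g n)"
 by (simp add: bdiff_def partial_sum_add partial_sum_scale)

lemma partial_sum_norm:
 "(\<And>i. i < n ==> f i \<in> car V) ==> bnorm V (psum V f n) \<le> (\<Sum>i<n. bnorm V (f i))"
proof (induction n)
 case (Suc n)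
 then show ?case using norm_triangle[of "psum V f n" "f n"] by force
qed auto

lemma partial_sum_shift:
 "(\<And>i. f i \<in> car V) ==> psum V f (Suc n) = badd V (f 0) (psum V (\<lambda>i. f (Suc i)) n)"
 by (induction n) (auto simp: add_assoc)

lemma partial_sum_append_diff:
 "(\<And>i. f i \<in> car V) ==> bdiff V (psum V f (n + k)) (psum V f n) = psum V (\<lambda>i. f (n + i)) k"
proof -
 assume f: "\<And>i. f i \<in> car V"
 have "psum V f (n + k) = badd V (psum V f n) (psum V (\<lambda>i. f (n + i)) k)"
  by (induction k) (auto simp: f add_assoc)
 then show ?thesis using f by simp
qed

lemma diag_norm:
 "(\<And>i. i \<le> N ==> u i (N - i) \<in> car V) ==> bnorm V (diag V u N) \<le> (\<Sum>i\<le>N. bnorm V (u i (N - i)))"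
 unfolding diag_def using partial_sum_norm[of "Suc N" "\<lambda>i. u i (N - i)"] by (simp add: lessThan_Suc_atMost)

text \<open>Both sides sum \<open>u i l\<close> over the triangle \<open>i + l < N\<close>, once by
  antidiagonals and once by rows. Passing from \<open>N\<close> to \<open>Suc N\<close> lengthens
  every row by one entry, including the new row, which was empty before.\<close>

lemma partial_sum_diag:
 assumes "\<And>i l. u i l \<in> car V"
 shows "psum V (diag V u) N = psum V (\<lambda>i. psum V (u i) (N - i)) N"
proof (induction N)
 case (Suc N)
 have "psum V (\<lambda>i. psum V (u i) (Suc N - i)) (Suc N)
   = psum V (\<lambda>i. badd V (psum V (u i) (N - i)) (u i (N - i))) (Suc N)"
  by (rule partial_sum_cong) (simp add: Suc_diff_le)
 also have "\<dots> = badd V (psum V (\<lambda>i. psum V (u i) (N - i)) (Suc N)) (diag V u N)"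
  unfolding diag_def using assms by (intro partial_sum_add) auto
 finally show ?case using Suc.IH assms by simp
qed simp

lemma bsumsD: "bsums V f s ==> s \<in> car V"
 "bsums V f s ==> (\<lambda>n. bnorm V (bdiff V (psum V f n) s)) \<longlonglongrightarrow> 0"
 by (auto simp: bsums_def limitin_btop)

lemma bsumsI:
 "s \<in> car V ==> (\<And>n. f n \<in> car V) ==>
  (\<lambda>n. bnorm V (bdiff V (psum V f n) s)) \<longlonglongrightarrow> 0 ==> bsums V f s"
 by (auto simp: bsums_def limitin_btop)

lemma bsums_unique: "bsums V f s ==> bsums V f t ==> s = t"
 unfolding bsums_def btop_def by (metis M.limitin_metric_unique trivial_limit_sequentially)

lemma bsums_finite:
 assumes "\<And>n. f n \<in> car V" "\<And>n. n \<ge> N ==> f n = bzero V"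
 shows "bsums V f (psum V f N)"
proof (rule bsumsI)
 have "psum V f (N + k) = psum V f N" for k
  by (induction k) (use assms in auto)
 then have eq: "psum V f n = psum V f N" if "n \<ge> N" for n
  using that by (metis le_add_diff_inverse)
 have "bnorm V (bdiff V (psum V f n) (psum V f N)) = 0" if "n \<ge> N" for n
  unfolding eq[OF that] using assms(1) by simp
 then have "\<forall>\<^sub>F n in sequentially. bnorm V (bdiff V (psum V f n) (psum V f N)) = 0"
  unfolding eventually_sequentially by blast
 then show "(\<lambda>n. bnorm V (bdiff V (psum V f n) (psum V f N))) \<longlonglongrightarrow> 0"
  by (rule tendsto_eventually)
qed (use assms in auto)

lemma bsums_shift:
 assumes "\<And>n. f n \<in> car V" "bsums V f s"
 shows "bsums V (\<lambda>n. f (Suc n)) (bdiff V s (f 0))"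
proof (rule bsumsI)
 have s: "s \<in> car V" using bsumsD assms(2) by blast
 show "bdiff V s (f 0) \<in> car V" "\<And>n. f (Suc n) \<in> car V" using s assms(1) by auto
 have "bdiff V (psum V (\<lambda>n. f (Suc n)) n) (bdiff V s (f 0)) = bdiff V (psum V f (Suc n)) s" for n
 proof -
  define p where "p = psum V (\<lambda>n. f (Suc n)) n"
  have p: "p \<in> car V" using assms(1) by (auto simp: p_def)
  have "bdiff V (psum V f (Suc n)) s = bdiff V (badd V (f 0) p) s"
   using partial_sum_shift[of f n] assms(1) by (simp add: p_def)
  also have "\<dots> = bdiff V p (bdiff V s (f 0))"
   using p s assms(1)[of 0] by (simp add: bdiff_def scale_add add_ac)
  finally show ?thesis by (simp add: p_def)
 qed
 then show "(\<lambda>n. bnorm V (bdiff V (psum V (\<lambda>n. f (Suc n)) n) (bdiff V s (f 0)))) \<longlonglongrightarrow> 0"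
  using LIMSEQ_Suc[OF bsumsD(2)[OF assms(2)]] by simp
qed

lemma geometric_sum_le:
 fixes t K :: real assumes "0 \<le> t" "t < 1" "0 \<le> K"
 shows "(\<Sum>i<k. K * t ^ (n + i)) \<le> K * t ^ n / (1 - t)"
proof -
 have "(\<Sum>i<k. K * t ^ (n + i)) = K * t ^ n * (\<Sum>i<k. t ^ i)"
  by (simp add: sum_distrib_left power_add mult_ac)
 also have "(\<Sum>i<k. t ^ i) \<le> 1 / (1 - t)"
  using assms by (simp add: sum_gp_strict divide_right_mono)
 then have "K * t ^ n * (\<Sum>i<k. t ^ i) \<le> K * t ^ n * (1 / (1 - t))"
  using assms by (intro mult_left_mono) auto
 finally show ?thesis by simp
qed

text \<open>The block of \<open>k\<close> terms following the first \<open>n\<close> is dominated by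
  a geometric sum uniformly in \<open>k\<close>, and the distance from the longer partial sum to
  \<open>s\<close> disappears as \<open>k\<close> grows.\<close>

lemma bsums_tail:
 assumes f: "\<And>n. f n \<in> car V" and s: "bsums V f s"
  and le: "\<And>n. bnorm V (f n) \<le> K * t ^ n" and t: "0 \<le> t" "t < 1" and K: "0 \<le> K"
 shows "bnorm V (bdiff V s (psum V f n)) \<le> K * t ^ n / (1 - t)"
proof -
 have sV: "s \<in> car V" using bsumsD s by blast
 have "bnorm V (bdiff V s (psum V f n))
   \<le> bnorm V (bdiff V (psum V f (k + n)) s) + K * t ^ n / (1 - t)" for k
 proof -
  have "bnorm V (bdiff V (psum V f (n + k)) (psum V f n)) \<le> (\<Sum>i<k. K * t ^ (n + i))"
   unfolding partial_sum_append_diff[OF f]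
   by (rule order_trans[OF partial_sum_norm]) (use f le in \<open>auto intro: sum_mono\<close>)
  also have "\<dots> \<le> K * t ^ n / (1 - t)" by (rule geometric_sum_le[OF t K])
  finally show ?thesis
   using norm_diff_triangle[of s "psum V f (n + k)" "psum V f n"] f sV
    norm_diff_commute[of s "psum V f (n + k)"]
   by (simp add: add.commute)
 qed
 moreover have "(\<lambda>k. bnorm V (bdiff V (psum V f (k + n)) s) + K * t ^ n / (1 - t))
   \<longlonglongrightarrow> 0 + K * t ^ n / (1 - t)"
  by (intro tendsto_add tendsto_const LIMSEQ_ignore_initial_segment bsumsD(2)[OF s])
 ultimately show ?thesis
  using LIMSEQ_le_const[of "\<lambda>k. bnorm V (bdiff V (psum V f (k + n)) s) + K * t ^ n / (1 - t)"] by auto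
qed

lemma bsums_norm_le:
 assumes f: "\<And>n. f n \<in> car V" and s: "bsums V f s"
  and le: "\<And>n. bnorm V (f n) \<le> K * t ^ n" and t: "0 \<le> t" "t < 1" and K: "0 \<le> K"
 shows "bnorm V s \<le> K / (1 - t)"
 using bsums_tail[OF assms, of 0] bsumsD(1)[OF s] by simp

text \<open>Cutting row \<open>i\<close> at length \<open>N - i\<close> costs at most
  \<open>K * t ^ N / (1 - t)\<close>, because \<open>t ^ i\<close> from the row and
  \<open>t ^ (N - i)\<close> from its tail multiply to \<open>t ^ N\<close>. There are
  \<open>N\<close> rows and \<open>N * t ^ N\<close> tends to 0, so summing by total degree gives
  the iterated sum.\<close>

lemma bsums_diag:
 assumes u: "\<And>i l. u i l \<in> car V" and le: "\<And>i l. bnorm V (u i l) \<le> K * t ^ (i + l)"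
  and t: "0 \<le> t" "t < 1" and K: "0 \<le> K"
  and v: "\<And>i. bsums V (u i) (v i)" and s: "bsums V v s"
 shows "bsums V (diag V u) s"
proof (rule bsumsI)
 have vV: "v i \<in> car V" for i using bsumsD v by blast
 have sV: "s \<in> car V" using bsumsD s by blast
 show "s \<in> car V" by fact
 show dV: "diag V u n \<in> car V" for n using u by (intro diag_closed)
 have "bnorm V (bdiff V (psum V v N) (psum V (diag V u) N)) \<le> K / (1 - t) * (of_nat N * t ^ N)" for N
 proof -
  have "bdiff V (psum V v N) (psum V (diag V u) N)
    = psum V (\<lambda>i. bdiff V (v i) (psum V (u i) (N - i))) N"
   unfolding partial_sum_diag[OF u] using u vV by (intro partial_sum_diff[symmetric]) auto
  also have "bnorm V \<dots> \<le> (\<Sum>i<N. bnorm V (bdiff V (v i) (psum V (u i) (N - i))))"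
   using u vV by (intro partial_sum_norm) auto
  also have "\<dots> \<le> (\<Sum>i<N. K * t ^ N / (1 - t))"
  proof (rule sum_mono)
   fix i assume "i \<in> {..<N}"
   then have eq: "(K * t ^ i) * t ^ (N - i) = K * t ^ N" by (simp flip: power_add)
   have "bnorm V (bdiff V (v i) (psum V (u i) (N - i))) \<le> (K * t ^ i) * t ^ (N - i) / (1 - t)"
    using le[of i] by (intro bsums_tail u v t) (use t K in \<open>simp_all add: power_add mult.assoc\<close>)
   then show "bnorm V (bdiff V (v i) (psum V (u i) (N - i))) \<le> K * t ^ N / (1 - t)"
    unfolding eq .
  qed
  also have "\<dots> = K / (1 - t) * (of_nat N * t ^ N)" by simp
  finally show ?thesis .
 qed
 then have "bnorm V (bdiff V (psum V (diag V u) N) s)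
   \<le> K / (1 - t) * (of_nat N * t ^ N) + bnorm V (bdiff V (psum V v N) s)" for N
  using norm_diff_triangle[of "psum V (diag V u) N" "psum V v N" s]
   norm_diff_commute[of "psum V (diag V u) N" "psum V v N"] vV sV dV
  by (smt (verit) partial_sum_closed)
 moreover have "(\<lambda>N. K / (1 - t) * (of_nat N * t ^ N) + bnorm V (bdiff V (psum V v N) s)) \<longlonglongrightarrow> 0"
  using t by (intro tendsto_add_zero tendsto_mult_right_zero powser_times_n_limit_0 bsumsD(2)[OF s]) auto
 moreover have "0 \<le> bnorm V (bdiff V (psum V (diag V u) N) s)" for N using dV sV by auto
 ultimately show "(\<lambda>N. bnorm V (bdiff V (psum V (diag V u) N) s)) \<longlonglongrightarrow> 0"
  by (rule nonneg_le_tendsto_zero[rotated])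
qed

end

subsection \<open>Linear maps\<close>

lemma is_linearI:
 "(\<And>x. x \<in> car V ==> T x \<in> car W) ==>
  (\<And>x y. x \<in> car V ==> y \<in> car V ==> T (badd V x y) = badd W (T x) (T y)) ==>
  (\<And>c x. x \<in> car V ==> T (bscale V c x) = bscale W c (T x)) ==> is_linear V W T"
 by (auto simp: is_linear_def)

lemma is_linearD:
 assumes "is_linear V W T" "x \<in> car V"
 shows "T x \<in> car W" "y \<in> car V ==> T (badd V x y) = badd W (T x) (T y)"
  "T (bscale V c x) = bscale W c (T x)"
 using assms by (auto simp: is_linear_def)

lemma is_linear_compose: "is_linear V W T ==> is_linear W Y S ==> is_linear V Y (\<lambda>x. S (T x))"
 by (auto simp: is_linear_def image_subset_iff)

lemma is_linear_cong:
 assumes "is_linear V W T" "nspace V" "\<And>x. x \<in> car V ==> T x = S x"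
 shows "is_linear V W S"
proof -
 interpret nspace V by fact
 show ?thesis using assms(1,3) by (auto simp: is_linear_def image_subset_iff)
qed

lemma is_linear_zero:
 assumes "is_linear V W T" "nspace V" "nspace W"
 shows "T (bzero V) = bzero W"
proof -
 interpret V: nspace V by fact
 interpret W: nspace W by fact
 show ?thesis using is_linearD(3)[OF assms(1), of "bzero V" 0] is_linearD(1)[OF assms(1), of "bzero V"] by simp
qed

lemma is_linear_diff:
 assumes "is_linear V W T" "nspace V" "x \<in> car V" "y \<in> car V"
 shows "T (bdiff V x y) = bdiff W (T x) (T y)"
proof -
 interpret V: nspace V by fact
 show ?thesis using assms by (simp add: bdiff_def is_linearD)
qed

lemma is_linear_const_zero: "nspace W ==> is_linear V W (\<lambda>x. bzero W)"
 by (intro is_linearI) (simp_all add: nspace.zero_closed nspace.add_zero nspace.scale_zero_right)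

lemma is_linear_partial_sum:
 assumes "nspace W" "nspace V" "\<And>i. i < n ==> is_linear V W (\<lambda>x. f x i)"
 shows "is_linear V W (\<lambda>x. psum W (f x) n)"
proof -
 interpret V: nspace V by fact
 interpret W: nspace W by fact
 note D = is_linearD[OF assms(3)]
 show ?thesis
 proof (rule is_linearI)
  fix x y assume xy: "x \<in> car V" "y \<in> car V"
  have "psum W (f (badd V x y)) n = psum W (\<lambda>i. badd W (f x i) (f y i)) n"
   using xy D by (intro partial_sum_cong) auto
  also have "\<dots> = badd W (psum W (f x) n) (psum W (f y) n)"
   using xy D by (intro W.partial_sum_add) auto
  finally show "psum W (f (badd V x y)) n = badd W (psum W (f x) n) (psum W (f y) n)" .
 next
  fix c x assume x: "x \<in> car V"
  have "psum W (f (bscale V c x)) n = psum W (\<lambda>i. bscale W c (f x i)) n"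
   using x D by (intro partial_sum_cong) auto
  also have "\<dots> = bscale W c (psum W (f x) n)"
   using x D by (intro W.partial_sum_scale) auto
  finally show "psum W (f (bscale V c x)) n = bscale W c (psum W (f x) n)" .
 qed (use D in auto)
qed

lemma is_linear_partial_sum_eq:
 assumes "is_linear V W T" "nspace V" "nspace W" "\<And>i. f i \<in> car V"
 shows "T (psum V f n) = psum W (\<lambda>i. T (f i)) n"
proof -
 interpret V: nspace V by fact
 show ?thesis by (induction n) (use assms is_linear_zero[OF assms(1-3)] in \<open>auto simp: is_linearD[OF assms(1)]\<close>)
qed

lemma bsums_linear:
 assumes "nspace V" "nspace W" "is_linear V W T"
  and K: "\<And>x. x \<in> car V ==> bnorm W (T x) \<le> K * bnorm V x"
  and f: "\<And>i. f i \<in> car V" "bsums V f s"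
 shows "bsums W (\<lambda>i. T (f i)) (T s)"
proof -
 interpret V: nspace V by fact
 interpret W: nspace W by fact
 note D = is_linearD[OF assms(3)]
 have s: "s \<in> car V" using V.bsumsD f by blast
 show ?thesis
 proof (rule W.bsumsI)
  have "bnorm W (bdiff W (psum W (\<lambda>i. T (f i)) n) (T s)) \<le> K * bnorm V (bdiff V (psum V f n) s)" for n
   using K[of "bdiff V (psum V f n) s"] f s
   by (simp add: is_linear_partial_sum_eq[OF assms(3,1,2)] is_linear_diff[OF assms(3,1)])
  moreover have "(\<lambda>n. K * bnorm V (bdiff V (psum V f n) s)) \<longlonglongrightarrow> 0"
   by (intro tendsto_mult_right_zero V.bsumsD f)
  moreover have "0 \<le> bnorm W (bdiff W (psum W (\<lambda>i. T (f i)) n) (T s))" for n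
   using D(1) f s by (intro W.norm_nonneg W.diff_closed W.partial_sum_closed) auto
  ultimately show "(\<lambda>n. bnorm W (bdiff W (psum W (\<lambda>i. T (f i)) n) (T s))) \<longlonglongrightarrow> 0"
   by (rule nonneg_le_tendsto_zero[rotated])
 qed (use D(1) f s in auto)
qed

subsection \<open>Expansions\<close>

definition bounded_family ::
 "('k::real_normed_field, 'v) bspace => ('k, 'w) bspace => (nat => 'v list => 'w) => real => real => bool"
 where
 "bounded_family V W m r C \<longleftrightarrow> r > 0 \<and> (\<forall>n. multilinear_on V W n (m n) \<and>
   (\<forall>xs. length xs = n \<and> set xs \<subseteq> car V -->
    bnorm W (m n xs) * r ^ n \<le> C * prod_list (map (bnorm V) xs)))"

text \<open>The pointwise content of \<open>banach_analytic_on\<close>, without the condition on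
  \<open>U\<close>. Proofs of analyticity work with this notion and add openness of the domain at
  the end.\<close>

definition analytic_at ::
 "('k::real_normed_field, 'v) bspace => ('k, 'w) bspace => 'v => ('v => 'w) => bool" where
 "analytic_at V W x f \<longleftrightarrow> x \<in> car V \<and> (\<exists>m r C. bounded_family V W m r C \<and>
   (\<forall>h\<in>car V. bnorm V h < r --> bsums W (\<lambda>n. m n (replicate n h)) (f (badd V x h))))"

lemma prod_list_norm_nonneg:
 "nspace V ==> set xs \<subseteq> car V ==> 0 \<le> prod_list (map (bnorm V) xs)"
 by (induction xs) (auto simp: nspace.norm_nonneg)

lemma bounded_familyD:
 assumes "bounded_family V W m r C" "length xs = n" "set xs \<subseteq> car V"
 shows "m n xs \<in> car W" "bnorm W (m n xs) * r ^ n \<le> C * prod_list (map (bnorm V) xs)"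
  "bnorm W (m n xs) \<le> C * (1 / r) ^ n * prod_list (map (bnorm V) xs)"
proof -
 show "m n xs \<in> car W" and *: "bnorm W (m n xs) * r ^ n \<le> C * prod_list (map (bnorm V) xs)"
  using assms unfolding bounded_family_def multilinear_on_def by auto
 have "r ^ n > 0" using assms by (auto simp: bounded_family_def)
 then show "bnorm W (m n xs) \<le> C * (1 / r) ^ n * prod_list (map (bnorm V) xs)"
  using * by (simp add: field_simps power_divide)
qed

lemma bounded_family_smaller:
 assumes "bounded_family V W m r C" "0 < r'" "r' \<le> r" "nspace W"
 shows "bounded_family V W m r' C"
 unfolding bounded_family_def
proof (intro conjI allI impI)
 interpret W: nspace W by fact
 fix n xs assume xs: "length xs = n \<and> set xs \<subseteq> car V"
 have "bnorm W (m n xs) * r' ^ n \<le> bnorm W (m n xs) * r ^ n"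
  using assms xs bounded_familyD(1)[OF assms(1), of xs n] by (intro mult_left_mono power_mono) auto
 also have "\<dots> \<le> C * prod_list (map (bnorm V) xs)" using bounded_familyD(2)[OF assms(1)] xs by blast
 finally show "bnorm W (m n xs) * r' ^ n \<le> C * prod_list (map (bnorm V) xs)" .
qed (use assms in \<open>auto simp: bounded_family_def\<close>)

lemma bounded_family_nonneg: "bounded_family V W m r C ==> nspace W ==> 0 \<le> C"
 using bounded_familyD(1,2)[of V W m r C "[]" 0] nspace.norm_nonneg[of W "m 0 []"] by simp

lemma bounded_family_mono:
 assumes "bounded_family V W m r C" "C \<le> C'" "nspace V"
 shows "bounded_family V W m r C'"
 unfolding bounded_family_def
proof (intro conjI allI impI)
 fix n xs assume xs: "length xs = n \<and> set xs \<subseteq> car V"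
 have "C * prod_list (map (bnorm V) xs) \<le> C' * prod_list (map (bnorm V) xs)"
  using assms xs by (intro mult_right_mono prod_list_norm_nonneg) auto
 then show "bnorm W (m n xs) * r ^ n \<le> C' * prod_list (map (bnorm V) xs)"
  using bounded_familyD(2)[OF assms(1)] xs by (meson order_trans)
qed (use assms in \<open>auto simp: bounded_family_def\<close>)

lemma analytic_at_cong:
 assumes "analytic_at V W x f" "nspace W" "r > 0"
  "\<And>h. h \<in> car V ==> bnorm V h < r ==> f (badd V x h) = g (badd V x h)"
 shows "analytic_at V W x g"
proof -
 obtain m r' C where m: "bounded_family V W m r' C"
  "\<And>h. h \<in> car V ==> bnorm V h < r' ==> bsums W (\<lambda>n. m n (replicate n h)) (f (badd V x h))"
  and x: "x \<in> car V"
  using assms(1) unfolding analytic_at_def by blast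
 have "bounded_family V W m (min r r') C"
  using m assms by (intro bounded_family_smaller[OF m(1)]) (auto simp: bounded_family_def)
 moreover have "bsums W (\<lambda>n. m n (replicate n h)) (g (badd V x h))"
  if "h \<in> car V" "bnorm V h < min r r'" for h
  using m(2)[of h] assms(4)[of h] that by simp
 ultimately show ?thesis unfolding analytic_at_def using x by blast
qed

text \<open>The requirement \<open>badd V x h \<in> U\<close> for small \<open>h\<close> is openness
  of \<open>U\<close>. Conversely the radius of an expansion may be reduced to that of a ball inside
  \<open>U\<close>, since \<open>bounded_family\<close> is inherited by smaller radii.\<close>

lemma banach_analytic_on_iff:
 assumes "nspace V" "nspace W"
 shows "banach_analytic_on V W U f \<longleftrightarrow> openin (btop V) U \<and> (\<forall>x\<in>U. analytic_at V W x f)"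
proof
 interpret V: nspace V by fact
 assume L: "banach_analytic_on V W U f"
 show "openin (btop V) U \<and> (\<forall>x\<in>U. analytic_at V W x f)"
 proof
  show "openin (btop V) U" using L unfolding V.openin_btop banach_analytic_on_def by meson
  show "\<forall>x\<in>U. analytic_at V W x f"
  proof
   fix x assume x: "x \<in> U"
   then obtain r C m where "r > 0" and m: "\<forall>n. multilinear_on V W n (m n) \<and>
       (\<forall>xs. length xs = n \<and> set xs \<subseteq> car V -->
        bnorm W (m n xs) * r ^ n \<le> C * prod_list (map (bnorm V) xs))"
    and s: "\<forall>h\<in>car V. bnorm V h < r --> badd V x h \<in> U \<and>
       limitin (btop W) (psum W (\<lambda>n. m n (replicate n h))) (f (badd V x h)) sequentially"
    using L unfolding banach_analytic_on_def by blast
   then have "bounded_family V W m r C"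
    "\<forall>h\<in>car V. bnorm V h < r --> bsums W (\<lambda>n. m n (replicate n h)) (f (badd V x h))"
    unfolding bounded_family_def bsums_def by auto
   moreover have "x \<in> car V" using L x unfolding banach_analytic_on_def by blast
   ultimately show "analytic_at V W x f" unfolding analytic_at_def by blast
  qed
 qed
next
 interpret V: nspace V by fact
 assume R: "openin (btop V) U \<and> (\<forall>x\<in>U. analytic_at V W x f)"
 show "banach_analytic_on V W U f"
  unfolding banach_analytic_on_def
 proof (intro conjI ballI)
  show "U \<subseteq> car V" using R V.openin_btop by blast
  fix x assume x: "x \<in> U"
  obtain m r C where m: "bounded_family V W m r C"
   "\<forall>h\<in>car V. bnorm V h < r --> bsums W (\<lambda>n. m n (replicate n h)) (f (badd V x h))"
   using R x unfolding analytic_at_def by blast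
  obtain d where d: "d > 0" "\<forall>h\<in>car V. bnorm V h < d --> badd V x h \<in> U"
   using R x unfolding V.openin_btop by blast
  have bf: "bounded_family V W m (min r d) C"
   using m d assms by (intro bounded_family_smaller[OF m(1)]) (auto simp: bounded_family_def)
  show "\<exists>r>0. \<exists>C m.
    (\<forall>n. multilinear_on V W n (m n) \<and>
       (\<forall>xs. length xs = n \<and> set xs \<subseteq> car V -->
        bnorm W (m n xs) * r ^ n \<le> C * prod_list (map (bnorm V) xs))) \<and>
    (\<forall>h\<in>car V. bnorm V h < r -->
       badd V x h \<in> U \<and>
       limitin (btop W) (psum W (\<lambda>n. m n (replicate n h))) (f (badd V x h)) sequentially)"
   by (rule exI[of _ "min r d"], rule conjI, use m d in \<open>simp add: bounded_family_def\<close>,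
     rule exI[of _ C], rule exI[of _ m])
     (use bf m d in \<open>auto simp: bounded_family_def bsums_def\<close>)
 qed
qed

lemma bounded_family_term_zero:
 assumes "bounded_family V W m r C" "nspace V" "nspace W" "n > 0"
 shows "m n (replicate n (bzero V)) = bzero W"
proof -
 interpret V: nspace V by fact
 interpret W: nspace W by fact
 have s: "set (replicate n (bzero V)) \<subseteq> car V" by auto
 have "prod_list (map (bnorm V) (replicate n (bzero V))) = 0" using assms(4) by (cases n) auto
 then have "bnorm W (m n (replicate n (bzero V))) \<le> 0"
  using bounded_familyD(3)[OF assms(1) _ s, of n] by (metis length_replicate mult_zero_right)
 then show ?thesis
  using bounded_familyD(1)[OF assms(1) _ s, of n] by (simp add: W.norm_eq_zero[symmetric] antisym)
qed

lemma analytic_at_value: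
 assumes "bounded_family V W m r C" "nspace V" "nspace W" "x \<in> car V"
  "\<forall>h\<in>car V. bnorm V h < r --> bsums W (\<lambda>n. m n (replicate n h)) (f (badd V x h))"
 shows "f x = m 0 []"
proof -
 interpret V: nspace V by fact
 interpret W: nspace W by fact
 have "r > 0" using assms by (auto simp: bounded_family_def)
 then have 1: "bsums W (\<lambda>n. m n (replicate n (bzero V))) (f x)"
  using assms(5)[rule_format, of "bzero V"] assms(4) by simp
 have "bsums W (\<lambda>n. m n (replicate n (bzero V))) (psum W (\<lambda>n. m n (replicate n (bzero V))) 1)"
  using bounded_family_term_zero[OF assms(1-3)] bounded_familyD(1)[OF assms(1), of "[]" 0]
  by (intro W.bsums_finite) (auto simp: Suc_le_eq neq0_conv intro: bounded_familyD(1)[OF assms(1)])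
 with 1 show ?thesis
  using W.bsums_unique bounded_familyD(1)[OF assms(1), of "[]" 0] by fastforce
qed

lemma analytic_at_closed:
 assumes "analytic_at V W x f" "nspace V" "nspace W"
 shows "x \<in> car V" "f x \<in> car W"
proof -
 obtain m r C where m: "bounded_family V W m r C" "x \<in> car V"
  "\<forall>h\<in>car V. bnorm V h < r --> bsums W (\<lambda>n. m n (replicate n h)) (f (badd V x h))"
  using assms(1) unfolding analytic_at_def by blast
 then show "x \<in> car V" "f x \<in> car W"
  using analytic_at_value[OF m(1) assms(2,3) m(2,3)] bounded_familyD(1)[OF m(1), of "[]" 0] by auto
qed

lemma prod_list_replicate_norm: "prod_list (map g (replicate n h)) = (g h :: real) ^ n"
 by (induction n) auto

text \<open>Only the constant term survives at \<open>h = 0\<close>, so removing it leaves the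
  increment. For \<open>bnorm V h < r / 2\<close> the remaining series is dominated by a geometric
  one with ratio below 1/2, which produces the factor 2.\<close>

lemma analytic_at_increment:
 assumes "bounded_family V W m r C" "nspace V" "nspace W" "x \<in> car V"
  "\<forall>h\<in>car V. bnorm V h < r --> bsums W (\<lambda>n. m n (replicate n h)) (f (badd V x h))"
  and h: "h \<in> car V" "bnorm V h < r / 2"
 shows "bsums W (\<lambda>n. m (Suc n) (replicate (Suc n) h)) (bdiff W (f (badd V x h)) (f x))"
  "bnorm W (bdiff W (f (badd V x h)) (f x)) \<le> 2 * C * bnorm V h / r"
proof -
 interpret V: nspace V by fact
 interpret W: nspace W by fact
 have r: "r > 0" using assms by (auto simp: bounded_family_def)
 have C: "C \<ge> 0" using bounded_family_nonneg assms by blast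
 have mW: "m n (replicate n h) \<in> car W" for n
  using h by (intro bounded_familyD(1)[OF assms(1)]) auto
 have "bsums W (\<lambda>n. m n (replicate n h)) (f (badd V x h))"
  using assms(5) h r by auto
 from W.bsums_shift[OF mW this]
 show s: "bsums W (\<lambda>n. m (Suc n) (replicate (Suc n) h)) (bdiff W (f (badd V x h)) (f x))"
  using analytic_at_value[OF assms(1-5)] by simp
 define \<theta> where "\<theta> = bnorm V h / r"
 have \<theta>: "0 \<le> \<theta>" "\<theta> < 1 / 2" using h r by (auto simp: \<theta>_def field_simps)
 have "bnorm W (bdiff W (f (badd V x h)) (f x)) \<le> (C * \<theta>) / (1 - \<theta>)"
 proof (rule W.bsums_norm_le[OF _ s])
  fix n
  have "bnorm W (m (Suc n) (replicate (Suc n) h)) \<le> C * (1 / r) ^ Suc n * prod_list (map (bnorm V) (replicate (Suc n) h))"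
   using h by (intro bounded_familyD(3)[OF assms(1)]) auto
  also have "\<dots> = C * \<theta> * \<theta> ^ n"
   unfolding prod_list_replicate_norm by (simp add: \<theta>_def power_divide)
  finally show "bnorm W (m (Suc n) (replicate (Suc n) h)) \<le> C * \<theta> * \<theta> ^ n" .
  show "m (Suc n) (replicate (Suc n) h) \<in> car W" by (rule mW)
 qed (use \<theta> C in auto)
 also have "\<dots> \<le> (C * \<theta>) / (1 / 2)"
  using \<theta> C by (intro divide_left_mono) auto
 finally show "bnorm W (bdiff W (f (badd V x h)) (f x)) \<le> 2 * C * bnorm V h / r"
  by (simp add: \<theta>_def mult_ac)
qed

lemma analytic_at_continuous:
 assumes "analytic_at V W x f" "nspace V" "nspace W" "e > 0"
 shows "\<exists>d>0. \<forall>h\<in>car V. bnorm V h < d --> f (badd V x h) \<in> car W \<and> bnorm W (bdiff W (f (badd V x h)) (f x)) < e"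
proof -
 interpret V: nspace V by fact
 interpret W: nspace W by fact
 obtain m r C where m: "bounded_family V W m r C" "x \<in> car V"
  "\<forall>h\<in>car V. bnorm V h < r --> bsums W (\<lambda>n. m n (replicate n h)) (f (badd V x h))"
  using assms(1) unfolding analytic_at_def by blast
 have r: "r > 0" using m by (auto simp: bounded_family_def)
 have C: "C \<ge> 0" using bounded_family_nonneg m assms by blast
 \<comment> \<open>The second bound inverts the increment estimate
   \<open>2 * C * bnorm V h / r\<close>; \<open>C + 1\<close> replaces \<open>C\<close> so that the
   quotient makes sense for \<open>C = 0\<close>.\<close>
 define d where "d = min (r / 2) (e * r / (2 * (C + 1)))"
 have "d > 0" using r C assms(4) by (auto simp: d_def)
 moreover have "f (badd V x h) \<in> car W \<and> bnorm W (bdiff W (f (badd V x h)) (f x)) < e"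
  if h: "h \<in> car V" "bnorm V h < d" for h
 proof
  have "bnorm V h < r / 2" "bnorm V h < e * r / (2 * (C + 1))" using h by (auto simp: d_def)
  then have 1: "bnorm V h < r / 2" "bnorm V h * (2 * (C + 1)) < e * r" using C by (auto simp: field_simps)
  show "f (badd V x h) \<in> car W"
  proof -
   have "bnorm V h < r" using 1(1) r by linarith
   then show ?thesis using m(3) h(1) W.bsumsD(1) by blast
  qed
  have "bnorm W (bdiff W (f (badd V x h)) (f x)) \<le> 2 * C * bnorm V h / r"
   by (rule analytic_at_increment(2)[OF m(1) assms(2,3) m(2,3) h(1) 1(1)])
  also have "\<dots> \<le> bnorm V h * (2 * (C + 1)) / r"
   using r C h by (intro divide_right_mono) (auto simp: algebra_simps)
  also have "\<dots> < e" using 1 r by (simp add: field_simps)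
  finally show "bnorm W (bdiff W (f (badd V x h)) (f x)) < e" .
 qed
 ultimately show ?thesis by blast
qed

subsection \<open>Composition of expansions\<close>

text \<open>
 Substituting the series \<open>k = (\<Sum>i. m (i + 1) (h, \<dots>, h))\<close> into \<open>p (k, \<dots>, k)\<close>, where \<open>p\<close> has degree \<open>j\<close>,
 produces the term \<open>blk Y m j L p\<close> of degree \<open>j + L\<close>: the sum over all ways to split the argument list
 into \<open>j\<close> nonempty consecutive blocks.
\<close>

primrec blk ::
 "('k, 'y) bspace => (nat => 'v list => 'w) => nat => nat => ('w list => 'y) => 'v list => 'y" where
 "blk Y m 0 L p xs = (if L = 0 then p [] else bzero Y)"
| "blk Y m (Suc j) L p xs =
   diag Y (\<lambda>i l. blk Y m j l (\<lambda>ys. p (m (Suc i) (take (Suc i) xs) # ys)) (drop (Suc i) xs)) L"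

lemma multilinear_on_closed:
 "multilinear_on V W n m ==> length xs = n ==> set xs \<subseteq> car V ==> m xs \<in> car W"
 by (auto simp: multilinear_on_def)

lemma multilinear_on_linear:
 "multilinear_on V W n m ==> length xs = n ==> set xs \<subseteq> car V ==> i < n ==>
  is_linear V W (\<lambda>x. m (xs[i := x]))"
 by (auto simp: multilinear_on_def)

lemma multilinear_on_Cons:
 assumes "multilinear_on V W (Suc n) m" "w \<in> car V"
 shows "multilinear_on V W n (\<lambda>ys. m (w # ys))"
 unfolding multilinear_on_def
proof (intro allI impI conjI)
 fix xs assume xs: "length xs = n \<and> set xs \<subseteq> car V"
 then show "m (w # xs) \<in> car W" using assms by (intro multilinear_on_closed[OF assms(1)]) auto
 fix i assume "i < n"
 then show "is_linear V W (\<lambda>x. m (w # xs[i := x]))"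
  using multilinear_on_linear[OF assms(1), of "w # xs" "Suc i"] xs assms(2) by auto
qed

lemma multilinear_on_head:
 assumes "multilinear_on V W (Suc n) m" "length ys = n" "set ys \<subseteq> car V" "nspace V"
 shows "is_linear V W (\<lambda>w. m (w # ys))"
 using multilinear_on_linear[OF assms(1), of "bzero V # ys" 0] assms nspace.zero_closed[OF assms(4)] by auto

lemma set_take_drop_subset: "set xs \<subseteq> A ==> set (take n xs) \<subseteq> A" "set xs \<subseteq> A ==> set (drop n xs) \<subseteq> A"
 using set_take_subset set_drop_subset by fast+

context
 fixes V :: "('k::real_normed_field, 'v) bspace" and W :: "('k, 'w) bspace" and Y :: "('k, 'y) bspace"
  and m :: "nat => 'v list => 'w" and r C :: real
 assumes nV: "nspace V" and nW: "nspace W" and nY: "nspace Y"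
  and bf: "bounded_family V W m r C"
begin

interpretation V: nspace V by (rule nV)
interpretation W: nspace W by (rule nW)
interpretation Y: nspace Y by (rule nY)

lemma bf_pos: "r > 0" "C \<ge> 0"
 using bf bounded_family_nonneg[OF bf nW] by (auto simp: bounded_family_def)

lemma bf_take_closed:
 assumes "set xs \<subseteq> car V" "length xs = Suc j + L" "i \<le> L"
 shows "m (Suc i) (take (Suc i) xs) \<in> car W"
 using assms by (intro bounded_familyD(1)[OF bf]) (auto simp: set_take_drop_subset)

lemma blk_closed:
 "multilinear_on W Y j p ==> length xs = j + L ==> set xs \<subseteq> car V ==> blk Y m j L p xs \<in> car Y"
proof (induction j arbitrary: L p xs)
 case 0
 then show ?case using multilinear_on_closed[of W Y 0 p "[]"] by auto
next
 case (Suc j)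
 show ?case
  unfolding blk.simps
 proof (rule Y.diag_closed)
  fix i assume i: "i \<le> L"
  show "blk Y m j (L - i) (\<lambda>ys. p (m (Suc i) (take (Suc i) xs) # ys)) (drop (Suc i) xs) \<in> car Y"
   using Suc.prems i
   by (intro Suc.IH multilinear_on_Cons[OF Suc.prems(1)] bf_take_closed) (auto simp: set_take_drop_subset)
 qed
qed

text \<open>If the varied argument sits in the block consumed by \<open>m\<close>, it reaches the
  remaining recursion only through the outer map. Hence linearity in a parameter \<open>x\<close> of
  the outer map \<open>q x\<close> is what has to be propagated.\<close>

lemma blk_linear_arg:
 assumes "nspace V0"
 shows "(\<And>x. x \<in> car V0 ==> multilinear_on W Y j (q x)) ==>
  (\<And>ys. length ys = j ==> set ys \<subseteq> car W ==> is_linear V0 Y (\<lambda>x. q x ys)) ==>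
  length xs = j + L ==> set xs \<subseteq> car V ==> is_linear V0 Y (\<lambda>x. blk Y m j L (q x) xs)"
proof (induction j arbitrary: L q xs)
 case 0
 then show ?case by (cases "L = 0") (auto simp: is_linear_const_zero nY)
next
 case (Suc j)
 show ?case
  unfolding blk.simps diag_def
 proof (rule is_linear_partial_sum[OF nY assms])
  fix i assume "i < Suc L"
  then have i: "i \<le> L" by simp
  note w = bf_take_closed[OF Suc.prems(4,3) i]
  show "is_linear V0 Y (\<lambda>x. blk Y m j (L - i) (\<lambda>ys. q x (m (Suc i) (take (Suc i) xs) # ys)) (drop (Suc i) xs))"
  proof (rule Suc.IH)
   show "multilinear_on W Y j (\<lambda>ys. q x (m (Suc i) (take (Suc i) xs) # ys))" if "x \<in> car V0" for x
    using multilinear_on_Cons[OF Suc.prems(1) w] that by simp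
  qed (use Suc.prems i w in \<open>auto simp: set_take_drop_subset\<close>)
 qed
qed

text \<open>The position \<open>n\<close> lies either in the first block, where linearity passes
  through \<open>m\<close> and the head argument of \<open>p\<close> and then through
  \<open>blk_linear_arg\<close>, or behind it, where the induction hypothesis applies at position
  \<open>n - Suc i\<close>.\<close>

lemma blk_linear_list:
 "multilinear_on W Y j p ==> length xs = j + L ==> set xs \<subseteq> car V ==> n < j + L ==>
  is_linear V Y (\<lambda>x. blk Y m j L p (xs[n := x]))"
proof (induction j arbitrary: L p xs n)
 case 0
 then show ?case by (auto simp: is_linear_const_zero nY)
next
 case (Suc j)
 show ?case
  unfolding blk.simps diag_def
 proof (rule is_linear_partial_sum[OF nY nV])
  fix i assume "i < Suc L"
  then have i: "i \<le> L" by simp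
  note w = bf_take_closed[OF Suc.prems(3,2) i]
  show "is_linear V Y (\<lambda>x. blk Y m j (L - i) (\<lambda>ys. p (m (Suc i) (take (Suc i) (xs[n := x])) # ys))
      (drop (Suc i) (xs[n := x])))"
  proof (cases "n < Suc i")
   case True
   have t: "length (take (Suc i) xs) = Suc i" using Suc.prems i by auto
   have lin: "is_linear V W (\<lambda>x. m (Suc i) ((take (Suc i) xs)[n := x]))"
    using bf True t Suc.prems unfolding bounded_family_def
    by (intro multilinear_on_linear) (auto simp: set_take_drop_subset)
   have "is_linear V Y (\<lambda>x. blk Y m j (L - i) (\<lambda>ys. p (m (Suc i) ((take (Suc i) xs)[n := x]) # ys)) (drop (Suc i) xs))"
   proof (rule blk_linear_arg[OF nV])
    show "multilinear_on W Y j (\<lambda>ys. p (m (Suc i) ((take (Suc i) xs)[n := x]) # ys))" if "x \<in> car V" for x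
     using multilinear_on_Cons[OF Suc.prems(1)] is_linearD(1)[OF lin that] by simp
    show "is_linear V Y (\<lambda>x. p (m (Suc i) ((take (Suc i) xs)[n := x]) # ys))"
     if "length ys = j" "set ys \<subseteq> car W" for ys
     using is_linear_compose[OF lin multilinear_on_head[OF Suc.prems(1) that nW]] .
   qed (use Suc.prems i in \<open>auto simp: set_take_drop_subset\<close>)
   then show ?thesis using True by (simp add: take_update_swap drop_update_cancel del: take_Suc_Cons)
  next
   case False
   have "is_linear V Y (\<lambda>x. blk Y m j (L - i) (\<lambda>ys. p (m (Suc i) (take (Suc i) xs) # ys)) ((drop (Suc i) xs)[n - Suc i := x]))"
    using Suc.prems i False w
    by (intro Suc.IH multilinear_on_Cons[OF Suc.prems(1)]) (auto simp: set_take_drop_subset)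
   then show ?thesis using False by (simp add: drop_update_swap)
  qed
 qed
qed

text \<open>A block of length \<open>k\<close> contributes \<open>C * (1 / r) ^ k\<close>, so every
  splitting gives \<open>C ^ j * (1 / r) ^ (j + L)\<close>. The additional
  \<open>2 ^ (j + L)\<close> bounds the number of splittings into \<open>j\<close> nonempty
  blocks.\<close>

lemma blk_norm:
 "multilinear_on W Y j p ==> 0 \<le> D ==>
  (\<And>ys. length ys = j ==> set ys \<subseteq> car W ==> bnorm Y (p ys) \<le> D * prod_list (map (bnorm W) ys)) ==>
  length xs = j + L ==> set xs \<subseteq> car V ==>
  bnorm Y (blk Y m j L p xs) \<le> D * C ^ j * (2 / r) ^ (j + L) * prod_list (map (bnorm V) xs)"
proof (induction j arbitrary: L p xs D)
 case 0
 show ?case using 0(3)[of "[]"] 0(1,2,4,5) bf_pos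
  by (auto intro!: mult_nonneg_nonneg prod_list_norm_nonneg nV)
next
 case (Suc j)
 define P where "P = prod_list (map (bnorm V) xs)"
 have P: "P \<ge> 0" unfolding P_def using Suc.prems by (intro prod_list_norm_nonneg nV)
 have "bnorm Y (blk Y m (Suc j) L p xs) \<le> (\<Sum>i\<le>L. bnorm Y (blk Y m j (L - i)
      (\<lambda>ys. p (m (Suc i) (take (Suc i) xs) # ys)) (drop (Suc i) xs)))"
  unfolding blk.simps
 proof (rule Y.diag_norm)
  fix i assume i: "i \<le> L"
  show "blk Y m j (L - i) (\<lambda>ys. p (m (Suc i) (take (Suc i) xs) # ys)) (drop (Suc i) xs) \<in> car Y"
   using Suc.prems i bf_take_closed[OF Suc.prems(5,4) i]
   by (intro blk_closed multilinear_on_Cons[OF Suc.prems(1)]) (auto simp: set_take_drop_subset)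
 qed
 \<comment> \<open>The first block, of length \<open>Suc i\<close>, costs
   \<open>C * (1 / r) ^ Suc i\<close>, while the induction bound for the rest carries
   \<open>2 ^ (j + (L - i))\<close>. The powers of \<open>1 / r\<close> combine independently of
   \<open>i\<close>, and the powers of 2 are left to be summed geometrically.\<close>
 also have "\<dots> \<le> (\<Sum>i\<le>L. D * C ^ Suc j * (1 / r) ^ (Suc j + L) * P * 2 ^ (j + (L - i)))"
 proof (rule sum_mono)
  fix i assume "i \<in> {..L}"
  then have i: "i \<le> L" by simp
  define w where "w = m (Suc i) (take (Suc i) xs)"
  define P1 where "P1 = prod_list (map (bnorm V) (take (Suc i) xs))"
  define P2 where "P2 = prod_list (map (bnorm V) (drop (Suc i) xs))"
  have P12: "P1 * P2 = P" unfolding P1_def P2_def P_def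
   by (metis append_take_drop_id map_append prod_list.append)
  have P2: "P2 \<ge> 0" unfolding P2_def using Suc.prems by (intro prod_list_norm_nonneg nV) (auto simp: set_take_drop_subset)
  have w: "w \<in> car W" unfolding w_def by (rule bf_take_closed[OF Suc.prems(5,4) i])
  have wn: "bnorm W w \<le> C * (1 / r) ^ Suc i * P1"
   unfolding w_def P1_def using Suc.prems i
   by (intro bounded_familyD(3)[OF bf]) (auto simp: set_take_drop_subset)
  have "bnorm Y (blk Y m j (L - i) (\<lambda>ys. p (w # ys)) (drop (Suc i) xs))
    \<le> (D * bnorm W w) * C ^ j * (2 / r) ^ (j + (L - i)) * P2"
   unfolding P2_def
  proof (rule Suc.IH)
   show "multilinear_on W Y j (\<lambda>ys. p (w # ys))" by (rule multilinear_on_Cons[OF Suc.prems(1) w])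
   show "bnorm Y (p (w # ys)) \<le> D * bnorm W w * prod_list (map (bnorm W) ys)"
    if "length ys = j" "set ys \<subseteq> car W" for ys
    using Suc.prems(3)[of "w # ys"] that w by (simp add: mult_ac)
  qed (use Suc.prems i w in \<open>auto simp: set_take_drop_subset\<close>)
  also have "\<dots> \<le> (D * (C * (1 / r) ^ Suc i * P1)) * C ^ j * (2 / r) ^ (j + (L - i)) * P2"
   using wn Suc.prems(2) bf_pos P2 by (intro mult_right_mono mult_left_mono) auto
  also have "\<dots> = D * C ^ Suc j * ((1 / r) ^ Suc i * (1 / r) ^ (j + (L - i))) * (P1 * P2) * 2 ^ (j + (L - i))"
   by (simp add: power_divide)
  also have "(1 / r) ^ Suc i * (1 / r) ^ (j + (L - i)) = (1 / r) ^ (Suc j + L)"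
   using i by (simp flip: power_add)
  finally show "bnorm Y (blk Y m j (L - i) (\<lambda>ys. p (m (Suc i) (take (Suc i) xs) # ys)) (drop (Suc i) xs))
    \<le> D * C ^ Suc j * (1 / r) ^ (Suc j + L) * P * 2 ^ (j + (L - i))"
   by (simp add: w_def P12)
 qed
 also have "\<dots> = D * C ^ Suc j * (1 / r) ^ (Suc j + L) * P * (\<Sum>i\<le>L. 2 ^ (j + (L - i)))"
  by (simp add: sum_distrib_left)
 also have "\<dots> \<le> D * C ^ Suc j * (1 / r) ^ (Suc j + L) * P * 2 ^ (Suc j + L)"
 proof (rule mult_left_mono)
  have "(\<Sum>i\<le>L. 2 ^ (j + (L - i)) :: real) = (\<Sum>i\<le>L. 2 ^ (j + i))"
   by (rule sum.reindex_bij_witness[of _ "\<lambda>i. L - i" "\<lambda>i. L - i"]) auto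
  also have "\<dots> \<le> 2 ^ (Suc j + L)"
   by (induction L) auto
  finally show "(\<Sum>i\<le>L. 2 ^ (j + (L - i)) :: real) \<le> 2 ^ (Suc j + L)" .
 qed (use Suc.prems(2) bf_pos P in auto)
 also have "\<dots> = D * C ^ Suc j * (2 / r) ^ (Suc j + L) * P"
  by (simp add: power_divide)
 finally show ?case unfolding P_def .
qed

text \<open>Induction on \<open>j\<close>. For a fixed first block the remaining blocks sum to
  \<open>p (w i # replicate j k)\<close> by the induction hypothesis; summing over \<open>i\<close>
  uses that \<open>p\<close> is bounded and linear in its first slot. The two sums merge into one
  over the total degree by \<open>bsums_diag\<close>, for which \<open>2 / r * bnorm V h < 1\<close>
  provides the geometric ratio.\<close>

lemma blk_bsums:
 assumes h: "h \<in> car V" "2 / r * bnorm V h < 1"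
  and k: "bsums W (\<lambda>i. m (Suc i) (replicate (Suc i) h)) k"
 shows "multilinear_on W Y j p ==> 0 \<le> D ==>
  (\<And>ys. length ys = j ==> set ys \<subseteq> car W ==> bnorm Y (p ys) \<le> D * prod_list (map (bnorm W) ys)) ==>
  bsums Y (\<lambda>L. blk Y m j L p (replicate (j + L) h)) (p (replicate j k))"
proof (induction j arbitrary: p D)
 case 0
 have "bsums Y (\<lambda>L. if L = 0 then p [] else bzero Y) (psum Y (\<lambda>L. if L = 0 then p [] else bzero Y) 1)"
  using multilinear_on_closed[OF 0(1)] by (intro Y.bsums_finite) auto
 then show ?case using multilinear_on_closed[OF 0(1), of "[]"] by simp
next
 case (Suc j)
 define w where "w i = m (Suc i) (replicate (Suc i) h)" for i
 have w: "w i \<in> car W" for i unfolding w_def using h by (intro bounded_familyD(1)[OF bf]) auto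
 have kW: "k \<in> car W" using W.bsumsD k by blast
 define t where "t = bnorm V h"
 have t: "t \<ge> 0" using h by (simp add: t_def)
 define \<theta> where "\<theta> = 2 / r * t"
 have \<theta>: "0 \<le> \<theta>" "\<theta> < 1" using h t bf_pos by (auto simp: \<theta>_def t_def)
 have wn: "bnorm W (w i) \<le> C * \<theta> * \<theta> ^ i" for i
 proof -
  have "bnorm W (w i) \<le> C * (1 / r) ^ Suc i * prod_list (map (bnorm V) (replicate (Suc i) h))"
   unfolding w_def using h by (intro bounded_familyD(3)[OF bf]) auto
  also have "\<dots> = C * (t / r) ^ Suc i" unfolding prod_list_replicate_norm by (simp add: t_def power_divide)
  also have "\<dots> \<le> C * \<theta> ^ Suc i"
   using bf_pos t by (intro mult_left_mono power_mono) (auto simp: \<theta>_def field_simps)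
  finally show ?thesis by simp
 qed
 define u where "u i l = blk Y m j l (\<lambda>ys. p (w i # ys)) (replicate (j + l) h)" for i l
 have ml: "multilinear_on W Y j (\<lambda>ys. p (w i # ys))" for i by (rule multilinear_on_Cons[OF Suc.prems(1) w])
 have pb: "bnorm Y (p (z # ys)) \<le> D * bnorm W z * prod_list (map (bnorm W) ys)"
  if "length ys = j" "set ys \<subseteq> car W" "z \<in> car W" for ys z
  using Suc.prems(3)[of "z # ys"] that by (simp add: mult_ac)
 have "bsums Y (diag Y u) (p (k # replicate j k))"
 proof (rule Y.bsums_diag)
  show "u i l \<in> car Y" for i l unfolding u_def using h by (intro blk_closed ml) auto
  show "bnorm Y (u i l) \<le> D * C ^ Suc j * \<theta> ^ Suc j * \<theta> ^ (i + l)" for i l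
  proof -
   have "bnorm Y (u i l) \<le> (D * bnorm W (w i)) * C ^ j * (2 / r) ^ (j + l) * prod_list (map (bnorm V) (replicate (j + l) h))"
    unfolding u_def using h Suc.prems(2) w pb by (intro blk_norm ml) auto
   also have "\<dots> = (D * bnorm W (w i)) * C ^ j * \<theta> ^ (j + l)"
    unfolding prod_list_replicate_norm by (simp add: \<theta>_def t_def power_mult_distrib power_divide)
   also have "\<dots> \<le> (D * (C * \<theta> * \<theta> ^ i)) * C ^ j * \<theta> ^ (j + l)"
    using wn Suc.prems(2) bf_pos \<theta> by (intro mult_right_mono mult_left_mono) auto
   also have "\<dots> = D * C ^ Suc j * \<theta> ^ Suc j * \<theta> ^ (i + l)" by (simp add: power_add)
   finally show ?thesis .
  qed
  show "bsums Y (u i) (p (w i # replicate j k))" for i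
   unfolding u_def using Suc.IH[OF ml, of "D * bnorm W (w i)" i] Suc.prems(2) w pb by simp
  show "bsums Y (\<lambda>i. p (w i # replicate j k)) (p (k # replicate j k))"
  proof (rule bsums_linear[OF nW nY, where K = "D * bnorm W k ^ j" and T = "\<lambda>z. p (z # replicate j k)"])
   show "is_linear W Y (\<lambda>z. p (z # replicate j k))"
    using kW by (intro multilinear_on_head[OF Suc.prems(1) _ _ nW]) auto
   show "bnorm Y (p (z # replicate j k)) \<le> D * bnorm W k ^ j * bnorm W z" if "z \<in> car W" for z
   proof -
    have "set (replicate j k) \<subseteq> car W" using kW by auto
    then show ?thesis using pb[of "replicate j k" z] that unfolding prod_list_replicate_norm by (simp add: mult_ac)
   qed
   show "bsums W w k" using k by (simp add: w_def[abs_def])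
  qed (use w in auto)
 qed (use \<theta> bf_pos Suc.prems in auto)
 moreover have "diag Y u L = blk Y m (Suc j) L p (replicate (Suc j + L) h)" for L
 proof -
  have "blk Y m (Suc j) L p (replicate (Suc j + L) h)
    = diag Y (\<lambda>i l. blk Y m j l (\<lambda>ys. p (m (Suc i) (take (Suc i) (replicate (Suc j + L) h)) # ys))
      (drop (Suc i) (replicate (Suc j + L) h))) L" by simp
  also have "\<dots> = diag Y u L"
   unfolding diag_def
  proof (rule partial_sum_cong)
   fix i assume "i < Suc L"
   then have 1: "take (Suc i) (replicate (Suc j + L) h) = replicate (Suc i) h"
    and 2: "drop (Suc i) (replicate (Suc j + L) h) = replicate (j + (L - i)) h"
    unfolding take_replicate drop_replicate
    by (auto simp: min_def intro: arg_cong[of _ _ "\<lambda>n. replicate n h"])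
   show "blk Y m j (L - i) (\<lambda>ys. p (m (Suc i) (take (Suc i) (replicate (Suc j + L) h)) # ys))
      (drop (Suc i) (replicate (Suc j + L) h)) = u i (L - i)"
    unfolding 1 2 u_def w_def ..
  qed
  finally show ?thesis by (rule sym)
 qed
 then have "diag Y u = (\<lambda>L. blk Y m (Suc j) L p (replicate (Suc j + L) h))" by (rule ext)
 ultimately show ?case by (simp only: replicate_Suc)
qed

end

text \<open>With \<open>k\<close> the increment of \<open>f\<close>, the expansion of
  \<open>g\<close> at \<open>f x\<close> has the summands \<open>p j (k, ..., k)\<close>. Each of
  them is itself a series in \<open>h\<close> by \<open>blk_bsums\<close>, and collecting total
  degree \<open>N\<close> gives the coefficient \<open>c N\<close>.\<close>

theorem analytic_at_compose:
 assumes f: "analytic_at V W x f" and g: "analytic_at W Y (f x) g"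
  and nV: "nspace V" and nW: "nspace W" and nY: "nspace Y"
 shows "analytic_at V Y x (\<lambda>z. g (f z))"
proof -
 interpret V: nspace V by fact
 interpret W: nspace W by fact
 interpret Y: nspace Y by fact
 obtain m r C where bf: "bounded_family V W m r C" and x: "x \<in> car V"
  and fs: "\<forall>h\<in>car V. bnorm V h < r --> bsums W (\<lambda>n. m n (replicate n h)) (f (badd V x h))"
  using f unfolding analytic_at_def by blast
 obtain p s D where bg: "bounded_family W Y p s D" and y: "f x \<in> car W"
  and gs: "\<forall>k\<in>car W. bnorm W k < s --> bsums Y (\<lambda>n. p n (replicate n k)) (g (badd W (f x) k))"
  using g unfolding analytic_at_def by blast
 have r: "r > 0" and s: "s > 0" using bf bg by (auto simp: bounded_family_def)
 have C: "C \<ge> 0" and D: "D \<ge> 0" using bounded_family_nonneg[OF bf nW] bounded_family_nonneg[OF bg nY] by auto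
 have ml: "multilinear_on W Y j (p j)" for j using bg by (auto simp: bounded_family_def)
 have pb: "bnorm Y (p j ys) \<le> D * (1 / s) ^ j * prod_list (map (bnorm W) ys)"
  if "length ys = j" "set ys \<subseteq> car W" for j ys
  using bounded_familyD(3)[OF bg that] .
 \<comment> \<open>Being at least 1, it satisfies
   \<open>(C / s) ^ j \<le> \<kappa> ^ (j + l)\<close>, a bound in terms of the total degree
   only.\<close>
 define \<kappa> where "\<kappa> = max 1 (C / s)"
 have \<kappa>: "\<kappa> \<ge> 1" "C / s \<le> \<kappa>" by (auto simp: \<kappa>_def)
 define c where "c N xs = diag Y (\<lambda>j l. blk Y m j l (p j) xs) N" for N xs
 \<comment> \<open>One factor 2 of the 4 pays for the powers of 2 in \<open>blk_norm\<close>, the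
   other for the \<open>Suc N \<le> 2 ^ N\<close> summands of \<open>c N\<close>. The same radius
   keeps the increment \<open>k\<close> below the radius \<open>s\<close> of
   \<open>g\<close>.\<close>
 define R where "R = r / (4 * \<kappa>)"
 have R: "R > 0" using r \<kappa> by (simp add: R_def)
 have blkn: "bnorm Y (blk Y m j l (p j) xs) \<le> D * (2 * \<kappa> / r) ^ (j + l) * prod_list (map (bnorm V) xs)"
  if "length xs = j + l" "set xs \<subseteq> car V" for j l xs
 proof -
  have "bnorm Y (blk Y m j l (p j) xs) \<le> (D * (1 / s) ^ j) * C ^ j * (2 / r) ^ (j + l) * prod_list (map (bnorm V) xs)"
   using that D s pb by (intro blk_norm[OF nV nW nY bf ml]) auto
  also have "(D * (1 / s) ^ j) * C ^ j = D * (C / s) ^ j" by (simp add: power_divide)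
  also have "D * (C / s) ^ j * (2 / r) ^ (j + l) * prod_list (map (bnorm V) xs)
    \<le> D * \<kappa> ^ (j + l) * (2 / r) ^ (j + l) * prod_list (map (bnorm V) xs)"
  proof (intro mult_right_mono mult_left_mono)
   have "(C / s) ^ j \<le> \<kappa> ^ j" using \<kappa> C s by (intro power_mono) auto
   also have "\<dots> \<le> \<kappa> ^ (j + l)" using \<kappa> by (intro power_increasing) auto
   finally show "(C / s) ^ j \<le> \<kappa> ^ (j + l)" .
  qed (use D r that nV in \<open>auto intro: prod_list_norm_nonneg\<close>)
  also have "\<dots> = D * (2 * \<kappa> / r) ^ (j + l) * prod_list (map (bnorm V) xs)"
   by (simp add: power_divide power_mult_distrib)
  finally show ?thesis .
 qed
 have "bounded_family V Y c R D"
  unfolding bounded_family_def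
 proof (intro conjI allI impI R)
  fix N
  have lin: "is_linear V Y (\<lambda>x. c N (xs[n := x]))" if "length xs = N" "set xs \<subseteq> car V" "n < N" for xs n
   unfolding c_def diag_def using that
   by (intro is_linear_partial_sum[OF nY nV] blk_linear_list[OF nV nW nY bf ml]) auto
  have cl: "c N xs \<in> car Y" if "length xs = N" "set xs \<subseteq> car V" for xs
   unfolding c_def using that by (intro Y.diag_closed blk_closed[OF nV nW nY bf ml]) auto
  show "multilinear_on V Y N (c N)" unfolding multilinear_on_def using lin cl by auto
  fix xs assume xs: "length xs = N \<and> set xs \<subseteq> car V"
  have "bnorm Y (c N xs) \<le> (\<Sum>i\<le>N. bnorm Y (blk Y m i (N - i) (p i) xs))"
   unfolding c_def using xs by (intro Y.diag_norm blk_closed[OF nV nW nY bf ml]) auto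
  also have "\<dots> \<le> (\<Sum>i\<le>N. D * (2 * \<kappa> / r) ^ N * prod_list (map (bnorm V) xs))"
  proof (rule sum_mono)
   fix i assume "i \<in> {..N}"
   then show "bnorm Y (blk Y m i (N - i) (p i) xs) \<le> D * (2 * \<kappa> / r) ^ N * prod_list (map (bnorm V) xs)"
    using blkn[of xs i "N - i"] xs by simp
  qed
  also have "\<dots> = real (Suc N) * (D * (2 * \<kappa> / r) ^ N * prod_list (map (bnorm V) xs))" by simp
  also have "\<dots> \<le> 2 ^ N * (D * (2 * \<kappa> / r) ^ N * prod_list (map (bnorm V) xs))"
  proof (intro mult_right_mono)
   have "Suc N \<le> 2 ^ N" by (induction N) auto
   then show "real (Suc N) \<le> 2 ^ N" by (metis of_nat_le_iff of_nat_numeral of_nat_power)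
  qed (use D r \<kappa> xs nV in \<open>auto intro!: mult_nonneg_nonneg prod_list_norm_nonneg\<close>)
  finally have "bnorm Y (c N xs) * R ^ N \<le> 2 ^ N * (D * (2 * \<kappa> / r) ^ N * prod_list (map (bnorm V) xs)) * R ^ N"
   using R by (intro mult_right_mono) auto
  also have "\<dots> = D * (2 * (2 * \<kappa> / r) * R) ^ N * prod_list (map (bnorm V) xs)"
   unfolding power_mult_distrib by (simp only: mult_ac)
  also have "2 * (2 * \<kappa> / r) * R = 1" using r \<kappa> by (simp add: R_def field_simps)
  finally show "bnorm Y (c N xs) * R ^ N \<le> D * prod_list (map (bnorm V) xs)" by simp
 qed
 moreover have "bsums Y (\<lambda>n. c n (replicate n h)) (g (f (badd V x h)))"
  if h: "h \<in> car V" "bnorm V h < R" for h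
 proof -
  define t where "t = bnorm V h"
  have t: "0 \<le> t" using h by (simp add: t_def)
  have t2: "4 * \<kappa> * t < r" using h \<kappa> by (simp add: t_def R_def field_simps)
  have t3: "4 * t < r" using t2 \<kappa> t mult_right_mono[of 1 \<kappa> "4 * t"] by linarith
  have h2: "bnorm V h < r / 2" using t3 t by (simp add: t_def)
  define k where "k = bdiff W (f (badd V x h)) (f x)"
  note inc = analytic_at_increment[OF bf nV nW x fs h(1) h2]
  have k: "bsums W (\<lambda>n. m (Suc n) (replicate (Suc n) h)) k" using inc(1) by (simp add: k_def)
  have kW: "k \<in> car W" using k W.bsumsD by blast
  have "bnorm V h < r" using h2 r by linarith
  then have fW: "f (badd V x h) \<in> car W" using fs h(1) W.bsumsD(1) by blast
  have "bnorm W k \<le> 2 * C * t / r" using inc(2) by (simp add: k_def t_def)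
  also have "\<dots> \<le> 2 * (\<kappa> * s) * t / r"
   using \<kappa> s t r by (intro divide_right_mono mult_right_mono mult_left_mono) (auto simp: field_simps)
  also have "\<dots> < s"
  proof -
   have "4 * \<kappa> * t * s < r * s" using t2 s by (intro mult_strict_right_mono) auto
   moreover have "0 \<le> \<kappa> * t * s" using \<kappa> t s by auto
   ultimately have "2 * (\<kappa> * s) * t < s * r" by (simp add: algebra_simps)
   then show ?thesis using r by (simp add: field_simps)
  qed
  finally have gsk: "bsums Y (\<lambda>n. p n (replicate n k)) (g (badd W (f x) k))"
   using gs kW by blast
  have "badd W (f x) k = f (badd V x h)" using y fW by (simp add: k_def)
  with gsk have gsk: "bsums Y (\<lambda>n. p n (replicate n k)) (g (f (badd V x h)))" by simp
  define u where "u j l = blk Y m j l (p j) (replicate (j + l) h)" for j l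
  define \<theta> where "\<theta> = 2 * \<kappa> / r * t"
  have \<theta>: "0 \<le> \<theta>" "\<theta> < 1" using t t2 \<kappa> r by (auto simp: \<theta>_def field_simps)
  have "bsums Y (diag Y u) (g (f (badd V x h)))"
  proof (rule Y.bsums_diag[OF _ _ \<theta> D _ gsk])
   show "u i l \<in> car Y" for i l unfolding u_def using h by (intro blk_closed[OF nV nW nY bf ml]) auto
   show "bnorm Y (u i l) \<le> D * \<theta> ^ (i + l)" for i l
   proof -
    have "set (replicate (i + l) h) \<subseteq> car V" using h by auto
    then show ?thesis using blkn[of "replicate (i + l) h" i l] unfolding prod_list_replicate_norm
     by (simp add: u_def \<theta>_def t_def power_mult_distrib power_divide mult.assoc)
   qed
   show "bsums Y (u i) (p i (replicate i k))" for i
    unfolding u_def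
   proof (rule blk_bsums[OF nV nW nY bf h(1) _ k ml, where D = "D * (1 / s) ^ i"])
    show "2 / r * bnorm V h < 1" using t3 r t by (simp add: t_def field_simps)
   qed (use D s pb in auto)
  qed
  moreover have "diag Y u n = c n (replicate n h)" for n
   unfolding diag_def c_def by (rule partial_sum_cong) (simp add: u_def)
  then have "diag Y u = (\<lambda>n. c n (replicate n h))" by (rule ext)
  ultimately show ?thesis by simp
 qed
 ultimately show ?thesis unfolding analytic_at_def using x by blast
qed

subsection \<open>Polynomial maps of low degree\<close>

text \<open>Constant, linear and bilinear maps all have expansions that stop at degree 2, so a
  single computation covers them. A family that terminates may be given any radius; 1 is
  taken.\<close>

lemma analytic_at_quadratic:
 assumes nV: "nspace V" and nW: "nspace W" and x: "x \<in> car V" and a: "a \<in> car W"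
  and L: "is_linear V W L" "\<And>h. h \<in> car V ==> bnorm W (L h) \<le> K * bnorm V h"
  and B: "\<And>k. k \<in> car V ==> is_linear V W (\<lambda>h. B h k)" "\<And>h. h \<in> car V ==> is_linear V W (B h)"
   "\<And>h k. h \<in> car V ==> k \<in> car V ==> bnorm W (B h k) \<le> K' * (bnorm V h * bnorm V k)"
  and f: "\<And>h. h \<in> car V ==> f (badd V x h) = badd W (badd W a (L h)) (B h h)"
 shows "analytic_at V W x f"
proof -
 interpret V: nspace V by fact
 interpret W: nspace W by fact
 define m where "m n xs = (if n = 0 then a else if n = 1 then L (xs ! 0)
   else if n = 2 then B (xs ! 0) (xs ! 1) else bzero W)" for n :: nat and xs
 \<comment> \<open>One constant for all three degrees; 0 is included since \<open>K\<close> and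
   \<open>K'\<close> may be negative, for instance on a trivial space.\<close>
 define C where "C = Max {bnorm W a, K, K', 0}"
 have C: "bnorm W a \<le> C" "K \<le> C" "K' \<le> C" "0 \<le> C" by (auto simp: C_def)
 have len1: "\<exists>u. xs = [u]" if "length xs = Suc 0" for xs :: "'b list"
  using that by (cases xs) auto
 have len2: "\<exists>u v. xs = [u, v]" if "length xs = Suc (Suc 0)" for xs :: "'b list"
  using that by (cases xs; cases "tl xs") auto
 have mW: "m n xs \<in> car W" if "length xs = n" "set xs \<subseteq> car V" for n xs
 proof -
  consider "n = 0" | "n = 1" | "n = 2" | "n > 2" by linarith
  then show ?thesis
   by cases (use that a in \<open>auto simp: m_def numeral_2_eq_2 dest!: len1 len2 intro: is_linearD(1)[OF L(1)] is_linearD(1)[OF B(2)]\<close>)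
 qed
 have "bounded_family V W m 1 C"
  unfolding bounded_family_def
 proof (intro conjI allI impI)
  fix n
  show "multilinear_on V W n (m n)"
   unfolding multilinear_on_def
  proof (intro allI impI conjI)
   fix xs assume xs: "length xs = n \<and> set xs \<subseteq> car V"
   then show "m n xs \<in> car W" using mW by blast
   fix i assume i: "i < n"
   consider "n = 1" | "n = 2" | "n > 2" using i by linarith
   then show "is_linear V W (\<lambda>x. m n (xs[i := x]))"
   proof cases
    case 1
    then obtain u where "xs = [u]" using xs len1 by auto
    then show ?thesis using 1 i L by (simp add: m_def)
   next
    case 2
    then obtain u v where uv: "xs = [u, v]" using xs len2[of xs] by (auto simp: numeral_2_eq_2)
    have "i = 0 \<or> i = 1" using i 2 by auto
    then show ?thesis using 2 uv xs B by (auto simp: m_def)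
   next
    case 3
    then show ?thesis by (simp add: m_def is_linear_const_zero nW)
   qed
  qed
  fix xs assume xs: "length xs = n \<and> set xs \<subseteq> car V"
  consider "n = 0" | "n = 1" | "n = 2" | "n > 2" by linarith
  then show "bnorm W (m n xs) * 1 ^ n \<le> C * prod_list (map (bnorm V) xs)"
  proof cases
   case 1 then show ?thesis using xs C by (simp add: m_def)
  next
   case 2
   then obtain u where u: "xs = [u]" using xs len1 by auto
   then have "bnorm W (L u) \<le> K * bnorm V u" "K * bnorm V u \<le> C * bnorm V u"
    using L(2) xs C by (auto intro!: mult_right_mono)
   then show ?thesis using u 2 by (simp add: m_def)
  next
   case 3
   then obtain u v where uv: "xs = [u, v]" using xs len2[of xs] by (auto simp: numeral_2_eq_2)
   then have "bnorm W (B u v) \<le> K' * (bnorm V u * bnorm V v)" "K' * (bnorm V u * bnorm V v) \<le> C * (bnorm V u * bnorm V v)"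
    using B(3) xs C by (auto intro!: mult_right_mono)
   then show ?thesis using uv 3 by (simp add: m_def)
  next
   case 4
   then show ?thesis using xs C by (auto simp: m_def intro!: mult_nonneg_nonneg prod_list_norm_nonneg nV)
  qed
 qed simp
 moreover have "bsums W (\<lambda>n. m n (replicate n h)) (f (badd V x h))" if h: "h \<in> car V" for h
 proof -
  have "bsums W (\<lambda>n. m n (replicate n h)) (psum W (\<lambda>n. m n (replicate n h)) 3)"
  proof (rule W.bsums_finite)
   show "m n (replicate n h) \<in> car W" for n using h by (intro mW) auto
   show "m n (replicate n h) = bzero W" if "n \<ge> 3" for n using that by (simp add: m_def)
  qed
  also have "psum W (\<lambda>n. m n (replicate n h)) 3 = f (badd V x h)"
   using f[OF h] a is_linearD(1)[OF L(1) h] by (simp add: m_def numeral_3_eq_3 numeral_2_eq_2)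
  finally show ?thesis .
 qed
 ultimately show ?thesis unfolding analytic_at_def using x by blast
qed

lemma analytic_at_const:
 assumes nV: "nspace V" and nW: "nspace W" and x: "x \<in> car V" and a: "a \<in> car W"
 shows "analytic_at V W x (\<lambda>_. a)"
proof -
 interpret W: nspace W by fact
 interpret V: nspace V by fact
 show ?thesis
  by (rule analytic_at_quadratic[OF nV nW x a, of "\<lambda>_. bzero W" 0 "\<lambda>_ _. bzero W" 0])
    (auto simp: is_linear_const_zero nW a)
qed

lemma analytic_at_linear:
 assumes nV: "nspace V" and nW: "nspace W" and x: "x \<in> car V"
  and L: "is_linear V W L" "\<And>h. h \<in> car V ==> bnorm W (L h) \<le> K * bnorm V h"
 shows "analytic_at V W x L"
proof -
 interpret W: nspace W by fact
 interpret V: nspace V by fact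
 have B: "L (badd V x h) = badd W (badd W (L x) (L h)) (bzero W)" if "h \<in> car V" for h
  using that x by (simp add: is_linearD[OF L(1)])
 show ?thesis
  by (rule analytic_at_quadratic[OF nV nW x _ L, of "L x" "\<lambda>_ _. bzero W" 0])
    (use x B in \<open>auto simp: is_linear_const_zero nW is_linearD(1)[OF L(1)]\<close>)
qed

lemma analytic_at_linear_compose:
 assumes "nspace V" "nspace W" "nspace Y" "analytic_at V W x f"
  and "is_linear W Y L" "\<And>h. h \<in> car W ==> bnorm Y (L h) \<le> K * bnorm W h"
 shows "analytic_at V Y x (\<lambda>z. L (f z))"
 by (rule analytic_at_compose[OF assms(4) analytic_at_linear[OF assms(2,3) _ assms(5,6)] assms(1-3)])
   (use analytic_at_closed(2)[OF assms(4,1,2)] in auto)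

subsection \<open>Products\<close>

lemma prod_bspace_simps [simp]:
 "car (prod_bspace V W) = car V \<times> car W"
 "bzero (prod_bspace V W) = (bzero V, bzero W)"
 "badd (prod_bspace V W) (x, y) (x', y') = (badd V x x', badd W y y')"
 "bscale (prod_bspace V W) c (x, y) = (bscale V c x, bscale W c y)"
 "bnorm (prod_bspace V W) (x, y) = max (bnorm V x) (bnorm W y)"
 by (auto simp: prod_bspace_def)

lemma bdiff_prod [simp]: "bdiff (prod_bspace V W) (x, y) (x', y') = (bdiff V x x', bdiff W y y')"
 by (simp add: bdiff_def)

lemma normed_prod:
 assumes "nspace V" "nspace W" shows "nspace (prod_bspace V W)"
proof -
 interpret V: nspace V by fact
 interpret W: nspace W by fact
 have max0: "max a b = 0 \<longleftrightarrow> a = 0 \<and> b = 0" if "0 \<le> a" "0 \<le> b" for a b :: real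
  using that by (auto simp: max_def)
 have tri: "bnorm V (badd V a a') \<le> max (bnorm V a) (bnorm W b) + max (bnorm V a') (bnorm W b')"
   "bnorm W (badd W b b') \<le> max (bnorm V a) (bnorm W b) + max (bnorm V a') (bnorm W b')"
  if "a \<in> car V" "b \<in> car W" "a' \<in> car V" "b' \<in> car W" for a b a' b'
  using V.norm_triangle[OF that(1,3)] W.norm_triangle[OF that(2,4)] by linarith+
 show ?thesis
  by unfold_locales
    (auto simp: V.add_ac W.add_ac V.scale_add W.scale_add V.add_scale W.add_scale max0
     V.norm_eq_zero W.norm_eq_zero max_mult_distrib_left le_max_iff_disj tri)
qed

lemma partial_sum_prod:
 "psum (prod_bspace V W) (\<lambda>n. (f n, g n)) n = (psum V f n, psum W g n)"
 by (induction n) auto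

lemma bsums_prod:
 assumes nV: "nspace V" and nW: "nspace W"
  and f: "\<And>n. f n \<in> car V" "bsums V f s" and g: "\<And>n. g n \<in> car W" "bsums W g t"
 shows "bsums (prod_bspace V W) (\<lambda>n. (f n, g n)) (s, t)"
proof -
 interpret V: nspace V by fact
 interpret W: nspace W by fact
 interpret VW: nspace "prod_bspace V W" by (rule normed_prod[OF nV nW])
 show ?thesis
 proof (rule VW.bsumsI)
  have "(\<lambda>n. max (bnorm V (bdiff V (psum V f n) s)) (bnorm W (bdiff W (psum W g n) t))) \<longlonglongrightarrow> max 0 0"
   using V.bsumsD(2)[OF f(2)] W.bsumsD(2)[OF g(2)] by (intro tendsto_max)
  then show "(\<lambda>n. bnorm (prod_bspace V W) (bdiff (prod_bspace V W) (psum (prod_bspace V W) (\<lambda>n. (f n, g n)) n) (s, t))) \<longlonglongrightarrow> 0"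
   by (simp add: partial_sum_prod)
 qed (use V.bsumsD W.bsumsD f g in auto)
qed

lemma is_linear_pair: "is_linear V W f ==> is_linear V Y g ==> is_linear V (prod_bspace W Y) (\<lambda>x. (f x, g x))"
 by (auto simp: is_linear_def)

lemma analytic_at_pair:
 assumes nV: "nspace V" and nW: "nspace W" and nY: "nspace Y"
  and f: "analytic_at V W x f" and g: "analytic_at V Y x g"
 shows "analytic_at V (prod_bspace W Y) x (\<lambda>z. (f z, g z))"
proof -
 interpret V: nspace V by fact
 obtain m r C where m: "bounded_family V W m r C" and x: "x \<in> car V"
  and fs: "\<forall>h\<in>car V. bnorm V h < r --> bsums W (\<lambda>n. m n (replicate n h)) (f (badd V x h))"
  using f unfolding analytic_at_def by blast
 obtain p s D where p: "bounded_family V Y p s D"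
  and gs: "\<forall>h\<in>car V. bnorm V h < s --> bsums Y (\<lambda>n. p n (replicate n h)) (g (badd V x h))"
  using g unfolding analytic_at_def by blast
 define R where "R = min r s"
 have R: "R > 0" "R \<le> r" "R \<le> s" using m p by (auto simp: R_def bounded_family_def)
 have m': "bounded_family V W m R (max C D)"
  by (rule bounded_family_mono[OF bounded_family_smaller[OF m R(1,2) nW] _ nV]) simp
 have p': "bounded_family V Y p R (max C D)"
  by (rule bounded_family_mono[OF bounded_family_smaller[OF p R(1,3) nY] _ nV]) simp
 have "bounded_family V (prod_bspace W Y) (\<lambda>n xs. (m n xs, p n xs)) R (max C D)"
  using m' p' R by (auto simp: bounded_family_def multilinear_on_def max_mult_distrib_right intro!: is_linear_pair)
 moreover have "bsums (prod_bspace W Y) (\<lambda>n. (m n (replicate n h), p n (replicate n h))) (f (badd V x h), g (badd V x h))"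
  if h: "h \<in> car V" "bnorm V h < R" for h
 proof (rule bsums_prod[OF nW nY])
  have s: "set (replicate n h) \<subseteq> car V" for n using h by auto
  show "m n (replicate n h) \<in> car W" "p n (replicate n h) \<in> car Y" for n
   using bounded_familyD(1)[OF m _ s] bounded_familyD(1)[OF p _ s] by auto
 qed (use fs gs h R in auto)
 ultimately show ?thesis unfolding analytic_at_def using x by blast
qed

lemma analytic_at_fst:
 assumes nV: "nspace V" and nW: "nspace W" and "x \<in> car V \<times> car W"
 shows "analytic_at (prod_bspace V W) V x fst" "analytic_at (prod_bspace V W) W x snd"
 by (rule analytic_at_linear[where K = 1]; use assms in \<open>auto simp: is_linear_def normed_prod\<close>)+

text \<open>\<open>b (v + h1) (w + h2)\<close> splits into the value at \<open>(v, w)\<close>, the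
  part \<open>b h1 w + b v h2\<close> linear in the pair, and \<open>b h1 h2\<close>. The last is
  the diagonal of the bilinear map \<open>b (fst h) (snd k)\<close> on the product.\<close>

lemma analytic_at_bilinear_aux:
 assumes nV: "nspace V" and nW: "nspace W" and nY: "nspace Y"
  and b: "\<And>w. w \<in> car W ==> is_linear V Y (\<lambda>v. b v w)" "\<And>v. v \<in> car V ==> is_linear W Y (b v)"
  and K: "\<And>v w. v \<in> car V ==> w \<in> car W ==> bnorm Y (b v w) \<le> K * (bnorm V v * bnorm W w)"
  and v: "v \<in> car V" and w: "w \<in> car W"
 shows "analytic_at (prod_bspace V W) Y (v, w) (\<lambda>z. b (fst z) (snd z))"
proof -
 interpret V: nspace V by fact
 interpret W: nspace W by fact
 interpret Y: nspace Y by fact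
 define K1 where "K1 = max K 0"
 have K1: "bnorm Y (b v w) \<le> K1 * (bnorm V v * bnorm W w)" if "v \<in> car V" "w \<in> car W" for v w
  using K[OF that] mult_right_mono[of K K1 "bnorm V v * bnorm W w"] that by (simp add: K1_def)
 have K10: "0 \<le> K1" by (simp add: K1_def)
 note D1 = is_linearD[OF b(1)] and D2 = is_linearD[OF b(2)]
 show ?thesis
 proof (rule analytic_at_quadratic[where a = "b v w" and L = "\<lambda>z. badd Y (b (fst z) w) (b v (snd z))"
    and B = "\<lambda>z z'. b (fst z) (snd z')" and K = "K1 * bnorm W w + K1 * bnorm V v" and K' = K1])
  show "is_linear (prod_bspace V W) Y (\<lambda>z. badd Y (b (fst z) w) (b v (snd z)))"
   using v w by (intro is_linearI) (auto simp: D1 D2 Y.add_ac Y.scale_add)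
  show "is_linear (prod_bspace V W) Y (\<lambda>h. b (fst h) (snd k))" if "k \<in> car (prod_bspace V W)" for k
   using that by (intro is_linearI) (auto simp: D1 D2)
  show "is_linear (prod_bspace V W) Y (\<lambda>k. b (fst h) (snd k))" if "h \<in> car (prod_bspace V W)" for h
   using that by (intro is_linearI) (auto simp: D1 D2)
  show "bnorm Y (badd Y (b (fst h) w) (b v (snd h))) \<le> (K1 * bnorm W w + K1 * bnorm V v) * bnorm (prod_bspace V W) h"
   if "h \<in> car (prod_bspace V W)" for h
  proof -
   obtain h1 h2 where h: "h = (h1, h2)" "h1 \<in> car V" "h2 \<in> car W" using \<open>h \<in> _\<close> by auto
   have "bnorm Y (badd Y (b h1 w) (b v h2)) \<le> bnorm Y (b h1 w) + bnorm Y (b v h2)"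
    using h v w by (intro Y.norm_triangle) (auto simp: D1 D2)
   also have "\<dots> \<le> K1 * (bnorm V h1 * bnorm W w) + K1 * (bnorm V v * bnorm W h2)"
    using K1 h v w by (intro add_mono) auto
   also have "\<dots> \<le> K1 * (max (bnorm V h1) (bnorm W h2) * bnorm W w) + K1 * (bnorm V v * max (bnorm V h1) (bnorm W h2))"
    using K10 v w by (intro add_mono mult_left_mono mult_right_mono) auto
   finally show ?thesis using h by (simp add: algebra_simps)
  qed
  show "bnorm Y (b (fst h) (snd k)) \<le> K1 * (bnorm (prod_bspace V W) h * bnorm (prod_bspace V W) k)"
   if hk: "h \<in> car (prod_bspace V W)" "k \<in> car (prod_bspace V W)" for h k
  proof -
   obtain h1 h2 k1 k2 where h: "h = (h1, h2)" "h1 \<in> car V" "h2 \<in> car W"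
    "k = (k1, k2)" "k1 \<in> car V" "k2 \<in> car W" using hk by auto
   have "bnorm Y (b h1 k2) \<le> K1 * (bnorm V h1 * bnorm W k2)" using K1 h by auto
   also have "\<dots> \<le> K1 * (max (bnorm V h1) (bnorm W h2) * max (bnorm V k1) (bnorm W k2))"
    using h K10 by (intro mult_left_mono mult_mono) (auto simp: le_max_iff_disj)
   finally show ?thesis using h by simp
  qed
  show "b (fst (badd (prod_bspace V W) (v, w) h)) (snd (badd (prod_bspace V W) (v, w) h)) =
    badd Y (badd Y (b v w) (badd Y (b (fst h) w) (b v (snd h)))) (b (fst h) (snd h))"
   if "h \<in> car (prod_bspace V W)" for h
   using that v w by (auto simp: D1 D2 Y.add_ac)
 qed (use v w nY in \<open>auto simp: normed_prod nV nW D1\<close>)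
qed

lemma analytic_at_bilinear:
 assumes nU: "nspace U" and nV: "nspace V" and nW: "nspace W" and nY: "nspace Y"
  and "\<And>w. w \<in> car W ==> is_linear V Y (\<lambda>v. b v w)" "\<And>v. v \<in> car V ==> is_linear W Y (b v)"
  and "\<And>v w. v \<in> car V ==> w \<in> car W ==> bnorm Y (b v w) \<le> K * (bnorm V v * bnorm W w)"
  and f: "analytic_at U V x f" and g: "analytic_at U W x g"
 shows "analytic_at U Y x (\<lambda>z. b (f z) (g z))"
proof -
 have "analytic_at (prod_bspace V W) Y (f x, g x) (\<lambda>z. b (fst z) (snd z))"
  using assms analytic_at_closed(2)[OF f nU nV] analytic_at_closed(2)[OF g nU nW]
  by (intro analytic_at_bilinear_aux) auto
 then have "analytic_at U Y x (\<lambda>z. b (fst (f z, g z)) (snd (f z, g z)))"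
  by (rule analytic_at_compose[OF analytic_at_pair[OF nU nV nW f g]]) (use normed_prod nU nV nW nY in auto)
 then show ?thesis by simp
qed

lemma analytic_at_add:
 assumes nV: "nspace V" and nW: "nspace W"
  and f: "analytic_at V W x f" and g: "analytic_at V W x g"
 shows "analytic_at V W x (\<lambda>z. badd W (f z) (g z))"
proof -
 interpret W: nspace W by fact
 have "analytic_at V W x (\<lambda>z. (\<lambda>p. badd W (fst p) (snd p)) (f z, g z))"
 proof (rule analytic_at_linear_compose[OF nV normed_prod[OF nW nW] nW analytic_at_pair[OF nV nW nW f g], where K = 2])
  show "is_linear (prod_bspace W W) W (\<lambda>p. badd W (fst p) (snd p))"
   by (intro is_linearI) (auto simp: W.add_ac W.scale_add)
  show "bnorm W (badd W (fst h) (snd h)) \<le> 2 * bnorm (prod_bspace W W) h" if "h \<in> car (prod_bspace W W)" for h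
   using that W.norm_triangle[of "fst h" "snd h"] by (cases h) auto
 qed
 then show ?thesis by simp
qed

text \<open>For the maximum norm a ball of the product is a product of balls of the same
  radius.\<close>

lemma btop_prod:
 assumes nV: "nspace V" and nW: "nspace W"
 shows "btop (prod_bspace V W) = prod_topology (btop V) (btop W)"
 unfolding topology_eq
proof (intro allI iffI)
 interpret V: nspace V by fact
 interpret W: nspace W by fact
 interpret VW: nspace "prod_bspace V W" by (rule normed_prod[OF nV nW])
 fix S
 show "openin (prod_topology (btop V) (btop W)) S" if S: "openin (btop (prod_bspace V W)) S"
  unfolding openin_prod_topology_alt
 proof (intro allI impI)
  fix x y assume xy: "(x, y) \<in> S"
  then obtain r where r: "r > 0" "\<forall>z\<in>car (prod_bspace V W). bnorm (prod_bspace V W) (bdiff (prod_bspace V W) z (x, y)) < r --> z \<in> S"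
   using S unfolding VW.openin_btop_dist by blast
  have xyV: "x \<in> car V" "y \<in> car W" using S xy unfolding VW.openin_btop_dist by auto
  define U where "U = {x' \<in> car V. bnorm V (bdiff V x' x) < r}"
  define U' where "U' = {y' \<in> car W. bnorm W (bdiff W y' y) < r}"
  have "openin (btop V) U" "openin (btop W) U'"
   unfolding U_def U'_def by (rule V.openin_ball[OF xyV(1)], rule W.openin_ball[OF xyV(2)])
  moreover have "x \<in> U" "y \<in> U'" using r(1) xyV by (simp_all add: U_def U'_def)
  moreover have "U \<times> U' \<subseteq> S"
  proof (rule subsetI)
   fix z assume z: "z \<in> U \<times> U'"
   then show "z \<in> S" by (intro r(2)[rule_format]) (auto simp: U_def U'_def)
  qed
  ultimately show "\<exists>U U'. openin (btop V) U \<and> openin (btop W) U' \<and> x \<in> U \<and> y \<in> U' \<and> U \<times> U' \<subseteq> S"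
   by blast
 qed
 show "openin (btop (prod_bspace V W)) S" if S: "openin (prod_topology (btop V) (btop W)) S"
  unfolding VW.openin_btop_dist
 proof (intro conjI ballI)
  show "S \<subseteq> car (prod_bspace V W)" using openin_subset[OF S] by simp
  fix z assume "z \<in> S"
  then obtain x y where z: "z = (x, y)" "(x, y) \<in> S" by (cases z) auto
  obtain U U' where U: "openin (btop V) U" "openin (btop W) U'" "x \<in> U" "y \<in> U'" "U \<times> U' \<subseteq> S"
   using S[unfolded openin_prod_topology_alt, rule_format, OF z(2)] by (elim exE conjE)
  obtain r where r: "r > 0" "\<forall>y\<in>car V. bnorm V (bdiff V y x) < r --> y \<in> U"
   using U unfolding V.openin_btop_dist by blast
  obtain s where s: "s > 0" "\<forall>z\<in>car W. bnorm W (bdiff W z y) < s --> z \<in> U'"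
   using U unfolding W.openin_btop_dist by blast
  show "\<exists>r>0. \<forall>y\<in>car (prod_bspace V W). bnorm (prod_bspace V W) (bdiff (prod_bspace V W) y z) < r --> y \<in> S"
   by (rule exI[of _ "min r s"]) (use r s U z in \<open>auto 4 3\<close>)
 qed
qed

subsection \<open>Operator norms\<close>

text \<open>The norm of \<open>blin\<close> for functions that are not cut down to an extensional
  representative; the linear parts of affine maps are of this kind.\<close>

definition opn :: "('k, 'v) bspace => ('k, 'w) bspace => ('v => 'w) => real" where
 "opn V W T = Sup {bnorm W (T x) | x. x \<in> car V \<and> bnorm V x \<le> 1}"

definition bounded_lin :: "('k, 'v) bspace => ('k, 'w) bspace => ('v => 'w) => bool" where
 "bounded_lin V W T \<longleftrightarrow> is_linear V W T \<and> (\<exists>C. \<forall>x\<in>car V. bnorm W (T x) \<le> C * bnorm V x)"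

context
 fixes V :: "('k::real_normed_field, 'v) bspace" and W :: "('k, 'w) bspace"
 assumes nV: "nspace V" and nW: "nspace W"
begin

interpretation V: nspace V by (rule nV)
interpretation W: nspace W by (rule nW)

lemma opn_le:
 assumes "\<And>x. x \<in> car V ==> bnorm W (T x) \<le> C * bnorm V x" "0 \<le> C"
 shows "opn V W T \<le> C"
 unfolding opn_def
proof (rule cSup_least)
 show "{bnorm W (T x) |x. x \<in> car V \<and> bnorm V x \<le> 1} \<noteq> {}"
  using V.zero_closed V.norm_zero by force
 fix y assume "y \<in> {bnorm W (T x) |x. x \<in> car V \<and> bnorm V x \<le> 1}"
 then obtain x where x: "y = bnorm W (T x)" "x \<in> car V" "bnorm V x \<le> 1" by blast
 then have "y \<le> C * bnorm V x" using assms by auto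
 also have "\<dots> \<le> C" using x assms(2) mult_left_le[of "bnorm V x" C] by simp
 finally show "y \<le> C" .
qed

lemma opn_bound:
 assumes T: "bounded_lin V W T" and x: "x \<in> car V"
 shows "bnorm W (T x) \<le> opn V W T * bnorm V x"
proof -
 have lin: "is_linear V W T" using T by (simp add: bounded_lin_def)
 obtain C where C: "\<And>x. x \<in> car V ==> bnorm W (T x) \<le> C * bnorm V x"
  using T by (auto simp: bounded_lin_def)
 have bdd: "bdd_above {bnorm W (T x) |x. x \<in> car V \<and> bnorm V x \<le> 1}"
 proof (rule bdd_aboveI)
  fix y assume "y \<in> {bnorm W (T x) |x. x \<in> car V \<and> bnorm V x \<le> 1}"
  then obtain x where x: "y = bnorm W (T x)" "x \<in> car V" "bnorm V x \<le> 1" by blast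
  have "y \<le> C * bnorm V x" using C x by auto
  also have "\<dots> \<le> \<bar>C\<bar> * 1" using x by (intro mult_mono) auto
  finally show "y \<le> \<bar>C\<bar>" by simp
 qed
 show ?thesis
 proof (cases "bnorm V x = 0")
  case True
  then show ?thesis using C[OF x] by simp
 next
  case False
  define y where "y = bscale V (of_real (1 / bnorm V x)) x"
  have p: "bnorm V x > 0" using False V.norm_nonneg[OF x] by linarith
  have y: "y \<in> car V" "bnorm V y = 1" using x p by (auto simp: y_def norm_divide)
  have "bnorm W (T y) \<le> opn V W T"
   unfolding opn_def by (rule cSup_upper[OF _ bdd]) (use y in auto)
  moreover have "T y = bscale W (of_real (1 / bnorm V x)) (T x)"
   unfolding y_def using is_linearD(3)[OF lin x] .
  ultimately have "bnorm W (T x) / bnorm V x \<le> opn V W T"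
   using p is_linearD(1)[OF lin x] by (simp add: norm_divide)
  then show ?thesis using p by (simp add: field_simps)
 qed
qed

lemma opn_nonneg: assumes "bounded_lin V W T" shows "0 \<le> opn V W T"
proof -
 obtain C where C: "\<And>x. x \<in> car V ==> bnorm W (T x) \<le> C * bnorm V x" and lin: "is_linear V W T"
  using assms by (auto simp: bounded_lin_def)
 have "bdd_above {bnorm W (T x) |x. x \<in> car V \<and> bnorm V x \<le> 1}"
 proof (rule bdd_aboveI)
  fix y assume "y \<in> {bnorm W (T x) |x. x \<in> car V \<and> bnorm V x \<le> 1}"
  then obtain x where x: "y = bnorm W (T x)" "x \<in> car V" "bnorm V x \<le> 1" by blast
  have "y \<le> C * bnorm V x" using C x by auto
  also have "\<dots> \<le> \<bar>C\<bar> * 1" using x by (intro mult_mono) auto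
  finally show "y \<le> \<bar>C\<bar>" by simp
 qed
 then have "bnorm W (T (bzero V)) \<le> opn V W T"
  unfolding opn_def by (rule cSup_upper[rotated]) auto
 then show ?thesis using is_linear_zero[OF lin nV nW] by simp
qed

lemma bounded_lin_closed: "bounded_lin V W T ==> x \<in> car V ==> T x \<in> car W"
 by (auto simp: bounded_lin_def is_linear_def)

lemma bounded_lin_zero: "bounded_lin V W (\<lambda>x. bzero W)"
 unfolding bounded_lin_def by (intro conjI is_linear_const_zero nW exI[of _ 0]) auto

lemma opn_zero_iff:
 assumes "bounded_lin V W T"
 shows "opn V W T = 0 \<longleftrightarrow> (\<forall>x\<in>car V. T x = bzero W)"
proof
 assume "opn V W T = 0"
 then show "\<forall>x\<in>car V. T x = bzero W"
  using opn_bound[OF assms] bounded_lin_closed[OF assms] by (auto simp: W.norm_eq_zero[symmetric] intro: antisym)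
next
 assume "\<forall>x\<in>car V. T x = bzero W"
 then have "opn V W T \<le> 0" by (intro opn_le) auto
 then show "opn V W T = 0" using opn_nonneg[OF assms] by simp
qed

lemma bounded_lin_add:
 assumes "bounded_lin V W S" "bounded_lin V W T" "\<And>x. x \<in> car V ==> R x = badd W (S x) (T x)"
 shows "bounded_lin V W R" "opn V W R \<le> opn V W S + opn V W T"
proof -
 note D = is_linearD[of V W S] is_linearD[of V W T]
 have l: "is_linear V W S" "is_linear V W T" using assms by (auto simp: bounded_lin_def)
 have le: "bnorm W (R x) \<le> (opn V W S + opn V W T) * bnorm V x" if "x \<in> car V" for x
 proof -
  have "bnorm W (R x) \<le> bnorm W (S x) + bnorm W (T x)"
   using that assms(3) l D by (auto intro!: W.norm_triangle)
  then show ?thesis using opn_bound[OF assms(1) that] opn_bound[OF assms(2) that] by (simp add: distrib_right)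
 qed
 have "is_linear V W R"
  using l by (intro is_linearI) (auto simp: assms(3) D W.add_ac W.scale_add)
 then show "bounded_lin V W R" using le unfolding bounded_lin_def by blast
 show "opn V W R \<le> opn V W S + opn V W T"
  using le opn_nonneg[OF assms(1)] opn_nonneg[OF assms(2)] by (intro opn_le) auto
qed

lemma bounded_lin_scale:
 assumes "bounded_lin V W T" "\<And>x. x \<in> car V ==> R x = bscale W c (T x)"
 shows "bounded_lin V W R" "opn V W R = norm c * opn V W T"
proof -
 have l: "is_linear V W T" using assms by (auto simp: bounded_lin_def)
 note D = is_linearD[OF l]
 have le: "bnorm W (R x) \<le> norm c * opn V W T * bnorm V x" if "x \<in> car V" for x
  using mult_left_mono[OF opn_bound[OF assms(1) that], of "norm c"] that D by (simp add: assms(2) mult.assoc)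
 have "is_linear V W R"
  using l by (intro is_linearI) (auto simp: assms(2) D W.scale_add mult.commute)
 then show b: "bounded_lin V W R" using le unfolding bounded_lin_def by blast
 have 1: "opn V W R \<le> norm c * opn V W T"
  using le opn_nonneg[OF assms(1)] by (intro opn_le) auto
 have 2: "norm c * opn V W T \<le> opn V W R"
 proof (cases "c = 0")
  case True
  then show ?thesis using opn_nonneg[OF b] by simp
 next
  case False
  then have "opn V W T \<le> opn V W R / norm c"
  proof (intro opn_le)
   fix x assume x: "x \<in> car V"
   have "norm c * bnorm W (T x) = bnorm W (R x)" using x D by (simp add: assms(2))
   also have "\<dots> \<le> opn V W R * bnorm V x" by (rule opn_bound[OF b x])
   finally show "bnorm W (T x) \<le> opn V W R / norm c * bnorm V x" using False by (simp add: field_simps)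
  qed (use opn_nonneg[OF b] in auto)
  then show ?thesis using False by (simp add: field_simps)
 qed
 show "opn V W R = norm c * opn V W T" using 1 2 by simp
qed

lemma bounded_lin_cong: "bounded_lin V W T ==> (\<And>x. x \<in> car V ==> T x = S x) ==> bounded_lin V W S"
 unfolding bounded_lin_def using is_linear_cong[OF _ nV, of W T S] by metis

lemma opn_cong: "(\<And>x. x \<in> car V ==> T x = S x) ==> opn V W T = opn V W S"
 unfolding opn_def by (rule arg_cong[of _ _ Sup]) (metis (no_types, lifting))

lemma blin_simps:
 "car (blin V W) = {T \<in> extensional (car V). bounded_lin V W T}"
 "bzero (blin V W) = (\<lambda>x\<in>car V. bzero W)"
 "badd (blin V W) S T = (\<lambda>x\<in>car V. badd W (S x) (T x))"
 "bscale (blin V W) c T = (\<lambda>x\<in>car V. bscale W c (T x))"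
 "bnorm (blin V W) = opn V W"
 by (auto simp: blin_def bounded_lin_def opn_def fun_eq_iff)

lemma normed_blin: "nspace (blin V W)"
proof
 have cl: "T x \<in> car W" if "bounded_lin V W T" "x \<in> car V" for T x
  using that by (rule bounded_lin_closed)
 show "bzero (blin V W) \<in> car (blin V W)"
  unfolding blin_simps using bounded_lin_cong[OF bounded_lin_zero] by auto
 show "bdiff (blin V W) S S = bzero (blin V W)" if "S \<in> car (blin V W)" for S
  using that unfolding blin_simps bdiff_def
  by (auto simp: fun_eq_iff restrict_def cl simp flip: bdiff_def[of W])
 show "badd (blin V W) S T \<in> car (blin V W)" if "S \<in> car (blin V W)" "T \<in> car (blin V W)" for S T
  using that unfolding blin_simps by (auto intro: bounded_lin_add(1)[of S T])
 show "bscale (blin V W) c T \<in> car (blin V W)" if "T \<in> car (blin V W)" for c T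
  using that unfolding blin_simps by (auto intro: bounded_lin_scale(1)[of T _ c])
 show "bnorm (blin V W) S = 0 \<longleftrightarrow> S = bzero (blin V W)" if "S \<in> car (blin V W)" for S
  using that unfolding blin_simps by (auto simp: opn_zero_iff fun_eq_iff restrict_def extensional_def)
 show "bnorm (blin V W) (badd (blin V W) S T) \<le> bnorm (blin V W) S + bnorm (blin V W) T"
  if "S \<in> car (blin V W)" "T \<in> car (blin V W)" for S T
  using that unfolding blin_simps by (auto intro: bounded_lin_add(2)[of S T])
 show "bnorm (blin V W) (bscale (blin V W) c T) = norm c * bnorm (blin V W) T" if "T \<in> car (blin V W)" for c T
  using that unfolding blin_simps by (auto intro: bounded_lin_scale(2)[of T _ c])
 show "0 \<le> bnorm (blin V W) T" if "T \<in> car (blin V W)" for T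
  using that unfolding blin_simps by (auto intro: opn_nonneg)
qed (auto simp: blin_simps fun_eq_iff restrict_def bounded_lin_closed W.add_ac W.scale_add W.add_scale extensional_def)

end

subsection \<open>Affine subspaces and spaces of affine maps\<close>

text \<open>Names the common direction \<open>D\<close> of an affine subspace, which
  \<open>affine_subspace\<close> leaves behind an existential quantifier over base points.\<close>

definition affine_dir :: "('k::real_normed_field, 'v) bspace => 'v set => 'v set => bool" where
 "affine_dir V A D \<longleftrightarrow> A \<noteq> {} \<and> A \<subseteq> car V \<and> lin_subspace V D \<and> (\<forall>a\<in>A. translate V A a = D)"

lemma affine_dirI:
 assumes nV: "nspace V" and D: "lin_subspace V D" and a0: "a0 \<in> car V" and A: "A = (\<lambda>h. badd V h a0) ` D"
 shows "affine_dir V A D"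
proof -
 interpret V: nspace V by fact
 have DV: "h \<in> car V" if "h \<in> D" for h using D that by (auto simp: lin_subspace_def)
 have "translate V A a = D" if aA: "a \<in> A" for a
 proof -
  obtain k where k: "k \<in> D" "a = badd V k a0" using aA A by blast
  have eq: "bdiff V (badd V h a0) a = bdiff V h k" if "h \<in> D" for h
   using that k a0 DV by (simp add: V.add_diff_add)
  have "translate V A a = (\<lambda>h. bdiff V h k) ` D"
   unfolding translate_def A by (force simp: eq)
  also have "\<dots> = D"
  proof
   show "(\<lambda>h. bdiff V h k) ` D \<subseteq> D" using V.lin_subspace_diff[OF D _ k(1)] by auto
   show "D \<subseteq> (\<lambda>h. bdiff V h k) ` D"
   proof
    fix h assume h: "h \<in> D"
    have "badd V h k \<in> D" using D h k by (auto simp: lin_subspace_def)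
    moreover have "h = bdiff V (badd V h k) k" using h k DV by simp
    ultimately show "h \<in> (\<lambda>h. bdiff V h k) ` D" by blast
   qed
  qed
  finally show ?thesis .
 qed
 moreover have "A \<subseteq> car V" using A DV a0 by auto
 moreover have "A \<noteq> {}" using A D by (auto simp: lin_subspace_def)
 ultimately show ?thesis using D by (simp add: affine_dir_def)
qed

lemma affine_dirD:
 assumes "affine_dir V A D" "nspace V"
 shows "A \<subseteq> car V" "lin_subspace V D" "D \<subseteq> car V" "a \<in> A ==> translate V A a = D"
  "a \<in> A ==> b \<in> A ==> bdiff V a b \<in> D" "a \<in> A ==> h \<in> D ==> badd V h a \<in> A"
proof -
 interpret V: nspace V by fact
 show *: "A \<subseteq> car V" "lin_subspace V D" "D \<subseteq> car V" using assms by (auto simp: affine_dir_def lin_subspace_def)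
 show t: "translate V A a = D" if "a \<in> A" for a using assms that by (auto simp: affine_dir_def)
 show "bdiff V a b \<in> D" if "a \<in> A" "b \<in> A" using t[OF that(2)] that unfolding translate_def by blast
 show "badd V h a \<in> A" if aA: "a \<in> A" and hD: "h \<in> D"
 proof -
  obtain b where "b \<in> A" "h = bdiff V b a" using t[OF aA] hD unfolding translate_def by blast
  then show ?thesis using * aA by (simp add: subset_iff)
 qed
qed

text \<open>Smallness near the origin bounds a linear map: \<open>h\<close> is rescaled to norm
  \<open>d / 2\<close>, where the value has norm below 1.\<close>

lemma norm_bound_from_unit:
 assumes nV: "nspace V" and nW: "nspace W" and lin: "is_linear V W T" and d: "d > 0"
  and T: "\<And>h. h \<in> car V ==> bnorm V h < d ==> bnorm W (T h) < 1"
  and h: "h \<in> car V"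
 shows "bnorm W (T h) \<le> 2 / d * bnorm V h"
proof -
 interpret V: nspace V by fact
 interpret W: nspace W by fact
 show ?thesis
 proof (cases "bnorm V h = 0")
  case True
  then have "h = bzero V" using V.norm_eq_zero h by simp
  then show ?thesis using is_linear_zero[OF lin nV nW] by simp
 next
  case False
  then have p: "bnorm V h > 0" using V.norm_nonneg[OF h] by linarith
  define c where "c = d / (2 * bnorm V h)"
  have c: "c > 0" using p d by (simp add: c_def)
  have "bnorm W (T (bscale V (of_real c) h)) < 1"
   using h p d c by (intro T) (auto simp: c_def norm_divide norm_mult)
  then have "c * bnorm W (T h) < 1"
   using c is_linearD(1)[OF lin h] by (simp add: is_linearD(3)[OF lin h])
  then show ?thesis using p d by (simp add: c_def field_simps)
 qed
qed

context
 fixes V :: "('k::real_normed_field, 'v) bspace" and W :: "('k, 'w) bspace" and A D a0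
 assumes nV: "nspace V" and nW: "nspace W" and A: "affine_dir V A D" and a0: "a0 \<in> A"
begin

interpretation V: nspace V by (rule nV)
interpretation W: nspace W by (rule nW)

lemma A_sub: "a \<in> A ==> a \<in> car V" "h \<in> D ==> h \<in> car V"
 using affine_dirD[OF A nV] by auto

lemma nD: "nspace (bsub V D)"
 using V.normed_bsub affine_dirD(2)[OF A nV] .

text \<open>With \<open>k = a1 - a0\<close>, additivity of the linear part at \<open>a0\<close>
  splits the increment from \<open>a0\<close> to \<open>h + a1\<close> into those by
  \<open>h\<close> and by \<open>k\<close>. Subtracting the latter leaves the increment from
  \<open>a1\<close>.\<close>

lemma lin_part_base:
 assumes S: "S ` A \<subseteq> car W" and lin: "is_linear (bsub V D) W (lin_part V W a0 S)" and a1: "a1 \<in> A" and h: "h \<in> D"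
 shows "lin_part V W a1 S h = lin_part V W a0 S h"
proof -
 define k where "k = bdiff V a1 a0"
 have k: "k \<in> D" unfolding k_def by (rule affine_dirD(5)[OF A nV a1 a0])
 have in_A: "badd V h a1 \<in> A" "badd V h a0 \<in> A" using affine_dirD(6)[OF A nV] a1 a0 h by auto
 have SA: "S a \<in> car W" if "a \<in> A" for a using S that by auto
 have eq: "badd V (badd V h k) a0 = badd V h a1" "badd V k a0 = a1"
  using A_sub h a0 a1 k by (simp_all add: k_def V.add_assoc)
 have "lin_part V W a0 S (badd V h k) = badd W (lin_part V W a0 S h) (lin_part V W a0 S k)"
  using is_linearD(2)[OF lin, of h k] h k by simp
 then have "bdiff W (S (badd V h a1)) (S a0) = badd W (lin_part V W a0 S h) (bdiff W (S a1) (S a0))"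
  by (simp add: lin_part_def eq)
 then have "bdiff W (bdiff W (S (badd V h a1)) (S a0)) (bdiff W (S a1) (S a0)) = lin_part V W a0 S h"
  using SA in_A a0 a1 by (simp add: lin_part_def)
 moreover have "bdiff W (bdiff W (S (badd V h a1)) (S a0)) (bdiff W (S a1) (S a0)) = bdiff W (S (badd V h a1)) (S a1)"
  using SA in_A a0 a1 by (simp add: bdiff_def W.scale_add W.add_ac)
 ultimately show ?thesis by (simp add: lin_part_def)
qed

lemma affine_map_iff:
 "affine_map V A W (car W) S \<longleftrightarrow> S ` A \<subseteq> car W \<and> is_linear (bsub V D) W (lin_part V W a0 S)"
proof
 show "affine_map V A W (car W) S ==> S ` A \<subseteq> car W \<and> is_linear (bsub V D) W (lin_part V W a0 S)"
  using a0 affine_dirD(4)[OF A nV] unfolding affine_map_def by metis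
 assume R: "S ` A \<subseteq> car W \<and> is_linear (bsub V D) W (lin_part V W a0 S)"
 have "is_linear (bsub V D) W (lin_part V W a1 S)" if "a1 \<in> A" for a1
  by (rule is_linear_cong[OF conjunct2[OF R] nD]) (use lin_part_base R that in auto)
 then show "affine_map V A W (car W) S"
  using R affine_dirD(4)[OF A nV] unfolding affine_map_def by metis
qed

text \<open>Continuity of an affine map at the base point bounds its linear part, by
  \<open>norm_bound_from_unit\<close>. Conversely a bounded linear part makes the map Lipschitz,
  since it is the same at every base point. This is what makes the supremum in the norm of
  \<open>baff\<close> finite.\<close>

lemma baff_carrier:
 "S \<in> car (baff V A a0 W) \<longleftrightarrow>
   S \<in> extensional A \<and> S ` A \<subseteq> car W \<and> bounded_lin (bsub V D) W (lin_part V W a0 S)"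
proof
 assume L: "S \<in> car (baff V A a0 W)"
 then have e: "S \<in> extensional A" and am: "affine_map V A W (car W) S"
  and c: "continuous_map (subtopology (btop V) A) (btop W) S" by (auto simp: baff_def)
 have S: "S ` A \<subseteq> car W" and lin: "is_linear (bsub V D) W (lin_part V W a0 S)"
  using am unfolding affine_map_iff by auto
 obtain U where U: "openin (subtopology (btop V) A) U" "a0 \<in> U" "\<forall>y\<in>U. bnorm W (bdiff W (S y) (S a0)) < 1"
  using c[unfolded W.continuous_map_into_btop, THEN conjunct2, rule_format, of a0 1] a0 A_sub(1)[OF a0]
  by (metis (no_types, lifting) IntI V.topspace_btop topspace_subtopology zero_less_one)
 obtain U' where U': "openin (btop V) U'" "U = U' \<inter> A" using U(1) unfolding openin_subtopology by blast
 obtain d where d: "d > 0" "\<forall>h\<in>car V. bnorm V h < d --> badd V a0 h \<in> U'"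
  using U' U(2) unfolding V.openin_btop by blast
 have "bnorm W (lin_part V W a0 S h) < 1" if h: "h \<in> D" "bnorm V h < d" for h
 proof -
  have "badd V a0 h \<in> U'" using d h A_sub(2)[OF h(1)] by blast
  then have "badd V h a0 \<in> U"
   using affine_dirD(6)[OF A nV a0 h(1)] U' V.add_commute[OF A_sub(1)[OF a0] A_sub(2)[OF h(1)]] by simp
  then show ?thesis using U by (simp add: lin_part_def)
 qed
 then have "\<forall>h\<in>car (bsub V D). bnorm W (lin_part V W a0 S h) \<le> 2 / d * bnorm (bsub V D) h"
  using norm_bound_from_unit[OF nD nW lin d(1)] by simp
 then show "S \<in> extensional A \<and> S ` A \<subseteq> car W \<and> bounded_lin (bsub V D) W (lin_part V W a0 S)"
  using e S lin unfolding bounded_lin_def by blast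
next
 assume R: "S \<in> extensional A \<and> S ` A \<subseteq> car W \<and> bounded_lin (bsub V D) W (lin_part V W a0 S)"
 then have S: "S ` A \<subseteq> car W" and lin: "is_linear (bsub V D) W (lin_part V W a0 S)"
  by (auto simp: bounded_lin_def)
 obtain C where C: "\<And>h. h \<in> D ==> bnorm W (lin_part V W a0 S h) \<le> C * bnorm V h"
  using R by (auto simp: bounded_lin_def)
 define C1 where "C1 = max C 1"
 have C1: "bnorm W (lin_part V W a0 S h) \<le> C1 * bnorm V h" if "h \<in> D" for h
  using C[OF that] mult_right_mono[of C C1 "bnorm V h"] A_sub(2)[OF that] by (simp add: C1_def)
 have C1p: "C1 > 0" by (simp add: C1_def)
 have "continuous_map (subtopology (btop V) A) (btop W) S"
  unfolding W.continuous_map_into_btop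
 proof (intro conjI ballI allI impI)
  show "S ` topspace (subtopology (btop V) A) \<subseteq> car W" using S by auto
  fix x and e :: real assume "x \<in> topspace (subtopology (btop V) A)" and e: "e > 0"
  then have x: "x \<in> A" by simp
  define U where "U = {y \<in> car V. bnorm V (bdiff V y x) < e / C1} \<inter> A"
  have "openin (subtopology (btop V) A) U"
   unfolding U_def openin_subtopology using V.openin_ball[OF A_sub(1)[OF x]] by blast
  moreover have "x \<in> U" using x A_sub e C1p by (simp add: U_def)
  moreover have "bnorm W (bdiff W (S y) (S x)) < e" if y: "y \<in> U" for y
  proof -
   have yA: "y \<in> A" and n: "bnorm V (bdiff V y x) < e / C1" using y by (auto simp: U_def)
   have d: "bdiff V y x \<in> D" by (rule affine_dirD(5)[OF A nV yA x])
   have "bdiff W (S y) (S x) = lin_part V W x S (bdiff V y x)"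
    using A_sub yA x by (simp add: lin_part_def)
   also have "\<dots> = lin_part V W a0 S (bdiff V y x)" by (rule lin_part_base[OF S lin x d])
   finally have "bnorm W (bdiff W (S y) (S x)) \<le> C1 * bnorm V (bdiff V y x)" using C1[OF d] by simp
   also have "\<dots> < e" using n C1p by (simp add: field_simps)
   finally show ?thesis .
  qed
  ultimately show "\<exists>U. openin (subtopology (btop V) A) U \<and> x \<in> U \<and> (\<forall>y\<in>U. bnorm W (bdiff W (S y) (S x)) < e)"
   by blast
 qed
 then show "S \<in> car (baff V A a0 W)" using R S lin affine_map_iff by (auto simp: baff_def)
qed

lemma baff_simps:
 "bzero (baff V A a0 W) = (\<lambda>x\<in>A. bzero W)"
 "badd (baff V A a0 W) S T = (\<lambda>x\<in>A. badd W (S x) (T x))"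
 "bscale (baff V A a0 W) c T = (\<lambda>x\<in>A. bscale W c (T x))"
 "bnorm (baff V A a0 W) T = opn (bsub V D) W (lin_part V W a0 T) + bnorm W (T a0)"
 using affine_dirD(4)[OF A nV a0] by (simp_all add: baff_def blin_simps(5)[OF nD nW] nV)

lemma bdiff_baff_eq: "bdiff (baff V A a0 W) S T = (\<lambda>x\<in>A. bdiff W (S x) (T x))"
 by (auto simp: bdiff_def baff_simps restrict_def fun_eq_iff)

lemma lin_part_add:
 assumes "S ` A \<subseteq> car W" "T ` A \<subseteq> car W" "h \<in> D"
 shows "lin_part V W a0 (\<lambda>x\<in>A. badd W (S x) (T x)) h = badd W (lin_part V W a0 S h) (lin_part V W a0 T h)"
 using assms a0 affine_dirD(6)[OF A nV a0] by (auto simp: lin_part_def intro!: W.add_diff_add)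

lemma lin_part_scale:
 assumes "S ` A \<subseteq> car W" "h \<in> D"
 shows "lin_part V W a0 (\<lambda>x\<in>A. bscale W c (S x)) h = bscale W c (lin_part V W a0 S h)"
proof -
 have "S (badd V h a0) \<in> car W" "S a0 \<in> car W" using assms a0 affine_dirD(6)[OF A nV a0] by auto
 then show ?thesis using a0 affine_dirD(6)[OF A nV a0 assms(2)] by (simp add: lin_part_def W.scale_diff)
qed

lemma lin_part_zero: "h \<in> D ==> lin_part V W a0 (\<lambda>x\<in>A. bzero W) h = bzero W"
 using a0 affine_dirD(6)[OF A nV a0] by (simp add: lin_part_def)

lemma normed_baff: "nspace (baff V A a0 W)"
proof
 define B where "B = baff V A a0 W"
 have cl: "S x \<in> car W" if "S \<in> car (baff V A a0 W)" "x \<in> A" for S x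
  using that by (auto simp: baff_carrier)
 have im: "S ` A \<subseteq> car W" and ex: "S \<in> extensional A" and bl: "bounded_lin (bsub V D) W (lin_part V W a0 S)"
  if "S \<in> car (baff V A a0 W)" for S
  using that by (auto simp: baff_carrier)
 show z: "bzero (baff V A a0 W) \<in> car (baff V A a0 W)"
  unfolding baff_carrier baff_simps
  using bounded_lin_cong[OF nD nW bounded_lin_zero[OF nD nW], of "lin_part V W a0 (\<lambda>x\<in>A. bzero W)"]
  by (auto simp: lin_part_zero)
 show "badd (baff V A a0 W) S T \<in> car (baff V A a0 W)"
  if "S \<in> car (baff V A a0 W)" "T \<in> car (baff V A a0 W)" for S T
 proof -
  have "bounded_lin (bsub V D) W (lin_part V W a0 (\<lambda>x\<in>A. badd W (S x) (T x)))"
   by (rule bounded_lin_add(1)[OF nD nW bl[OF that(1)] bl[OF that(2)]])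
     (use lin_part_add[OF im[OF that(1)] im[OF that(2)]] in simp)
  then show ?thesis unfolding baff_carrier baff_simps using cl that by auto
 qed
 show "bscale (baff V A a0 W) c T \<in> car (baff V A a0 W)" if "T \<in> car (baff V A a0 W)" for c T
 proof -
  have "bounded_lin (bsub V D) W (lin_part V W a0 (\<lambda>x\<in>A. bscale W c (T x)))"
   by (rule bounded_lin_scale(1)[OF nD nW bl[OF that]])
     (use lin_part_scale[OF im[OF that]] in simp)
  then show ?thesis unfolding baff_carrier baff_simps using cl that by auto
 qed
 show "bdiff (baff V A a0 W) S S = bzero (baff V A a0 W)" if "S \<in> car (baff V A a0 W)" for S
  unfolding bdiff_baff_eq baff_simps using cl[OF that] by (auto simp: restrict_def fun_eq_iff)
 show "0 \<le> bnorm (baff V A a0 W) T" if "T \<in> car (baff V A a0 W)" for T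
  unfolding baff_simps using opn_nonneg[OF nD nW bl[OF that]] cl[OF that a0] by simp
 show "bnorm (baff V A a0 W) T = 0 \<longleftrightarrow> T = bzero (baff V A a0 W)" if T: "T \<in> car (baff V A a0 W)" for T
 proof
  assume "bnorm (baff V A a0 W) T = 0"
  then have 0: "opn (bsub V D) W (lin_part V W a0 T) = 0" "bnorm W (T a0) = 0"
   unfolding baff_simps using opn_nonneg[OF nD nW bl[OF T]] W.norm_nonneg[OF cl[OF T a0]] by linarith+
  have "T x = bzero W" if x: "x \<in> A" for x
  proof -
   have d: "bdiff V x a0 \<in> D" by (rule affine_dirD(5)[OF A nV x a0])
   have "lin_part V W a0 T (bdiff V x a0) = bzero W"
    using 0(1) d unfolding opn_zero_iff[OF nD nW bl[OF T]] by simp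
   then have "bdiff W (T x) (T a0) = bzero W" using x a0 A_sub by (simp add: lin_part_def)
   then have "T x = T a0" using W.diff_eq_zero_iff[OF cl[OF T x] cl[OF T a0]] by simp
   then show ?thesis using 0(2) W.norm_eq_zero[OF cl[OF T a0]] by simp
  qed
  then show "T = bzero (baff V A a0 W)"
   using ex[OF T] by (auto simp: baff_simps fun_eq_iff extensional_def)
 next
  assume "T = bzero (baff V A a0 W)"
  moreover have "opn (bsub V D) W (lin_part V W a0 (\<lambda>x\<in>A. bzero W)) = 0"
   using opn_cong[OF nD nW, of "lin_part V W a0 (\<lambda>x\<in>A. bzero W)" "\<lambda>_. bzero W"] lin_part_zero
    opn_zero_iff[OF nD nW bounded_lin_zero[OF nD nW]] by simp
  ultimately show "bnorm (baff V A a0 W) T = 0" unfolding baff_simps(4) using a0 by (simp add: baff_simps(1))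
 qed
 show "bnorm (baff V A a0 W) (badd (baff V A a0 W) S T) \<le> bnorm (baff V A a0 W) S + bnorm (baff V A a0 W) T"
  if S: "S \<in> car (baff V A a0 W)" and T: "T \<in> car (baff V A a0 W)" for S T
  using bounded_lin_add(2)[OF nD nW bl[OF S] bl[OF T], of "lin_part V W a0 (badd (baff V A a0 W) S T)"]
   lin_part_add[OF im[OF S] im[OF T]] W.norm_triangle[OF cl[OF S a0] cl[OF T a0]] a0
  unfolding baff_simps by simp
 show "bnorm (baff V A a0 W) (bscale (baff V A a0 W) c T) = norm c * bnorm (baff V A a0 W) T"
  if T: "T \<in> car (baff V A a0 W)" for c T
  using bounded_lin_scale(2)[OF nD nW bl[OF T], of "lin_part V W a0 (bscale (baff V A a0 W) c T)" c]
   lin_part_scale[OF im[OF T]] cl[OF T a0] a0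
  unfolding baff_simps by (simp add: distrib_left)
 show "badd (baff V A a0 W) S (bzero (baff V A a0 W)) = S" if S: "S \<in> car (baff V A a0 W)" for S
  unfolding baff_simps using cl[OF S] ex[OF S] by (auto simp: fun_eq_iff extensional_def)
 show "bscale (baff V A a0 W) 1 S = S" if S: "S \<in> car (baff V A a0 W)" for S
  unfolding baff_simps using cl[OF S] ex[OF S] by (auto simp: fun_eq_iff extensional_def)
 show "badd (baff V A a0 W) S T = badd (baff V A a0 W) T S"
  if S: "S \<in> car (baff V A a0 W)" and T: "T \<in> car (baff V A a0 W)" for S T
  unfolding baff_simps using cl[OF S] cl[OF T] by (auto simp: fun_eq_iff restrict_def W.add_ac)
 show "badd (baff V A a0 W) (badd (baff V A a0 W) S T) R = badd (baff V A a0 W) S (badd (baff V A a0 W) T R)"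
  if S: "S \<in> car (baff V A a0 W)" and T: "T \<in> car (baff V A a0 W)" and R: "R \<in> car (baff V A a0 W)" for S T R
  unfolding baff_simps using cl[OF S] cl[OF T] cl[OF R] by (auto simp: fun_eq_iff restrict_def W.add_assoc)
 show "bscale (baff V A a0 W) c (badd (baff V A a0 W) S T) = badd (baff V A a0 W) (bscale (baff V A a0 W) c S) (bscale (baff V A a0 W) c T)"
  if S: "S \<in> car (baff V A a0 W)" and T: "T \<in> car (baff V A a0 W)" for c S T
  unfolding baff_simps using cl[OF S] cl[OF T] by (auto simp: fun_eq_iff restrict_def W.scale_add)
 show "bscale (baff V A a0 W) (c + d) S = badd (baff V A a0 W) (bscale (baff V A a0 W) c S) (bscale (baff V A a0 W) d S)"
  if S: "S \<in> car (baff V A a0 W)" for c d S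
  unfolding baff_simps using cl[OF S] by (auto simp: fun_eq_iff restrict_def W.add_scale)
 show "bscale (baff V A a0 W) c (bscale (baff V A a0 W) d S) = bscale (baff V A a0 W) (c * d) S"
  if S: "S \<in> car (baff V A a0 W)" for c d S
  unfolding baff_simps using cl[OF S] by (auto simp: fun_eq_iff restrict_def)
qed

lemma baff_norm_le:
 assumes "\<And>h. h \<in> D ==> bnorm W (lin_part V W a0 T h) \<le> C * bnorm V h" "0 \<le> C" "bnorm W (T a0) \<le> C'"
 shows "bnorm (baff V A a0 W) T \<le> C + C'"
 unfolding baff_simps using opn_le[OF nD nW, of "lin_part V W a0 T" C] assms by simp

end

subsection \<open>Complemented subspaces\<close>

lemma partial_sum_bsub [simp]: "psum (bsub V S) f n = psum V f n"
 by (induction n) auto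

lemma bsums_bsub:
 assumes "nspace V" "lin_subspace V S" "bsums (bsub V S) f s"
 shows "bsums V f s" "s \<in> S"
proof -
 interpret V: nspace V by fact
 interpret S: nspace "bsub V S" by (rule V.normed_bsub[OF assms(2)])
 have sub: "S \<subseteq> car V" using assms by (auto simp: lin_subspace_def)
 show "bsums V f s" "s \<in> S"
  using assms(3) sub unfolding bsums_def V.limitin_btop S.limitin_btop
  by (auto elim: eventually_mono)
qed

lemma bsums_exists:
 assumes "banach_space V" and f: "\<And>n. f n \<in> car V" and le: "\<And>n. bnorm V (f n) \<le> K * t ^ n"
  and t: "0 \<le> t" "t < 1" and K: "0 \<le> K"
 shows "\<exists>s. bsums V f s"
proof -
 interpret V: nspace V by (rule banach_space_imp_normed[OF assms(1)])
 have d: "bnorm V (bdiff V (psum V f (n + k)) (psum V f n)) \<le> K * t ^ n / (1 - t)" for n k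
  unfolding V.partial_sum_append_diff[OF f]
  by (rule order_trans[OF V.partial_sum_norm], rule f, rule order_trans[OF sum_mono V.geometric_sum_le[OF t K]], rule le)
 have "V.M.MCauchy (psum V f)"
  unfolding V.M.MCauchy_def
 proof (intro conjI allI impI)
  show "range (psum V f) \<subseteq> car V" using f by auto
  fix e :: real assume e: "e > 0"
  have "(\<lambda>n. K * t ^ n / (1 - t)) \<longlonglongrightarrow> K * 0 / (1 - t)"
   using t by (intro tendsto_intros LIMSEQ_power_zero) auto
  then have "\<forall>\<^sub>F n in sequentially. K * t ^ n / (1 - t) < e"
   using e by (auto dest: order_tendstoD(2))
  then obtain N where N: "K * t ^ n / (1 - t) < e" if "n \<ge> N" for n by (auto simp: eventually_sequentially)
  have *: "bdist V (psum V f m) (psum V f n) < e" if "N \<le> n" "n \<le> m" for n m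
   using d[of n "m - n"] N[OF that(1)] that f by (simp add: V.bdist_eq)
  show "\<exists>N. \<forall>n n'. N \<le> n --> N \<le> n' --> bdist V (psum V f n) (psum V f n') < e"
  proof (intro exI[of _ N] allI impI)
   fix n n' assume "N \<le> n" "N \<le> n'"
   then show "bdist V (psum V f n) (psum V f n') < e"
    using *[of n n'] *[of n' n] V.M.commute by (cases "n \<le> n'") auto
  qed
 qed
 then obtain s where "limitin V.M.mtopology (psum V f) s sequentially"
  using banach_space.complete[OF assms(1)] unfolding V.M.mcomplete_def by blast
 then show ?thesis unfolding bsums_def btop_def by blast
qed

lemma closed_complementsD:
 assumes "F \<in> closed_complements V E"
 shows "closed_lin_subspace V F" "E \<inter> F = {bzero V}"
  "v \<in> car V ==> \<exists>x\<in>E. \<exists>y\<in>F. v = badd V x y"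
 using assms unfolding closed_complements_def by blast+

lemma complement_unique:
 assumes nV: "nspace V" and E: "lin_subspace V E" and F: "lin_subspace V F" and EF: "E \<inter> F = {bzero V}"
  and x: "x \<in> E" "x' \<in> E" and y: "y \<in> F" "y' \<in> F" and eq: "badd V x y = badd V x' y'"
 shows "x = x'" "y = y'"
proof -
 interpret V: nspace V by fact
 have in_V: "x \<in> car V" "x' \<in> car V" "y \<in> car V" "y' \<in> car V"
  using E F x y by (auto simp: lin_subspace_def)
 have "badd V (bdiff V x x') (bdiff V y y') = bzero V"
  using in_V eq V.add_diff_add[of x y x' y'] by simp
 then have "bdiff V x x' = bdiff V y' y"
  using in_V V.neg_diff[of y y'] V.add_right_cancel[of "bdiff V x x'" "bdiff V y' y" "bdiff V y y'"]
  by (metis V.diff_closed V.diff_add_diff V.diff_self)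
 moreover have "bdiff V x x' \<in> E" "bdiff V y' y \<in> F"
  using V.lin_subspace_diff E F x y by auto
 ultimately have "bdiff V x x' = bzero V" "bdiff V y' y = bzero V" using EF by auto
 then show "x = x'" "y = y'" using V.diff_eq_zero_iff in_V by auto
qed

text \<open>
 The open mapping theorem for the addition \<open>E \<times> F \<rightarrow> V\<close>, proved from Baire's theorem in the usual way:
 the closures of the sums of bounded sets exhaust \<open>V\<close>, so every vector is approximated by such
 sums up to half its norm, and the approximation is iterated.
\<close>

lemma complement_approx:
 assumes bV: "banach_space V" and E: "closed_lin_subspace V E" and F: "F \<in> closed_complements V E"
 obtains c where "c \<ge> 0"
  "\<And>v. v \<in> car V ==> \<exists>x\<in>E. \<exists>y\<in>F. bnorm V x \<le> c * bnorm V v \<and> bnorm V y \<le> c * bnorm V v \<and>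
    bnorm V (bdiff V v (badd V x y)) \<le> bnorm V v / 2"
proof -
 interpret V: nspace V by (rule banach_space_imp_normed[OF bV])
 have lE: "lin_subspace V E" and lF: "lin_subspace V F"
  using E closed_complementsD(1)[OF F] by (auto simp: closed_lin_subspace_iff)
 have EV: "\<And>x. x \<in> E ==> x \<in> car V" and FV: "\<And>x. x \<in> F ==> x \<in> car V"
  using lE lF by (auto simp: lin_subspace_def)
 define A where "A n = {badd V x y | x y. x \<in> E \<and> y \<in> F \<and> bnorm V x \<le> real n \<and> bnorm V y \<le> real n}" for n
 define K where "K n = V.M.mtopology closure_of A n" for n
 have AV: "A n \<subseteq> car V" for n using EV FV by (auto simp: A_def)
 have AK: "A n \<subseteq> K n" for n unfolding K_def using AV by (intro closure_of_subset) simp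
 have "\<exists>n. V.M.mtopology interior_of K n \<noteq> {}"
 proof (rule ccontr)
  assume "\<not> ?thesis"
  then have "V.M.mtopology interior_of \<Union>(range K) = {}"
   using banach_space.complete[OF bV] by (intro V.M.metric_Baire_category_alt) (auto simp: K_def)
  moreover have "\<Union>(range K) = car V"
  proof
   show "\<Union>(range K) \<subseteq> car V" unfolding K_def
    using closure_of_subset_topspace[of V.M.mtopology] by auto
   show "car V \<subseteq> \<Union>(range K)"
   proof
    fix v assume "v \<in> car V"
    then obtain x y where xy: "x \<in> E" "y \<in> F" "v = badd V x y" using closed_complementsD(3)[OF F] by blast
    obtain n where "max (bnorm V x) (bnorm V y) \<le> real n" using real_arch_simple by blast
    then have "v \<in> A n" using xy unfolding A_def by auto
    then show "v \<in> \<Union>(range K)" using AK by blast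
   qed
  qed
  ultimately have "car V = {}" using interior_of_topspace[of V.M.mtopology] by simp
  then show False using V.zero_closed by blast
 qed
 then obtain n z where "z \<in> V.M.mtopology interior_of K n" by blast
 then obtain r where zV: "z \<in> car V" and r: "r > 0" "V.M.mball z r \<subseteq> K n"
  unfolding V.M.metric_interior_of by blast
 have near: "\<exists>a\<in>A n. bnorm V (bdiff V a u) < r / 8" if "u \<in> car V" "bnorm V (bdiff V u z) < r" for u
 proof -
  have "u \<in> V.M.mball z r" using that zV V.norm_diff_commute[of u z] by (simp add: V.bdist_eq)
  then have "u \<in> K n" using r by blast
  then have "\<forall>r>0. \<exists>a\<in>A n. a \<in> V.M.mball u r"
   unfolding K_def V.M.metric_closure_of by (elim CollectE conjE)
  moreover have "r / 8 > 0" using r by simp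
  ultimately obtain a where a: "a \<in> A n" "a \<in> V.M.mball u (r / 8)" by blast
  then show ?thesis using that V.norm_diff_commute[of a u] by (auto simp: V.bdist_eq intro!: bexI[of _ a])
 qed
 show thesis
 proof (rule that)
  show "4 * real n / r \<ge> 0" using r by simp
  fix v assume v: "v \<in> car V"
  show "\<exists>x\<in>E. \<exists>y\<in>F. bnorm V x \<le> 4 * real n / r * bnorm V v \<and> bnorm V y \<le> 4 * real n / r * bnorm V v \<and>
    bnorm V (bdiff V v (badd V x y)) \<le> bnorm V v / 2"
  proof (cases "bnorm V v = 0")
   case True
   then have "v = bzero V" using V.norm_eq_zero v by simp
   then show ?thesis using lE lF by (intro bexI[of _ "bzero V"]) (auto simp: lin_subspace_def)
  next
   case False
   then have p: "bnorm V v > 0" using V.norm_nonneg[OF v] by linarith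
   \<comment> \<open>Then \<open>w\<close>, which is \<open>v / t\<close>, has norm
     \<open>r / 2\<close>, so \<open>w + z\<close> and \<open>z\<close> both lie in the ball where
     \<open>A n\<close> is dense. Two approximations within \<open>r / 8\<close> give
     \<open>w\<close> up to \<open>r / 4\<close>, half its norm, and the components of their
     difference are at most \<open>2 * n\<close>.\<close>
   define t where "t = 2 * bnorm V v / r"
   have t: "t > 0" using p r by (simp add: t_def)
   define w where "w = bscale V (of_real (1 / t)) v"
   have w: "w \<in> car V" "bnorm V w = r / 2" and vw: "v = bscale V (of_real t) w"
    using v p r t by (simp_all add: w_def t_def norm_divide norm_mult)
   obtain a where a: "a \<in> A n" "bnorm V (bdiff V a (badd V w z)) < r / 8"
    using near[of "badd V w z"] w zV r by auto
   obtain b where b: "b \<in> A n" "bnorm V (bdiff V b z) < r / 8"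
    using near[of z] zV r by auto
   obtain x y where x: "a = badd V x y" "x \<in> E" "y \<in> F" "bnorm V x \<le> n" "bnorm V y \<le> n"
    using a(1) by (auto simp: A_def)
   obtain x' y' where x': "b = badd V x' y'" "x' \<in> E" "y' \<in> F" "bnorm V x' \<le> n" "bnorm V y' \<le> n"
    using b(1) by (auto simp: A_def)
   have abV: "a \<in> car V" "b \<in> car V" using a(1) b(1) AV by auto
   define x2 where "x2 = bscale V (of_real t) (bdiff V x x')"
   define y2 where "y2 = bscale V (of_real t) (bdiff V y y')"
   have dx: "bdiff V x x' \<in> E" "bdiff V y y' \<in> F" using V.lin_subspace_diff lE lF x x' by auto
   have mem: "x2 \<in> E" "y2 \<in> F" using dx lE lF by (auto simp: x2_def y2_def lin_subspace_def)
   have "bnorm V (bdiff V x x') \<le> 2 * n" "bnorm V (bdiff V y y') \<le> 2 * n"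
    using V.norm_diff_le[of x x'] V.norm_diff_le[of y y'] x x' EV FV by force+
   then have "t * bnorm V (bdiff V x x') \<le> t * (2 * n)" "t * bnorm V (bdiff V y y') \<le> t * (2 * n)"
    using t by (auto intro: mult_left_mono)
   moreover have "bnorm V x2 = t * bnorm V (bdiff V x x')" "bnorm V y2 = t * bnorm V (bdiff V y y')"
    using dx EV FV t unfolding x2_def y2_def by simp_all
   moreover have "t * (2 * n) = 4 * real n / r * bnorm V v" by (simp add: t_def)
   ultimately have n2: "bnorm V x2 \<le> 4 * real n / r * bnorm V v" "bnorm V y2 \<le> 4 * real n / r * bnorm V v"
    by simp_all
   have "badd V x2 y2 = bscale V (of_real t) (bdiff V a b)"
    unfolding x2_def y2_def x x' using EV FV dx x x' by (simp add: V.scale_add[symmetric] V.add_diff_add)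
   then have "bdiff V v (badd V x2 y2) = bscale V (of_real t) (bdiff V w (bdiff V a b))"
    unfolding vw using w abV by (simp add: V.scale_diff)
   moreover have "bnorm V (bdiff V w (bdiff V a b)) \<le> r / 4"
   proof -
    have "badd V z (badd V (bscale V (- 1) a) (bscale V (- 1) z)) = bscale V (- 1) a"
     using V.add_left_commute[of z "bscale V (- 1) a" "bscale V (- 1) z"] abV zV by simp
    then have "bdiff V w (bdiff V a b) = bdiff V (bdiff V b z) (bdiff V a (badd V w z))"
     using w abV zV by (simp add: bdiff_def V.scale_add V.add_ac)
    then show ?thesis using V.norm_diff_le[of "bdiff V b z" "bdiff V a (badd V w z)"] a b abV w zV by simp
   qed
   ultimately have "bnorm V (bdiff V v (badd V x2 y2)) \<le> t * (r / 4)"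
    using t w abV by simp
   also have "\<dots> = bnorm V v / 2" using r by (simp add: t_def)
   finally show ?thesis using mem n2 by blast
  qed
 qed
qed

text \<open>The corrections in \<open>E\<close> and in \<open>F\<close> are summed separately, each
  in its own complete space, and uniqueness of the decomposition identifies the first sum with
  \<open>x\<close>. The geometric ratio 1/2 turns the constant \<open>c\<close> of the approximation
  into \<open>2 * c\<close>.\<close>

lemma complement_bound:
 assumes bV: "banach_space V" and E: "closed_lin_subspace V E" and F: "F \<in> closed_complements V E"
 obtains C where "\<And>x y. x \<in> E ==> y \<in> F ==> bnorm V x \<le> C * bnorm V (badd V x y)"
proof -
 interpret V: nspace V by (rule banach_space_imp_normed[OF bV])
 have lE: "lin_subspace V E" and cF: "closed_lin_subspace V F" and lF: "lin_subspace V F"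
  using E closed_complementsD(1)[OF F] by (auto simp: closed_lin_subspace_iff)
 have EV: "\<And>x. x \<in> E ==> x \<in> car V" and FV: "\<And>x. x \<in> F ==> x \<in> car V"
  using lE lF by (auto simp: lin_subspace_def)
 obtain c where c: "c \<ge> 0"
  "\<And>v. v \<in> car V ==> \<exists>x\<in>E. \<exists>y\<in>F. bnorm V x \<le> c * bnorm V v \<and> bnorm V y \<le> c * bnorm V v \<and>
    bnorm V (bdiff V v (badd V x y)) \<le> bnorm V v / 2"
  using complement_approx[OF assms] by blast
 then obtain px py where p: "\<And>v. v \<in> car V ==> px v \<in> E \<and> py v \<in> F \<and> bnorm V (px v) \<le> c * bnorm V v \<and>
   bnorm V (py v) \<le> c * bnorm V v \<and> bnorm V (bdiff V v (badd V (px v) (py v))) \<le> bnorm V v / 2"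
  by metis
 show thesis
 proof (rule that)
  fix x y assume x: "x \<in> E" and y: "y \<in> F"
  define v where "v = badd V x y"
  have v: "v \<in> car V" using x y EV FV by (simp add: v_def)
  \<comment> \<open>\<open>vs k\<close> is what remains of \<open>v\<close> after \<open>k\<close>
    approximations.\<close>
  define vs where "vs = rec_nat v (\<lambda>_ u. bdiff V u (badd V (px u) (py u)))"
  have vs0: "vs 0 = v" and vsS: "vs (Suc k) = bdiff V (vs k) (badd V (px (vs k)) (py (vs k)))" for k
   by (simp_all add: vs_def)
  have vsV: "vs k \<in> car V" for k
   by (induction k) (use v p EV FV in \<open>auto simp: vs0 vsS\<close>)
  have vsn: "bnorm V (vs k) \<le> bnorm V v * (1 / 2) ^ k" for k
  proof (induction k)
   case (Suc k)
   then show ?case using p[OF vsV[of k]] by (simp add: vsS)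
  qed (simp add: vs0)
  define fx where "fx k = px (vs k)" for k
  define fy where "fy k = py (vs k)" for k
  have fx: "fx k \<in> E" "fx k \<in> car V" "bnorm V (fx k) \<le> c * bnorm V v * (1 / 2) ^ k"
   and fy: "fy k \<in> F" "fy k \<in> car V" "bnorm V (fy k) \<le> c * bnorm V v * (1 / 2) ^ k" for k
   using p[OF vsV[of k]] EV FV mult_left_mono[OF vsn[of k] c(1)] by (auto simp: fx_def fy_def mult.assoc)
  have cv: "0 \<le> c * bnorm V v" using c v by simp
  obtain s where "bsums (bsub V E) fx s"
   using bsums_exists[OF banach_bsub[OF bV E], of fx "c * bnorm V v" "1 / 2"] fx cv by auto
  then have s: "bsums V fx s" "s \<in> E" using bsums_bsub[OF V.nspace_axioms lE] by auto
  obtain t where "bsums (bsub V F) fy t"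
   using bsums_exists[OF banach_bsub[OF bV cF], of fy "c * bnorm V v" "1 / 2"] fy cv by auto
  then have t: "bsums V fy t" "t \<in> F" using bsums_bsub[OF V.nspace_axioms lF] by auto
  have "bsums V (\<lambda>k. badd V (fx k) (fy k)) (badd V s t)"
  proof -
   have "bsums V (\<lambda>k. (\<lambda>z. badd V (fst z) (snd z)) (fx k, fy k)) ((\<lambda>z. badd V (fst z) (snd z)) (s, t))"
   proof (rule bsums_linear[OF normed_prod V.nspace_axioms, where K = 2])
    show "is_linear (prod_bspace V V) V (\<lambda>z. badd V (fst z) (snd z))"
     by (intro is_linearI) (auto simp: V.add_ac V.scale_add)
    show "bnorm V (badd V (fst z) (snd z)) \<le> 2 * bnorm (prod_bspace V V) z" if "z \<in> car (prod_bspace V V)" for z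
     using that V.norm_triangle[of "fst z" "snd z"] by (cases z) auto
    show "bsums (prod_bspace V V) (\<lambda>k. (fx k, fy k)) (s, t)"
     using s t fx fy V.nspace_axioms by (intro bsums_prod) auto
   qed (use fx fy V.nspace_axioms in auto)
   then show ?thesis by simp
  qed
  moreover have "bsums V (\<lambda>k. badd V (fx k) (fy k)) v"
  proof (rule V.bsumsI[OF v])
   have ps: "badd V (psum V (\<lambda>k. badd V (fx k) (fy k)) n) (vs n) = v" for n
   proof (induction n)
    case (Suc n)
    define q where "q = psum V (\<lambda>k. badd V (fx k) (fy k)) n"
    have q: "q \<in> car V" using fx fy by (auto simp: q_def)
    have "badd V (badd V q (badd V (fx n) (fy n))) (vs (Suc n)) = badd V q (vs n)"
     unfolding vsS fx_def[symmetric] fy_def[symmetric] using q fx(2) fy(2) vsV by (simp add: V.add_assoc)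
    then show ?case using Suc by (simp add: q_def)
   qed (simp add: vs0 v)
   have "bnorm V (bdiff V (psum V (\<lambda>k. badd V (fx k) (fy k)) n) v) = bnorm V (vs n)" for n
   proof -
    define q where "q = psum V (\<lambda>k. badd V (fx k) (fy k)) n"
    have q: "q \<in> car V" using fx fy by (auto simp: q_def)
    have "bdiff V v q = vs n" using ps[of n] q vsV by (metis V.add_diff_cancel_left q_def)
    then show ?thesis using V.norm_diff_commute[OF q v] by (simp add: q_def)
   qed
   moreover have "(\<lambda>n. bnorm V (vs n)) \<longlonglongrightarrow> 0"
   proof (rule nonneg_le_tendsto_zero[OF _ vsn])
    show "(\<lambda>n. bnorm V v * (1 / 2) ^ n) \<longlonglongrightarrow> 0"
     by (intro tendsto_mult_right_zero LIMSEQ_power_zero) auto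
   qed (use vsV in auto)
   ultimately show "(\<lambda>n. bnorm V (bdiff V (psum V (\<lambda>k. badd V (fx k) (fy k)) n) v)) \<longlonglongrightarrow> 0" by simp
  qed (use fx fy in auto)
  ultimately have "badd V s t = badd V x y" using V.bsums_unique by (simp add: v_def)
  then have "s = x"
   using complement_unique(1)[OF V.nspace_axioms lE lF closed_complementsD(2)[OF F] s(2) x t(2) y] by simp
  moreover have "bnorm V s \<le> c * bnorm V v / (1 - 1 / 2)"
   by (rule V.bsums_norm_le[OF fx(2) s(1) fx(3)]) (use cv in auto)
  ultimately show "bnorm V x \<le> 2 * c * bnorm V (badd V x y)" by (simp add: v_def)
 qed
qed

definition cproj :: "('k::real_normed_field, 'v) bspace => 'v set => 'v set => 'v => 'v" where
 "cproj V E F v = (THE x. x \<in> E \<and> (\<exists>y\<in>F. v = badd V x y))"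

lemma cproj:
 assumes bV: "banach_space V" and E: "closed_lin_subspace V E" and F: "F \<in> closed_complements V E"
 shows "x \<in> E ==> y \<in> F ==> cproj V E F (badd V x y) = x"
  "x \<in> E ==> cproj V E F x = x"
  "y \<in> F ==> cproj V E F y = bzero V"
  "v \<in> car V ==> cproj V E F v \<in> E"
  "v \<in> car V ==> bdiff V v (cproj V E F v) \<in> F"
  "is_linear V (bsub V E) (cproj V E F)"
  "\<exists>C. \<forall>v\<in>car V. bnorm V (cproj V E F v) \<le> C * bnorm V v"
proof -
 interpret V: nspace V by (rule banach_space_imp_normed[OF bV])
 have lE: "lin_subspace V E" and lF: "lin_subspace V F"
  using E closed_complementsD(1)[OF F] by (auto simp: closed_lin_subspace_iff)
 have EV: "\<And>x. x \<in> E ==> x \<in> car V" and FV: "\<And>x. x \<in> F ==> x \<in> car V"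
  using lE lF by (auto simp: lin_subspace_def)
 show *: "cproj V E F (badd V x y) = x" if "x \<in> E" "y \<in> F" for x y
  unfolding cproj_def
 proof (rule the_equality)
  show "x \<in> E \<and> (\<exists>y'\<in>F. badd V x y = badd V x y')" using that by blast
  fix x' assume "x' \<in> E \<and> (\<exists>y'\<in>F. badd V x y = badd V x' y')"
  then show "x' = x"
   using complement_unique(1)[OF V.nspace_axioms lE lF closed_complementsD(2)[OF F] that(1) _ that(2)] by metis
 qed
 show "cproj V E F x = x" if "x \<in> E"
  using *[OF that, of "bzero V"] that EV lF by (simp add: lin_subspace_def)
 show "cproj V E F y = bzero V" if "y \<in> F"
  using *[of "bzero V", OF _ that] that FV lE by (simp add: lin_subspace_def)
 have dec: "\<exists>x\<in>E. \<exists>y\<in>F. v = badd V x y \<and> cproj V E F v = x" if "v \<in> car V" for v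
  using closed_complementsD(3)[OF F that] * by metis
 show "cproj V E F v \<in> E" if "v \<in> car V" using dec[OF that] by auto
 show "bdiff V v (cproj V E F v) \<in> F" if v: "v \<in> car V"
 proof -
  obtain x y where x: "x \<in> E" "y \<in> F" "v = badd V x y" "cproj V E F v = x" using dec[OF v] by blast
  then have "bdiff V v x = y" using EV FV by simp
  then show ?thesis using x by simp
 qed
 show "is_linear V (bsub V E) (cproj V E F)"
 proof (rule is_linearI)
  show "cproj V E F v \<in> car (bsub V E)" if "v \<in> car V" for v using dec[OF that] by auto
  fix v assume v: "v \<in> car V"
  obtain x y where x: "x \<in> E" "y \<in> F" "v = badd V x y" "cproj V E F v = x" using dec[OF v] by blast
  show "cproj V E F (badd V v w) = badd (bsub V E) (cproj V E F v) (cproj V E F w)" if w: "w \<in> car V" for w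
  proof -
   obtain x' y' where x': "x' \<in> E" "y' \<in> F" "w = badd V x' y'" "cproj V E F w = x'" using dec[OF w] by blast
   have "badd V v w = badd V (badd V x x') (badd V y y')"
    using x x' EV FV by (simp add: V.add_ac)
   moreover have "badd V x x' \<in> E" "badd V y y' \<in> F" using x x' lE lF by (auto simp: lin_subspace_def)
   ultimately show ?thesis using * x x' by simp
  qed
  show "cproj V E F (bscale V c v) = bscale (bsub V E) c (cproj V E F v)" for c
  proof -
   have "bscale V c v = badd V (bscale V c x) (bscale V c y)" using x EV FV by (simp add: V.scale_add)
   moreover have "bscale V c x \<in> E" "bscale V c y \<in> F" using x lE lF by (auto simp: lin_subspace_def)
   ultimately show ?thesis using * x by simp
  qed
 qed
 obtain C where C: "\<And>x y. x \<in> E ==> y \<in> F ==> bnorm V x \<le> C * bnorm V (badd V x y)"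
  using complement_bound[OF assms] by blast
 show "\<exists>C. \<forall>v\<in>car V. bnorm V (cproj V E F v) \<le> C * bnorm V v"
  using dec C by metis
qed

text \<open>The function takes values in \<open>S\<close>, but the coefficients of its expansion are
  only known to lie in \<open>W\<close>. Composing with a bounded projection onto \<open>S\<close>
  moves the coefficients into \<open>S\<close> and leaves the function unchanged near
  \<open>x\<close>.\<close>

lemma analytic_at_corestrict:
 assumes nV: "nspace V" and bW: "banach_space W" and S: "closed_lin_subspace W S" and c: "closed_complements W S \<noteq> {}"
  and f: "analytic_at V W x f" and r: "r > 0" "\<And>h. h \<in> car V ==> bnorm V h < r ==> f (badd V x h) \<in> S"
 shows "analytic_at V (bsub W S) x f"
proof -
 interpret W: nspace W by (rule banach_space_imp_normed[OF bW])
 obtain F where F: "F \<in> closed_complements W S" using c by blast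
 have nS: "nspace (bsub W S)" using W.normed_bsub S by (auto simp: closed_lin_subspace_iff)
 obtain C where C: "\<forall>v\<in>car W. bnorm W (cproj W S F v) \<le> C * bnorm W v" using cproj(7)[OF bW S F] by blast
 have "analytic_at V (bsub W S) x (\<lambda>z. cproj W S F (f z))"
  by (rule analytic_at_linear_compose[OF nV W.nspace_axioms nS f cproj(6)[OF bW S F], where K = C]) (use C in auto)
 then show ?thesis
  by (rule analytic_at_cong[OF _ nS r(1)]) (use cproj(2)[OF bW S F] r in auto)
qed

lemma analytic_at_restrict:
 assumes nV: "nspace V" and nW: "nspace W" and S: "lin_subspace V S" and x: "x \<in> S"
  and f: "analytic_at V W x f"
 shows "analytic_at (bsub V S) W x f"
proof -
 interpret V: nspace V by fact
 have nS: "nspace (bsub V S)" by (rule V.normed_bsub[OF S])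
 have "analytic_at (bsub V S) V x (\<lambda>z. z)"
  by (rule analytic_at_linear[OF nS nV, where K = 1]) (use x S in \<open>auto simp: is_linear_def lin_subspace_def\<close>)
 from analytic_at_compose[OF this f nS nV nW] show ?thesis by simp
qed

abbreviation (input) "ap \<equiv> blinfun_apply"
abbreviation (input) "idb \<equiv> id_blinfun"
abbreviation (input) "rg \<equiv> range_map"
abbreviation (input) blinfun_mult (infixl "oL" 55) where "A oL B \<equiv> blinfun_compose A B"

subsection \<open>Charts\<close>

text \<open>The part of a source chart that \<open>analytic_mapI\<close> uses: an injective map with
  open image and continuous inverse. It passes to restrictions and products directly, so it is
  available for the product charts of trivialisations.\<close>

definition wchart :: "'m topology => 'm set => ('m => 'v) => ('k::real_normed_field, 'v) bspace => bool" where
 "wchart T U p V \<longleftrightarrow> nspace V \<and> U \<subseteq> topspace T \<and> inj_on p U \<and> openin (btop V) (p ` U) \<and>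
   continuous_map (subtopology (btop V) (p ` U)) T (inv_into U p)"

lemma homeomorphic_map_inv_into:
 assumes "homeomorphic_map X Y f"
 shows "inj_on f (topspace X)" "f ` topspace X = topspace Y" "continuous_map Y X (inv_into (topspace X) f)"
proof -
 obtain g where g: "homeomorphic_maps X Y f g" using assms homeomorphic_map_maps by blast
 show i: "inj_on f (topspace X)" and im: "f ` topspace X = topspace Y"
  using assms homeomorphic_imp_injective_map homeomorphic_imp_surjective_map by blast+
 have "continuous_map Y X g" using g by (simp add: homeomorphic_maps_def)
 moreover have "g y = inv_into (topspace X) f y" if "y \<in> topspace Y" for y
  using g that i im by (metis homeomorphic_maps_def continuous_map_image_subset_topspace image_subset_iff inv_into_f_f)
 ultimately show "continuous_map Y X (inv_into (topspace X) f)"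
  using continuous_map_eq by blast
qed

lemma is_chart_wchart:
 assumes "is_chart T (U, p, V)" shows "wchart T U p V"
proof -
 have 1: "openin T U" "banach_space V" "openin (btop V) (p ` U)"
  "homeomorphic_map (subtopology T U) (subtopology (btop V) (p ` U)) p" using assms by auto
 have U: "topspace (subtopology T U) = U" using 1(1) openin_subset by fastforce
 note h = homeomorphic_map_inv_into[OF 1(4), unfolded U]
 have img: "topspace (subtopology (btop V) (p ` U)) = p ` U" using 1(3) openin_subset by fastforce
 have "continuous_map (subtopology (btop V) (p ` U)) T (inv_into U p)"
  using h(3) by (rule continuous_map_into_fulltopology)
 then show ?thesis
  unfolding wchart_def
  using 1(1,3) h(1) banach_space_imp_normed[OF 1(2)] openin_subset[OF 1(1)] by simp
qed

lemma wchart_restrict: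
 assumes "wchart T U p V" "openin T S" shows "wchart (subtopology T S) (U \<inter> S) p V"
proof -
 have nV: "nspace V" and U: "U \<subseteq> topspace T" and i: "inj_on p U" and o: "openin (btop V) (p ` U)"
  and c: "continuous_map (subtopology (btop V) (p ` U)) T (inv_into U p)"
  using assms(1) by (auto simp: wchart_def)
 have sub: "p ` U \<subseteq> topspace (btop V)" using o openin_subset by blast
 have eq: "p ` (U \<inter> S) = {y \<in> topspace (subtopology (btop V) (p ` U)). inv_into U p y \<in> S}"
  using i sub by auto
 have "openin (subtopology (btop V) (p ` U)) (p ` (U \<inter> S))"
  unfolding eq by (rule openin_continuous_map_preimage[OF c assms(2)])
 then have o2: "openin (btop V) (p ` (U \<inter> S))" using o openin_trans_full by blast
 have inv: "inv_into (U \<inter> S) p y = inv_into U p y" if "y \<in> p ` (U \<inter> S)" for y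
  using that i by (auto simp: inv_into_f_f inj_on_Int)
 have "continuous_map (subtopology (btop V) (p ` (U \<inter> S))) T (inv_into U p)"
  by (rule continuous_map_from_subtopology_mono[OF c]) auto
 then have "continuous_map (subtopology (btop V) (p ` (U \<inter> S))) T (inv_into (U \<inter> S) p)"
  by (rule continuous_map_eq) (use inv in auto)
 then have "continuous_map (subtopology (btop V) (p ` (U \<inter> S))) (subtopology T S) (inv_into (U \<inter> S) p)"
  using inv i unfolding continuous_map_in_subtopology by (auto simp: inv_into_f_f)
 then show ?thesis unfolding wchart_def using nV U i o2 by (auto simp: inj_on_Int)
qed

lemma wchart_prod:
 assumes 1: "wchart T U p V" and 2: "wchart T' U' p' V'"
 shows "wchart (prod_topology T T') (U \<times> U') (map_prod p p') (prod_bspace V V')"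
  "(y, y') \<in> p ` U \<times> p' ` U' ==> inv_into (U \<times> U') (map_prod p p') (y, y') = (inv_into U p y, inv_into U' p' y')"
proof -
 have i: "inj_on p U" "inj_on p' U'" using 1 2 by (auto simp: wchart_def)
 have n: "nspace V" "nspace V'" using 1 2 by (auto simp: wchart_def)
 have inj: "inj_on (map_prod p p') (U \<times> U')" using i by (rule map_prod_inj_on)
 show *: "inv_into (U \<times> U') (map_prod p p') (y, y') = (inv_into U p y, inv_into U' p' y')"
  if "(y, y') \<in> p ` U \<times> p' ` U'" for y y'
  by (rule inv_into_f_eq[OF inj]) (use that i in \<open>auto simp: inv_into_f_f\<close>)
 have im: "map_prod p p' ` (U \<times> U') = p ` U \<times> p' ` U'" by (rule map_prod_surj_on) auto
 have b: "btop (prod_bspace V V') = prod_topology (btop V) (btop V')" by (rule btop_prod[OF n])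
 have o: "openin (btop (prod_bspace V V')) (p ` U \<times> p' ` U')"
  unfolding b using 1 2 by (auto simp: wchart_def openin_prod_Times_iff)
 have st: "subtopology (prod_topology (btop V) (btop V')) (p ` U \<times> p' ` U')
   = prod_topology (subtopology (btop V) (p ` U)) (subtopology (btop V') (p' ` U'))"
  by (rule subtopology_Times)
 have "continuous_map (subtopology (btop (prod_bspace V V')) (p ` U \<times> p' ` U')) (prod_topology T T')
   (\<lambda>(y, y'). (inv_into U p y, inv_into U' p' y'))"
  unfolding b st continuous_map_prod_top using 1 2 by (auto simp: wchart_def)
 then have "continuous_map (subtopology (btop (prod_bspace V V')) (p ` U \<times> p' ` U')) (prod_topology T T')
   (inv_into (U \<times> U') (map_prod p p'))"
  by (rule continuous_map_eq) (use * in auto)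
 then show "wchart (prod_topology T T') (U \<times> U') (map_prod p p') (prod_bspace V V')"
  unfolding wchart_def using 1 2 inj o im by (auto simp: wchart_def normed_prod)
qed

text \<open>The domain of the coordinate expression is the preimage of \<open>U'\<close> under
  \<open>f\<close> composed with the inverse chart, hence open by continuity. What remains to be
  supplied is an expansion at each point.\<close>

lemma analytic_mapI:
 assumes c: "continuous_map (mtop M) (mtop N) f"
  and M: "\<And>U p V. (U, p, V) \<in> atlas M ==> wchart (mtop M) U p V"
  and N: "\<And>U p V. (U, p, V) \<in> atlas N ==> openin (mtop N) U \<and> nspace V"
  and an: "\<And>U p V U' p' V' u. (U, p, V) \<in> atlas M ==> (U', p', V') \<in> atlas N ==> u \<in> U ==> f u \<in> U' ==>
    analytic_at V V' (p u) (\<lambda>y. p' (f (inv_into U p y)))"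
 shows "analytic_map M N f"
proof -
 have "banach_analytic_on V V' (p ` (U \<inter> f -` U')) (p' \<circ> f \<circ> inv_into U p)"
  if 1: "(U, p, V) \<in> atlas M" and 2: "(U', p', V') \<in> atlas N" for U p V U' p' V'
 proof -
  note w = M[OF 1, unfolded wchart_def]
  note n = N[OF 2]
  have sub: "p ` U \<subseteq> topspace (btop V)" using w openin_subset by blast
  have "continuous_map (subtopology (btop V) (p ` U)) (mtop N) (f \<circ> inv_into U p)"
   using w c continuous_map_compose by blast
  then have "openin (subtopology (btop V) (p ` U)) {y \<in> topspace (subtopology (btop V) (p ` U)). (f \<circ> inv_into U p) y \<in> U'}"
   using n openin_continuous_map_preimage by blast
  also have "{y \<in> topspace (subtopology (btop V) (p ` U)). (f \<circ> inv_into U p) y \<in> U'} = p ` (U \<inter> f -` U')"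
   using w sub by (auto simp: inv_into_f_f)
  finally have "openin (btop V) (p ` (U \<inter> f -` U'))" using w openin_trans_full by blast
  then show ?thesis
   using an[OF 1 2] w n by (subst banach_analytic_on_iff) (auto simp: comp_def)
 qed
 then show ?thesis unfolding analytic_map_def using c by fast
qed

subsection \<open>Spaces carried by a subset of a Banach space type\<close>

text \<open>If the norm of a difference is the distance of the ambient type, then open sets and
  Cauchy sequences are the usual ones. This serves the whole space, the operators, the scalar line
  and the fibres with a moved origin alike.\<close>

lemma typed_bspace:
 fixes V :: "('k::real_normed_field, 'x::banach) bspace"
 assumes nV: "nspace V" and d: "\<And>x y. x \<in> car V ==> y \<in> car V ==> bnorm V (bdiff V x y) = dist x y"
 shows "btop V = top_of_set (car V)" "complete (car V) ==> banach_space V"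
proof -
 interpret V: nspace V by fact
 show *: "btop V = top_of_set (car V)"
  unfolding topology_eq V.openin_btop_dist openin_euclidean_subtopology_iff
  using d by (metis subset_iff)
 assume c: "complete (car V)"
 have "V.M.mcomplete"
  unfolding V.M.mcomplete_def
 proof (intro allI impI)
  fix s assume C: "V.M.MCauchy s"
  then have r: "\<And>n. s n \<in> car V" unfolding V.M.MCauchy_def by auto
  have "Cauchy s"
   unfolding Cauchy_def
  proof (intro allI impI)
   fix e :: real assume "e > 0"
   then obtain N where "\<forall>n n'. N \<le> n --> N \<le> n' --> bdist V (s n) (s n') < e"
    using C unfolding V.M.MCauchy_def by blast
   then show "\<exists>M. \<forall>m\<ge>M. \<forall>n\<ge>M. dist (s m) (s n) < e"
    using r d by (auto simp: V.bdist_eq)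
  qed
  then obtain l where l: "l \<in> car V" "s \<longlonglongrightarrow> l"
   using c r unfolding complete_def by blast
  have "(\<lambda>n. dist (s n) l) \<longlonglongrightarrow> 0" using l(2) tendsto_dist_iff by blast
  then have "limitin (btop V) s l sequentially"
   unfolding V.limitin_btop using l r d by auto
  then show "\<exists>x. limitin V.M.mtopology s x sequentially" unfolding btop_def by blast
 qed
 then show "banach_space V" using banach_spaceI nV by blast
qed

section \<open>The algebra of bounded operators commuting with the scalars\<close>

context K_banach
begin

lemma sc_minus [simp]: "sc (- 1) x = - x"
 using scale_minus_left[of 1 x] by simp

lemma bounded_linear_sc: "bounded_linear (sc c)"
proof (rule bounded_linear_intro[where K = "norm c"])
 show "sc c (r *\<^sub>R x) = r *\<^sub>R sc c x" for r x
  unfolding scale_of_real[symmetric] by (simp add: mult.commute)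
qed (simp_all add: scale_right_distrib norm_scale mult.commute)

lemma whole_simps [simp]:
 "car (whole_space sc) = UNIV" "bzero (whole_space sc) = 0" "badd (whole_space sc) = (+)"
 "bscale (whole_space sc) = sc" "bnorm (whole_space sc) = norm" "bdiff (whole_space sc) = (-)"
 by (auto simp: whole_space_def bdiff_def fun_eq_iff)

lemma normed_whole: "nspace (whole_space sc)"
 by unfold_locales (auto simp: scale_right_distrib scale_left_distrib norm_scale norm_triangle_ineq)

lemma banach_whole: "banach_space (whole_space sc)"
 by (rule typed_bspace[OF normed_whole]) (auto simp: dist_norm complete_UNIV)

lemma btop_whole: "btop (whole_space sc) = euclidean"
 using typed_bspace(1)[OF normed_whole] by (simp add: dist_norm)

definition OP :: "('a \<Rightarrow>\<^sub>L 'a) set" where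
 "OP = {T. \<forall>c x. ap T (sc c x) = sc c (ap T x)}"

lemma OP_D: "T \<in> OP ==> ap T (sc c x) = sc c (ap T x)"
 by (simp add: OP_def)

lemma op_scale_apply: "ap (Blinfun (\<lambda>x. sc c (ap T x))) x = sc c (ap T x)"
 by (subst bounded_linear_Blinfun_apply) (auto intro: bounded_linear_compose[OF bounded_linear_sc] blinfun.bounded_linear_right)

lemma op_scale_minus: "Blinfun (\<lambda>x. - ap T x) = - T"
 by (rule blinfun_eqI) (subst bounded_linear_Blinfun_apply, auto intro: bounded_linear_minus blinfun.bounded_linear_right simp: blinfun.minus_left)

abbreviation "op \<equiv> op_space sc"

lemma op_simps [simp]:
 "car op = OP" "bzero op = 0" "badd op = (+)" "bnorm op = norm" "bdiff op = (-)"
 by (auto simp: op_space_def bdiff_def fun_eq_iff OP_def op_scale_minus)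

lemma op_scale [simp]: "ap (bscale op c T) x = sc c (ap T x)"
 by (simp add: op_space_def op_scale_apply)

lemma OP_closed [simp, intro]:
 "0 \<in> OP" "idb \<in> OP" "S \<in> OP ==> T \<in> OP ==> S + T \<in> OP" "S \<in> OP ==> T \<in> OP ==> S - T \<in> OP"
 "T \<in> OP ==> - T \<in> OP" "S \<in> OP ==> T \<in> OP ==> S oL T \<in> OP" "T \<in> OP ==> bscale op c T \<in> OP"
 by (auto simp: OP_def blinfun.bilinear_simps scale_right_distrib scale_right_diff_distrib mult.commute)

lemma norm_op_scale: "norm (bscale op c T) = norm c * norm T"
proof -
 have le: "norm (bscale op c T) \<le> norm c * norm T" for c T
  by (rule norm_blinfun_bound) (auto simp: norm_scale norm_blinfun mult.assoc intro!: mult_left_mono)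
 show ?thesis
 proof (cases "c = 0")
  case True
  then have "bscale op c T = 0" by (intro blinfun_eqI) simp
  then show ?thesis using True by simp
 next
  case False
  have "T = bscale op (1 / c) (bscale op c T)" using False by (intro blinfun_eqI) simp
  then have "norm T \<le> norm (1 / c) * norm (bscale op c T)" using le by metis
  then show ?thesis using le[of c T] False by (simp add: norm_divide field_simps)
 qed
qed

lemma normed_op: "nspace op"
proof
 show "bscale op c (badd op x y) = badd op (bscale op c x) (bscale op c y)" for c x y
  by (rule blinfun_eqI) (simp add: blinfun.bilinear_simps scale_right_distrib)
 show "bscale op (c + d) x = badd op (bscale op c x) (bscale op d x)" for c d x
  by (rule blinfun_eqI) (simp add: blinfun.bilinear_simps scale_left_distrib)
 show "bscale op c (bscale op d x) = bscale op (c * d) x" for c d x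
  by (rule blinfun_eqI) simp
 show "bscale op 1 x = x" for x
  by (rule blinfun_eqI) simp
qed (auto simp: norm_op_scale norm_triangle_ineq)

lemma closed_OP: "closed OP"
proof -
 have eq: "OP = (\<Inter>c. \<Inter>x. {T. ap T (sc c x) = sc c (ap T x)})"
  by (auto simp: OP_def)
 have *: "closed {T :: 'a \<Rightarrow>\<^sub>L 'a. ap T (sc c x) = sc c (ap T x)}" for c x
  by (intro closed_Collect_eq continuous_intros bounded_linear.continuous_on[OF bounded_linear_sc])
 show ?thesis unfolding eq by (intro closed_INT ballI *)
qed

lemma banach_op: "banach_space op"
 by (rule typed_bspace[OF normed_op]) (auto simp: dist_norm complete_eq_closed closed_OP)

lemma btop_op: "btop op = top_of_set OP"
 using typed_bspace(1)[OF normed_op] by (simp add: dist_norm)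

lemma bsums_opI:
 assumes "\<And>n. f n \<in> OP" "s \<in> OP" "f sums s"
 shows "bsums op f s"
proof (rule nspace.bsumsI[OF normed_op])
 have "psum op f n = (\<Sum>i<n. f i)" for n by (induction n) auto
 then show "(\<lambda>n. bnorm op (bdiff op (psum op f n) s)) \<longlonglongrightarrow> 0"
  using assms(3) by (simp add: sums_def LIM_zero tendsto_norm_zero)
qed (use assms in auto)

lemma op_linear_compose:
 "B \<in> OP ==> is_linear op op (\<lambda>A. A oL B)" "B \<in> OP ==> is_linear op op (\<lambda>A. B oL A)"
 by (auto intro!: is_linearI blinfun_eqI simp: blinfun.bilinear_simps OP_D)

lemma analytic_at_op_mult:
 assumes "nspace V" "analytic_at V op x f" "analytic_at V op x g"
 shows "analytic_at V op x (\<lambda>z. f z oL g z)"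
 by (rule analytic_at_bilinear[OF assms(1) normed_op normed_op normed_op _ _ _ assms(2,3), where K = 1])
   (use op_linear_compose norm_blinfun_compose in auto)

lemma analytic_at_op_add:
 assumes "nspace V" "analytic_at V op x f" "analytic_at V op x g"
 shows "analytic_at V op x (\<lambda>z. f z + g z)"
 using analytic_at_add[OF assms(1) normed_op assms(2,3)] by simp

lemma analytic_at_op_minus:
 assumes "nspace V" "analytic_at V op x f"
 shows "analytic_at V op x (\<lambda>z. - f z)"
 by (rule analytic_at_linear_compose[OF assms(1) normed_op normed_op assms(2), where K = 1])
   (auto intro!: is_linearI blinfun_eqI simp: blinfun.bilinear_simps)

lemma analytic_at_op_diff:
 assumes "nspace V" "analytic_at V op x f" "analytic_at V op x g"
 shows "analytic_at V op x (\<lambda>z. f z - g z)"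
 using analytic_at_op_add[OF assms(1,2) analytic_at_op_minus[OF assms(1,3)]] by simp

lemma analytic_at_op_const:
 assumes "nspace V" "x \<in> car V" "A \<in> OP"
 shows "analytic_at V op x (\<lambda>z. A)"
 using analytic_at_const[OF assms(1) normed_op assms(2)] assms(3) by simp

lemma analytic_at_op_ident: "A \<in> OP ==> analytic_at op op A (\<lambda>z. z)"
 by (rule analytic_at_linear[OF normed_op normed_op, where K = 1]) (auto intro!: is_linearI)

lemmas analytic_at_op_intros = analytic_at_op_mult analytic_at_op_add analytic_at_op_minus analytic_at_op_diff
 analytic_at_op_const analytic_at_op_ident

end

subsection \<open>Inversion\<close>

definition op_inverse :: "('a::banach \<Rightarrow>\<^sub>L 'a) => ('a \<Rightarrow>\<^sub>L 'a) => bool" where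
 "op_inverse A B \<longleftrightarrow> A oL B = idb \<and> B oL A = idb"

definition inv_op :: "('a::banach \<Rightarrow>\<^sub>L 'a) => ('a \<Rightarrow>\<^sub>L 'a)" where
 "inv_op A = (SOME B. op_inverse A B)"

lemma op_inverse_apply: "op_inverse A B ==> ap A (ap B x) = x"
 "op_inverse A B ==> ap B (ap A x) = x"
 unfolding op_inverse_def by (metis blinfun_apply_blinfun_compose blinfun_apply_id_blinfun)+

lemma op_inverseI:
 "(\<And>x. ap A (ap B x) = x) ==> (\<And>x. ap B (ap A x) = x) ==> op_inverse A B"
 unfolding op_inverse_def by (auto intro: blinfun_eqI)

lemma inv_op_eq: assumes "op_inverse A B" shows "inv_op A = B"
proof -
 have "op_inverse A (inv_op A)" unfolding inv_op_def by (rule someI[of _ B]) fact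
 then show ?thesis by (intro blinfun_eqI) (metis assms op_inverse_apply)
qed

lemma op_inverse_id: "op_inverse idb idb"
 by (rule op_inverseI) auto

definition blinfun_pow :: "('a::banach \<Rightarrow>\<^sub>L 'a) => nat => ('a \<Rightarrow>\<^sub>L 'a)" where
 "blinfun_pow N n = ((\<lambda>S. N oL S) ^^ n) idb"

lemma blinfun_pow_simps [simp]: "blinfun_pow N 0 = idb" "blinfun_pow N (Suc n) = N oL blinfun_pow N n"
 by (simp_all add: blinfun_pow_def)

lemma blinfun_pow_commute: "blinfun_pow N n oL N = N oL blinfun_pow N n"
proof (rule blinfun_eqI)
 show "ap (blinfun_pow N n oL N) x = ap (N oL blinfun_pow N n) x" for x
  by (induction n arbitrary: x) auto
qed

lemma norm_blinfun_pow: "norm (blinfun_pow N n) \<le> norm N ^ n"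
proof (induction n)
 case 0
 show ?case using norm_blinfun_id_le by simp
next
 case (Suc n)
 have "norm (blinfun_pow N (Suc n)) \<le> norm N * norm (blinfun_pow N n)" by (simp add: norm_blinfun_compose)
 also have "\<dots> \<le> norm N * norm N ^ n" using Suc by (intro mult_left_mono) auto
 finally show ?case by simp
qed

lemma neumann:
 fixes N :: "'a::banach \<Rightarrow>\<^sub>L 'a"
 assumes "norm N < 1"
 shows "summable (blinfun_pow N)" "op_inverse (idb - N) (suminf (blinfun_pow N))"
proof -
 show s: "summable (blinfun_pow N)"
  by (rule summable_comparison_test'[of "\<lambda>n. norm N ^ n" 0]) (use assms norm_blinfun_pow summable_geometric in auto)
 define S where "S = suminf (blinfun_pow N)"
 have S: "blinfun_pow N sums S" unfolding S_def using s summable_sums by blast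
 have S1: "(\<lambda>n. blinfun_pow N (Suc n)) sums (S - idb)"
  using sums_split_initial_segment[OF S, of 1] by simp
 have "(\<lambda>n. N oL blinfun_pow N n) sums (N oL S)"
  by (rule bounded_linear.sums[OF bounded_bilinear.bounded_linear_right[OF bounded_bilinear_blinfun_compose] S])
 then have 1: "N oL S = S - idb" using S1 sums_unique2 by fastforce
 have "(\<lambda>n. blinfun_pow N n oL N) sums (S oL N)"
  by (rule bounded_linear.sums[OF bounded_bilinear.bounded_linear_left[OF bounded_bilinear_blinfun_compose] S])
 then have 2: "S oL N = S - idb" using S1 sums_unique2 unfolding blinfun_pow_commute by fastforce
 show "op_inverse (idb - N) (suminf (blinfun_pow N))"
  unfolding S_def[symmetric]
 proof (rule op_inverseI)
  fix x
  have "ap N (ap S x) = ap S x - x" "ap S (ap N x) = ap S x - x"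
   using arg_cong[OF 1, of "\<lambda>A. ap A x"] arg_cong[OF 2, of "\<lambda>A. ap A x"]
   by (simp_all add: blinfun.bilinear_simps)
  then show "ap (idb - N) (ap S x) = x" "ap S (ap (idb - N) x) = x"
   by (simp_all add: blinfun.bilinear_simps)
 qed
qed

text \<open>\<open>A + H = A (I + B H)\<close>, so the inverse is the Neumann series in
  \<open>- B H\<close> composed with \<open>B\<close>.\<close>

lemma op_inverse_perturb:
 fixes A B H :: "'a::banach \<Rightarrow>\<^sub>L 'a"
 assumes "op_inverse A B" "norm B * norm H < 1"
 shows "op_inverse (A + H) (suminf (blinfun_pow (- (B oL H))) oL B)" "summable (blinfun_pow (- (B oL H)))"
proof -
 have n: "norm (- (B oL H)) < 1" using norm_blinfun_compose[of B H] assms(2) by simp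
 define S where "S = suminf (blinfun_pow (- (B oL H)))"
 note S = neumann[OF n, folded S_def]
 show "summable (blinfun_pow (- (B oL H)))" by (rule S)
 have 1: "ap S x + ap B (ap H (ap S x)) = x"
  and 2: "ap S (x + ap B (ap H x)) = x" for x
  using op_inverse_apply[OF S(2), of x] by (auto simp: blinfun.bilinear_simps)
 show "op_inverse (A + H) (suminf (blinfun_pow (- (B oL H))) oL B)"
  unfolding S_def[symmetric]
 proof (rule op_inverseI)
  fix x
  have "ap A (ap S (ap B x) + ap B (ap H (ap S (ap B x)))) = x"
   unfolding 1 by (rule op_inverse_apply[OF assms(1)])
  then show "ap (A + H) (ap (S oL B) x) = x"
   by (simp add: blinfun.bilinear_simps op_inverse_apply[OF assms(1)])
  show "ap (S oL B) (ap (A + H) x) = x"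
   using 2[of x] by (simp add: blinfun.bilinear_simps op_inverse_apply[OF assms(1)])
 qed
qed

context K_banach
begin

lemma op_inverse_OP:
 assumes "op_inverse A B" "A \<in> OP" shows "B \<in> OP"
 unfolding OP_def
proof (intro CollectI allI)
 fix c x
 have "ap B (sc c x) = ap B (sc c (ap A (ap B x)))"
  by (simp add: op_inverse_apply[OF assms(1)])
 also have "\<dots> = ap B (ap A (sc c (ap B x)))"
  by (simp add: OP_D[OF assms(2)])
 also have "\<dots> = sc c (ap B x)" by (rule op_inverse_apply[OF assms(1)])
 finally show "ap B (sc c x) = sc c (ap B x)" .
qed

text \<open>The term of degree \<open>n\<close> in the Neumann series is the diagonal of the
  multilinear map sending \<open>H1, ..., Hn\<close> to \<open>(- 1) ^ n B H1 B ... Hn B\<close>,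
  which \<open>foldr\<close> builds.\<close>

lemma analytic_at_inv_op:
 assumes AB: "op_inverse A B" and A: "A \<in> OP"
 shows "analytic_at op op A inv_op"
proof -
 have B: "B \<in> OP" by (rule op_inverse_OP[OF AB A])
 define m where "m n xs = foldr (\<lambda>H S. - (B oL H oL S)) xs B" for n :: nat and xs
 \<comment> \<open>\<open>norm B + 1\<close> avoids a division by zero and gives
   \<open>norm B * r \<le> 1\<close>, so the factor \<open>r\<close> per argument absorbs the factor
   \<open>norm B\<close> per argument.\<close>
 define r where "r = 1 / (norm B + 1)"
 have "0 < norm B + 1" by (simp add: add_nonneg_pos)
 then have r: "r > 0" "norm B * r \<le> 1" by (simp_all add: r_def)
 have mOP: "m n xs \<in> OP" if "set xs \<subseteq> OP" for n xs
  using that by (induction xs) (auto simp: m_def B)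
 have lin: "is_linear op op (\<lambda>x. m n (xs[i := x]))" if "set xs \<subseteq> OP" "i < length xs" for n xs i
  using that
 proof (induction xs arbitrary: i)
  case (Cons H xs)
  have "is_linear op op (\<lambda>x. - (B oL x oL S))" if "S \<in> OP" for S
   using that B by (auto intro!: is_linearI blinfun_eqI simp: blinfun.bilinear_simps OP_D)
  moreover have "is_linear op op (\<lambda>x. - (B oL H oL x))"
   using Cons.prems B by (auto intro!: is_linearI blinfun_eqI simp: blinfun.bilinear_simps OP_D)
  moreover have "is_linear op op (\<lambda>x. m n (xs[j := x]))" if "j < length xs" for j
   using Cons that by simp
  ultimately show ?case
   using Cons.prems mOP[of xs n] is_linear_compose[of op op "\<lambda>x. m n (xs[i - 1 := x])" op "\<lambda>x. - (B oL H oL x)"]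
   by (cases i) (auto simp: m_def)
 qed simp
 have bound: "norm (m n xs) * r ^ length xs \<le> norm B * prod_list (map norm xs)" for n xs
 proof (induction xs)
  case (Cons H xs)
  have "norm (m n (H # xs)) \<le> norm (B oL H) * norm (m n xs)"
   by (simp add: m_def norm_blinfun_compose)
  also have "\<dots> \<le> norm B * norm H * norm (m n xs)"
   by (intro mult_right_mono norm_blinfun_compose) auto
  finally have "norm (m n (H # xs)) * r ^ length (H # xs) \<le> norm B * norm H * norm (m n xs) * r ^ length (H # xs)"
   using r by (intro mult_right_mono) auto
  also have "\<dots> = (norm B * r) * norm H * (norm (m n xs) * r ^ length xs)" by simp
  also have "\<dots> \<le> 1 * norm H * (norm B * prod_list (map norm xs))"
   using Cons.IH r by (intro mult_mono[of "norm B * r * norm H" "1 * norm H" "norm (m n xs) * r ^ length xs"] mult_right_mono) auto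
  finally show ?case by (simp add: mult_ac)
 qed (simp add: m_def)
 have "bounded_family op op m r (norm B)"
  unfolding bounded_family_def multilinear_on_def using r(1) mOP lin bound by auto
 moreover have "bsums op (\<lambda>n. m n (replicate n H)) (inv_op (A + H))" if H: "H \<in> OP" "norm H < r" for H
 proof (rule bsums_opI)
  show "m n (replicate n H) \<in> OP" for n using H by (intro mOP) auto
  have "norm B * norm H \<le> norm B * r" using H by (intro mult_left_mono) auto
  then have n: "norm B * norm H < 1"
   using r(2) H(2) by (metis add_pos_nonneg dual_order.strict_trans1 less_eq_real_def linorder_not_le mult_less_cancel_left_pos mult_zero_left norm_ge_zero zero_less_one)
  note inv = op_inverse_perturb[OF AB n]
  show "inv_op (A + H) \<in> OP" unfolding inv_op_eq[OF inv(1)] by (rule op_inverse_OP[OF inv(1)]) (use A H in auto)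
  have "m n (replicate n H) = blinfun_pow (- (B oL H)) n oL B" for n
   by (induction n) (auto simp: m_def intro!: blinfun_eqI simp: blinfun.bilinear_simps)
  moreover have "(\<lambda>n. blinfun_pow (- (B oL H)) n oL B) sums (suminf (blinfun_pow (- (B oL H))) oL B)"
   by (rule bounded_linear.sums[OF bounded_bilinear.bounded_linear_left[OF bounded_bilinear_blinfun_compose] summable_sums[OF inv(2)]])
  ultimately show "(\<lambda>n. m n (replicate n H)) sums inv_op (A + H)" unfolding inv_op_eq[OF inv(1)] by simp
 qed
 ultimately show ?thesis unfolding analytic_at_def using A by auto
qed

end

subsection \<open>Projections and complements\<close>

text \<open>A Cauchy sequence is sent to \<open>W\<close>, where it converges, and \<open>p\<close>
  maps the limit back. This yields completeness of the operators from \<open>E\<close> to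
  \<open>F\<close>, as a retract of the operators on the whole space.\<close>

lemma banach_retract:
 assumes nV: "nspace V" and bW: "banach_space W"
  and i: "is_linear V W i" "\<And>x. x \<in> car V ==> bnorm W (i x) \<le> K * bnorm V x"
  and p: "is_linear W V p" "\<And>x. x \<in> car W ==> bnorm V (p x) \<le> L * bnorm W x"
  and pi: "\<And>x. x \<in> car V ==> p (i x) = x"
 shows "banach_space V"
proof -
 interpret V: nspace V by fact
 interpret W: nspace W by (rule banach_space_imp_normed[OF bW])
 have cl: "\<And>x. x \<in> car V ==> i x \<in> car W" "\<And>x. x \<in> car W ==> p x \<in> car V"
  by (rule is_linearD(1)[OF i(1)], assumption, rule is_linearD(1)[OF p(1)], assumption)
 define K1 where "K1 = max K 1"
 have K1: "K1 > 0" "bnorm W (i x) \<le> K1 * bnorm V x" if "x \<in> car V" for x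
  using i(2)[OF that] mult_right_mono[of K K1 "bnorm V x"] V.norm_nonneg[OF that] by (auto simp: K1_def)
 note K1 = K1(1)[OF V.zero_closed] K1(2)
 have "V.M.mcomplete"
  unfolding V.M.mcomplete_def
 proof (intro allI impI)
  fix s assume C: "V.M.MCauchy s"
  then have r: "\<And>n. s n \<in> car V" unfolding V.M.MCauchy_def by auto
  have "W.M.MCauchy (\<lambda>n. i (s n))"
   unfolding W.M.MCauchy_def
  proof (intro conjI allI impI)
   show "range (\<lambda>n. i (s n)) \<subseteq> car W" using r cl by auto
   fix e :: real assume "e > 0"
   then have "e / K1 > 0" using K1 by simp
   then obtain N where N: "\<And>n n'. N \<le> n ==> N \<le> n' ==> bdist V (s n) (s n') < e / K1"
    using C unfolding V.M.MCauchy_def by blast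
   have "bdist W (i (s n)) (i (s n')) < e" if "N \<le> n" "N \<le> n'" for n n'
   proof -
    have "bdist W (i (s n)) (i (s n')) = bnorm W (i (bdiff V (s n) (s n')))"
     using r cl by (simp add: W.bdist_eq is_linear_diff[OF i(1) nV])
    also have "\<dots> \<le> K1 * bnorm V (bdiff V (s n) (s n'))" using K1 r by auto
    also have "\<dots> < e" using N[OF that] K1 r by (simp add: V.bdist_eq field_simps)
    finally show ?thesis .
   qed
   then show "\<exists>N. \<forall>n n'. N \<le> n --> N \<le> n' --> bdist W (i (s n)) (i (s n')) < e" by blast
  qed
  then obtain l where "limitin (btop W) (\<lambda>n. i (s n)) l sequentially"
   using banach_space.complete[OF bW] unfolding W.M.mcomplete_def btop_def by blast
  then have l: "l \<in> car W" "(\<lambda>n. bnorm W (bdiff W (i (s n)) l)) \<longlonglongrightarrow> 0"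
   unfolding W.limitin_btop by auto
  have "bnorm V (bdiff V (s n) (p l)) \<le> L * bnorm W (bdiff W (i (s n)) l)" for n
   using p(2)[of "bdiff W (i (s n)) l"] l(1) r[of n] cl(1)[of "s n"]
   by (simp add: is_linear_diff[OF p(1) W.nspace_axioms] pi)
  moreover have "(\<lambda>n. L * bnorm W (bdiff W (i (s n)) l)) \<longlonglongrightarrow> 0"
   by (rule tendsto_mult_right_zero[OF l(2)])
  moreover have "0 \<le> bnorm V (bdiff V (s n) (p l))" for n using r cl l by auto
  ultimately have "(\<lambda>n. bnorm V (bdiff V (s n) (p l))) \<longlonglongrightarrow> 0"
   by (rule nonneg_le_tendsto_zero[rotated])
  then have "limitin (btop V) s (p l) sequentially" unfolding V.limitin_btop using r cl l by auto
  then show "\<exists>x. limitin V.M.mtopology s x sequentially" unfolding btop_def by blast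
 qed
 then show ?thesis using banach_spaceI nV by blast
qed

lemma id_perturb:
 fixes H :: "'a::banach \<Rightarrow>\<^sub>L 'a"
 assumes "norm H < 1" shows "\<exists>B. op_inverse (idb + H) B"
proof -
 have "norm (idb :: 'a \<Rightarrow>\<^sub>L 'a) * norm H \<le> 1 * norm H"
  by (intro mult_right_mono norm_blinfun_id_le) auto
 then have "norm (idb :: 'a \<Rightarrow>\<^sub>L 'a) * norm H < 1" using assms by simp
 from op_inverse_perturb(1)[OF op_inverse_id this] show ?thesis by blast
qed

context K_banach
begin

abbreviation "Gr \<equiv> grassmannian sc"
abbreviation "Cpl \<equiv> complements_of sc"
abbreviation "SO \<equiv> sub_ops sc"
abbreviation "X \<equiv> whole_space sc"

lemma ap_diff: "ap (S - T) x = ap S x - ap T x" "ap (S + T) x = ap S x + ap T x" "ap (- S) x = - ap S x"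
 "ap S (x + y) = ap S x + ap S y" "ap S (x - y) = ap S x - ap S y" "ap S 0 = 0" "ap 0 x = 0" "ap S (- x) = - ap S x"
 by (simp_all add: blinfun.bilinear_simps)

text \<open>Complementarity of \<open>E\<close> and \<open>F\<close> expressed by one operator: it
  determines \<open>E\<close> as its fixed points and \<open>F\<close> as its kernel, from which
  closedness, linearity and the complement relation are read off.\<close>

definition isproj :: "('a \<Rightarrow>\<^sub>L 'a) => 'a set => 'a set => bool" where
 "isproj P E F \<longleftrightarrow> P \<in> OP \<and> (\<forall>x. ap P x \<in> E) \<and> (\<forall>x\<in>E. ap P x = x) \<and> (\<forall>x. x - ap P x \<in> F) \<and> (\<forall>y\<in>F. ap P y = 0)"

definition proj :: "'a set => 'a set => ('a \<Rightarrow>\<^sub>L 'a)" where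
 "proj E F = (THE P. isproj P E F)"

lemma isprojD:
 assumes "isproj P E F"
 shows "P \<in> OP" "ap P x \<in> E" "x \<in> E ==> ap P x = x" "x - ap P x \<in> F" "y \<in> F ==> ap P y = 0"
 using assms by (auto simp: isproj_def)

lemma isproj_unique: assumes "isproj P E F" "isproj P' E F" shows "P = P'"
proof (rule blinfun_eqI)
 fix x
 have "ap P' (x - ap P x) = 0" using isprojD[OF assms(1)] isprojD[OF assms(2)] by blast
 moreover have "ap P' (ap P x) = ap P x" using isprojD[OF assms(1)] isprojD[OF assms(2)] by blast
 ultimately show "ap P x = ap P' x" by (simp add: ap_diff)
qed

lemma proj_eq: "isproj P E F ==> proj E F = P"
 unfolding proj_def by (rule the_equality) (auto intro: isproj_unique)

lemma isproj_sets: assumes "isproj P E F" shows "E = {x. ap P x = x}" "F = {x. ap P x = 0}" "E = range (ap P)"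
proof -
 note p = isprojD[OF assms]
 show "E = {x. ap P x = x}" using p(2,3) by (metis (mono_tags, lifting) Collect_cong Collect_mem_eq)
 show "F = {x. ap P x = 0}" using p(4,5) by (metis (mono_tags, lifting) Collect_cong Collect_mem_eq diff_zero)
 show "E = range (ap P)" using p(2,3) by (metis image_subset_iff rangeI subsetI subset_antisym)
qed

lemma isproj_swap: assumes "isproj P E F" shows "isproj (idb - P) F E"
 using isprojD[OF assms] unfolding isproj_def by (auto simp: ap_diff)

lemma isproj_comp: assumes "isproj P E F" shows "P oL P = P"
 using isprojD[OF assms] by (intro blinfun_eqI) auto

lemma lin_subspace_whole: "lin_subspace X E \<longleftrightarrow> 0 \<in> E \<and> (\<forall>x\<in>E. \<forall>y\<in>E. x + y \<in> E) \<and> (\<forall>c. \<forall>x\<in>E. sc c x \<in> E)"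
 by (simp add: lin_subspace_def)

lemma closed_lin_whole: "closed_lin_subspace X E \<longleftrightarrow> lin_subspace X E \<and> closed E"
 by (simp add: closed_lin_subspace_iff btop_whole)

lemma closed_lin_isproj: assumes "isproj P E F" shows "closed_lin_subspace X E" "closed_lin_subspace X F"
proof -
 have P: "P \<in> OP" using isprojD[OF assms] by blast
 show "closed_lin_subspace X E" "closed_lin_subspace X F"
  unfolding closed_lin_whole lin_subspace_whole isproj_sets(1)[OF assms] isproj_sets(2)[OF assms]
  using P by (auto simp: ap_diff OP_D intro!: closed_Collect_eq continuous_intros)
qed

lemma isproj_complement: assumes "isproj P E F" shows "F \<in> Cpl E" "E \<in> Cpl F"
proof -
 note p = isprojD[OF assms]
 have "E \<inter> F = {0}"
  unfolding isproj_sets(1)[OF assms] isproj_sets(2)[OF assms] by (auto simp: ap_diff)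
 moreover have "\<exists>x y. v = x + y \<and> x \<in> E \<and> y \<in> F" for v
  by (rule exI[of _ "ap P v"], rule exI[of _ "v - ap P v"]) (use p in auto)
 then have "{x + y | x y. x \<in> E \<and> y \<in> F} = UNIV" by blast
 moreover have "\<exists>x y. v = x + y \<and> x \<in> F \<and> y \<in> E" for v
  by (rule exI[of _ "v - ap P v"], rule exI[of _ "ap P v"]) (use p in auto)
 then have "{x + y | x y. x \<in> F \<and> y \<in> E} = UNIV" by blast
 ultimately show "F \<in> Cpl E" "E \<in> Cpl F"
  using closed_lin_isproj[OF assms] by (auto simp: complements_of_def closed_complements_def)
qed

text \<open>Boundedness of the algebraic projection \<open>cproj\<close> is the open mapping bound
  of \<open>complement_bound\<close>.\<close>

lemma isproj_exists:
 assumes "closed_lin_subspace X E" "F \<in> Cpl E"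
 shows "isproj (proj E F) E F"
proof -
 have F: "F \<in> closed_complements X E" using assms by (simp add: complements_of_def)
 note c = cproj[OF banach_whole assms(1) F]
 define p where "p = cproj X E F"
 have lin: "p (x + y) = p x + p y" "p (sc c x) = sc c (p x)" for x y c
  using is_linearD(2,3)[OF c(6)] by (auto simp: p_def)
 obtain C where C: "norm (p v) \<le> C * norm v" for v using c(7) by (auto simp: p_def)
 have "bounded_linear p"
  by (rule bounded_linear_intro[where K = C]) (use lin C in \<open>auto simp: scale_of_real[symmetric] mult.commute\<close>)
 then have ap: "ap (Blinfun p) x = p x" for x by (simp add: bounded_linear_Blinfun_apply)
 have "isproj (Blinfun p) E F"
  unfolding isproj_def OP_def using lin c(2-5)[folded p_def] by (auto simp: ap)
 then show ?thesis using proj_eq by metis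
qed

lemma grassmannianI: assumes "isproj P E F" "E \<noteq> {0}" "E \<noteq> UNIV" shows "E \<in> Gr"
 using closed_lin_isproj[OF assms(1)] isproj_complement[OF assms(1)] assms(2,3) by (auto simp: grassmannian_def)

lemma grassmannianD:
 assumes "E \<in> Gr"
 shows "closed_lin_subspace X E" "E \<noteq> {0}" "E \<noteq> UNIV" "\<exists>F. F \<in> Cpl E"
  "F \<in> Cpl E ==> isproj (proj E F) E F"
 using assms isproj_exists by (auto simp: grassmannian_def)

text \<open>A trivial complement \<open>W\<close> of \<open>F\<close> would make \<open>F\<close>
  everything or zero, and then \<open>E\<close> zero or everything. Hence the whole chart domain of
  \<open>F\<close> consists of elements of the Grassmannian.\<close>

lemma complement_sym:
 assumes "E \<in> Gr" "F \<in> Cpl E" "W \<in> Cpl F"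
 shows "isproj (proj W F) W F" "W \<in> Gr"
proof -
 note p = grassmannianD(5)[OF assms(1,2)]
 have F: "closed_lin_subspace X F" using closed_lin_isproj[OF p] by blast
 have q: "isproj (idb - proj F W) W F"
  using isproj_swap[OF isproj_exists[OF F assms(3)]] .
 then show "isproj (proj W F) W F" using proj_eq by metis
 have "W \<noteq> {0}"
 proof
  assume "W = {0}"
  then have "F = UNIV" using isprojD(4)[OF q] isprojD(2)[OF q] by fastforce
  then have "E = {0}" using isprojD(5)[OF p] isprojD(3)[OF p] closed_lin_isproj(1)[OF p]
   by (auto simp: closed_lin_whole lin_subspace_whole)
  then show False using grassmannianD(2)[OF assms(1)] by blast
 qed
 moreover have "W \<noteq> UNIV"
 proof
  assume "W = UNIV"
  then have "y = 0" if "y \<in> F" for y using isprojD(3,5)[OF q] that by (metis UNIV_I)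
  then have "x - ap (proj E F) x = 0" for x using isprojD(4)[OF p] by blast
  then have "x = ap (proj E F) x" for x by (metis eq_iff_diff_eq_0)
  then have "E = UNIV" using isprojD(2)[OF p] by (metis UNIV_eq_I)
  then show False using grassmannianD(3)[OF assms(1)] by blast
 qed
 ultimately show "W \<in> Gr" using grassmannianI[OF q] by blast
qed

lemma complements_sym: "E \<in> Gr ==> F \<in> Cpl E ==> E \<in> Cpl F"
 using isproj_complement(2) grassmannianD(5) by blast

lemma isproj_idempotent: assumes "isproj P E F" "E \<in> Gr"
 shows "P \<in> idempotents sc" "rg P = E"
proof -
 show r: "rg P = E" using isproj_sets(3)[OF assms(1)] by (simp add: range_map_def)
 have "P \<noteq> 0" using r grassmannianD(2)[OF assms(2)] by (auto simp: range_map_def ap_diff)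
 moreover have "P \<noteq> idb" using r grassmannianD(3)[OF assms(2)] by (auto simp: range_map_def)
 ultimately show "P \<in> idempotents sc"
  using isproj_comp[OF assms(1)] isprojD(1)[OF assms(1)] by (simp add: idempotents_def)
qed

lemma idempotentsD: assumes "Q \<in> idempotents sc"
 shows "Q \<in> OP" "Q oL Q = Q" "ap Q (ap Q x) = ap Q x" "isproj Q (rg Q) {x. ap Q x = 0}" "rg Q \<in> Gr"
proof -
 show 1: "Q \<in> OP" "Q oL Q = Q" using assms by (auto simp: idempotents_def)
 then show 2: "ap Q (ap Q x) = ap Q x" for x by (metis blinfun_apply_blinfun_compose)
 show 3: "isproj Q (rg Q) {x. ap Q x = 0}"
  unfolding isproj_def range_map_def using 1 2 by (auto simp: ap_diff)
 have "rg Q \<noteq> {0}"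
 proof
  assume "rg Q = {0}"
  then have "ap Q x = 0" for x unfolding range_map_def by blast
  then have "Q = 0" by (intro blinfun_eqI) (simp add: ap_diff)
  then show False using assms by (simp add: idempotents_def)
 qed
 moreover have "rg Q \<noteq> UNIV"
 proof
  assume "rg Q = UNIV"
  then have "ap Q x = x" for x using isprojD(3)[OF 3, of x] by simp
  then have "Q = idb" by (intro blinfun_eqI) simp
  then show False using assms by (simp add: idempotents_def)
 qed
 ultimately show "rg Q \<in> Gr" using grassmannianI[OF 3] by blast
qed

subsection \<open>Graph charts\<close>

text \<open>\<open>ext E F T\<close> is \<open>T\<close> on \<open>E\<close> and zero on
  \<open>F\<close>; \<open>res E F\<close> cuts an operator to \<open>E\<close> and drops the
  \<open>E\<close>-component of its values. Together they exhibit the operators from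
  \<open>E\<close> to \<open>F\<close> as a retract of \<open>OP\<close>, so chart computations can
  be done with globally defined operators.\<close>

definition ext :: "'a set => 'a set => ('a => 'a) => ('a \<Rightarrow>\<^sub>L 'a)" where
 "ext E F T = Blinfun (\<lambda>x. T (ap (proj E F) x))"

definition res :: "'a set => 'a set => ('a \<Rightarrow>\<^sub>L 'a) => 'a => 'a" where
 "res E F A = (\<lambda>x\<in>E. ap A x - ap (proj E F) (ap A x))"

context
 fixes E F P
 assumes E: "E \<in> Gr" and F: "F \<in> Cpl E"
 defines "P \<equiv> proj E F"
begin

lemma P: "isproj P E F" unfolding P_def by (rule grassmannianD(5)[OF E F])

lemma nE: "nspace (bsub X E)" and nF: "nspace (bsub X F)"
 using closed_lin_isproj[OF P] nspace.normed_bsub[OF normed_whole] by (auto simp: closed_lin_subspace_iff)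

lemma sub_ops_carrier:
 "T \<in> car (SO E F) \<longleftrightarrow> T \<in> extensional E \<and> bounded_lin (bsub X E) (bsub X F) T"
 unfolding sub_ops_def blin_simps[OF nE nF] by simp

lemma sub_ops_D:
 assumes "T \<in> car (SO E F)"
 shows "x \<in> E ==> T x \<in> F" "x \<in> E ==> y \<in> E ==> T (x + y) = T x + T y" "x \<in> E ==> T (sc c x) = sc c (T x)"
  "x \<in> E ==> norm (T x) \<le> bnorm (SO E F) T * norm x" "T \<in> extensional E"
  "0 \<le> bnorm (SO E F) T"
proof -
 have b: "bounded_lin (bsub X E) (bsub X F) T" using assms by (simp add: sub_ops_carrier)
 then have l: "is_linear (bsub X E) (bsub X F) T" by (simp add: bounded_lin_def)
 show "x \<in> E ==> T x \<in> F" "x \<in> E ==> y \<in> E ==> T (x + y) = T x + T y" "x \<in> E ==> T (sc c x) = sc c (T x)"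
  using is_linearD[OF l, of x] by auto
 show "x \<in> E ==> norm (T x) \<le> bnorm (SO E F) T * norm x"
  using opn_bound[OF nE nF b, of x] by (simp add: sub_ops_def blin_simps[OF nE nF])
 show "T \<in> extensional E" using assms by (simp add: sub_ops_carrier)
 show "0 \<le> bnorm (SO E F) T"
  using opn_nonneg[OF nE nF b] by (simp add: sub_ops_def blin_simps[OF nE nF])
qed

lemma normed_sub_ops: "nspace (SO E F)"
 unfolding sub_ops_def by (rule normed_blin[OF nE nF])

lemma ext_apply:
 assumes T: "T \<in> car (SO E F)"
 shows "ap (ext E F T) x = T (ap P x)" "norm (ext E F T) \<le> norm P * bnorm (SO E F) T"
  "ext E F T \<in> OP" "ap (ext E F T) x \<in> F" "y \<in> F ==> ap (ext E F T) y = 0"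
proof -
 note p = isprojD[OF P] and t = sub_ops_D[OF T]
 have bd: "norm (T (ap P x)) \<le> norm P * bnorm (SO E F) T * norm x" for x
 proof -
  have "norm (T (ap P x)) \<le> bnorm (SO E F) T * norm (ap P x)" using t(4) p(2) by blast
  also have "\<dots> \<le> bnorm (SO E F) T * (norm P * norm x)" using t(6) norm_blinfun by (intro mult_left_mono) auto
  finally show ?thesis by (simp add: mult_ac)
 qed
 have "bounded_linear (\<lambda>x. T (ap P x))"
 proof (rule bounded_linear_intro[where K = "norm P * bnorm (SO E F) T"])
  show "T (ap P (x + y)) = T (ap P x) + T (ap P y)" for x y using t(2) p(2) by (simp add: ap_diff)
  show "T (ap P (r *\<^sub>R x)) = r *\<^sub>R T (ap P x)" for r x
   using t(3)[OF p(2), of "of_real r" x] OP_D[OF p(1), of "of_real r" x] by (simp add: scale_of_real)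
 qed (use bd in \<open>simp add: mult_ac\<close>)
 then show *: "ap (ext E F T) x = T (ap P x)" for x unfolding ext_def P_def by (simp add: bounded_linear_Blinfun_apply)
 show "norm (ext E F T) \<le> norm P * bnorm (SO E F) T"
  by (rule norm_blinfun_bound) (use bd * t(6) in auto)
 show "ext E F T \<in> OP" unfolding OP_def using t(3)[OF p(2)] OP_D[OF p(1)] by (simp add: *)
 show "ap (ext E F T) x \<in> F" using t(1)[OF p(2)] by (simp add: *)
 show "ap (ext E F T) y = 0" if "y \<in> F"
  using p(5)[OF that] t(3)[of "ap P y" 0] p(2) by (metis * scale_zero_left)
qed

lemma linear_ext: "is_linear (SO E F) op (ext E F)"
proof (rule is_linearI)
 interpret S: nspace "SO E F" by (rule normed_sub_ops)
 have val: "badd (SO E F) S T x = S x + T x" "bscale (SO E F) c T x = sc c (T x)"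
  if "x \<in> E" for S T x c
  using that by (simp_all add: sub_ops_def blin_simps[OF nE nF])
 show "ext E F T \<in> car op" if "T \<in> car (SO E F)" for T using ext_apply(3)[OF that] by simp
 show "ext E F (badd (SO E F) S T) = badd op (ext E F S) (ext E F T)"
  if "S \<in> car (SO E F)" "T \<in> car (SO E F)" for S T
  using that isprojD(2)[OF P] by (intro blinfun_eqI) (simp add: ap_diff ext_apply(1) val)
 show "ext E F (bscale (SO E F) c T) = bscale op c (ext E F T)"
  if "T \<in> car (SO E F)" for c T
  using that isprojD(2)[OF P] by (intro blinfun_eqI) (simp add: ap_diff ext_apply(1) val)
qed

lemma res_apply: "x \<in> E ==> res E F A x = ap A x - ap P (ap A x)"
 by (simp add: res_def P_def)

lemma linear_res: "is_linear op (SO E F) (res E F)"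
 and norm_res: "A \<in> OP ==> bnorm (SO E F) (res E F A) \<le> norm (idb - P) * norm A"
proof -
 note p = isprojD[OF P]
 have bd: "norm (res E F A x) \<le> norm (idb - P) * norm A * norm x" if "x \<in> E" for A x
 proof -
  have "norm (res E F A x) = norm (ap ((idb - P) oL A) x)" using that by (simp add: res_apply ap_diff)
  also have "\<dots> \<le> norm ((idb - P) oL A) * norm x" by (rule norm_blinfun)
  also have "\<dots> \<le> norm (idb - P) * norm A * norm x" by (intro mult_right_mono norm_blinfun_compose) auto
  finally show ?thesis .
 qed
 have add_E: "x + y \<in> E" "sc c x \<in> E" if "x \<in> E" "y \<in> E" for x y c
  using closed_lin_isproj(1)[OF P] that by (auto simp: closed_lin_whole lin_subspace_whole)
 have cl: "res E F A \<in> car (SO E F)" if A: "A \<in> OP" for A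
  unfolding sub_ops_carrier bounded_lin_def
 proof (intro conjI)
  show "res E F A \<in> extensional E" by (simp add: res_def)
  show "is_linear (bsub X E) (bsub X F) (res E F A)"
  proof (rule is_linearI)
   show "res E F A x \<in> car (bsub X F)" if "x \<in> car (bsub X E)" for x
    using that p(4) by (simp add: res_apply)
   show "res E F A (badd (bsub X E) x y) = badd (bsub X F) (res E F A x) (res E F A y)"
    if "x \<in> car (bsub X E)" "y \<in> car (bsub X E)" for x y
    using that add_E by (simp add: res_apply ap_diff)
   show "res E F A (bscale (bsub X E) c x) = bscale (bsub X F) c (res E F A x)"
    if "x \<in> car (bsub X E)" for c x
    using that add_E(2) A p(1) by (simp add: res_apply OP_D scale_right_diff_distrib)
  qed
  show "\<exists>C. \<forall>x\<in>car (bsub X E). bnorm (bsub X F) (res E F A x) \<le> C * bnorm (bsub X E) x"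
   using bd by auto
 qed
 have val: "badd (SO E F) S T = (\<lambda>x\<in>E. S x + T x)" "bscale (SO E F) c T = (\<lambda>x\<in>E. sc c (T x))"
  for S T c
  by (simp_all add: sub_ops_def blin_simps[OF nE nF])
 show "is_linear op (SO E F) (res E F)"
  by (rule is_linearI)
    (use cl p(1) in \<open>auto simp: val fun_eq_iff res_def ap_diff OP_D scale_right_diff_distrib simp flip: P_def\<close>)
 show "bnorm (SO E F) (res E F A) \<le> norm (idb - P) * norm A" if "A \<in> OP"
  unfolding sub_ops_def blin_simps[OF nE nF] by (rule opn_le[OF nE nF]) (use bd in auto)
qed

lemma res_closed: "A \<in> OP ==> res E F A \<in> car (SO E F)"
 using is_linearD(1)[OF linear_res] by simp

lemma res_ext:
 assumes "T \<in> car (SO E F)" shows "res E F (P + ext E F T) = T" "res E F (ext E F T) = T"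
proof -
 note p = isprojD[OF P] and t = sub_ops_D[OF assms]
 have "res E F (P + ext E F T) x = T x \<and> res E F (ext E F T) x = T x" for x
 proof (cases "x \<in> E")
  case True
  then show ?thesis
   using t(1)[of x] p(3)[of x] p(5)[of "T x"] by (simp add: res_apply ap_diff ext_apply(1)[OF assms])
 next
  case False
  then show ?thesis using t(5) by (simp add: res_def extensional_def)
 qed
 then show "res E F (P + ext E F T) = T" "res E F (ext E F T) = T" by blast+
qed

lemma banach_sub_ops: "banach_space (SO E F)"
 by (rule banach_retract[OF normed_sub_ops banach_op linear_ext _ linear_res])
   (use ext_apply(2) norm_res res_ext in auto)

text \<open>Adding \<open>T (P z)\<close> to the \<open>E\<close>-component \<open>P z\<close> of
  \<open>z\<close> reaches the graph and differs from \<open>z\<close> only by an element of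
  \<open>F\<close>. In terms of projections along \<open>F\<close> the graph map is therefore
  affine.\<close>

lemma isproj_graph:
 assumes T: "T \<in> car (SO E F)"
 shows "isproj (P + ext E F T) (graph_of E T) F"
proof -
 note p = isprojD[OF P] and t = sub_ops_D[OF T] and e = ext_apply[OF T]
 have "z - ap (P + ext E F T) z \<in> F" for z
 proof -
  have "(z - ap P z) + sc (- 1) (ap (ext E F T) z) \<in> F"
   using closed_lin_isproj(2)[OF P] p(4)[of z] e(4)[of z] unfolding closed_lin_whole lin_subspace_whole by blast
  then show ?thesis by (simp add: ap_diff algebra_simps)
 qed
 moreover have "ap (P + ext E F T) z \<in> graph_of E T" for z
  using p(2) by (auto simp: ap_diff e(1) graph_of_def)
 moreover have "ap (P + ext E F T) z = z" if "z \<in> graph_of E T" for z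
 proof -
  obtain x where x: "x \<in> E" "z = x + T x" using \<open>z \<in> graph_of E T\<close> by (auto simp: graph_of_def)
  have Pz: "ap P z = x" using x p(3) p(5) t(1) by (simp add: ap_diff)
  have "ap (P + ext E F T) z = ap P z + T (ap P z)" by (simp add: ap_diff(2) e(1))
  then show ?thesis unfolding Pz using x by simp
 qed
 moreover have "ap (P + ext E F T) y = 0" if "y \<in> F" for y
  using p(5)[OF that] e(5)[OF that] by (simp add: ap_diff)
 ultimately show ?thesis unfolding isproj_def using p(1) e(3) by auto
qed

lemma graph_complement: "T \<in> car (SO E F) ==> graph_of E T \<in> Cpl F"
 and proj_graph: "T \<in> car (SO E F) ==> proj (graph_of E T) F = P + ext E F T"
 using isproj_complement(2)[OF isproj_graph] proj_eq[OF isproj_graph] by blast+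

text \<open>Projections \<open>P\<close> and \<open>G\<close> along the same \<open>F\<close>
  satisfy \<open>P G = P\<close> and \<open>G P = G\<close>, since \<open>x - G x\<close> and
  \<open>x - P x\<close> lie in the kernel of both. Hence \<open>G = P + (I - P) G P\<close>, and
  \<open>res\<close> extracts the second summand.\<close>

lemma graph_res:
 assumes W: "W \<in> Cpl F" shows "graph_of E (res E F (proj W F)) = W"
  "P + ext E F (res E F (proj W F)) = proj W F"
proof -
 define G where "G = proj W F"
 have G: "isproj G W F" unfolding G_def by (rule complement_sym(1)[OF E F W])
 note p = isprojD[OF P] and g = isprojD[OF G]
 have PG: "ap P (ap G x) = ap P x" for x using p(5)[OF g(4)[of x]] by (simp add: ap_diff)
 have GP: "ap G (ap P x) = ap G x" for x using g(5)[OF p(4)[of x]] by (simp add: ap_diff)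
 have r: "x + res E F G x = ap G x" if "x \<in> E" for x using that p(3)[OF that] by (simp add: res_apply PG)
 have "W = {ap G x | x. x \<in> E}"
 proof
  show "W \<subseteq> {ap G x | x. x \<in> E}"
  proof
   fix w assume "w \<in> W"
   then have "w = ap G (ap P w)" using GP g(3) by simp
   then show "w \<in> {ap G x | x. x \<in> E}" using p(2) by blast
  qed
 qed (use g(2) in auto)
 then show "graph_of E (res E F (proj W F)) = W"
  unfolding G_def[symmetric] graph_of_def using r by force
 show "P + ext E F (res E F (proj W F)) = proj W F"
  unfolding G_def[symmetric]
  using p(2) p(3) by (intro blinfun_eqI) (simp add: ap_diff ext_apply(1)[OF res_closed[OF g(1)]] res_apply PG GP)
qed

lemma inj_graph: "inj_on (graph_of E) (car (SO E F))"
 by (rule inj_on_inverseI[where g = "\<lambda>W. res E F (proj W F)"]) (simp add: proj_graph res_ext)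

lemma chart_eq: "W \<in> Cpl F ==> inv_into (car (SO E F)) (graph_of E) W = res E F (proj W F)"
 by (rule inv_into_f_eq[OF inj_graph]) (auto simp: graph_res res_closed isprojD(1)[OF complement_sym(1)[OF E F]])

lemma graph_zero: "graph_of E (bzero (SO E F)) = E" "bzero (SO E F) \<in> car (SO E F)"
 by (auto simp: graph_of_def sub_ops_def blin_simps[OF nE nF])
   (use nspace.zero_closed[OF normed_sub_ops] in \<open>auto simp: sub_ops_def blin_simps[OF nE nF]\<close>)

end

subsection \<open>The projection onto the range of an idempotent along a fixed complement\<close>

text \<open>Near \<open>R0\<close> with \<open>G0 = proj (range R0) F\<close>, the operator \<open>M = I - G0 + R G0\<close> is invertible, fixes \<open>F\<close> and
 maps the range of \<open>R0\<close> onto that of \<open>R\<close>, so that \<open>proj (range R) F = M G0 M\<^sup>-\<^sup>1 = R G0 M\<^sup>-\<^sup>1\<close>.\<close>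

definition nproj :: "'a set => ('a \<Rightarrow>\<^sub>L 'a) => ('a \<Rightarrow>\<^sub>L 'a) => ('a \<Rightarrow>\<^sub>L 'a)" where
 "nproj F R0 R = (R oL proj (rg R0) F) oL
   inv_op (idb - proj (rg R0) F + (R oL proj (rg R0) F))"

text \<open>For \<open>R\<close> close to \<open>R0\<close> the operator
  \<open>M R = I + (R - R0) G\<close> is invertible. That \<open>R\<close> maps the range of
  \<open>R0\<close> onto its own range comes from the invertible \<open>U\<close>, which satisfies
  \<open>R U = U R0\<close>; the inverse of \<open>M R\<close> undoes this map and fixes
  \<open>F\<close> pointwise.\<close>

lemma nproj:
 assumes R0: "R0 \<in> idempotents sc" and G0: "isproj (proj (rg R0) F) (rg R0) F"
 shows "\<exists>\<delta>>0. \<forall>R\<in>idempotents sc. norm (R - R0) < \<delta> --> isproj (nproj F R0 R) (rg R) F"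
  and "analytic_at op op R0 (nproj F R0)"
proof -
 define G where "G = proj (rg R0) F"
 note g = isprojD[OF G0, folded G_def]
 note r0 = isprojD[OF idempotentsD(4)[OF R0]]
 have R0G: "ap R0 (ap G x) = ap G x" for x using g(2) r0(3) by blast
 define M where "M R = idb - G + (R oL G)" for R
 have M0: "M R0 = idb" unfolding M_def by (rule blinfun_eqI) (simp add: ap_diff R0G)
 have np: "nproj F R0 R = (R oL G) oL inv_op (M R)" for R unfolding nproj_def M_def G_def ..
 have id: "op_inverse (M R0) idb" unfolding M0 by (rule op_inverse_id)
 have aM: "analytic_at op op R0 M"
  unfolding M_def using g(1) r0(1) by (intro analytic_at_op_intros normed_op) auto
 have "analytic_at op op (M R0) inv_op"
  by (rule analytic_at_inv_op[OF id]) (use g(1) r0(1) in \<open>auto simp: M_def\<close>)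
 from analytic_at_compose[OF aM this normed_op normed_op normed_op]
 show "analytic_at op op R0 (nproj F R0)"
  unfolding np using g(1) r0(1) by (intro analytic_at_op_intros normed_op) auto
 \<comment> \<open>Small enough for both perturbations of the identity: \<open>(R - R0) G\<close>
   for \<open>M R\<close>, and \<open>(R - R0) (2 R0 - I)\<close> for the intertwining operator,
   with \<open>norm (2 R0 - I) \<le> 2 * norm R0 + 1\<close>.\<close>
 define \<delta> where "\<delta> = 1 / (norm G + 2 * norm R0 + 3)"
 have \<delta>: "\<delta> > 0" unfolding \<delta>_def by (simp add: add_nonneg_pos)
 have "isproj (nproj F R0 R) (rg R) F" if R: "R \<in> idempotents sc" and n: "norm (R - R0) < \<delta>" for R
 proof -
  note r = isprojD[OF idempotentsD(4)[OF R]]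
  have RR: "ap R (ap R x) = ap R x" for x by (rule idempotentsD(3)[OF R])
  have pos: "0 < norm G + 2 * norm R0 + 3" by (simp add: add_nonneg_pos)
  have n1: "norm (R - R0) * (norm G + 2 * norm R0 + 3) < 1" using n pos by (simp add: \<delta>_def field_simps)
  have nG: "norm ((R - R0) oL G) < 1"
  proof -
   have "norm ((R - R0) oL G) \<le> norm (R - R0) * norm G" by (rule norm_blinfun_compose)
   also have "\<dots> \<le> norm (R - R0) * (norm G + 2 * norm R0 + 3)" by (intro mult_left_mono) auto
   finally show ?thesis using n1 by simp
  qed
  have "M R = idb + ((R - R0) oL G)" unfolding M_def by (rule blinfun_eqI) (simp add: ap_diff R0G)
  then obtain N where N: "op_inverse (M R) N"
   using id_perturb[OF nG] by metis
  \<comment> \<open>The usual intertwiner of two nearby idempotents: it is the identity at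
    \<open>R = R0\<close> and carries the range of \<open>R0\<close> into that of
    \<open>R\<close>.\<close>
  define U where "U = (R oL R0) + ((idb - R) oL (idb - R0))"
  have "U = idb + ((R - R0) oL (R0 + R0 - idb))"
   unfolding U_def by (rule blinfun_eqI) (simp add: ap_diff idempotentsD(3)[OF R0] algebra_simps)
  moreover have "norm ((R - R0) oL (R0 + R0 - idb)) < 1"
  proof -
   have "norm (R0 + R0 - idb) \<le> norm (R0 + R0) + norm (idb :: 'a \<Rightarrow>\<^sub>L 'a)" by (rule norm_triangle_ineq4)
   also have "\<dots> \<le> 2 * norm R0 + 1" using norm_triangle_ineq[of R0 R0] norm_blinfun_id_le[where 'a='a] by linarith
   finally have le: "norm (R0 + R0 - idb) \<le> norm G + 2 * norm R0 + 3" using norm_ge_zero[of G] by linarith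
   have "norm ((R - R0) oL (R0 + R0 - idb)) \<le> norm (R - R0) * norm (R0 + R0 - idb)" by (rule norm_blinfun_compose)
   also have "\<dots> \<le> norm (R - R0) * (norm G + 2 * norm R0 + 3)" using le by (intro mult_left_mono) auto
   finally show ?thesis using n1 by simp
  qed
  ultimately obtain U' where U': "op_inverse U U'"
   using id_perturb by metis
  have UR: "ap R (ap U x) = ap U (ap R0 x)" for x
   unfolding U_def by (simp add: ap_diff RR idempotentsD(3)[OF R0])
  have onto: "\<exists>y\<in>rg R0. z = ap R y" if z: "z \<in> rg R" for z
  proof -
   have "z = ap R (ap U (ap U' z))" using r(3)[OF z] op_inverse_apply(1)[OF U'] by simp
   also have "\<dots> = ap U (ap R0 (ap U' z))" by (rule UR)
   also have "\<dots> = ap R (ap R0 (ap U' z))"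
    unfolding U_def by (simp add: ap_diff idempotentsD(3)[OF R0])
   finally show ?thesis using r0(2) by blast
  qed
  have MF: "ap (M R) y = y" if "y \<in> F" for y using g(5)[OF that] by (simp add: M_def ap_diff)
  have ME: "ap (M R) y = ap R y" if "y \<in> rg R0" for y using g(3)[OF that] by (simp add: M_def ap_diff)
  have NF: "ap N y = y" if "y \<in> F" for y using op_inverse_apply(2)[OF N, of y] MF[OF that] by simp
  have np2: "ap (nproj F R0 R) x = ap R (ap G (ap N x))" for x
   unfolding np inv_op_eq[OF N] by simp
  show ?thesis
   unfolding isproj_def
  proof (intro conjI allI ballI)
   have "M R \<in> OP" unfolding M_def using g(1) r(1) by auto
   then show "nproj F R0 R \<in> OP"
    unfolding np inv_op_eq[OF N] using g(1) r(1) op_inverse_OP[OF N] by auto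
   show "ap (nproj F R0 R) x \<in> rg R" for x unfolding np2 by (rule r(2))
   show "ap (nproj F R0 R) z = z" if zR: "z \<in> rg R" for z
   proof -
    obtain y where y: "y \<in> rg R0" "z = ap R y" using onto[OF zR] by blast
    have "ap N z = y" using op_inverse_apply(2)[OF N, of y] ME[OF y(1)] y(2) by simp
    then show ?thesis unfolding np2 using g(3)[OF y(1)] y(2) by simp
   qed
   show "ap (nproj F R0 R) y = 0" if "y \<in> F" for y unfolding np2 NF[OF that] g(5)[OF that] by (simp add: ap_diff)
   show "x - ap (nproj F R0 R) x \<in> F" for x
   proof -
    have "x = ap (M R) (ap N x)" by (rule op_inverse_apply(1)[OF N, symmetric])
    also have "\<dots> = (ap N x - ap G (ap N x)) + ap R (ap G (ap N x))" by (simp add: M_def ap_diff)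
    finally have "x - ap (nproj F R0 R) x = ap N x - ap G (ap N x)" unfolding np2 by (simp add: algebra_simps)
    then show ?thesis using g(4) by simp
   qed
  qed
 qed
 then show "\<exists>\<delta>>0. \<forall>R\<in>idempotents sc. norm (R - R0) < \<delta> --> isproj (nproj F R0 R) (rg R) F" using \<delta> by blast
qed

end

lemma openin_subtopologyI: "openin X A ==> A \<subseteq> C ==> openin (subtopology X C) A"
 by (metis inf.absorb1 openin_subtopology_Int)

context K_banach
begin

subsection \<open>The topology of the Grassmannian\<close>

text \<open>Near \<open>x\<close> the value \<open>proj (rg (f z)) F\<close> is
  \<open>nproj F (f x) (f z)\<close>, by uniqueness of projections, and \<open>nproj\<close> has an
  expansion. The second claim records that \<open>F\<close> remains a complement of nearby
  ranges.\<close>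

lemma analytic_at_range_proj:
 assumes nV: "nspace V" and f: "analytic_at V op x f" and fx: "f x \<in> idempotents sc"
  and d: "d > 0" "\<And>h. h \<in> car V ==> bnorm V h < d ==> f (badd V x h) \<in> idempotents sc"
  and F: "isproj (proj (rg (f x)) F) (rg (f x)) F"
 shows "analytic_at V op x (\<lambda>z. proj (rg (f z)) F)"
  and "\<exists>e>0. \<forall>h\<in>car V. bnorm V h < e -->
   isproj (proj (rg (f (badd V x h))) F) (rg (f (badd V x h))) F"
proof -
 interpret V: nspace V by fact
 obtain k where k: "k > 0" "\<forall>R\<in>idempotents sc. norm (R - f x) < k --> isproj (nproj F (f x) R) (rg R) F"
  using nproj(1)[OF fx F] by blast
 obtain e where e: "e > 0" "\<forall>h\<in>car V. bnorm V h < e --> norm (f (badd V x h) - f x) < k"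
  using analytic_at_continuous[OF f nV normed_op k(1)] by auto
 have *: "isproj (nproj F (f x) (f (badd V x h))) (rg (f (badd V x h))) F"
  if "h \<in> car V" "bnorm V h < min d e" for h
  using k(2) e(2) d(2) that by auto
 have "analytic_at V op x (\<lambda>z. nproj F (f x) (f z))"
  by (rule analytic_at_compose[OF f nproj(2)[OF fx F] nV normed_op normed_op])
 then show "analytic_at V op x (\<lambda>z. proj (rg (f z)) F)"
  by (rule analytic_at_cong[OF _ normed_op, of _ _ _ "min d e"]) (use d e proj_eq[OF *] in auto)
 show "\<exists>e>0. \<forall>h\<in>car V. bnorm V h < e -->
   isproj (proj (rg (f (badd V x h))) F) (rg (f (badd V x h))) F"
  by (rule exI[of _ "min d e"]) (use d e * proj_eq[OF *] in auto)
qed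

lemma graph_idempotent:
 assumes E: "E \<in> Gr" and F: "F \<in> Cpl E" and T: "T \<in> car (SO E F)"
 shows "proj E F + ext E F T \<in> idempotents sc" "rg (proj E F + ext E F T) = graph_of E T"
  "graph_of E T \<in> Gr"
proof -
 show g: "graph_of E T \<in> Gr"
  using complement_sym(2)[OF E F graph_complement[OF E F T]] .
 show "proj E F + ext E F T \<in> idempotents sc" "rg (proj E F + ext E F T) = graph_of E T"
  using isproj_idempotent[OF isproj_graph[OF E F T] g] by auto
qed

lemma complement_isproj:
 assumes "W \<in> Gr"
 shows "W \<in> Cpl F \<and> closed_lin_subspace X F \<longleftrightarrow> isproj (proj W F) W F"
proof
 assume "W \<in> Cpl F \<and> closed_lin_subspace X F"
 then show "isproj (proj W F) W F"
  using isproj_swap[OF isproj_exists[of F W]] proj_eq by metis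
next
 assume "isproj (proj W F) W F"
 then show "W \<in> Cpl F \<and> closed_lin_subspace X F"
  using isproj_complement closed_lin_isproj by blast
qed

lemma analytic_at_graph:
 assumes E: "E \<in> Gr" and F: "F \<in> Cpl E" and T: "T \<in> car (SO E F)"
 shows "analytic_at (SO E F) op T (\<lambda>T. proj E F + ext E F T)"
proof -
 have n: "nspace (SO E F)" by (rule normed_sub_ops[OF E F])
 have "analytic_at (SO E F) op T (ext E F)"
  by (rule analytic_at_linear[OF n normed_op T linear_ext[OF E F], where K = "norm (proj E F)"])
    (use ext_apply(2)[OF E F] in auto)
 then show ?thesis
  using analytic_at_op_add[OF n analytic_at_op_const[OF n T]] isprojD(1)[OF grassmannianD(5)[OF E F]] by blast
qed

text \<open>This is the coordinate change of the Grassmannian up to a final \<open>res\<close>. The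
  graph is the range of the idempotent \<open>proj E F + ext E F T\<close>, which is affine in
  \<open>T\<close>, and it is then projected along the other complement.\<close>

lemma analytic_at_graph_proj:
 assumes E: "E \<in> Gr" and F: "F \<in> Cpl E" and T: "T \<in> car (SO E F)"
  and E': "E' \<in> Gr" and F': "F' \<in> Cpl E'" and g: "graph_of E T \<in> Cpl F'"
 shows "analytic_at (SO E F) op T (\<lambda>T. proj (graph_of E T) F')"
  and "\<exists>e>0. \<forall>h\<in>car (SO E F). bnorm (SO E F) h < e -->
    graph_of E (badd (SO E F) T h) \<in> Cpl F'"
proof -
 interpret S: nspace "SO E F" by (rule normed_sub_ops[OF E F])
 have F'c: "closed_lin_subspace X F'" using closed_lin_isproj[OF grassmannianD(5)[OF E' F']] by blast
 have p: "isproj (proj (rg (proj E F + ext E F T)) F') (rg (proj E F + ext E F T)) F'"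
  unfolding graph_idempotent(2)[OF E F T] using complement_isproj[OF graph_idempotent(3)[OF E F T], of F'] g F'c by blast
 have idem: "proj E F + ext E F (badd (SO E F) T h) \<in> idempotents sc"
  if "h \<in> car (SO E F)" "bnorm (SO E F) h < 1" for h
  using graph_idempotent(1)[OF E F] T that by blast
 note r = analytic_at_range_proj[where f = "\<lambda>T. proj E F + ext E F T" and x = T and d = 1, OF S.nspace_axioms analytic_at_graph[OF E F T] graph_idempotent(1)[OF E F T] zero_less_one idem p]
 have eq: "rg (proj E F + ext E F (badd (SO E F) T h)) = graph_of E (badd (SO E F) T h)"
  if "h \<in> car (SO E F)" for h
  using graph_idempotent(2)[OF E F] T that by blast
 show "analytic_at (SO E F) op T (\<lambda>T. proj (graph_of E T) F')"
  by (rule analytic_at_cong[OF r(1) normed_op zero_less_one]) (simp_all add: eq)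
 obtain e where "e > 0" "\<forall>h\<in>car (SO E F). bnorm (SO E F) h < e -->
   isproj (proj (graph_of E (badd (SO E F) T h)) F') (graph_of E (badd (SO E F) T h)) F'"
  using r(2) eq by auto
 then show "\<exists>e>0. \<forall>h\<in>car (SO E F). bnorm (SO E F) h < e -->
    graph_of E (badd (SO E F) T h) \<in> Cpl F'"
  using isproj_complement(2) by blast
qed

abbreviation "GM \<equiv> grassmann_manifold sc"
abbreviation "TG \<equiv> mtop (grassmann_manifold sc)"

lemma openin_generator:
 assumes E: "E \<in> Gr" and F: "F \<in> Cpl E" and D: "openin (btop (SO E F)) D"
 shows "openin TG (graph_of E ` D)"
 unfolding grassmann_manifold_def using assms by (auto intro!: topology_generated_by_Basis)

text \<open>Openness tested in all graph charts at once. Its agreement with the topology generated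
  by images of open sets, shown in \<open>openin_TG\<close>, amounts to continuity of the coordinate
  changes.\<close>

definition gr_open :: "'a set set => bool" where
 "gr_open S \<longleftrightarrow> S \<subseteq> Gr \<and> (\<forall>E\<in>Gr. \<forall>F\<in>Cpl E.
   openin (btop (SO E F)) {T \<in> car (SO E F). graph_of E T \<in> S})"

lemma gr_open_proj_preimage:
 assumes E': "E' \<in> Gr" and F': "F' \<in> Cpl E'" and S: "openin (top_of_set OP) S"
 shows "gr_open {W \<in> Cpl F'. proj W F' \<in> S}"
 unfolding gr_open_def
proof (intro conjI ballI)
 show "{W \<in> Cpl F'. proj W F' \<in> S} \<subseteq> Gr"
  using complement_sym(2)[OF E' F'] by blast
 fix E F assume E: "E \<in> Gr" and F: "F \<in> Cpl E"
 interpret S: nspace "SO E F" by (rule normed_sub_ops[OF E F])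
 show "openin (btop (SO E F)) {T \<in> car (SO E F). graph_of E T \<in> {W \<in> Cpl F'. proj W F' \<in> S}}"
  unfolding S.openin_btop
 proof (intro conjI ballI)
  fix T assume "T \<in> {T \<in> car (SO E F). graph_of E T \<in> {W \<in> Cpl F'. proj W F' \<in> S}}"
  then have T: "T \<in> car (SO E F)" "graph_of E T \<in> Cpl F'" "proj (graph_of E T) F' \<in> S" by auto
  note a = analytic_at_graph_proj[OF E F T(1) E' F' T(2)]
  obtain e where e: "e > 0" "\<forall>h\<in>car (SO E F). bnorm (SO E F) h < e -->
    graph_of E (badd (SO E F) T h) \<in> Cpl F'" using a(2) by blast
  obtain k where k: "k > 0" "\<And>A. A \<in> OP ==> norm (A - proj (graph_of E T) F') < k ==> A \<in> S"
   using S T(3) unfolding openin_euclidean_subtopology_iff dist_norm by blast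
  obtain d where d: "d > 0" "\<forall>h\<in>car (SO E F). bnorm (SO E F) h < d -->
   proj (graph_of E (badd (SO E F) T h)) F' \<in> OP \<and> norm (proj (graph_of E (badd (SO E F) T h)) F' - proj (graph_of E T) F') < k"
   using analytic_at_continuous[OF a(1) S.nspace_axioms normed_op k(1)] by auto
  show "\<exists>r>0. \<forall>h\<in>car (SO E F). bnorm (SO E F) h < r -->
    badd (SO E F) T h \<in> {T \<in> car (SO E F). graph_of E T \<in> {W \<in> Cpl F'. proj W F' \<in> S}}"
   by (rule exI[of _ "min e d"]) (use e d k(2) T(1) in auto)
 qed auto
qed

lemma openin_res_preimage:
 assumes E: "E \<in> Gr" and F: "F \<in> Cpl E" and D: "openin (btop (SO E F)) D"
 shows "openin (top_of_set OP) {A \<in> OP. res E F A \<in> D}"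
 unfolding openin_euclidean_subtopology_iff
proof (intro conjI ballI)
 interpret S: nspace "SO E F" by (rule normed_sub_ops[OF E F])
 fix A assume "A \<in> {A \<in> OP. res E F A \<in> D}"
 then have A: "A \<in> OP" "res E F A \<in> D" by auto
 obtain r where r: "r > 0" "\<And>T. T \<in> car (SO E F) ==> bnorm (SO E F) (bdiff (SO E F) T (res E F A)) < r ==> T \<in> D"
  using D A(2) unfolding S.openin_btop_dist by blast
 define K where "K = norm (idb - proj E F) + 1"
 have K: "K > 0" by (simp add: K_def add_nonneg_pos)
 show "\<exists>e>0. \<forall>A'\<in>OP. dist A' A < e --> A' \<in> {A \<in> OP. res E F A \<in> D}"
 proof (intro exI[of _ "r / K"] conjI ballI impI)
  show "r / K > 0" using r K by simp
  fix A' assume A': "A' \<in> OP" "dist A' A < r / K"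
  have "bdiff (SO E F) (res E F A') (res E F A) = res E F (A' - A)"
   using is_linear_diff[OF linear_res[OF E F] normed_op, of A' A] A A' by simp
  then have "bnorm (SO E F) (bdiff (SO E F) (res E F A') (res E F A)) \<le> norm (idb - proj E F) * norm (A' - A)"
   using norm_res[OF E F, of "A' - A"] A A' by auto
  also have "\<dots> \<le> K * norm (A' - A)" by (intro mult_right_mono) (auto simp: K_def)
  also have "\<dots> < r" using A'(2) K by (simp add: dist_norm field_simps)
  finally show "A' \<in> {A \<in> OP. res E F A \<in> D}" using r(2) res_closed[OF E F] A' by auto
 qed
qed auto

lemma graph_image_eq:
 assumes E: "E \<in> Gr" and F: "F \<in> Cpl E" and D: "D \<subseteq> car (SO E F)"
 shows "graph_of E ` D = {W \<in> Cpl F. proj W F \<in> {A \<in> OP. res E F A \<in> D}}"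
proof
 show "graph_of E ` D \<subseteq> {W \<in> Cpl F. proj W F \<in> {A \<in> OP. res E F A \<in> D}}"
 proof
  fix W assume "W \<in> graph_of E ` D"
  then obtain T where T: "T \<in> D" "W = graph_of E T" "T \<in> car (SO E F)" using D by blast
  then show "W \<in> {W \<in> Cpl F. proj W F \<in> {A \<in> OP. res E F A \<in> D}}"
   using graph_complement[OF E F T(3)] proj_graph[OF E F T(3)] res_ext(1)[OF E F T(3)]
    isprojD(1)[OF isproj_graph[OF E F T(3)]] by auto
 qed
 show "{W \<in> Cpl F. proj W F \<in> {A \<in> OP. res E F A \<in> D}} \<subseteq> graph_of E ` D"
  using graph_res(1)[OF E F] by fastforce
qed

text \<open>A generator is the preimage of an open set of operators under
  \<open>W \<mapsto> proj W F\<close>, and such preimages are open in every chart by the analytic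
  coordinate changes. Conversely each \<open>W\<close> in \<open>S\<close> is the graph of the zero
  operator in a chart centred at \<open>W\<close>, which gives a generator containing
  \<open>W\<close> and contained in \<open>S\<close>.\<close>

lemma openin_TG: "openin TG S \<longleftrightarrow> gr_open S"
proof
 assume "openin TG S"
 then have "generate_topology_on {graph_of E ` D | E F D. E \<in> Gr \<and> F \<in> Cpl E \<and>
                 openin (btop (SO E F)) D} S"
  by (simp add: grassmann_manifold_def openin_topology_generated_by_iff)
 then show "gr_open S"
 proof induction
  case Empty
  then show ?case by (simp add: gr_open_def)
 next
  case (Int S S')
  have eq: "{T \<in> C. g T \<in> S \<inter> S'} = {T \<in> C. g T \<in> S} \<inter> {T \<in> C. g T \<in> S'}" for C :: "('a => 'a) set" and g by blast
  show ?case using Int.IH unfolding gr_open_def eq by (simp add: openin_Int le_infI1)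
 next
  case (UN K)
  have eq: "{T \<in> C. g T \<in> \<Union>K} = \<Union>((\<lambda>S. {T \<in> C. g T \<in> S}) ` K)" for C :: "('a => 'a) set" and g by blast
  show ?case using UN.IH unfolding gr_open_def eq by (auto intro!: openin_Union)
 next
  case (Basis S)
  then obtain E F D where E: "E \<in> Gr" and F: "F \<in> Cpl E"
   and D: "openin (btop (SO E F)) D" and S: "S = graph_of E ` D" by blast
  have "D \<subseteq> car (SO E F)"
   using openin_subset[OF D] nspace.topspace_btop[OF normed_sub_ops[OF E F]] by simp
  then show ?case
   unfolding S graph_image_eq[OF E F \<open>D \<subseteq> _\<close>]
   by (intro gr_open_proj_preimage[OF E F] openin_res_preimage[OF E F D])
 qed
next
 assume S: "gr_open S"
 have "\<exists>U. openin TG U \<and> W \<in> U \<and> U \<subseteq> S" if W: "W \<in> S" for W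
 proof -
  have E: "W \<in> Gr" using S W by (auto simp: gr_open_def)
  obtain F where F: "F \<in> Cpl W" using grassmannianD(4)[OF E] by blast
  define D where "D = {T \<in> car (SO W F). graph_of W T \<in> S}"
  have "openin (btop (SO W F)) D" using S E F by (auto simp: gr_open_def D_def)
  then have "openin TG (graph_of W ` D)" by (rule openin_generator[OF E F])
  moreover have "W \<in> graph_of W ` D"
   using graph_zero[OF E F] W by (intro image_eqI[of _ _ "bzero (SO W F)"]) (auto simp: D_def)
  ultimately show ?thesis by (intro exI[of _ "graph_of W ` D"]) (auto simp: D_def)
 qed
 then show "openin TG S" using openin_subopen by blast
qed

lemma topspace_TG [simp]: "topspace TG = Gr"
proof
 show "topspace TG \<subseteq> Gr"
  using openin_topspace[of TG] unfolding openin_TG gr_open_def by blast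
 have "gr_open (Gr)"
  unfolding gr_open_def
 proof (intro conjI ballI)
  fix E F assume E: "E \<in> Gr" and F: "F \<in> Cpl E"
  have "{T \<in> car (SO E F). graph_of E T \<in> Gr} = topspace (btop (SO E F))"
   using graph_idempotent(3)[OF E F] nspace.topspace_btop[OF normed_sub_ops[OF E F]] by auto
  then show "openin (btop (SO E F)) {T \<in> car (SO E F). graph_of E T \<in> Gr}" by simp
 qed simp
 then show "Gr \<subseteq> topspace TG" using openin_TG openin_subset by blast
qed

lemma openin_proj_preimage:
 assumes "E \<in> Gr" "F \<in> Cpl E" "openin (top_of_set OP) S"
 shows "openin TG {W \<in> Cpl F. proj W F \<in> S}"
 using gr_open_proj_preimage[OF assms] openin_TG by blast

lemma openin_complements:
 assumes E: "E \<in> Gr" and F: "F \<in> Cpl E"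
 shows "openin TG (Cpl F)"
proof -
 have "Cpl F = {W \<in> Cpl F. proj W F \<in> OP}"
  using complement_sym(1)[OF E F] isprojD(1) by blast
 then show ?thesis using openin_proj_preimage[OF E F, of OP] by simp
qed

lemma continuous_proj:
 assumes E: "E \<in> Gr" and F: "F \<in> Cpl E"
 shows "continuous_map (subtopology TG (Cpl F)) euclidean (\<lambda>W. proj W F)"
 unfolding continuous_map_def
proof (intro conjI allI impI)
 fix S :: "('a \<Rightarrow>\<^sub>L 'a) set" assume "openin euclidean S"
 then have "openin (top_of_set OP) (OP \<inter> S)" by (auto simp: openin_open)
 then have "openin TG {W \<in> Cpl F. proj W F \<in> OP \<inter> S}" by (rule openin_proj_preimage[OF E F])
 moreover have "{W \<in> Cpl F. proj W F \<in> OP \<inter> S} = {W \<in> topspace (subtopology TG (Cpl F)). proj W F \<in> S}"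
  using complement_sym(2)[OF E F] isprojD(1)[OF complement_sym(1)[OF E F]] by auto
 ultimately show "openin (subtopology TG (Cpl F)) {W \<in> topspace (subtopology TG (Cpl F)). proj W F \<in> S}"
  by (intro openin_subtopologyI) auto
qed auto

definition gchart :: "'a set => 'a set => 'a set => 'a => 'a" where
 "gchart E F = inv_into (car (SO E F)) (graph_of E)"

lemma gchart_eq: "E \<in> Gr ==> F \<in> Cpl E ==> W \<in> Cpl F ==> gchart E F W = res E F (proj W F)"
 unfolding gchart_def by (rule chart_eq)

lemma atlas_GM: "c \<in> atlas GM \<longleftrightarrow> (\<exists>E F. c = (Cpl F, gchart E F, SO E F) \<and>
  E \<in> Gr \<and> F \<in> Cpl E)"
 by (auto simp: grassmann_manifold_def gchart_def)

context
 fixes E F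
 assumes E: "E \<in> Gr" and F: "F \<in> Cpl E"
begin

lemma gchart_graph: "T \<in> car (SO E F) ==> gchart E F (graph_of E T) = T"
 unfolding gchart_def by (rule inv_into_f_f[OF inj_graph[OF E F]])

lemma graph_gchart: "W \<in> Cpl F ==> graph_of E (gchart E F W) = W"
 by (simp add: gchart_eq[OF E F] graph_res[OF E F])

lemma gchart_closed: "W \<in> Cpl F ==> gchart E F W \<in> car (SO E F)"
 using res_closed[OF E F] isprojD(1)[OF complement_sym(1)[OF E F]] by (simp add: gchart_eq[OF E F])

lemma gchart_image: "gchart E F ` Cpl F = car (SO E F)"
proof (intro equalityI subsetI)
 show "T \<in> gchart E F ` Cpl F" if "T \<in> car (SO E F)" for T
  using gchart_graph[OF that] graph_complement[OF E F that] by (metis image_eqI)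
qed (use gchart_closed in auto)

lemma inj_gchart: "inj_on (gchart E F) (Cpl F)"
 by (metis graph_gchart inj_on_inverseI)

lemma inv_gchart: "T \<in> car (SO E F) ==> inv_into (Cpl F) (gchart E F) T = graph_of E T"
 by (rule inv_into_f_eq[OF inj_gchart]) (simp_all add: graph_complement[OF E F] gchart_graph)

lemma is_chart_gchart: "is_chart TG (Cpl F, gchart E F, SO E F)"
proof -
 interpret S: nspace "SO E F" by (rule normed_sub_ops[OF E F])
 have sub: "Cpl F \<subseteq> Gr" using complement_sym(2)[OF E F] by blast
 have "homeomorphic_maps (subtopology TG (Cpl F)) (btop (SO E F)) (gchart E F) (graph_of E)"
  unfolding homeomorphic_maps_def
 proof (intro conjI ballI)
  show "continuous_map (subtopology TG (Cpl F)) (btop (SO E F)) (gchart E F)"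
   unfolding continuous_map_def
  proof (intro conjI allI impI)
   show "gchart E F \<in> topspace (subtopology TG (Cpl F)) \<rightarrow> topspace (btop (SO E F))"
    using gchart_closed by auto
   fix D assume D: "openin (btop (SO E F)) D"
   then have DV: "D \<subseteq> car (SO E F)" using openin_subset by fastforce
   have "{W \<in> topspace (subtopology TG (Cpl F)). gchart E F W \<in> D} = graph_of E ` D"
   proof (intro equalityI subsetI)
    fix W assume "W \<in> {W \<in> topspace (subtopology TG (Cpl F)). gchart E F W \<in> D}"
    then have "W \<in> Cpl F" "gchart E F W \<in> D" by auto
    then show "W \<in> graph_of E ` D" using graph_gchart by (metis image_eqI)
   next
    fix W assume "W \<in> graph_of E ` D"
    then obtain T where "T \<in> D" "W = graph_of E T" by blast
    then show "W \<in> {W \<in> topspace (subtopology TG (Cpl F)). gchart E F W \<in> D}"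
     using DV sub gchart_graph[of T] graph_complement[OF E F, of T] by auto
   qed
   moreover have "graph_of E ` D \<subseteq> Cpl F" using DV graph_complement[OF E F] by blast
   ultimately show "openin (subtopology TG (Cpl F)) {W \<in> topspace (subtopology TG (Cpl F)). gchart E F W \<in> D}"
    using openin_generator[OF E F D] by (intro openin_subtopologyI) auto
  qed
  show "continuous_map (btop (SO E F)) (subtopology TG (Cpl F)) (graph_of E)"
   unfolding continuous_map_in_subtopology
  proof
   show "continuous_map (btop (SO E F)) TG (graph_of E)"
    unfolding continuous_map_def
    using graph_idempotent(3)[OF E F] E F by (auto simp: openin_TG gr_open_def)
   show "graph_of E \<in> topspace (btop (SO E F)) \<rightarrow> Cpl F" using graph_complement[OF E F] by auto
  qed
 qed (use graph_gchart gchart_graph in auto)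
 moreover have "subtopology (btop (SO E F)) (gchart E F ` Cpl F) = btop (SO E F)"
  unfolding gchart_image using subtopology_topspace[of "btop (SO E F)"] by simp
 moreover have "openin (btop (SO E F)) (gchart E F ` Cpl F)"
  unfolding gchart_image using openin_topspace[of "btop (SO E F)"] by simp
 ultimately show ?thesis
  using openin_complements[OF E F] banach_sub_ops[OF E F] homeomorphic_maps_map by auto
qed

end

text \<open>The gap metric: a subspace is encoded by its distance function, normalised to be bounded.\<close>

definition gap_fun :: "'a set => 'a \<Rightarrow>\<^sub>C real" where
 "gap_fun E = Bcontfun (\<lambda>x. infdist x E / (1 + norm x))"

lemma infdist_le_norm: "0 \<in> E ==> infdist x E \<le> norm x" for x :: 'a
 using infdist_le[of 0 E x] by simp

lemma gap_fun_apply: assumes "0 \<in> E" shows "apply_bcontfun (gap_fun E) x = infdist x E / (1 + norm x)"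
proof -
 have pos: "1 + norm (x :: 'a) \<noteq> 0" for x using norm_ge_zero[of x] by linarith
 have "(\<lambda>x. infdist x E / (1 + norm x)) \<in> bcontfun"
 proof (rule bcontfun_normI)
  show "continuous_on UNIV (\<lambda>x. infdist x E / (1 + norm x))"
   using pos by (intro continuous_intros continuous_on_infdist) auto
  show "norm (infdist x E / (1 + norm x)) \<le> 1" for x
   using infdist_le_norm[OF assms, of x] infdist_nonneg[of x E] by (simp add: divide_le_eq)
 qed
 then show ?thesis by (simp add: gap_fun_def Bcontfun_inverse)
qed

text \<open>A point \<open>y\<close> of \<open>E\<close> near \<open>x\<close> is moved into
  \<open>E'\<close> at cost \<open>t * norm y\<close>, at most
  \<open>t * (dist x y + norm x)\<close>. Minimising over \<open>y\<close> and using
  \<open>infdist x E \<le> norm x\<close> costs \<open>2 * t * norm x\<close> in total, and the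
  normalisation by \<open>1 + norm x\<close> makes this uniform in \<open>x\<close>.\<close>

lemma gap_fun_le:
 assumes E: "0 \<in> E" and E': "0 \<in> E'" and t: "0 \<le> t"
  and g: "\<And>y. y \<in> E ==> g y \<in> E' \<and> norm (g y - y) \<le> t * norm y"
  and g': "\<And>y. y \<in> E' ==> g' y \<in> E \<and> norm (g' y - y) \<le> t * norm y"
 shows "dist (gap_fun E) (gap_fun E') \<le> 2 * t"
proof (rule dist_bound)
 have le: "infdist x E' \<le> infdist x E + 2 * t * norm x"
  if E: "0 \<in> E" and E': "0 \<in> E'" and g: "\<And>y. y \<in> E ==> g y \<in> E' \<and> norm (g y - y) \<le> t * norm y" for x :: 'a and E E' g
 proof -
  have *: "(infdist x E' - t * norm x) / (1 + t) \<le> dist x y" if y: "y \<in> E" for y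
  proof -
   have "infdist x E' \<le> dist x (g y)" using g[OF y] by (intro infdist_le) auto
   also have "\<dots> \<le> dist x y + norm (g y - y)" using dist_triangle[of x "g y" y] by (simp add: dist_norm norm_minus_commute)
   also have "\<dots> \<le> dist x y + t * norm y" using g[OF y] by simp
   also have "\<dots> \<le> dist x y + t * (dist x y + norm x)"
    using t norm_triangle_sub[of y x] by (intro add_left_mono mult_left_mono) (auto simp: dist_norm norm_minus_commute)
   finally have "infdist x E' - t * norm x \<le> dist x y * (1 + t)" by (simp add: algebra_simps)
   then show ?thesis using t by (simp add: divide_le_eq)
  qed
  have ne: "infdist x E = (INF y\<in>E. dist x y)" by (rule infdist_notempty) (use E in auto)
  have "(infdist x E' - t * norm x) / (1 + t) \<le> infdist x E"
   unfolding ne by (rule cINF_greatest) (use E * in auto)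
  then have "infdist x E' - t * norm x \<le> infdist x E * (1 + t)" using t by (simp add: divide_le_eq)
  moreover have "t * infdist x E \<le> t * norm x" using infdist_le_norm[OF E] t by (intro mult_left_mono)
  ultimately show ?thesis by (simp add: algebra_simps)
 qed
 fix x :: 'a
 have pos: "1 + norm x > 0" by (simp add: add_pos_nonneg)
 have "\<bar>infdist x E - infdist x E'\<bar> \<le> 2 * t * norm x"
  using le[OF E E' g, of x] le[OF E' E g', of x] by linarith
 also have "\<dots> \<le> 2 * t * (1 + norm x)" using t by (intro mult_left_mono) auto
 finally have "\<bar>infdist x E - infdist x E'\<bar> / (1 + norm x) \<le> 2 * t" using pos by (simp add: divide_le_eq)
 then show "dist (apply_bcontfun (gap_fun E) x) (apply_bcontfun (gap_fun E') x) \<le> 2 * t"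
  using pos by (simp add: gap_fun_apply E E' dist_real_def abs_divide flip: diff_divide_distrib)
qed

lemma grassmannian_zero: "E \<in> Gr ==> 0 \<in> E" "E \<in> Gr ==> closed E"
 using grassmannianD(1) by (auto simp: closed_lin_whole lin_subspace_whole)

text \<open>Each projection moves the vectors of the other subspace into its own range with relative
  error \<open>norm (P - P')\<close>. So the gap is controlled by projections with a common kernel,
  that is, by the charts.\<close>

lemma gap_fun_proj:
 assumes p: "isproj P E F" "isproj P' E' F" and "E \<in> Gr" "E' \<in> Gr"
 shows "dist (gap_fun E) (gap_fun E') \<le> 2 * norm (P - P')"
proof (rule gap_fun_le[where g = "ap P'" and g' = "ap P"])
 show "ap P' y \<in> E' \<and> norm (ap P' y - y) \<le> norm (P - P') * norm y" if "y \<in> E" for y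
  using isprojD(3)[OF p(1) that] isprojD(2)[OF p(2)] norm_blinfun[of "P - P'" y] by (simp add: ap_diff norm_minus_commute)
 show "ap P y \<in> E \<and> norm (ap P y - y) \<le> norm (P - P') * norm y" if "y \<in> E'" for y
  using isprojD(3)[OF p(2) that] isprojD(2)[OF p(1)] norm_blinfun[of "P - P'" y] by (simp add: ap_diff)
qed (use assms grassmannian_zero in auto)

lemma continuous_gap_fun: "continuous_map TG euclidean gap_fun"
proof -
 have "\<exists>U. openin TG U \<and> E \<in> U \<and> (\<forall>W\<in>U. dist (gap_fun E) (gap_fun W) < e)"
  if E: "E \<in> Gr" and e: "e > 0" for E e
 proof -
  obtain F where F: "F \<in> Cpl E" using grassmannianD(4)[OF E] by blast
  have EF: "E \<in> Cpl F" by (rule complements_sym[OF E F])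
  define U where "U = {W \<in> Cpl F. proj W F \<in> OP \<inter> ball (proj E F) (e / 2)}"
  have "openin TG U" unfolding U_def by (rule openin_proj_preimage[OF E F]) (auto simp: openin_open)
  moreover have "E \<in> U" using EF e isprojD(1)[OF complement_sym(1)[OF E F EF]] by (simp add: U_def)
  moreover have "dist (gap_fun E) (gap_fun W) < e" if W: "W \<in> U" for W
  proof -
   have WF: "W \<in> Cpl F" and n: "norm (proj E F - proj W F) < e / 2"
    using W by (auto simp: U_def dist_norm)
   show ?thesis
    using gap_fun_proj[OF complement_sym(1)[OF E F EF] complement_sym(1)[OF E F WF] E complement_sym(2)[OF E F WF]] n
    by simp
  qed
  ultimately show ?thesis by blast
 qed
 then show ?thesis
  unfolding mtopology_is_euclidean[symmetric] Met_TC.continuous_map_to_metric by simp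
qed

lemma gap_fun_inj: "inj_on gap_fun (Gr)"
proof (rule inj_onI)
 fix E E' assume E: "E \<in> Gr" and E': "E' \<in> Gr" and eq: "gap_fun E = gap_fun E'"
 have "infdist x E = infdist x E'" for x
 proof -
  have "1 + norm x \<noteq> 0" using norm_ge_zero[of x] by linarith
  then show ?thesis
   using arg_cong[OF eq, of "\<lambda>f. apply_bcontfun f x"] grassmannian_zero E E' by (simp add: gap_fun_apply)
 qed
 then have "x \<in> E \<longleftrightarrow> x \<in> E'" for x
  using in_closed_iff_infdist_zero grassmannian_zero E E' by (metis empty_iff)
 then show "E = E'" by blast
qed

lemma Hausdorff_TG: "Hausdorff_space TG"
 by (rule Hausdorff_space_injective_preimage[OF _ continuous_gap_fun]) (use gap_fun_inj in auto)

text \<open>In a graph chart the coordinate of \<open>W\<close> is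
  \<open>res E F (proj W F)\<close>, a bounded linear function of the projection.\<close>

lemma analytic_at_gchart:
 assumes nV: "nspace V" and E: "E \<in> Gr" and F: "F \<in> Cpl E"
  and f: "analytic_at V op x (\<lambda>z. proj (g z) F)"
  and d: "d > 0" "\<And>h. h \<in> car V ==> bnorm V h < d ==> g (badd V x h) \<in> Cpl F"
 shows "analytic_at V (SO E F) x (\<lambda>z. gchart E F (g z))"
proof -
 have "analytic_at V (SO E F) x (\<lambda>z. res E F (proj (g z) F))"
  by (rule analytic_at_linear_compose[OF nV normed_op normed_sub_ops[OF E F] f linear_res[OF E F]])
    (use norm_res[OF E F] in auto)
 then show ?thesis
  by (rule analytic_at_cong[OF _ normed_sub_ops[OF E F] d(1)]) (use d gchart_eq[OF E F] in auto)
qed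

lemma banach_manifold_GM: "banach_manifold GM"
 unfolding banach_manifold_def
proof (intro conjI ballI)
 show "Hausdorff_space TG" by (rule Hausdorff_TG)
 show "is_chart TG c" if "c \<in> atlas GM" for c using that is_chart_gchart atlas_GM by auto
 show "\<Union> (fst ` atlas GM) = topspace TG"
 proof
  show "\<Union> (fst ` atlas GM) \<subseteq> topspace TG" using complement_sym(2) by (auto simp: atlas_GM)
  show "topspace TG \<subseteq> \<Union> (fst ` atlas GM)"
  proof
   fix W assume "W \<in> topspace TG"
   then have W: "W \<in> Gr" by simp
   then obtain F where F: "F \<in> Cpl W" using grassmannianD(4) by blast
   then have "(Cpl F, gchart W F, SO W F) \<in> atlas GM" using W by (auto simp: atlas_GM)
   then show "W \<in> \<Union> (fst ` atlas GM)" using complements_sym[OF W F] by force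
  qed
 qed
 have half: "banach_analytic_on (SO E F) (SO E' F') (gchart E F ` (Cpl F \<inter> Cpl F'))
   (gchart E' F' \<circ> inv_into (Cpl F) (gchart E F))"
  if E: "E \<in> Gr" and F: "F \<in> Cpl E" and E': "E' \<in> Gr" and F': "F' \<in> Cpl E'"
  for E F E' F'
 proof -
  interpret S: nspace "SO E F" by (rule normed_sub_ops[OF E F])
  have im: "gchart E F ` (Cpl F \<inter> Cpl F') = {T \<in> car (SO E F). graph_of E T \<in> Cpl F'}"
  proof (intro equalityI subsetI)
   fix T assume "T \<in> gchart E F ` (Cpl F \<inter> Cpl F')"
   then obtain W where "W \<in> Cpl F" "W \<in> Cpl F'" "T = gchart E F W" by blast
   then show "T \<in> {T \<in> car (SO E F). graph_of E T \<in> Cpl F'}"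
    using gchart_closed[OF E F] graph_gchart[OF E F] by auto
  next
   fix T assume T: "T \<in> {T \<in> car (SO E F). graph_of E T \<in> Cpl F'}"
   then have "graph_of E T \<in> Cpl F \<inter> Cpl F'" "T = gchart E F (graph_of E T)"
    using gchart_graph[OF E F] graph_complement[OF E F] by auto
   then show "T \<in> gchart E F ` (Cpl F \<inter> Cpl F')" by (metis image_eqI)
  qed
  have "gr_open (Cpl F')" using openin_complements[OF E' F'] openin_TG by blast
  then have o: "openin (btop (SO E F)) {T \<in> car (SO E F). graph_of E T \<in> Cpl F'}"
   using E F by (auto simp: gr_open_def)
  have "analytic_at (SO E F) (SO E' F') T (gchart E' F' \<circ> inv_into (Cpl F) (gchart E F))"
   if T: "T \<in> car (SO E F)" "graph_of E T \<in> Cpl F'" for T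
  proof -
   note a = analytic_at_graph_proj[OF E F T(1) E' F' T(2)]
   obtain e where e: "e > 0" "\<And>h. h \<in> car (SO E F) ==> bnorm (SO E F) h < e ==>
     graph_of E (badd (SO E F) T h) \<in> Cpl F'" using a(2) by blast
   have "analytic_at (SO E F) (SO E' F') T (\<lambda>T. gchart E' F' (graph_of E T))"
    by (rule analytic_at_gchart[where g = "graph_of E" and d = e, OF S.nspace_axioms E' F' a(1) e])
   then show ?thesis
    by (rule analytic_at_cong[OF _ normed_sub_ops[OF E' F'] zero_less_one]) (use inv_gchart[OF E F] T in auto)
  qed
  then show ?thesis
   unfolding banach_analytic_on_iff[OF S.nspace_axioms normed_sub_ops[OF E' F']] im using o by auto
 qed
 show "compatible c c'" if c: "c \<in> atlas GM" and c': "c' \<in> atlas GM" for c c'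
 proof -
  obtain E F where c: "c = (Cpl F, gchart E F, SO E F)" "E \<in> Gr" "F \<in> Cpl E"
   using c unfolding atlas_GM by blast
  obtain E' F' where c': "c' = (Cpl F', gchart E' F', SO E' F')" "E' \<in> Gr" "F' \<in> Cpl E'"
   using c' unfolding atlas_GM by blast
  show ?thesis
   using half[OF c(2,3) c'(2,3)] half[OF c'(2,3) c(2,3)]
   unfolding c(1) c'(1) Int_commute[of "Cpl F'"] by simp
 qed
qed

end

lemma continuous_map_analytic:
 assumes nV: "nspace V" and nW: "nspace W" and f: "\<And>x. x \<in> S ==> analytic_at V W x f"
 shows "continuous_map (subtopology (btop V) S) (btop W) f"
proof -
 interpret V: nspace V by fact
 interpret W: nspace W by fact
 show ?thesis
  unfolding W.continuous_map_into_btop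
 proof (intro conjI ballI allI impI)
  show "f ` topspace (subtopology (btop V) S) \<subseteq> car W" using analytic_at_closed(2)[OF f nV nW] by auto
  fix x and e :: real assume "x \<in> topspace (subtopology (btop V) S)" and e: "e > 0"
  then have x: "x \<in> S" "x \<in> car V" by auto
  obtain d where d: "d > 0" "\<forall>h\<in>car V. bnorm V h < d --> f (badd V x h) \<in> car W \<and> bnorm W (bdiff W (f (badd V x h)) (f x)) < e"
   using analytic_at_continuous[OF f[OF x(1)] nV nW e] by blast
  define U where "U = {y \<in> car V. bnorm V (bdiff V y x) < d} \<inter> S"
  have "openin (subtopology (btop V) S) U"
   unfolding U_def by (intro openin_subtopology_Int V.openin_ball x(2))
  moreover have "x \<in> U" using x d by (simp add: U_def)
  moreover have "bnorm W (bdiff W (f y) (f x)) < e" if "y \<in> U" for y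
   using d(2)[rule_format, of "bdiff V y x"] that x by (simp add: U_def)
  ultimately show "\<exists>U. openin (subtopology (btop V) S) U \<and> x \<in> U \<and> (\<forall>y\<in>U. bnorm W (bdiff W (f y) (f x)) < e)" by blast
 qed
qed

context K_banach
begin

subsection \<open>Charts of the manifold of idempotents\<close>

abbreviation "I \<equiv> idempotents sc"
abbreviation "IM \<equiv> idempotent_manifold sc"

lemma I_sub: "I \<subseteq> OP" using idempotentsD(1) by blast

lemma mtop_IM [simp]: "mtop IM = top_of_set I"
 using I_sub by (simp add: idempotent_manifold_def induced_submanifold_def affine_manifold_def btop_op subtopology_subtopology Int_absorb1)

text \<open>A chart of the operator space that straightens the idempotents to the subspace
  \<open>W\<close>. Compatibility with the atlas of the affine manifold is replaced by analyticity
  of \<open>p\<close> and its inverse; \<open>atlas_IM\<close> shows that these are exactly the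
  charts of \<open>IM\<close>.\<close>

definition mchart :: "('a \<Rightarrow>\<^sub>L 'a) set => (('a \<Rightarrow>\<^sub>L 'a) => ('a \<Rightarrow>\<^sub>L 'a)) => ('k, 'a \<Rightarrow>\<^sub>L 'a) bspace => ('a \<Rightarrow>\<^sub>L 'a) set => bool" where
 "mchart U p V W \<longleftrightarrow> banach_space V \<and> openin (top_of_set OP) U \<and> inj_on p U \<and> openin (btop V) (p ` U) \<and>
   (\<forall>R\<in>U. analytic_at op V R p) \<and> (\<forall>R\<in>U. analytic_at V op (p R) (inv_into U p)) \<and>
   closed_lin_subspace V W \<and> closed_complements V W \<noteq> {} \<and> p ` (U \<inter> I) = p ` U \<inter> W"

lemma mchartD:
 assumes "mchart U p V W"
 shows "banach_space V" "openin (top_of_set OP) U" "inj_on p U" "openin (btop V) (p ` U)"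
  "R \<in> U ==> analytic_at op V R p" "R \<in> U ==> analytic_at V op (p R) (inv_into U p)"
  "closed_lin_subspace V W" "closed_complements V W \<noteq> {}" "p ` (U \<inter> I) = p ` U \<inter> W"
  "nspace V" "U \<subseteq> OP" "lin_subspace V W" "nspace (bsub V W)" "p ` U \<subseteq> car V"
proof -
 show *: "banach_space V" "openin (top_of_set OP) U" "inj_on p U" "openin (btop V) (p ` U)"
  "R \<in> U ==> analytic_at op V R p" "R \<in> U ==> analytic_at V op (p R) (inv_into U p)"
  "closed_lin_subspace V W" "closed_complements V W \<noteq> {}" "p ` (U \<inter> I) = p ` U \<inter> W"
  using assms by (auto simp: mchart_def)
 show n: "nspace V" using *(1) by (rule banach_space_imp_normed)
 show "U \<subseteq> OP" using openin_subset[OF *(2)] by simp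
 show l: "lin_subspace V W" using *(7) by (simp add: closed_lin_subspace_iff)
 show "nspace (bsub V W)" by (rule nspace.normed_bsub[OF n l])
 show "p ` U \<subseteq> car V" using openin_subset[OF *(4)] nspace.topspace_btop[OF n] by simp
qed

lemma translate_OP: "a0 \<in> OP ==> translate op OP a0 = OP"
proof
 assume a: "a0 \<in> OP"
 show "translate op OP a0 \<subseteq> OP" using a by (auto simp: translate_def)
 show "OP \<subseteq> translate op OP a0"
 proof
  fix A assume "A \<in> OP"
  then have "A + a0 \<in> OP" "A = (A + a0) - a0" using a by auto
  then show "A \<in> translate op OP a0" unfolding translate_def op_simps by blast
 qed
qed

text \<open>The atlas of the operator space consists of the translations
  \<open>A \<mapsto> A - a0\<close>. The one with \<open>a0 = 0\<close> yields analyticity of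
  \<open>p\<close> and of its inverse, and composing with translations gives back compatibility with
  all the others.\<close>

lemma compatible_iff:
 assumes bV: "banach_space V" and U: "openin (top_of_set OP) U" and i: "inj_on p U" and o: "openin (btop V) (p ` U)"
 shows "(\<forall>c\<in>atlas (affine_manifold op OP). compatible (U, p, V) c) \<longleftrightarrow>
  (\<forall>R\<in>U. analytic_at op V R p) \<and> (\<forall>R\<in>U. analytic_at V op (p R) (inv_into U p))"
proof -
 interpret V: nspace V by (rule banach_space_imp_normed[OF bV])
 have UO: "U \<subseteq> OP" using openin_subset[OF U] by simp
 have UOP: "U \<inter> OP = U" "OP \<inter> U = U" using UO by auto
 have at: "atlas (affine_manifold op OP) = {(OP, \<lambda>a. a - a0, op) | a0. a0 \<in> OP}"
  unfolding affine_manifold_def by (auto simp: translate_OP)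
 have inv: "inv_into OP (\<lambda>a. a - a0) y = y + a0" if "a0 \<in> OP" "y \<in> OP" for a0 y
  using that by (intro inv_into_f_eq) (auto simp: inj_on_def)
 have opU: "openin (btop op) ((\<lambda>a. a - a0) ` U)" if a0: "a0 \<in> OP" for a0
  unfolding btop_op openin_euclidean_subtopology_iff
 proof (intro conjI ballI)
  show "(\<lambda>a. a - a0) ` U \<subseteq> OP" using a0 UO by auto
  fix y assume "y \<in> (\<lambda>a. a - a0) ` U"
  then obtain R where R: "R \<in> U" "y = R - a0" by blast
  obtain e where e: "e > 0" "\<And>R'. R' \<in> OP ==> dist R' R < e ==> R' \<in> U"
   using U R(1) unfolding openin_euclidean_subtopology_iff by blast
  have "z \<in> (\<lambda>a. a - a0) ` U" if "z \<in> OP" "dist z y < e" for z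
  proof -
   have "dist (z + a0) R = dist z y" unfolding R(2) dist_norm by (simp add: algebra_simps)
   then have "z + a0 \<in> U" using e that a0 by auto
   then show ?thesis by (intro image_eqI[of _ _ "z + a0"]) auto
  qed
  then show "\<exists>e>0. \<forall>x'\<in>OP. dist x' y < e --> x' \<in> (\<lambda>a. a - a0) ` U" using e(1) by blast
 qed
 show ?thesis
 proof
  assume "\<forall>c\<in>atlas (affine_manifold op OP). compatible (U, p, V) c"
  then have "compatible (U, p, V) (OP, \<lambda>a. a - 0, op)" unfolding at by blast
  then have 1: "banach_analytic_on V op (p ` U) ((\<lambda>a. a) \<circ> inv_into U p)"
   and 2: "banach_analytic_on op V U (p \<circ> inv_into OP (\<lambda>a. a))"
   by (simp_all add: UOP)
  show "(\<forall>R\<in>U. analytic_at op V R p) \<and> (\<forall>R\<in>U. analytic_at V op (p R) (inv_into U p))"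
  proof (intro conjI ballI)
   fix R assume R: "R \<in> U"
   have "analytic_at op V R (p \<circ> inv_into OP (\<lambda>a. a))"
    using 2[unfolded banach_analytic_on_iff[OF normed_op V.nspace_axioms]] R by simp
   then show "analytic_at op V R p"
    by (rule analytic_at_cong[OF _ V.nspace_axioms zero_less_one])
      (use R UO inv[of 0] in auto)
   have "analytic_at V op (p R) ((\<lambda>a. a) \<circ> inv_into U p)"
    using 1[unfolded banach_analytic_on_iff[OF V.nspace_axioms normed_op]] R by simp
   then show "analytic_at V op (p R) (inv_into U p)" by (simp add: comp_def)
  qed
 next
  assume R: "(\<forall>R\<in>U. analytic_at op V R p) \<and> (\<forall>R\<in>U. analytic_at V op (p R) (inv_into U p))"
  show "\<forall>c\<in>atlas (affine_manifold op OP). compatible (U, p, V) c"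
   unfolding at
  proof safe
   fix a0 assume a0: "a0 \<in> OP"
   have "analytic_at V op y ((\<lambda>a. a - a0) \<circ> inv_into U p)" if y: "y \<in> p ` U" for y
   proof -
    have a: "analytic_at V op y (inv_into U p)" using R y by blast
    show ?thesis unfolding comp_def
     using analytic_at_op_diff[OF V.nspace_axioms a analytic_at_op_const[OF V.nspace_axioms analytic_at_closed(1)[OF a V.nspace_axioms normed_op] a0]] .
   qed
   moreover have "analytic_at op V y (p \<circ> inv_into OP (\<lambda>a. a - a0))" if y: "y \<in> (\<lambda>a. a - a0) ` U" for y
   proof -
    have yU: "y + a0 \<in> U" and yO: "y \<in> OP" using y UO a0 by auto
    have "analytic_at op op y (\<lambda>z. z + a0)"
     using yO a0 by (intro analytic_at_op_intros normed_op) auto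
    from analytic_at_compose[OF this _ normed_op normed_op V.nspace_axioms, of p]
    have "analytic_at op V y (\<lambda>z. p (z + a0))" using R yU by blast
    then show ?thesis
     by (rule analytic_at_cong[OF _ V.nspace_axioms zero_less_one]) (use inv a0 yO in auto)
   qed
   ultimately show "compatible (U, p, V) (OP, \<lambda>a. a - a0, op)"
    unfolding compatible.simps UOP banach_analytic_on_iff[OF V.nspace_axioms normed_op]
     banach_analytic_on_iff[OF normed_op V.nspace_axioms] using o opU[OF a0] by blast
  qed
 qed
qed

lemma mchart_homeomorphic:
 assumes "mchart U p V W"
 shows "homeomorphic_map (subtopology (top_of_set OP) U) (subtopology (btop V) (p ` U)) p"
  and "homeomorphic_map (top_of_set (U \<inter> I)) (subtopology (btop (bsub V W)) (p ` (U \<inter> I))) p"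
proof -
 note m = mchartD[OF assms]
 have inv: "inv_into U p (p R) = R" if "R \<in> U" for R using that m(3) by simp
 have st: "subtopology (top_of_set OP) S = top_of_set S" if "S \<subseteq> OP" for S
  using that by (simp add: subtopology_subtopology Int_absorb1)
 have c1: "continuous_map (top_of_set U) (btop V) p"
  using continuous_map_analytic[OF normed_op m(10), of U p] m(5) st[OF m(11)] by (simp add: btop_op)
 have "continuous_map (subtopology (btop V) (p ` U)) (btop op) (inv_into U p)"
  by (rule continuous_map_analytic[OF m(10) normed_op]) (use m(6) in auto)
 then have c2: "continuous_map (subtopology (btop V) (p ` U)) euclidean (inv_into U p)"
  unfolding btop_op by (rule continuous_map_into_fulltopology)
 have "homeomorphic_maps (top_of_set U) (subtopology (btop V) (p ` U)) p (inv_into U p)"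
  unfolding homeomorphic_maps_def using c1 c2 inv by (auto simp: continuous_map_in_subtopology)
 then show "homeomorphic_map (subtopology (top_of_set OP) U) (subtopology (btop V) (p ` U)) p"
  unfolding st[OF m(11)] using homeomorphic_maps_map by blast
 have sub: "p ` (U \<inter> I) \<subseteq> W" using m(9) by auto
 have b: "subtopology (btop (bsub V W)) (p ` (U \<inter> I)) = subtopology (btop V) (p ` (U \<inter> I))"
  using nspace.btop_bsub[OF m(10,12)] sub by (simp add: subtopology_subtopology Int_absorb1)
 have c3: "continuous_map (top_of_set (U \<inter> I)) (btop V) p"
  by (rule continuous_map_from_subtopology_mono[OF c1]) auto
 have c4: "continuous_map (subtopology (btop V) (p ` (U \<inter> I))) euclidean (inv_into U p)"
  by (rule continuous_map_from_subtopology_mono[OF c2]) auto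
 have "homeomorphic_maps (top_of_set (U \<inter> I)) (subtopology (btop V) (p ` (U \<inter> I))) p (inv_into U p)"
  unfolding homeomorphic_maps_def using c3 c4 inv by (auto simp: continuous_map_in_subtopology)
 then show "homeomorphic_map (top_of_set (U \<inter> I)) (subtopology (btop (bsub V W)) (p ` (U \<inter> I))) p"
  unfolding b using homeomorphic_maps_map by blast
qed

lemma atlas_IM: "c \<in> atlas IM \<longleftrightarrow> (\<exists>U p V W. c = (U \<inter> I, p, bsub V W) \<and> mchart U p V W)"
proof -
 have mt: "mtop (affine_manifold op OP) = top_of_set OP"
  by (simp add: affine_manifold_def btop_op subtopology_subtopology)
 have "(is_chart (top_of_set OP) (U, p, V) \<and> (\<forall>c\<in>atlas (affine_manifold op OP). compatible (U, p, V) c) \<and>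
     closed_lin_subspace V W \<and> closed_complements V W \<noteq> {} \<and> p ` (U \<inter> I) = p ` U \<inter> W) \<longleftrightarrow> mchart U p V W" for U p V W
 proof
  assume L: "is_chart (top_of_set OP) (U, p, V) \<and> (\<forall>c\<in>atlas (affine_manifold op OP). compatible (U, p, V) c) \<and>
     closed_lin_subspace V W \<and> closed_complements V W \<noteq> {} \<and> p ` (U \<inter> I) = p ` U \<inter> W"
  then have 1: "openin (top_of_set OP) U" "banach_space V" "openin (btop V) (p ` U)"
   and w: "wchart (top_of_set OP) U p V" using is_chart_wchart by auto
  then have i: "inj_on p U" by (simp add: wchart_def)
  show "mchart U p V W"
   unfolding mchart_def using L 1 i compatible_iff[OF 1(2,1) i 1(3)] by blast
 next
  assume m: "mchart U p V W"
  note d = mchartD[OF m]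
  have "is_chart (top_of_set OP) (U, p, V)" using d(1,2,4) mchart_homeomorphic(1)[OF m] by simp
  moreover have "\<forall>c\<in>atlas (affine_manifold op OP). compatible (U, p, V) c"
   using compatible_iff[OF d(1-4)] d(5,6) by blast
  ultimately show "is_chart (top_of_set OP) (U, p, V) \<and> (\<forall>c\<in>atlas (affine_manifold op OP). compatible (U, p, V) c) \<and>
     closed_lin_subspace V W \<and> closed_complements V W \<noteq> {} \<and> p ` (U \<inter> I) = p ` U \<inter> W"
   using d(7-9) by blast
 qed
 then show ?thesis
  unfolding idempotent_manifold_def induced_submanifold_def op_simps mt by auto
qed

lemma mchart_inv_eq: assumes "mchart U p V W" "y \<in> p ` (U \<inter> I)" shows "inv_into (U \<inter> I) p y = inv_into U p y"
 using assms(2) mchartD(3)[OF assms(1)] by (auto simp: inv_into_f_f inj_on_Int)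

lemma mchart_is_chart: assumes "mchart U p V W" shows "is_chart (top_of_set I) (U \<inter> I, p, bsub V W)"
proof -
 note m = mchartD[OF assms]
 have "openin (top_of_set I) (U \<inter> I)"
  using m(2) I_sub unfolding openin_open by blast
 moreover have "openin (btop (bsub V W)) (p ` (U \<inter> I))"
  unfolding nspace.btop_bsub[OF m(10,12)] m(9) by (rule openin_subtopology_Int[OF m(4)])
 moreover have "subtopology (top_of_set I) (U \<inter> I) = top_of_set (U \<inter> I)"
  by (simp add: subtopology_subtopology Int_absorb1)
 ultimately show ?thesis
  using mchart_homeomorphic(2)[OF assms] banach_bsub[OF m(1,7)] by simp
qed

lemma mchart_inv:
 assumes m: "mchart U p V W" and R: "R \<in> U" "R \<in> I"
 shows "analytic_at (bsub V W) op (p R) (inv_into (U \<inter> I) p)"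
proof -
 note d = mchartD[OF m]
 have RW: "p R \<in> W" using d(9) R by blast
 have a: "analytic_at (bsub V W) op (p R) (inv_into U p)"
  by (rule analytic_at_restrict[OF d(10) normed_op d(12) RW d(6)[OF R(1)]])
 obtain r where r: "r > 0" "\<forall>h\<in>car V. bnorm V h < r --> badd V (p R) h \<in> p ` U"
  using d(4) R(1) unfolding nspace.openin_btop[OF d(10)] by blast
 show ?thesis
 proof (rule analytic_at_cong[OF a normed_op r(1)])
  fix h assume h: "h \<in> car (bsub V W)" "bnorm (bsub V W) h < r"
  have "badd V (p R) h \<in> p ` (U \<inter> I)"
   using r(2) h d(12) RW d(9) by (auto simp: lin_subspace_def)
  then show "inv_into U p (badd (bsub V W) (p R) h) = inv_into (U \<inter> I) p (badd (bsub V W) (p R) h)"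
   using mchart_inv_eq[OF m] by simp
 qed
qed

text \<open>The image lies in \<open>W\<close> because \<open>f\<close> stays among the idempotents,
  and \<open>W\<close> is complemented, so \<open>analytic_at_corestrict\<close> applies. This
  reduces maps into the manifold of idempotents to operator-valued expressions.\<close>

lemma mchart_into:
 assumes m: "mchart U p V W" and nV1: "nspace V1" and f: "analytic_at V1 op x f" "f x \<in> U"
  and d: "d > 0" "\<And>h. h \<in> car V1 ==> bnorm V1 h < d ==> f (badd V1 x h) \<in> I"
 shows "analytic_at V1 (bsub V W) x (\<lambda>z. p (f z))"
proof -
 note D = mchartD[OF m]
 obtain k where k: "k > 0" "\<And>R. R \<in> OP ==> dist R (f x) < k ==> R \<in> U"
  using D(2) f(2) unfolding openin_euclidean_subtopology_iff by blast
 obtain e where e: "e > 0" "\<forall>h\<in>car V1. bnorm V1 h < e --> f (badd V1 x h) \<in> OP \<and> norm (f (badd V1 x h) - f x) < k"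
  using analytic_at_continuous[OF f(1) nV1 normed_op k(1)] by auto
 have a: "analytic_at V1 V x (\<lambda>z. p (f z))"
  by (rule analytic_at_compose[OF f(1) D(5)[OF f(2)] nV1 normed_op D(10)])
 show ?thesis
 proof (rule analytic_at_corestrict[OF nV1 D(1,7,8) a])
  show "min d e > 0" using d e by simp
  fix h assume h: "h \<in> car V1" "bnorm V1 h < min d e"
  then have "f (badd V1 x h) \<in> U \<inter> I" using d(2) e(2) k(2) by (auto simp: dist_norm)
  then show "p (f (badd V1 x h)) \<in> W" using D(9) by blast
 qed
qed

subsection \<open>Charts adapted to the idempotents\<close>

text \<open>
 In block form with respect to \<open>P\<close> and \<open>I - P\<close>, with \<open>T = R21 R11\<^sup>-\<^sup>1\<close>, the chart sends \<open>R\<close> to the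
 blocks \<open>(R11 + R12 T - 1, R12, T, R22 - T R12)\<close>. The diagonal blocks vanish exactly at idempotents, and the
 inverse is polynomial. The operator \<open>blk_inv P R\<close> is the inverse of the block \<open>R11\<close>, extended by zero.
\<close>

definition blk_inv :: "('a \<Rightarrow>\<^sub>L 'a) => ('a \<Rightarrow>\<^sub>L 'a) => ('a \<Rightarrow>\<^sub>L 'a)" where
 "blk_inv P R = inv_op ((P oL R oL P) + (idb - P)) oL P"

definition idem_chart :: "('a \<Rightarrow>\<^sub>L 'a) => ('a \<Rightarrow>\<^sub>L 'a) => ('a \<Rightarrow>\<^sub>L 'a)" where
 "idem_chart P R = (let T = (R oL blk_inv P R) - P; Q = idb - P in
   R - P - (Q oL R oL P) + T + (P oL R oL T) - (T oL R oL Q))"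

definition idem_param :: "('a \<Rightarrow>\<^sub>L 'a) => ('a \<Rightarrow>\<^sub>L 'a) => ('a \<Rightarrow>\<^sub>L 'a)" where
 "idem_param P B = (let Q = idb - P; b = P oL B oL Q; T = Q oL B oL P; a = P + (P oL B oL P) - (b oL T) in
   a + b + (T oL a) + (T oL b) + (Q oL B oL Q))"

text \<open>The first condition makes the block \<open>R11\<close> invertible, so that the chart
  formula has its meaning. The second, invertibility of \<open>I - R22\<close>, forces the Schur
  complement \<open>R22 - T R12\<close> of an idempotent to vanish.\<close>

definition idem_dom :: "('a \<Rightarrow>\<^sub>L 'a) => ('a \<Rightarrow>\<^sub>L 'a) set" where
 "idem_dom P = {R \<in> OP. (\<exists>S. op_inverse ((P oL R oL P) + (idb - P)) S) \<and>
   (\<exists>S. op_inverse (idb - ((idb - P) oL R oL (idb - P))) S)}"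

lemma open_invertible: "open {A :: 'a \<Rightarrow>\<^sub>L 'a. \<exists>S. op_inverse A S}"
 unfolding open_dist
proof (intro ballI)
 fix A :: "'a \<Rightarrow>\<^sub>L 'a" assume "A \<in> {A. \<exists>S. op_inverse A S}"
 then obtain S where S: "op_inverse A S" by blast
 have pos: "norm S + 1 > 0" by (simp add: add_nonneg_pos)
 show "\<exists>e>0. \<forall>A'. dist A' A < e --> A' \<in> {A. \<exists>S. op_inverse A S}"
 proof (intro exI[of _ "1 / (norm S + 1)"] conjI allI impI)
  fix A' assume "dist A' A < 1 / (norm S + 1)"
  then have "norm (A' - A) * (norm S + 1) < 1" using pos by (simp add: dist_norm field_simps)
  moreover have "norm S * norm (A' - A) \<le> norm (A' - A) * (norm S + 1)" by (simp add: algebra_simps)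
  ultimately have "norm S * norm (A' - A) < 1" by linarith
  then have "op_inverse (A + (A' - A)) (suminf (blinfun_pow (- (S oL (A' - A)))) oL S)"
   by (rule op_inverse_perturb(1)[OF S])
  then show "A' \<in> {A. \<exists>S. op_inverse A S}" by auto
 qed (use pos in simp)
qed

lemmas blinfun_compose_continuous [continuous_intros] =
 bounded_bilinear.continuous_on[OF bounded_bilinear_blinfun_compose]

context
 fixes P assumes P: "P \<in> idempotents sc"
begin

lemma P_OP: "P \<in> OP" using idempotentsD(1)[OF P] .
lemma PP: "ap P (ap P x) = ap P x" using idempotentsD(3)[OF P] .

lemma openin_idem_dom: "openin (top_of_set OP) (idem_dom P)"
proof -
 have "open ((\<lambda>R. (P oL R oL P) + (idb - P)) -` {A. \<exists>S. op_inverse A S})"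
  by (intro open_vimage open_invertible continuous_intros)
 moreover have "open ((\<lambda>R. idb - ((idb - P) oL R oL (idb - P))) -` {A. \<exists>S. op_inverse A S})"
  by (intro open_vimage open_invertible continuous_intros)
 ultimately have "open ((\<lambda>R. (P oL R oL P) + (idb - P)) -` {A. \<exists>S. op_inverse A S} \<inter>
   (\<lambda>R. idb - ((idb - P) oL R oL (idb - P))) -` {A. \<exists>S. op_inverse A S})" by (rule open_Int)
 moreover have "idem_dom P = OP \<inter> ((\<lambda>R. (P oL R oL P) + (idb - P)) -` {A. \<exists>S. op_inverse A S} \<inter>
   (\<lambda>R. idb - ((idb - P) oL R oL (idb - P))) -` {A. \<exists>S. op_inverse A S})"
  by (auto simp: idem_dom_def)
 ultimately show ?thesis unfolding openin_open by blast
qed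

lemma P_idem_dom: "P \<in> idem_dom P"
proof -
 have "(P oL P oL P) + (idb - P) = idb" "idb - ((idb - P) oL P oL (idb - P)) = idb"
  by (rule blinfun_eqI, simp add: ap_diff PP)+
 then show ?thesis unfolding idem_dom_def using P_OP op_inverse_id by auto
qed

lemma idem_dom_OP: "R \<in> idem_dom P ==> R \<in> OP" by (simp add: idem_dom_def)

text \<open>The operator \<open>P R P + (I - P)\<close> is block diagonal, so its inverse
  \<open>K\<close> commutes with \<open>P\<close>. Therefore \<open>K P\<close> inverts the block
  \<open>R11\<close> on the range of \<open>P\<close> and vanishes on the kernel.\<close>

lemma blk_inv:
 assumes R: "R \<in> idem_dom P"
 defines "L \<equiv> blk_inv P R"
 shows "ap P (ap L x) = ap L x" "ap L (ap P x) = ap L x" "ap P (ap R (ap L x)) = ap P x" "ap L (ap R (ap P x)) = ap P x"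
  "ap L (ap R (ap L x)) = ap L x"
proof -
 obtain K where K: "op_inverse ((P oL R oL P) + (idb - P)) K" using R by (auto simp: idem_dom_def)
 have L: "ap L x = ap K (ap P x)" for x by (simp add: L_def blk_inv_def inv_op_eq[OF K])
 have K1: "ap P (ap R (ap P (ap K x))) + (ap K x - ap P (ap K x)) = x" for x
  using op_inverse_apply(1)[OF K, of x] by (simp add: ap_diff)
 have K2: "ap K (ap P (ap R (ap P x)) + (x - ap P x)) = x" for x
  using op_inverse_apply(2)[OF K, of x] by (simp add: ap_diff)
 have comm: "ap P (ap K x) = ap K (ap P x)" for x
 proof -
  have "ap P x = ap P (ap R (ap P (ap K x)))" using arg_cong[OF K1[of x], of "ap P"] by (simp add: ap_diff PP)
  then have "ap K (ap P x) = ap K (ap P (ap R (ap P (ap P (ap K x)))) + (ap P (ap K x) - ap P (ap P (ap K x))))"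
   by (simp add: PP)
  also have "\<dots> = ap P (ap K x)" by (rule K2)
  finally show ?thesis by simp
 qed
 show 1: "ap P (ap L x) = ap L x" for x unfolding L comm PP ..
 show 2: "ap L (ap P x) = ap L x" for x unfolding L PP ..
 show 3: "ap P (ap R (ap L x)) = ap P x" for x
  using K1[of "ap P x"] 1[of x] by (simp add: L)
 show 4: "ap L (ap R (ap P x)) = ap P x" for x
  using K2[of "ap P x"] by (simp add: L PP)
 show "ap L (ap R (ap L x)) = ap L x" for x using 4[of "ap L x"] 1 by simp
qed

lemma idem_chart_apply:
 assumes R: "R \<in> idem_dom P"
 defines "T x \<equiv> ap R (ap (blk_inv P R) x) - ap P x"
 shows "ap (idem_chart P R) x = ap R x - ap P x - (ap R (ap P x) - ap P (ap R (ap P x))) + T x + ap P (ap R (T x)) - T (ap R (x - ap P x))"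
 by (simp add: idem_chart_def Let_def ap_diff T_def)

lemma idem_param_chart: assumes R: "R \<in> idem_dom P" shows "idem_param P (idem_chart P R) = R"
 by (rule blinfun_eqI) (simp add: idem_param_def Let_def idem_chart_apply[OF R] ap_diff PP blk_inv[OF R] algebra_simps)

text \<open>Let \<open>a\<close> be the upper left block of \<open>idem_param P B\<close>. The
  identities for \<open>blk_inv\<close> give \<open>a (L y) = P y\<close>, so the quotient block
  \<open>T\<close> of the chart is the lower left block of \<open>B\<close>; with this known the
  remaining blocks cancel by expansion.\<close>

lemma idem_chart_param: assumes B: "B \<in> OP" and R: "idem_param P B \<in> idem_dom P" shows "idem_chart P (idem_param P B) = B"
proof (rule blinfun_eqI)
 fix x
 define L where "L = blk_inv P (idem_param P B)"
 note b = blk_inv[OF R, folded L_def]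
 have param: "ap (idem_param P B) y =
   (ap P y + ap P (ap B (ap P y)) - ap P (ap B (ap B (ap P y) - ap P (ap B (ap P y)))) + ap P (ap B (ap P (ap B (ap P y) - ap P (ap B (ap P y))))))
   + ap P (ap B (y - ap P y))
   + (ap B (ap P y + ap P (ap B (ap P y)) - ap P (ap B (ap B (ap P y) - ap P (ap B (ap P y)))) + ap P (ap B (ap P (ap B (ap P y) - ap P (ap B (ap P y))))))
    - ap P (ap B (ap P y + ap P (ap B (ap P y)) - ap P (ap B (ap B (ap P y) - ap P (ap B (ap P y)))) + ap P (ap B (ap P (ap B (ap P y) - ap P (ap B (ap P y))))))))
   + (ap B (ap P (ap B (y - ap P y))) - ap P (ap B (ap P (ap B (y - ap P y)))))
   + (ap B (y - ap P y) - ap P (ap B (y - ap P y)))" for y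
  by (simp add: idem_param_def Let_def ap_diff PP algebra_simps)
 define a where "a y = ap P y + ap P (ap B (ap P y)) - ap P (ap B (ap B (ap P y) - ap P (ap B (ap P y)))) + ap P (ap B (ap P (ap B (ap P y) - ap P (ap B (ap P y)))))" for y
 have pL: "ap (idem_param P B) (ap L y) = a (ap L y) + (ap B (a (ap L y)) - ap P (ap B (a (ap L y))))" for y
  unfolding param a_def[symmetric] by (simp add: b(1) ap_diff)
 have "ap P (ap (idem_param P B) (ap L y)) = a (ap L y)" for y
  unfolding pL by (simp add: ap_diff PP) (simp add: a_def ap_diff PP)
 then have aL: "a (ap L y) = ap P y" for y using b(3) by simp
 have T: "ap (idem_param P B) (ap L y) - ap P y = ap B (ap P y) - ap P (ap B (ap P y))" for y
  unfolding pL aL by simp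
 show "ap (idem_chart P (idem_param P B)) x = ap B x"
  unfolding idem_chart_apply[OF R] unfolding T[unfolded L_def] unfolding param by (simp add: ap_diff PP algebra_simps)
qed

lemma idem_param_OP: "B \<in> OP ==> idem_param P B \<in> OP"
 unfolding idem_param_def Let_def using P_OP by auto

lemma idem_chart_image: "idem_chart P ` idem_dom P = {B \<in> OP. idem_param P B \<in> idem_dom P}"
proof (intro equalityI subsetI)
 fix B assume "B \<in> idem_chart P ` idem_dom P"
 then obtain R where R: "R \<in> idem_dom P" "B = idem_chart P R" by blast
 obtain K where K: "op_inverse ((P oL R oL P) + (idb - P)) K" using R(1) by (auto simp: idem_dom_def)
 have "K \<in> OP" by (rule op_inverse_OP[OF K]) (use P_OP idem_dom_OP[OF R(1)] in auto)
 then have "B \<in> OP"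
  unfolding R(2) idem_chart_def Let_def blk_inv_def inv_op_eq[OF K] using P_OP idem_dom_OP[OF R(1)] by auto
 then show "B \<in> {B \<in> OP. idem_param P B \<in> idem_dom P}" using R idem_param_chart by simp
next
 fix B assume "B \<in> {B \<in> OP. idem_param P B \<in> idem_dom P}"
 then show "B \<in> idem_chart P ` idem_dom P" using idem_chart_param by (metis (mono_tags, lifting) image_eqI mem_Collect_eq)
qed

definition off_diag :: "('a \<Rightarrow>\<^sub>L 'a) set" where
 "off_diag = {B \<in> OP. (P oL B oL P) = 0 \<and> ((idb - P) oL B oL (idb - P)) = 0}"

text \<open>If \<open>R\<close> is idempotent, \<open>R11 R11 + R12 R21 = R11\<close>, so
  \<open>R11 + R12 T = 1\<close> on the range of \<open>P\<close>, and the Schur complement vanishes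
  by the second condition in \<open>idem_dom\<close>. Conversely vanishing diagonal blocks make
  \<open>R\<close> a conjugate of \<open>P + b\<close>, where \<open>b\<close> is the upper right
  block of \<open>B\<close>.\<close>

lemma idem_chart_idempotent:
 assumes R: "R \<in> idem_dom P"
 shows "R \<in> I \<longleftrightarrow> idem_chart P R \<in> off_diag"
proof
 define B where "B = idem_chart P R"
 have B: "B \<in> OP" "idem_param P B = R" using R idem_chart_image idem_param_chart by (auto simp: B_def)
 define L where "L = blk_inv P R"
 note b = blk_inv[OF R, folded L_def]
 have Ba: "ap B x = ap R x - ap P x - (ap R (ap P x) - ap P (ap R (ap P x))) + (ap R (ap L x) - ap P x)
   + ap P (ap R (ap R (ap L x) - ap P x)) - (ap R (ap L (ap R (x - ap P x))) - ap P (ap R (x - ap P x)))" for x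
  unfolding B_def idem_chart_apply[OF R] L_def ..
 show "idem_chart P R \<in> off_diag" if RI: "R \<in> I"
 proof -
  have RR: "ap R (ap R x) = ap R x" for x by (rule idempotentsD(3)[OF RI])
  have 1: "P oL B oL P = 0"
   by (rule blinfun_eqI) (simp add: Ba ap_diff PP b RR algebra_simps)
  define D where "D = (idb - P) oL B oL (idb - P)"
  obtain S where S: "op_inverse (idb - ((idb - P) oL R oL (idb - P))) S"
   using R by (auto simp: idem_dom_def)
  have Da: "ap D x = (ap R (x - ap P x) - ap P (ap R (x - ap P x))) - (ap R (ap L (ap R (x - ap P x))) - ap P (ap R (x - ap P x)))" for x
   unfolding D_def by (simp add: Ba ap_diff PP b algebra_simps)
  \<comment> \<open>\<open>D\<close> is the Schur complement \<open>R22 - T R12\<close>. For an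
    idempotent, \<open>(1 - R22) R21 = R21 R11\<close> gives \<open>(1 - R22) T = R21\<close>, and
    then \<open>R22 R22 + R21 R12 = R22\<close> gives \<open>(1 - R22) D = 0\<close>.\<close>
  have "ap (idb - ((idb - P) oL R oL (idb - P))) (ap D x) = 0" for x
   by (simp add: Da ap_diff PP b RR algebra_simps)
  then have "ap D x = 0" for x using op_inverse_apply(2)[OF S, of "ap D x"] by (metis ap_diff(6))
  then have "D = 0" by (intro blinfun_eqI) (simp add: ap_diff)
  then show ?thesis using 1 B(1) unfolding off_diag_def D_def B_def by simp
 qed
 show "R \<in> I" if W: "idem_chart P R \<in> off_diag"
 proof -
  have z: "P oL B oL P = 0" "(idb - P) oL B oL (idb - P) = 0" using W by (auto simp: off_diag_def B_def)
  have z1: "ap P (ap B (ap P x)) = 0" for x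
   using arg_cong[OF z(1), of "\<lambda>A. ap A x"] by (simp add: ap_diff)
  have z2: "ap B (x - ap P x) = ap P (ap B (x - ap P x))" for x
   using arg_cong[OF z(2), of "\<lambda>A. ap A x"] by (simp add: ap_diff algebra_simps)
  have z2': "ap B x = ap B (ap P x) + ap P (ap B x)" for x
  proof -
   have "ap B x = ap B (ap P x) + ap B (x - ap P x)" by (simp add: ap_diff)
   also have "ap B (x - ap P x) = ap P (ap B x)" by (subst z2) (simp add: ap_diff z1)
   finally show ?thesis .
  qed
  define b where "b x = ap P (ap B x)" for x
  define t where "t x = ap B (ap P x)" for x
  have bl: "b (x + y) = b x + b y" "b (x - y) = b x - b y" "b 0 = 0" "b (- x) = - b x"
   and tl: "t (x + y) = t x + t y" "t (x - y) = t x - t y" "t 0 = 0" "t (- x) = - t x" for x y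
   by (simp_all add: b_def t_def ap_diff)
  have r: "ap P (b x) = b x" "b (ap P x) = 0" "ap P (t x) = 0" "t (ap P x) = t x" "t (t x) = 0" "b (b x) = 0" for x
   using z1 PP by (simp_all add: b_def t_def ap_diff)
  \<comment> \<open>These terms are the product \<open>(I + t) (P + b) (I - t)\<close>. As
    \<open>t t = 0\<close>, this is a conjugate of the idempotent \<open>P + b\<close>.\<close>
  have Rb: "ap R x = ap P x - b (t x) + b x + t x - t (b (t x)) + t (b x)" for x
  proof -
   have "ap (idem_param P B) x = ap P x - b (t x) + b x + t (ap P x) - t (b (t x)) + t (b x)"
    unfolding idem_param_def Let_def
    by (simp add: ap_diff PP z1 b_def t_def algebra_simps) (rule z2')
   then show ?thesis unfolding B(2) r(4) .
  qed
  have RR: "ap R (ap R x) = ap R x" for x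
   unfolding Rb by (simp add: ap_diff bl tl r PP algebra_simps)
  then have "R oL R = R" by (intro blinfun_eqI) simp
  moreover have "R \<noteq> 0"
  proof
   assume R0: "R = 0"
   have "ap P x = 0" for x
   proof -
    have "ap P x + t x - b (t x) - t (b (t x)) = 0" using Rb[of "ap P x"] R0 by (simp add: r ap_diff PP algebra_simps bl tl)
    moreover have "b x + t (b x) = 0" for x
     using Rb[of x] Rb[of "ap P x"] R0 by (simp add: r ap_diff PP algebra_simps bl tl)
    then have "ap P (b x + t (b x)) = 0" for x by (simp add: ap_diff)
    then have "b x = 0" for x by (simp add: ap_diff r)
    ultimately have "ap P x + t x = 0" by (simp add: tl)
    then have "ap P (ap P x + t x) = 0" by (simp add: ap_diff)
    then show ?thesis by (simp add: ap_diff PP r)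
   qed
   then have "P = 0" by (intro blinfun_eqI) (simp add: ap_diff)
   then show False using P by (simp add: idempotents_def)
  qed
  moreover have "R \<noteq> idb"
  proof
   assume R1: "R = idb"
   have "x = ap P x" for x
   proof -
    define y where "y = x - ap P x"
    have y: "ap P y = 0" by (simp add: y_def ap_diff PP)
    have ty: "t y = 0" using r(4)[of y] y tl(3) by simp
    have yy: "y = b y + t (b y)" using Rb[of y] R1 y ty by (simp add: bl tl)
    have "ap P (b y + t (b y)) = b y" by (simp add: ap_diff r)
    then have "ap P y = b y" using arg_cong[OF yy, of "ap P"] by simp
    then have "b y = 0" using y by simp
    then have "y = 0" using \<open>y = b y + t (b y)\<close> tl by simp
    then show ?thesis by (simp add: y_def)
   qed
   then have "P = idb" by (intro blinfun_eqI) simp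
   then show False using P by (simp add: idempotents_def)
  qed
  ultimately show ?thesis using idem_dom_OP[OF R] by (simp add: idempotents_def)
 qed
qed

lemma analytic_idem_param: "B \<in> OP ==> analytic_at op op B (idem_param P)"
 unfolding idem_param_def[abs_def] Let_def using P_OP by (intro analytic_at_op_intros normed_op) auto

lemma analytic_idem_chart: assumes R: "R \<in> idem_dom P" shows "analytic_at op op R (idem_chart P)"
proof -
 have RO: "R \<in> OP" by (rule idem_dom_OP[OF R])
 obtain K where K: "op_inverse ((P oL R oL P) + (idb - P)) K" using R by (auto simp: idem_dom_def)
 have a: "analytic_at op op R (\<lambda>R. (P oL R oL P) + (idb - P))"
  using RO P_OP by (intro analytic_at_op_intros normed_op) auto
 have "analytic_at op op ((P oL R oL P) + (idb - P)) inv_op"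
  by (rule analytic_at_inv_op[OF K]) (use RO P_OP in auto)
 note i = analytic_at_compose[where f = "\<lambda>R. (P oL R oL P) + (idb - P)", OF a this normed_op normed_op normed_op]
 show ?thesis
  unfolding idem_chart_def[abs_def] Let_def blk_inv_def using RO P_OP
  by (intro analytic_at_op_intros i normed_op) auto
qed

text \<open>A complement is formed by the block diagonal operators; both spaces are cut out by two
  equations that are linear and continuous in \<open>B\<close>.\<close>

lemma off_diag_complemented: "closed_lin_subspace op off_diag" "closed_complements op off_diag \<noteq> {}"
proof -
 let ?Q = "idb - P"
 define diag where "diag = {B \<in> OP. (P oL B oL ?Q) = 0 \<and> (?Q oL B oL P) = 0}"
 have lin1: "lin_subspace op {B \<in> OP. (A oL B oL C) = 0 \<and> (A' oL B oL C') = 0}"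
  if "A \<in> OP" "A' \<in> OP" for A C A' C' :: "'a \<Rightarrow>\<^sub>L 'a"
  unfolding lin_subspace_def
 proof (intro conjI ballI allI)
  show "{B \<in> OP. (A oL B oL C) = 0 \<and> (A' oL B oL C') = 0} \<subseteq> car op" by auto
  show "bzero op \<in> {B \<in> OP. (A oL B oL C) = 0 \<and> (A' oL B oL C') = 0}" by (auto intro!: blinfun_eqI simp: ap_diff)
  fix B assume B: "B \<in> {B \<in> OP. (A oL B oL C) = 0 \<and> (A' oL B oL C') = 0}"
  then have e: "A oL B oL C = 0" "A' oL B oL C' = 0" by auto
  have b: "ap A (ap B (ap C x)) = 0" "ap A' (ap B (ap C' x)) = 0" for x
   using arg_cong[OF e(1), of "\<lambda>F. ap F x"] arg_cong[OF e(2), of "\<lambda>F. ap F x"] by (auto simp: ap_diff)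
  show "bscale op c B \<in> {B \<in> OP. (A oL B oL C) = 0 \<and> (A' oL B oL C') = 0}" for c
   using B that b by (auto intro!: blinfun_eqI simp: ap_diff OP_D)
  fix B' assume B': "B' \<in> {B \<in> OP. (A oL B oL C) = 0 \<and> (A' oL B oL C') = 0}"
  then have e': "A oL B' oL C = 0" "A' oL B' oL C' = 0" by auto
  have b': "ap A (ap B' (ap C x)) = 0" "ap A' (ap B' (ap C' x)) = 0" for x
   using arg_cong[OF e'(1), of "\<lambda>F. ap F x"] arg_cong[OF e'(2), of "\<lambda>F. ap F x"] by (auto simp: ap_diff)
  show "badd op B B' \<in> {B \<in> OP. (A oL B oL C) = 0 \<and> (A' oL B oL C') = 0}"
   using B B' b b' by (auto intro!: blinfun_eqI simp: ap_diff)
 qed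
 have cl: "closedin (btop op) {B \<in> OP. (A oL B oL C) = 0 \<and> (A' oL B oL C') = 0}" for A C A' C' :: "'a \<Rightarrow>\<^sub>L 'a"
 proof -
  have "closed {B. (A oL B oL C) = 0 \<and> (A' oL B oL C') = 0}"
   by (intro closed_Collect_conj closed_Collect_eq continuous_intros)
  moreover have "{B \<in> OP. (A oL B oL C) = 0 \<and> (A' oL B oL C') = 0} = OP \<inter> {B. (A oL B oL C) = 0 \<and> (A' oL B oL C') = 0}" by auto
  ultimately show ?thesis unfolding btop_op closedin_closed by blast
 qed
 have Q: "?Q \<in> OP" using P_OP by auto
 show c1: "closed_lin_subspace op off_diag"
  unfolding closed_lin_subspace_iff off_diag_def using lin1[OF P_OP Q] cl by blast
 have c2: "closed_lin_subspace op diag"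
  unfolding closed_lin_subspace_iff diag_def using lin1[OF P_OP Q] cl by blast
 have dec: "B = ((P oL B oL ?Q) + (?Q oL B oL P)) + ((P oL B oL P) + (?Q oL B oL ?Q))" for B
  by (rule blinfun_eqI) (simp add: ap_diff algebra_simps)
 have "off_diag \<inter> diag = {bzero op}"
 proof
  show "off_diag \<inter> diag \<subseteq> {bzero op}"
  proof
   fix B assume "B \<in> off_diag \<inter> diag"
   then have "B = 0" using dec[of B] by (simp add: off_diag_def diag_def)
   then show "B \<in> {bzero op}" by simp
  qed
  show "{bzero op} \<subseteq> off_diag \<inter> diag"
   using c1 c2 by (auto simp: closed_lin_subspace_iff lin_subspace_def)
 qed
 moreover have "{badd op x y | x y. x \<in> off_diag \<and> y \<in> diag} = car op"
 proof (intro equalityI subsetI)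
  fix B assume "B \<in> car op"
  then have B: "B \<in> OP" by simp
  have "(P oL B oL ?Q) + (?Q oL B oL P) \<in> off_diag"
   unfolding off_diag_def using B P_OP Q by (auto intro!: blinfun_eqI simp: ap_diff PP)
  moreover have "(P oL B oL P) + (?Q oL B oL ?Q) \<in> diag"
   unfolding diag_def using B P_OP Q by (auto intro!: blinfun_eqI simp: ap_diff PP)
  ultimately show "B \<in> {badd op x y | x y. x \<in> off_diag \<and> y \<in> diag}" using dec[of B] unfolding op_simps by blast
 qed (auto simp: off_diag_def diag_def)
 ultimately show "closed_complements op off_diag \<noteq> {}" unfolding closed_complements_def using c2 by blast
qed

lemma mchart_idem: "mchart (idem_dom P) (idem_chart P) op off_diag"
proof -
 have inj: "inj_on (idem_chart P) (idem_dom P)" by (metis idem_param_chart inj_on_inverseI)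
 have inv: "inv_into (idem_dom P) (idem_chart P) B = idem_param P B" if "B \<in> idem_chart P ` idem_dom P" for B
  using that idem_param_chart inj by (auto simp: inv_into_f_f)
 have "continuous_on UNIV (idem_param P)"
  unfolding idem_param_def[abs_def] Let_def by (intro continuous_intros)
 moreover obtain U where U: "open U" "idem_dom P = OP \<inter> U" using openin_idem_dom unfolding openin_open by blast
 ultimately have "open (idem_param P -` U)" using open_vimage by blast
 moreover have "idem_chart P ` idem_dom P = OP \<inter> idem_param P -` U"
  using idem_chart_image idem_param_OP by (simp only: U(2)) blast
 ultimately have o: "openin (btop op) (idem_chart P ` idem_dom P)" unfolding btop_op openin_open by blast
 have a: "analytic_at op op (idem_chart P R) (inv_into (idem_dom P) (idem_chart P))" if R: "R \<in> idem_dom P" for R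
 proof -
  have BO: "idem_chart P R \<in> OP" using idem_chart_image R by blast
  obtain r where r: "r > 0" "\<forall>h\<in>car op. bnorm op h < r --> badd op (idem_chart P R) h \<in> idem_chart P ` idem_dom P"
   using o R unfolding nspace.openin_btop[OF normed_op] by blast
  show ?thesis
   by (rule analytic_at_cong[OF analytic_idem_param[OF BO] normed_op r(1)]) (use r(2) inv in auto)
 qed
 have "idem_chart P ` (idem_dom P \<inter> I) = idem_chart P ` idem_dom P \<inter> off_diag"
  using idem_chart_idempotent by blast
 then show ?thesis
  unfolding mchart_def using banach_op openin_idem_dom inj o a analytic_idem_chart off_diag_complemented by blast
qed

end

lemma banach_manifold_IM: "banach_manifold IM"
 unfolding banach_manifold_def
proof (intro conjI ballI)
 show "Hausdorff_space (mtop IM)" by (simp add: Hausdorff_space_subtopology)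
 show "is_chart (mtop IM) c" if c: "c \<in> atlas IM" for c
 proof -
  obtain U p V W where "c = (U \<inter> I, p, bsub V W)" "mchart U p V W" using c unfolding atlas_IM by blast
  then show ?thesis using mchart_is_chart by simp
 qed
 show "\<Union> (fst ` atlas IM) = topspace (mtop IM)"
 proof
  show "\<Union> (fst ` atlas IM) \<subseteq> topspace (mtop IM)" unfolding Union_eq by (auto simp: atlas_IM)
  show "topspace (mtop IM) \<subseteq> \<Union> (fst ` atlas IM)"
  proof
   fix P assume "P \<in> topspace (mtop IM)"
   then have P: "P \<in> I" by simp
   then have "(idem_dom P \<inter> I, idem_chart P, bsub op (off_diag P)) \<in> atlas IM"
    unfolding atlas_IM using mchart_idem[OF P] by blast
   then show "P \<in> \<Union> (fst ` atlas IM)" using P_idem_dom[OF P] P by force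
  qed
 qed
 have half: "banach_analytic_on (bsub V W) (bsub V' W') (p ` ((U \<inter> I) \<inter> (U' \<inter> I))) (p' \<circ> inv_into (U \<inter> I) p)"
  if m: "mchart U p V W" and m': "mchart U' p' V' W'" for U p V W U' p' V' W'
 proof -
  note d = mchartD[OF m] and d' = mchartD[OF m']
  have "openin (top_of_set I) (U' \<inter> I)" using mchart_is_chart[OF m'] by simp
  from wchart_restrict[OF is_chart_wchart[OF mchart_is_chart[OF m]] this]
  have w: "openin (btop (bsub V W)) (p ` ((U \<inter> I) \<inter> (U' \<inter> I)))" by (simp add: wchart_def)
  have "analytic_at (bsub V W) (bsub V' W') y (p' \<circ> inv_into (U \<inter> I) p)"
   if y: "y \<in> p ` ((U \<inter> I) \<inter> (U' \<inter> I))" for y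
  proof -
   obtain R where R: "R \<in> U" "R \<in> U'" "R \<in> I" "y = p R" using y by blast
   have inv: "inv_into (U \<inter> I) p z \<in> I" if "z \<in> p ` (U \<inter> I)" for z using inv_into_into[OF that] by blast
   obtain r where r: "r > 0" "\<forall>h\<in>car (bsub V W). bnorm (bsub V W) h < r --> badd (bsub V W) y h \<in> p ` ((U \<inter> I) \<inter> (U' \<inter> I))"
    using w y unfolding nspace.openin_btop[OF d(13)] by blast
   have "inv_into (U \<inter> I) p y = R" using R d(3) by (simp add: inv_into_f_f inj_on_Int)
   then have "analytic_at (bsub V W) (bsub V' W') y (\<lambda>z. p' (inv_into (U \<inter> I) p z))"
    using mchart_inv[OF m R(1,3)] R r inv by (intro mchart_into[OF m' d(13), where d = r]) auto
   then show ?thesis by (simp add: comp_def)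
  qed
  then show ?thesis unfolding banach_analytic_on_iff[OF d(13) d'(13)] using w by blast
 qed
 show "compatible c c'" if c: "c \<in> atlas IM" and c': "c' \<in> atlas IM" for c c'
 proof -
  obtain U p V W where c: "c = (U \<inter> I, p, bsub V W)" "mchart U p V W" using c unfolding atlas_IM by blast
  obtain U' p' V' W' where c': "c' = (U' \<inter> I, p', bsub V' W')" "mchart U' p' V' W'" using c' unfolding atlas_IM by blast
  show ?thesis
   using half[OF c(2) c'(2)] half[OF c'(2) c(2)] unfolding c(1) c'(1) Int_commute[of "U' \<inter> I"] by simp
 qed
qed

end

lemma wchart_near:
 assumes "wchart T U p V" "u \<in> U"
 shows "\<exists>r>0. \<forall>h\<in>car V. bnorm V h < r --> badd V (p u) h \<in> p ` U"
proof -
 have n: "nspace V" and o: "openin (btop V) (p ` U)" using assms(1) by (auto simp: wchart_def)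
 show ?thesis using o assms(2) unfolding nspace.openin_btop[OF n] by blast
qed

lemma wchart_cong:
 assumes "wchart T U p V" "u \<in> U" "analytic_at V W (p u) g" "nspace W" "\<And>y. y \<in> p ` U ==> g y = f y"
 shows "analytic_at V W (p u) f"
proof -
 obtain r where r: "r > 0" "\<And>h. h \<in> car V ==> bnorm V h < r ==> badd V (p u) h \<in> p ` U"
  using wchart_near[OF assms(1,2)] by blast
 show ?thesis by (rule analytic_at_cong[OF assms(3,4) r(1)]) (use r assms(5) in auto)
qed

lemma analytic_at_incl:
 assumes nV: "nspace V" and nW: "nspace W" and S: "lin_subspace W S" and f: "analytic_at V (bsub W S) x f"
 shows "analytic_at V W x f"
 by (rule analytic_at_linear_compose[OF nV nspace.normed_bsub[OF nW S] nW f, where L = "\<lambda>x. x" and K = 1])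
   (use S in \<open>auto simp: is_linear_def lin_subspace_def\<close>)

lemma wchart_affine:
 assumes nV: "nspace V" and A: "affine_dir V A D" and a0: "a0 \<in> A"
 shows "wchart (subtopology (btop V) A) A (\<lambda>a. bdiff V a a0) (bsub V D)"
  and "(\<lambda>a. bdiff V a a0) ` A = D" and "h \<in> D ==> inv_into A (\<lambda>a. bdiff V a a0) h = badd V h a0"
proof -
 interpret V: nspace V by fact
 note d = affine_dirD[OF A nV]
 have nD: "nspace (bsub V D)" by (rule V.normed_bsub[OF d(2)])
 have AV: "a \<in> A ==> a \<in> car V" and DV: "h \<in> D ==> h \<in> car V" for a h using d(1,3) by auto
 show im: "(\<lambda>a. bdiff V a a0) ` A = D" using d(4)[OF a0] by (simp add: translate_def)
 have inj: "inj_on (\<lambda>a. bdiff V a a0) A"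
  by (rule inj_on_inverseI[where g = "\<lambda>h. badd V h a0"]) (use AV a0 in auto)
 show inv: "inv_into A (\<lambda>a. bdiff V a a0) h = badd V h a0" if "h \<in> D" for h
  by (rule inv_into_f_eq[OF inj d(6)[OF a0 that]]) (use AV[OF a0] DV[OF that] in simp)
 have "analytic_at V V h (\<lambda>h. badd V h a0)" if "h \<in> car V" for h
  by (rule analytic_at_add[OF nV nV analytic_at_linear[OF nV nV that, where K = 1] analytic_at_const[OF nV nV that AV[OF a0]]])
    (auto simp: is_linear_def)
 then have "continuous_map (subtopology (btop V) D) (btop V) (\<lambda>h. badd V h a0)"
  using DV by (intro continuous_map_analytic[OF nV nV]) auto
 then have "continuous_map (subtopology (btop V) D) (subtopology (btop V) A) (\<lambda>h. badd V h a0)"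
  using d(6)[OF a0] by (auto simp: continuous_map_in_subtopology)
 then have "continuous_map (subtopology (btop V) D) (subtopology (btop V) A) (inv_into A (\<lambda>a. bdiff V a a0))"
  by (rule continuous_map_eq) (use inv in auto)
 moreover have "subtopology (btop (bsub V D)) D = subtopology (btop V) D"
  unfolding V.btop_bsub[OF d(2)] by (simp add: subtopology_subtopology)
 moreover have "openin (btop (bsub V D)) D"
  using openin_topspace[of "btop (bsub V D)"] nspace.topspace_btop[OF nD] by simp
 ultimately show "wchart (subtopology (btop V) A) A (\<lambda>a. bdiff V a a0) (bsub V D)"
  unfolding wchart_def im using nD inj d(1) by auto
qed

lemma atlas_affine:
 assumes "affine_dir V A D" "nspace V"
 shows "c \<in> atlas (affine_manifold V A) \<longleftrightarrow> (\<exists>a0\<in>A. c = (A, \<lambda>a. bdiff V a a0, bsub V D))"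
 using affine_dirD(4)[OF assms] by (auto simp: affine_manifold_def)

lemma mtop_affine: "mtop (affine_manifold V A) = subtopology (btop V) A"
 by (simp add: affine_manifold_def)

context K_banach
begin

subsection \<open>The range map\<close>

lemma atlas_IM_wchart:
 assumes "mchart U p V W" shows "wchart (top_of_set I) (U \<inter> I) p (bsub V W)"
 by (rule is_chart_wchart[OF mchart_is_chart[OF assms]])

lemma wchart_GM: "E \<in> Gr ==> F \<in> Cpl E ==> wchart TG (Cpl F) (gchart E F) (SO E F)"
 by (rule is_chart_wchart[OF is_chart_gchart])

text \<open>For a complement \<open>F\<close> of the range of \<open>R\<close>, the range of a
  nearby \<open>R'\<close> is the graph of \<open>res E F (nproj F R R')\<close>, and this operator
  depends continuously on \<open>R'\<close>.\<close>

lemma continuous_range_map: "continuous_map (top_of_set I) TG rg"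
 unfolding continuous_map_def
proof (intro conjI allI impI)
 show "rg \<in> topspace (top_of_set I) \<rightarrow> topspace TG" using idempotentsD(5) by auto
 fix S assume S: "openin TG S"
 show "openin (top_of_set I) {R \<in> topspace (top_of_set I). rg R \<in> S}"
  unfolding openin_euclidean_subtopology_iff
 proof (intro conjI ballI)
  fix R assume "R \<in> {R \<in> topspace (top_of_set I). rg R \<in> S}"
  then have R: "R \<in> I" "rg R \<in> S" by auto
  define E where "E = rg R"
  have E: "E \<in> Gr" using idempotentsD(5)[OF R(1)] by (simp add: E_def)
  obtain F where F: "F \<in> Cpl E" using grassmannianD(4)[OF E] by blast
  have EF: "E \<in> Cpl F" by (rule complements_sym[OF E F])
  have p: "isproj (proj E F) E F" by (rule grassmannianD(5)[OF E F])
  define D where "D = {T \<in> car (SO E F). graph_of E T \<in> S}"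
  have "openin (btop (SO E F)) D" using S E F unfolding openin_TG gr_open_def D_def by blast
  note o = openin_res_preimage[OF E F this]
  have "nproj F R R = proj E F"
  proof -
   obtain k where "k > 0" "\<forall>R'\<in>idempotents sc. norm (R' - R) < k --> isproj (nproj F R R') (rg R') F"
    using nproj(1)[OF R(1), of F] p by (auto simp: E_def)
   then have "isproj (nproj F R R) E F" using R(1) by (simp add: E_def)
   then show ?thesis using proj_eq by simp
  qed
  moreover have "proj E F \<in> {A \<in> OP. res E F A \<in> D}"
   using isprojD(1)[OF p] res_closed[OF E F] graph_res(1)[OF E F EF] R(2) by (simp add: D_def E_def)
  ultimately obtain q where q: "q > 0" "\<And>A. A \<in> OP ==> norm (A - nproj F R R) < q ==> res E F A \<in> D"
   using o unfolding openin_euclidean_subtopology_iff dist_norm by (metis (no_types, lifting) mem_Collect_eq)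
  note n = nproj[OF R(1), of F, folded E_def, OF p]
  obtain k where k: "k > 0" "\<forall>R'\<in>I. norm (R' - R) < k --> isproj (nproj F R R') (rg R') F" using n(1) by blast
  obtain d where d: "d > 0" "\<And>H. H \<in> OP ==> norm H < d ==> nproj F R (R + H) \<in> OP \<and> norm (nproj F R (R + H) - nproj F R R) < q"
   using analytic_at_continuous[OF n(2) normed_op normed_op q(1)] by auto
  show "\<exists>e>0. \<forall>R'\<in>I. dist R' R < e --> R' \<in> {R \<in> topspace (top_of_set I). rg R \<in> S}"
  proof (intro exI[of _ "min k d"] conjI ballI impI)
   fix R' assume R': "R' \<in> I" "dist R' R < min k d"
   then have pr: "isproj (nproj F R R') (rg R') F" using k(2) by (simp add: dist_norm)
   have "res E F (nproj F R R') \<in> D"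
    using d(2)[of "R' - R"] R' R(1) idempotentsD(1) q(2) by (simp add: dist_norm)
   then have "graph_of E (res E F (proj (rg R') F)) \<in> S" unfolding proj_eq[OF pr] by (simp add: D_def)
   then show "R' \<in> {R \<in> topspace (top_of_set I). rg R \<in> S}"
    using graph_res(1)[OF E F isproj_complement(2)[OF pr]] R' by simp
  qed (use k d in simp)
 qed auto
qed

lemma range_chart:
 assumes m: "mchart U q V W" and R: "R \<in> U" "R \<in> I" and E: "E \<in> Gr" and F: "F \<in> Cpl E"
  and RF: "rg R \<in> Cpl F"
 shows "analytic_at (bsub V W) op (q R) (\<lambda>y. proj (rg (inv_into (U \<inter> I) q y)) F)"
  and "analytic_at (bsub V W) (SO E F) (q R) (\<lambda>y. gchart E F (rg (inv_into (U \<inter> I) q y)))"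
proof -
 note w = atlas_IM_wchart[OF m] and n = mchartD(13)[OF m]
 have i: "inv_into (U \<inter> I) q (q R) = R" using R mchartD(3)[OF m] by (simp add: inv_into_f_f inj_on_Int)
 have p: "isproj (proj (rg R) F) (rg R) F" by (rule complement_sym(1)[OF E F RF])
 have "R \<in> U \<inter> I" using R by blast
 then obtain r where r: "r > 0" "\<And>h. h \<in> car (bsub V W) ==> bnorm (bsub V W) h < r ==> badd (bsub V W) (q R) h \<in> q ` (U \<inter> I)"
  using wchart_near[OF w] by blast
 have r': "inv_into (U \<inter> I) q (badd (bsub V W) (q R) h) \<in> I" if "h \<in> car (bsub V W)" "bnorm (bsub V W) h < r" for h
  using inv_into_into[OF r(2)[OF that]] by blast
 note a = analytic_at_range_proj[where f = "inv_into (U \<inter> I) q" and F = F, OF n mchart_inv[OF m R], unfolded i, OF R(2) r(1) r' p]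
 show 1: "analytic_at (bsub V W) op (q R) (\<lambda>y. proj (rg (inv_into (U \<inter> I) q y)) F)" by (rule a(1))
 obtain e where e: "e > 0" "\<forall>h\<in>car (bsub V W). bnorm (bsub V W) h < e -->
   isproj (proj (rg (inv_into (U \<inter> I) q (badd (bsub V W) (q R) h))) F) (rg (inv_into (U \<inter> I) q (badd (bsub V W) (q R) h))) F"
  using a(2) by blast
 then have e2: "rg (inv_into (U \<inter> I) q (badd (bsub V W) (q R) h)) \<in> Cpl F"
  if "h \<in> car (bsub V W)" "bnorm (bsub V W) h < e" for h
  using isproj_complement(2) that by blast
 show "analytic_at (bsub V W) (SO E F) (q R) (\<lambda>y. gchart E F (rg (inv_into (U \<inter> I) q y)))"
  by (rule analytic_at_gchart[where g = "\<lambda>y. rg (inv_into (U \<inter> I) q y)", OF n E F 1 e(1) e2])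
qed

lemma analytic_range_map: "analytic_map IM GM rg"
proof (rule analytic_mapI)
 show "continuous_map (mtop IM) TG rg" using continuous_range_map by simp
 show "wchart (mtop IM) U p V" if "(U, p, V) \<in> atlas IM" for U p V
  using that atlas_IM_wchart unfolding atlas_IM by auto
 show "openin TG U \<and> nspace V" if "(U, p, V) \<in> atlas GM" for U p V
  using that openin_complements normed_sub_ops unfolding atlas_GM by auto
 show "analytic_at V V' (p u) (\<lambda>y. p' (rg (inv_into U p y)))"
  if 1: "(U, p, V) \<in> atlas IM" and 2: "(U', p', V') \<in> atlas GM" and u: "u \<in> U" "rg u \<in> U'" for U p V U' p' V' u
 proof -
  obtain U1 V1 W where c: "U = U1 \<inter> I" "V = bsub V1 W" "mchart U1 p V1 W" using 1 unfolding atlas_IM by blast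
  obtain E F where d: "U' = Cpl F" "p' = gchart E F" "V' = SO E F" "E \<in> Gr" "F \<in> Cpl E"
   using 2 unfolding atlas_GM by blast
  show ?thesis using range_chart(2)[OF c(3) _ _ d(4,5)] u unfolding c d by blast
 qed
qed

subsection \<open>Fibres and trivialisations\<close>

definition Fib :: "'a set => ('a \<Rightarrow>\<^sub>L 'a) set" where "Fib E = {Q \<in> I. rg Q = E}"
definition Dir :: "'a set => ('a \<Rightarrow>\<^sub>L 'a) set" where "Dir E = {H \<in> OP. (\<forall>x. ap H x \<in> E) \<and> (\<forall>x\<in>E. ap H x = 0)}"

text \<open>One complement for each subspace, fixed once, so that the neighbourhood and the
  trivialisation are functions of the base point alone, as the bundle definitions ask.\<close>

definition cE :: "'a set => 'a set" where "cE E = (SOME F. F \<in> Cpl E)"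
definition VV :: "'a set => 'a set set" where "VV E = Cpl (cE E)"
definition NN :: "'a set => 'a set => ('a \<Rightarrow>\<^sub>L 'a)" where "NN E w = proj w (cE E) - proj E (cE E)"
definition Th :: "'a set => 'a set \<times> ('a \<Rightarrow>\<^sub>L 'a) => ('a \<Rightarrow>\<^sub>L 'a)" where
 "Th E z = (idb + NN E (fst z)) oL snd z oL (idb - NN E (fst z))"
definition Thi :: "'a set => ('a \<Rightarrow>\<^sub>L 'a) => ('a \<Rightarrow>\<^sub>L 'a)" where
 "Thi E R = (idb - NN E (rg R)) oL R oL (idb + NN E (rg R))"

lemma fiber_IM: "fiber (mtop IM) rg E = Fib E"
 by (auto simp: fiber_def Fib_def)

text \<open>The idempotents with range \<open>E\<close> are described by conditions that are affine
  and closed in \<open>Q\<close>. Nontriviality of \<open>E\<close> excludes the zero operator and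
  the identity.\<close>

lemma Fib_iff: assumes E: "E \<in> Gr"
 shows "Q \<in> Fib E \<longleftrightarrow> Q \<in> OP \<and> (\<forall>x. ap Q x \<in> E) \<and> (\<forall>x\<in>E. ap Q x = x)"
proof
 assume "Q \<in> Fib E"
 then have Q: "Q \<in> I" "rg Q = E" by (auto simp: Fib_def)
 show "Q \<in> OP \<and> (\<forall>x. ap Q x \<in> E) \<and> (\<forall>x\<in>E. ap Q x = x)"
  using isprojD[OF idempotentsD(4)[OF Q(1)]] Q(2) by blast
next
 assume R: "Q \<in> OP \<and> (\<forall>x. ap Q x \<in> E) \<and> (\<forall>x\<in>E. ap Q x = x)"
 then have "isproj Q E {x. ap Q x = 0}" unfolding isproj_def by (simp add: ap_diff)
 from isproj_idempotent[OF this E] show "Q \<in> Fib E" by (simp add: Fib_def)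
qed

lemma Dir_lin: assumes E: "E \<in> Gr" shows "lin_subspace op (Dir E)"
 using grassmannianD(1)[OF E] unfolding closed_lin_whole lin_subspace_whole lin_subspace_def Dir_def
 by (auto simp: ap_diff)

lemma Fib_affine: assumes E: "E \<in> Gr" and Q0: "Q0 \<in> Fib E" shows "affine_dir op (Fib E) (Dir E)"
proof (rule affine_dirI[OF normed_op Dir_lin[OF E]])
 have q: "Q0 \<in> OP" "\<And>x. ap Q0 x \<in> E" "\<And>x. x \<in> E ==> ap Q0 x = x" using Q0 Fib_iff[OF E] by auto
 then show "Q0 \<in> car op" by simp
 have Es: "x + y \<in> E" "x - y \<in> E" if "x \<in> E" "y \<in> E" for x y
  using grassmannianD(1)[OF E] that nspace.lin_subspace_diff[OF normed_whole, of E x y]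
  unfolding closed_lin_whole lin_subspace_whole by auto
 show "Fib E = (\<lambda>h. badd op h Q0) ` Dir E"
 proof (intro equalityI subsetI)
  fix Q assume "Q \<in> Fib E"
  then have "Q - Q0 \<in> Dir E" unfolding Fib_iff[OF E] Dir_def using q Es by (auto simp: ap_diff)
  then show "Q \<in> (\<lambda>h. badd op h Q0) ` Dir E" by (rule image_eqI[rotated]) simp
 qed (use q Es in \<open>auto simp: Fib_iff[OF E] Dir_def ap_diff\<close>)
qed

lemma cE: "E \<in> Gr ==> cE E \<in> Cpl E"
 unfolding cE_def using grassmannianD(4) by (rule someI_ex)

context
 fixes E assumes E: "E \<in> Gr"
begin

lemma VV: "openin TG (VV E)" "E \<in> VV E" "VV E \<subseteq> Gr"
 unfolding VV_def using openin_complements[OF E cE[OF E]] complements_sym[OF E cE[OF E]] complement_sym(2)[OF E cE[OF E]] by auto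

lemma pE_Fib: "proj E (cE E) \<in> Fib E"
 unfolding Fib_iff[OF E] using isprojD[OF grassmannianD(5)[OF E cE[OF E]]] by blast

text \<open>Let \<open>P\<close>, \<open>G\<close> be the projections onto \<open>E\<close> and
  \<open>v\<close> along the same complement. Then \<open>P G = P\<close> and
  \<open>G P = G\<close>, so \<open>(G - P) (G - P) = G - G - P + P = 0\<close>. Hence
  \<open>I - N\<close> inverts \<open>I + N\<close>, and \<open>I + N\<close> agrees with
  \<open>G\<close> on \<open>E\<close>.\<close>

lemma NN: assumes v: "v \<in> VV E"
 shows "NN E v \<in> OP" "ap (NN E v) (ap (NN E v) x) = 0" "x \<in> E ==> x + ap (NN E v) x \<in> v" "w \<in> v ==> w - ap (NN E v) w \<in> E"
proof -
 note p = isprojD[OF grassmannianD(5)[OF E cE[OF E]]]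
 note g = isprojD[OF complement_sym(1)[OF E cE[OF E], of v]] v[unfolded VV_def]
 show "NN E v \<in> OP" using p(1) g by (simp add: NN_def)
 have GP: "ap (proj v (cE E)) (ap (proj E (cE E)) x) = ap (proj v (cE E)) x" for x using g(5)[OF g(6) p(4), of x] by (simp add: ap_diff)
 have PG: "ap (proj E (cE E)) (ap (proj v (cE E)) x) = ap (proj E (cE E)) x" for x using p(5)[OF g(4)[OF g(6)], of x] by (simp add: ap_diff)
 show "ap (NN E v) (ap (NN E v) x) = 0"
  using p(3)[OF p(2), of x] g(3)[OF g(6) g(2)[OF g(6)], of x] by (simp add: NN_def ap_diff GP PG)
 show "x + ap (NN E v) x \<in> v" if "x \<in> E" using p(3)[OF that] g(2)[OF g(6)] by (simp add: NN_def ap_diff)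
 show "w - ap (NN E v) w \<in> E" if "w \<in> v" using g(3)[OF g(6) that] p(2) by (simp add: NN_def ap_diff)
qed

lemma Th_apply: "ap (Th E (w, Q)) x = ap Q (x - ap (NN E w) x) + ap (NN E w) (ap Q (x - ap (NN E w) x))"
 by (simp add: Th_def ap_diff)

lemma Thi_apply: "rg R = w ==> ap (Thi E R) x = ap R (x + ap (NN E w) x) - ap (NN E w) (ap R (x + ap (NN E w) x))"
 by (simp add: Thi_def ap_diff)

lemma Th_Fib: assumes "v \<in> VV E" "Q \<in> Fib E" shows "Th E (v, Q) \<in> Fib v"
proof -
 note n = NN[OF assms(1)]
 have q: "Q \<in> OP" "\<And>x. ap Q x \<in> E" "\<And>x. x \<in> E ==> ap Q x = x" using assms(2) Fib_iff[OF E] by auto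
 have "Th E (v, Q) \<in> OP" unfolding Th_def using q(1) n(1) by auto
 moreover have "ap (Th E (v, Q)) x \<in> v" for x unfolding Th_apply using n(3)[OF q(2)] .
 moreover have "ap (Th E (v, Q)) w = w" if "w \<in> v" for w
  unfolding Th_apply q(3)[OF n(4)[OF that]] by (simp add: ap_diff n(2))
 ultimately show ?thesis using Fib_iff VV(3) assms(1) by blast
qed

lemma Thi_Fib: assumes "v \<in> VV E" "R \<in> Fib v" shows "Thi E R \<in> Fib E" "Th E (v, Thi E R) = R"
proof -
 note n = NN[OF assms(1)]
 have v: "v \<in> Gr" and rm: "rg R = v" using VV(3) assms by (auto simp: Fib_def)
 have q: "R \<in> OP" "\<And>x. ap R x \<in> v" "\<And>x. x \<in> v ==> ap R x = x" using assms(2) Fib_iff[OF v] by auto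
 have "Thi E R \<in> OP" unfolding Thi_def rm using q(1) n(1) by auto
 moreover have "ap (Thi E R) x \<in> E" for x unfolding Thi_apply[OF rm] using n(4)[OF q(2)] .
 moreover have "ap (Thi E R) w = w" if "w \<in> E" for w
  unfolding Thi_apply[OF rm] q(3)[OF n(3)[OF that]] by (simp add: ap_diff n(2))
 ultimately show "Thi E R \<in> Fib E" unfolding Fib_iff[OF E] by blast
 show "Th E (v, Thi E R) = R"
  by (rule blinfun_eqI) (simp add: Th_apply Thi_apply[OF rm] ap_diff n(2))
qed

lemma Thi_Th: assumes "w \<in> VV E" "Q \<in> Fib E" shows "Thi E (Th E (w, Q)) = Q" "rg (Th E (w, Q)) = w"
proof -
 show rm: "rg (Th E (w, Q)) = w" using Th_Fib[OF assms] by (simp add: Fib_def)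
 show "Thi E (Th E (w, Q)) = Q"
  by (rule blinfun_eqI) (simp add: Thi_apply[OF rm] Th_apply ap_diff NN(2)[OF assms(1)])
qed

lemma Th_image: assumes "w \<in> VV E" shows "(\<lambda>x. Th E (w, x)) ` Fib E = Fib w"
 using Th_Fib[OF assms] Thi_Fib[OF assms] by (metis (no_types, lifting) image_eqI image_subsetI subsetI subset_antisym)

lemma inj_Th: "inj_on (Th E) (VV E \<times> Fib E)"
 by (rule inj_on_inverseI[where g = "\<lambda>R. (rg R, Thi E R)"]) (auto simp: Thi_Th)

lemma inv_Th: assumes "R \<in> I" "rg R \<in> VV E" shows "inv_into (VV E \<times> Fib E) (Th E) R = (rg R, Thi E R)"
 by (rule inv_into_f_eq[OF inj_Th]) (use Thi_Fib[OF assms(2)] assms in \<open>auto simp: Fib_def\<close>)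

lemma Th_bij: "Th E ` (VV E \<times> Fib E) = I \<inter> rg -` VV E"
proof (intro equalityI subsetI)
 fix R assume "R \<in> I \<inter> rg -` VV E"
 then have "R = Th E (rg R, Thi E R)" "Thi E R \<in> Fib E" "rg R \<in> VV E"
  using Thi_Fib[of "rg R" R] by (auto simp: Fib_def)
 then show "R \<in> Th E ` (VV E \<times> Fib E)" by blast
qed (use Th_Fib in \<open>auto simp: Fib_def\<close>)

lemma continuous_NN: "continuous_map (subtopology TG (VV E)) euclidean (NN E)"
 unfolding NN_def[abs_def] VV_def
 by (intro continuous_map_diff continuous_proj[OF E cE[OF E]]) auto

lemma analytic_NN:
 assumes E1: "E1 \<in> Gr" and F1: "F1 \<in> Cpl E1" and T: "T \<in> car (SO E1 F1)" "graph_of E1 T \<in> VV E"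
 shows "analytic_at (SO E1 F1) op T (\<lambda>T. NN E (graph_of E1 T))"
 unfolding NN_def
 by (intro analytic_at_op_diff analytic_at_op_const normed_sub_ops[OF E1 F1] T(1)
   analytic_at_graph_proj(1)[OF E1 F1 T(1) E cE[OF E] T(2)[unfolded VV_def]] isprojD(1)[OF grassmannianD(5)[OF E cE[OF E]]])

end

lemma continuous_map_blinfun_compose:
 fixes f g :: "'m => ('a \<Rightarrow>\<^sub>L 'a)"
 assumes "continuous_map T euclidean f" "continuous_map T euclidean g"
 shows "continuous_map T euclidean (\<lambda>x. f x oL g x)"
 using assms unfolding continuous_map_atin
 by (simp add: bounded_bilinear.tendsto[OF bounded_bilinear_blinfun_compose])

lemma affine_fibers_IM: "affine_fibers (mtop IM) TG rg (\<lambda>E. op)"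
 unfolding affine_fibers_def fiber_IM
proof (intro ballI conjI)
 fix E assume "E \<in> topspace TG"
 then have E: "E \<in> Gr" by simp
 note A = Fib_affine[OF E pE_Fib[OF E]]
 show "banach_space op" by (rule banach_op)
 have "closed (Dir E)"
 proof -
  have eq: "Dir E = OP \<inter> (\<Inter>x. (\<lambda>H. ap H x) -` E) \<inter> (\<Inter>x\<in>E. {H. ap H x = 0})" by (auto simp: Dir_def)
  have 1: "closed ((\<lambda>H. ap H x) -` E)" for x
   by (intro continuous_closed_vimage grassmannian_zero(2)[OF E] continuous_intros)
  have 2: "closed {H. ap H x = 0}" for x by (intro closed_Collect_eq continuous_intros)
  show ?thesis unfolding eq by (intro closed_Int closed_INT ballI closed_OP 1 2)
 qed
 then have "closed_lin_subspace op (Dir E)"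
  unfolding closed_lin_subspace_iff btop_op using Dir_lin[OF E] by (auto simp: closedin_closed Dir_def)
 then show "affine_subspace op (Fib E)"
  using affine_dirD[OF A normed_op] pE_Fib[OF E] unfolding affine_subspace_def by metis
 have "Fib E \<subseteq> I" "Fib E \<subseteq> OP" using I_sub by (auto simp: Fib_def)
 then show "subtopology (mtop IM) (Fib E) = subtopology (btop op) (Fib E)"
  by (simp add: btop_op subtopology_subtopology Int_absorb1)
qed

lemma fiberwise_affine_IM:
 assumes E: "E \<in> Gr" shows "fiberwise_affine (mtop IM) rg (\<lambda>E. op) E (VV E) (Th E)"
 unfolding fiberwise_affine_def fiber_IM
proof (intro ballI conjI)
 fix w assume w: "w \<in> VV E"
 show im: "(\<lambda>x. Th E (w, x)) ` Fib E = Fib w" by (rule Th_image[OF E w])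
 have A: "affine_dir op (Fib E) (Dir E)" by (rule Fib_affine[OF E pE_Fib[OF E]])
 show "affine_map op (Fib E) op (Fib w) (\<lambda>x. Th E (w, x))"
  unfolding affine_map_def
 proof (intro conjI ballI)
  fix a0 assume a0: "a0 \<in> Fib E"
  have lp: "lin_part op op a0 (\<lambda>x. Th E (w, x)) H = (idb + NN E w) oL H oL (idb - NN E w)" for H
   unfolding lin_part_def Th_def by (rule blinfun_eqI) (simp add: ap_diff algebra_simps)
  show "is_linear (bsub op (translate op (Fib E) a0)) op (lin_part op op a0 (\<lambda>x. Th E (w, x)))"
   unfolding affine_dirD(4)[OF A normed_op a0] lp using NN(1)[OF E w]
   by (intro is_linearI) (auto simp: Dir_def ap_diff OP_D scale_right_distrib scale_right_diff_distrib intro!: blinfun_eqI)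
 qed (use im in auto)
qed

text \<open>The map \<open>H \<mapsto> P H (I - P)\<close> is a bounded projection of
  \<open>OP\<close> onto \<open>Dir E\<close>; composing with it moves the coefficients of the
  expansion into \<open>Dir E\<close>.\<close>

lemma analytic_at_Dir:
 assumes nV: "nspace V" and E: "E \<in> Gr" and f: "analytic_at V op x f"
  and d: "d > 0" "\<And>h. h \<in> car V ==> bnorm V h < d ==> f (badd V x h) \<in> Dir E"
 shows "analytic_at V (bsub op (Dir E)) x f"
proof -
 define P where "P = proj E (cE E)"
 note p = isprojD[OF grassmannianD(5)[OF E cE[OF E]], folded P_def]
 define L where "L H = P oL H oL (idb - P)" for H
 have nD: "nspace (bsub op (Dir E))" by (rule nspace.normed_bsub[OF normed_op Dir_lin[OF E]])
 have "analytic_at V (bsub op (Dir E)) x (\<lambda>z. L (f z))"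
 proof (rule analytic_at_linear_compose[OF nV normed_op nD f, where K = "norm P * norm (idb - P)"])
  have "L H \<in> Dir E" if "H \<in> OP" for H
   unfolding Dir_def using that p(1) p(2) p(3) by (auto simp: L_def) (simp add: ap_diff)
  then show "is_linear op (bsub op (Dir E)) L"
   using p(1) by (intro is_linearI) (auto simp: L_def ap_diff OP_D scale_right_diff_distrib intro!: blinfun_eqI)
  show "bnorm (bsub op (Dir E)) (L H) \<le> norm P * norm (idb - P) * bnorm op H" if "H \<in> car op" for H
  proof -
   have "norm (L H) \<le> norm (P oL H) * norm (idb - P)" unfolding L_def by (rule norm_blinfun_compose)
   also have "\<dots> \<le> (norm P * norm H) * norm (idb - P)" by (intro mult_right_mono norm_blinfun_compose) auto
   finally show ?thesis by (simp add: mult_ac)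
  qed
 qed
 then show ?thesis
 proof (rule analytic_at_cong[OF _ nD d(1)])
  fix h assume h: "h \<in> car V" "bnorm V h < d"
  then have "f (badd V x h) \<in> Dir E" using d(2) by blast
  then show "L (f (badd V x h)) = f (badd V x h)"
   using p(2,3) by (intro blinfun_eqI) (auto simp: L_def Dir_def ap_diff)
 qed
qed

lemma atlas_sub_GM: "c \<in> atlas (open_submanifold GM S) \<longleftrightarrow> (\<exists>E F. c = (Cpl F \<inter> S, gchart E F, SO E F) \<and>
  E \<in> Gr \<and> F \<in> Cpl E)"
proof -
 have "c \<in> atlas (open_submanifold GM S) \<longleftrightarrow> (\<exists>U p V. c = (U \<inter> S, p, V) \<and> (U, p, V) \<in> atlas GM)"
  by (auto simp: open_submanifold_def)
 then show ?thesis unfolding atlas_GM by blast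
qed

lemma atlas_sub_IM: "c \<in> atlas (open_submanifold IM S) \<longleftrightarrow> (\<exists>U p V W. c = (U \<inter> I \<inter> S, p, bsub V W) \<and> mchart U p V W)"
proof -
 have "c \<in> atlas (open_submanifold IM S) \<longleftrightarrow> (\<exists>U p V. c = (U \<inter> S, p, V) \<and> (U, p, V) \<in> atlas IM)"
  by (auto simp: open_submanifold_def)
 moreover have "(U, p, V) \<in> atlas IM \<longleftrightarrow> (\<exists>U1 V1 W. U = U1 \<inter> I \<and> V = bsub V1 W \<and> mchart U1 p V1 W)" for U p V
  unfolding atlas_IM by simp
 ultimately show ?thesis by simp metis
qed

lemma mtop_sub: "mtop (open_submanifold M S) = subtopology (mtop M) S"
 by (simp add: open_submanifold_def)

lemma wchart_sub_GM:
 assumes "E \<in> Gr" "F \<in> Cpl E" "openin TG S"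
 shows "wchart (subtopology TG S) (Cpl F \<inter> S) (gchart E F) (SO E F)"
  "T \<in> gchart E F ` (Cpl F \<inter> S) ==> T \<in> car (SO E F)"
  "T \<in> gchart E F ` (Cpl F \<inter> S) ==> inv_into (Cpl F \<inter> S) (gchart E F) T = graph_of E T"
  "T \<in> gchart E F ` (Cpl F \<inter> S) ==> graph_of E T \<in> Cpl F \<inter> S"
proof -
 show "wchart (subtopology TG S) (Cpl F \<inter> S) (gchart E F) (SO E F)"
  by (rule wchart_restrict[OF wchart_GM[OF assms(1,2)] assms(3)])
 assume T: "T \<in> gchart E F ` (Cpl F \<inter> S)"
 then obtain W where W: "W \<in> Cpl F" "W \<in> S" "T = gchart E F W" by blast
 show "T \<in> car (SO E F)" using gchart_closed[OF assms(1,2) W(1)] W(3) by simp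
 have g: "graph_of E T = W" using graph_gchart[OF assms(1,2) W(1)] W(3) by simp
 show "graph_of E T \<in> Cpl F \<inter> S" using g W by simp
 show "inv_into (Cpl F \<inter> S) (gchart E F) T = graph_of E T"
  unfolding g by (rule inv_into_f_eq) (use inj_gchart[OF assms(1,2)] W in \<open>auto simp: inj_on_Int\<close>)
qed

lemma openin_range_vimage: "openin TG S ==> openin (top_of_set I) (I \<inter> rg -` S)"
 using openin_continuous_map_preimage[OF continuous_range_map, of S] by (simp add: vimage_def Int_def)

lemma sub_IM_top: "subtopology (top_of_set I) (rg -` S) = top_of_set (I \<inter> rg -` S)"
 by (simp add: subtopology_subtopology)

lemma wchart_sub_IM:
 assumes m: "mchart U p V W" and S: "openin TG S"
 shows "wchart (top_of_set (I \<inter> rg -` S)) (U \<inter> I \<inter> rg -` S) p (bsub V W)"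
  "y \<in> p ` (U \<inter> I \<inter> rg -` S) ==> inv_into (U \<inter> I \<inter> rg -` S) p y = inv_into (U \<inter> I) p y"
  "y \<in> p ` (U \<inter> I \<inter> rg -` S) ==> inv_into (U \<inter> I) p y \<in> I \<inter> rg -` S"
proof -
 have eq: "U \<inter> I \<inter> (I \<inter> rg -` S) = U \<inter> I \<inter> rg -` S" by blast
 show "wchart (top_of_set (I \<inter> rg -` S)) (U \<inter> I \<inter> rg -` S) p (bsub V W)"
  using wchart_restrict[OF atlas_IM_wchart[OF m] openin_range_vimage[OF S]] unfolding eq by (simp add: subtopology_subtopology)
 have i: "inj_on p U" by (rule mchartD(3)[OF m])
 show "inv_into (U \<inter> I \<inter> rg -` S) p y = inv_into (U \<inter> I) p y"
  "inv_into (U \<inter> I) p y \<in> I \<inter> rg -` S"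
  if "y \<in> p ` (U \<inter> I \<inter> rg -` S)"
  using that i by (auto simp: inv_into_f_f inj_on_Int)
qed

text \<open>Both directions are operator expressions in \<open>NN E\<close> and the fibre variable.
  Towards the idempotents the result is read in a chart by \<open>mchart_into\<close>; backwards the
  base component is handled by \<open>range_chart\<close> and the fibre component is moved into
  \<open>Dir E\<close>.\<close>

lemma analytic_trivialization_Th:
 assumes E: "E \<in> Gr"
 shows "analytic_trivialization IM GM rg (\<lambda>E. op) E (VV E) (Th E)"
proof -
 note A = Fib_affine[OF E pE_Fib[OF E]]
 let ?PM = "prod_manifold (open_submanifold GM (VV E)) (affine_manifold op (Fib E))"
 let ?SM = "open_submanifold IM (rg -` VV E)"
 have OF: "OP \<inter> Fib E = Fib E" using affine_dirD(1)[OF A normed_op] by auto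
 have tP: "mtop ?PM = prod_topology (subtopology TG (VV E)) (top_of_set (Fib E))"
  by (simp add: prod_manifold_def mtop_sub mtop_affine btop_op subtopology_subtopology OF)
 have tS: "mtop ?SM = top_of_set (I \<inter> rg -` VV E)" by (simp add: mtop_sub sub_IM_top)
 have topP: "topspace (mtop ?PM) = VV E \<times> Fib E" unfolding tP using VV(3)[OF E] by auto
 have nD: "nspace (bsub op (Dir E))" by (rule nspace.normed_bsub[OF normed_op Dir_lin[OF E]])
 have aP: "(\<exists>E1 F1. \<exists>a0\<in>Fib E. c = ((Cpl F1 \<inter> VV E) \<times> Fib E, map_prod (gchart E1 F1) (\<lambda>a. bdiff op a a0),
   prod_bspace (SO E1 F1) (bsub op (Dir E))) \<and> E1 \<in> Gr \<and> F1 \<in> Cpl E1)" if "c \<in> atlas ?PM" for c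
  using that atlas_affine[OF A normed_op] by (auto simp: prod_manifold_def atlas_sub_GM)
 note wA = wchart_affine[OF normed_op A]
 have w2: "wchart (top_of_set (Fib E)) (Fib E) (\<lambda>a. bdiff op a a0) (bsub op (Dir E))" if "a0 \<in> Fib E" for a0
  using wA(1)[OF that] by (simp add: btop_op subtopology_subtopology OF)
 have cN1: "continuous_map (prod_topology (subtopology TG (VV E)) (top_of_set (Fib E))) euclidean (\<lambda>z. NN E (fst z))"
  using continuous_map_compose[OF continuous_map_fst continuous_NN[OF E]] by (simp add: comp_def)
 have c1: "continuous_map (mtop ?PM) (mtop ?SM) (Th E)"
  unfolding tP tS continuous_map_in_subtopology
 proof
  show "continuous_map (prod_topology (subtopology TG (VV E)) (top_of_set (Fib E))) euclidean (Th E)"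
   unfolding Th_def[abs_def]
   using continuous_map_into_fulltopology[OF continuous_map_snd]
   by (intro continuous_map_blinfun_compose continuous_map_add continuous_map_diff cN1) auto
  show "Th E \<in> topspace (prod_topology (subtopology TG (VV E)) (top_of_set (Fib E))) \<rightarrow> I \<inter> rg -` VV E"
   using Th_bij[OF E] VV(3)[OF E] by auto
 qed
 have cr: "continuous_map (top_of_set (I \<inter> rg -` VV E)) (subtopology TG (VV E)) rg"
  using continuous_map_from_subtopology_mono[OF continuous_range_map, of "I \<inter> rg -` VV E"]
  by (auto simp: continuous_map_in_subtopology)
 have cN2: "continuous_map (top_of_set (I \<inter> rg -` VV E)) euclidean (\<lambda>R. NN E (rg R))"
  using continuous_map_compose[OF cr continuous_NN[OF E]] by (simp add: comp_def)
 have inv: "inv_into (topspace (mtop ?PM)) (Th E) R = (rg R, Thi E R)" if "R \<in> I \<inter> rg -` VV E" for R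
  unfolding topP using inv_Th[OF E] that by auto
 have "continuous_map (mtop ?SM) (mtop ?PM) (\<lambda>R. (rg R, Thi E R))"
  unfolding tP tS continuous_map_pairwise
 proof
  show "continuous_map (top_of_set (I \<inter> rg -` VV E)) (subtopology TG (VV E)) (fst \<circ> (\<lambda>R. (rg R, Thi E R)))"
   using cr by (simp add: comp_def)
  have "continuous_map (top_of_set (I \<inter> rg -` VV E)) euclidean (Thi E)"
   unfolding Thi_def[abs_def]
   by (intro continuous_map_blinfun_compose continuous_map_add continuous_map_diff cN2)
     (auto intro: continuous_map_from_subtopology)
  then show "continuous_map (top_of_set (I \<inter> rg -` VV E)) (top_of_set (Fib E)) (snd \<circ> (\<lambda>R. (rg R, Thi E R)))"
   using Thi_Fib(1)[OF E] by (auto simp: comp_def continuous_map_in_subtopology Fib_def[of "rg _"])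
 qed
 then have c2: "continuous_map (mtop ?SM) (mtop ?PM) (inv_into (topspace (mtop ?PM)) (Th E))"
  by (rule continuous_map_eq) (use inv tS in auto)
 have "analytic_map ?PM ?SM (Th E)"
 proof (rule analytic_mapI[OF c1])
  show "wchart (mtop ?PM) U p V" if c: "(U, p, V) \<in> atlas ?PM" for U p V
   using aP[OF c] wchart_prod(1)[OF wchart_sub_GM(1)[OF _ _ VV(1)[OF E]] w2] unfolding tP by auto
  show "openin (mtop ?SM) U \<and> nspace V" if c: "(U, p, V) \<in> atlas ?SM" for U p V
  proof -
   obtain U1 V1 W where c: "U = U1 \<inter> I \<inter> rg -` VV E" "V = bsub V1 W" "mchart U1 p V1 W" using c unfolding atlas_sub_IM by blast
   have "openin (top_of_set I) (U1 \<inter> I)" using mchart_is_chart[OF c(3)] by simp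
   then show ?thesis unfolding mtop_sub mtop_IM c using openin_subtopology_Int mchartD(13)[OF c(3)] by blast
  qed
  fix U p V U' p' V' u
  assume c: "(U, p, V) \<in> atlas ?PM" and c': "(U', p', V') \<in> atlas ?SM" and u: "u \<in> U" "Th E u \<in> U'"
  obtain E1 F1 a0 where 1: "a0 \<in> Fib E" "U = (Cpl F1 \<inter> VV E) \<times> Fib E" "p = map_prod (gchart E1 F1) (\<lambda>a. bdiff op a a0)"
   "V = prod_bspace (SO E1 F1) (bsub op (Dir E))" "E1 \<in> Gr" "F1 \<in> Cpl E1" using aP[OF c] by blast
  obtain U1 V1 W where 2: "U' = U1 \<inter> I \<inter> rg -` VV E" "V' = bsub V1 W" "mchart U1 p' V1 W" using c' unfolding atlas_sub_IM by blast
  note s = wchart_sub_GM[OF 1(5,6) VV(1)[OF E]]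
  note nS = normed_sub_ops[OF 1(5,6)]
  note wp = wchart_prod[OF s(1) w2[OF 1(1)]]
  have nV: "nspace V" unfolding 1(4) by (rule normed_prod[OF nS nD])
  have w: "wchart (mtop ?PM) U p V" using wp(1) unfolding tP 1(2-4) .
  \<comment> \<open>\<open>Th E\<close> after the inverse of the product chart: the graph map in the
    base, translation by \<open>a0\<close> in the fibre.\<close>
  define g where "g y = Th E (graph_of E1 (fst y), snd y + a0)" for y
  obtain v Q where u2: "u = (v, Q)" "v \<in> Cpl F1" "v \<in> VV E" "Q \<in> Fib E" using u(1) unfolding 1(2) by blast
  have im: "p ` U = gchart E1 F1 ` (Cpl F1 \<inter> VV E) \<times> Dir E"
   unfolding 1(2,3) map_prod_surj_on[OF refl refl] wA(2)[OF 1(1)] ..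
  have inv_y: "inv_into U p y = (graph_of E1 (fst y), snd y + a0)" if "y \<in> p ` U" for y
   using that wp(2)[of "fst y" "snd y"] s(3) wA(2,3)[OF 1(1)] unfolding im unfolding 1(2,3) by (cases y) auto
  have a0O: "a0 \<in> OP" using 1(1) OF by auto
  define T where "T = gchart E1 F1 v"
  have Tin: "T \<in> gchart E1 F1 ` (Cpl F1 \<inter> VV E)" unfolding T_def using u2 by blast
  have QD: "Q - a0 \<in> Dir E" using affine_dirD(5)[OF A normed_op u2(4) 1(1)] by simp
  have pu: "p u = (T, Q - a0)" unfolding 1(3) u2(1) T_def by simp
  have puV: "p u \<in> car V" unfolding pu 1(4) using s(2)[OF Tin] QD by simp
  have "analytic_at V (SO E1 F1) (p u) fst" "analytic_at V (bsub op (Dir E)) (p u) snd"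
   unfolding 1(4) using puV by (auto intro!: analytic_at_fst[OF nS nD] simp: 1(4))
  note fs = this(1) analytic_at_incl[OF nV normed_op Dir_lin[OF E] this(2)]
  have aN: "analytic_at V op (p u) (\<lambda>y. NN E (graph_of E1 (fst y)))"
   using analytic_at_compose[OF fs(1) _ nV nS normed_op, of "\<lambda>T. NN E (graph_of E1 T)"] analytic_NN[OF E 1(5,6) s(2)[OF Tin]] s(4)[OF Tin]
   unfolding pu by simp
  have ag: "analytic_at V op (p u) g"
   unfolding g_def[abs_def] Th_def fst_conv snd_conv
   by (intro analytic_at_op_mult analytic_at_op_add analytic_at_op_diff analytic_at_op_const nV puV fs(2) aN a0O) auto
  have gI: "g y \<in> I" if "y \<in> p ` U" for y
   using that Th_Fib[OF E, of "graph_of E1 (fst y)" "snd y + a0"] s(4)[of "fst y"] affine_dirD(6)[OF A normed_op 1(1), of "snd y"]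
   unfolding im g_def by (auto simp: Fib_def)
  have gu: "g (p u) = Th E u"
   using inv_y[of "p u"] u(1) w unfolding wchart_def g_def by (metis image_eqI inv_into_f_f)
  obtain r where r: "r > 0" "\<And>h. h \<in> car V ==> bnorm V h < r ==> badd V (p u) h \<in> p ` U"
   using wchart_near[OF w u(1)] by blast
  have "analytic_at V (bsub V1 W) (p u) (\<lambda>y. p' (g y))"
   by (rule mchart_into[OF 2(3) nV ag _ r(1)]) (use gu u(2) gI r(2) in \<open>auto simp: 2(1)\<close>)
  then show "analytic_at V V' (p u) (\<lambda>y. p' (Th E (inv_into U p y)))"
   unfolding 2(2) by (rule wchart_cong[OF w u(1) _ mchartD(13)[OF 2(3)]]) (simp add: inv_y g_def)
 qed
 moreover have "analytic_map ?SM ?PM (inv_into (topspace (mtop ?PM)) (Th E))"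
 proof (rule analytic_mapI[OF c2])
  show "wchart (mtop ?SM) U p V" if c: "(U, p, V) \<in> atlas ?SM" for U p V
  proof -
   obtain U1 V1 W where c: "U = U1 \<inter> I \<inter> rg -` VV E" "V = bsub V1 W" "mchart U1 p V1 W" using c unfolding atlas_sub_IM by blast
   show ?thesis unfolding tS c by (rule wchart_sub_IM(1)[OF c(3) VV(1)[OF E]])
  qed
  show "openin (mtop ?PM) U \<and> nspace V" if c: "(U, p, V) \<in> atlas ?PM" for U p V
  proof -
   obtain E1 F1 a0 where 1: "a0 \<in> Fib E" "U = (Cpl F1 \<inter> VV E) \<times> Fib E"
    "V = prod_bspace (SO E1 F1) (bsub op (Dir E))" "E1 \<in> Gr" "F1 \<in> Cpl E1" using aP[OF c] by blast
   show ?thesis unfolding 1 tP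
    using openin_subtopology_Int[OF openin_complements[OF 1(4,5)]] normed_prod[OF normed_sub_ops[OF 1(4,5)] nD]
    by (auto simp: openin_prod_Times_iff)
  qed
  fix U p V U' p' V' R
  assume c: "(U, p, V) \<in> atlas ?SM" and c': "(U', p', V') \<in> atlas ?PM" and R: "R \<in> U" "inv_into (topspace (mtop ?PM)) (Th E) R \<in> U'"
  obtain U1 V1 W where 2: "U = U1 \<inter> I \<inter> rg -` VV E" "V = bsub V1 W" "mchart U1 p V1 W" using c unfolding atlas_sub_IM by blast
  obtain E1 F1 a0 where 1: "a0 \<in> Fib E" "U' = (Cpl F1 \<inter> VV E) \<times> Fib E" "p' = map_prod (gchart E1 F1) (\<lambda>a. bdiff op a a0)"
   "V' = prod_bspace (SO E1 F1) (bsub op (Dir E))" "E1 \<in> Gr" "F1 \<in> Cpl E1" using aP[OF c'] by blast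
  note w = wchart_sub_IM[OF 2(3) VV(1)[OF E], folded 2(1,2)]
  have nV: "nspace V" unfolding 2(2) by (rule mchartD(13)[OF 2(3)])
  note nS = normed_sub_ops[OF 1(5,6)]
  have RI: "R \<in> U1" "R \<in> I" "rg R \<in> VV E" using R(1) unfolding 2(1) by auto
  have RF: "rg R \<in> Cpl F1" using R(2) inv[of R] RI unfolding 1(2) by auto
  have iR: "inv_into (U1 \<inter> I) p (p R) = R" using RI mchartD(3)[OF 2(3)] by (simp add: inv_into_f_f inj_on_Int)
  define j where "j = inv_into (U1 \<inter> I) p"
  have aj: "analytic_at V op (p R) j" unfolding 2(2) j_def by (rule mchart_inv[OF 2(3) RI(1,2)])
  have a1: "analytic_at V (SO E1 F1) (p R) (\<lambda>y. gchart E1 F1 (rg (j y)))"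
   unfolding 2(2) j_def by (rule range_chart(2)[OF 2(3) RI(1,2) 1(5,6) RF])
  have aN: "analytic_at V op (p R) (\<lambda>y. NN E (rg (j y)))"
   unfolding NN_def j_def 2(2)
   by (intro analytic_at_op_diff analytic_at_op_const range_chart(1)[OF 2(3) RI(1,2) E cE[OF E] RI(3)[unfolded VV_def]]
     mchartD(13)[OF 2(3)] isprojD(1)[OF grassmannianD(5)[OF E cE[OF E]]])
     (use analytic_at_closed(1)[OF mchart_inv[OF 2(3) RI(1,2)] mchartD(13)[OF 2(3)] normed_op] in auto)
  have pV: "p R \<in> car V" by (rule analytic_at_closed(1)[OF aj nV normed_op])
  have a2: "analytic_at V op (p R) (\<lambda>y. Thi E (j y) - a0)"
   unfolding Thi_def
   by (intro analytic_at_op_mult analytic_at_op_add analytic_at_op_diff analytic_at_op_const nV pV aj aN) (use 1(1) OF in auto)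
  have jI: "j y \<in> I \<inter> rg -` VV E" if "y \<in> p ` U" for y using w(3)[OF that] by (simp add: j_def)
  obtain r where r: "r > 0" "\<And>h. h \<in> car V ==> bnorm V h < r ==> badd V (p R) h \<in> p ` U"
   using wchart_near[OF w(1) R(1)] by blast
  have "Thi E (j y) - a0 \<in> Dir E" if y: "y \<in> p ` U" for y
   using affine_dirD(5)[OF A normed_op Thi_Fib(1)[OF E] 1(1), of "rg (j y)" "j y"] jI[OF y] by (simp add: Fib_def)
  then have a3: "analytic_at V (bsub op (Dir E)) (p R) (\<lambda>y. Thi E (j y) - a0)"
   by (intro analytic_at_Dir[OF nV E a2 r(1)]) (use r(2) in auto)
  show "analytic_at V V' (p R) (\<lambda>y. p' (inv_into (topspace (mtop ?PM)) (Th E) (inv_into U p y)))"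
   unfolding 1(4)
   by (rule wchart_cong[OF w(1) R(1) analytic_at_pair[OF nV nS nD a1 a3] normed_prod[OF nS nD]])
     (use inv jI in \<open>simp add: w(2) 1(3) flip: j_def\<close>)
 qed
 moreover have "bij_betw (Th E) (topspace (mtop ?PM)) (topspace (mtop ?SM))"
  unfolding bij_betw_def topP tS using inj_Th[OF E] Th_bij[OF E] by simp
 ultimately show ?thesis
  unfolding analytic_trivialization_def bianalytic_map_def fiber_IM using VV(1,2)[OF E] by auto
qed

end

lemma (in nspace) continuous_map_by_bound:
 assumes "f ` topspace X \<subseteq> car V"
  and "\<And>x. x \<in> topspace X ==> \<exists>r. continuous_map X euclideanreal r \<and> r x = 0 \<and> (\<forall>y\<in>topspace X. bnorm V (bdiff V (f y) (f x)) \<le> r y)"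
 shows "continuous_map X (btop V) f"
 unfolding continuous_map_into_btop
proof (intro conjI ballI allI impI)
 fix x and e :: real assume x: "x \<in> topspace X" and e: "e > 0"
 obtain r where r: "continuous_map X euclideanreal r" "r x = 0" "\<forall>y\<in>topspace X. bnorm V (bdiff V (f y) (f x)) \<le> r y"
  using assms(2)[OF x] by blast
 have "openin X {y \<in> topspace X. r y \<in> {..<e}}" by (rule openin_continuous_map_preimage[OF r(1)]) simp
 then show "\<exists>U. openin X U \<and> x \<in> U \<and> (\<forall>y\<in>U. bnorm V (bdiff V (f y) (f x)) < e)"
  using r(2,3) x e by (intro exI[of _ "{y \<in> topspace X. r y \<in> {..<e}}"]) force
qed (use assms(1) in auto)

context K_banach
begin

subsection \<open>Transition maps\<close>

text \<open>The isomorphism that carries \<open>E1\<close> to \<open>w\<close> by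
  \<open>I + NN E1 w\<close> and then \<open>w\<close> to \<open>E2\<close> by
  \<open>I - NN E2 w\<close>. Its inverse is \<open>TA E2 E1 w\<close>, so the transition map is
  conjugation by it.\<close>

definition TA :: "'a set => 'a set => 'a set => ('a \<Rightarrow>\<^sub>L 'a)" where
 "TA E1 E2 w = (idb - NN E2 w) oL (idb + NN E1 w)"

lemma norm_compose3: "norm (A oL x oL B) \<le> norm A * norm B * norm x" for A x B :: "'a \<Rightarrow>\<^sub>L 'a"
proof -
 have "norm (A oL x oL B) \<le> norm (A oL x) * norm B" by (rule norm_blinfun_compose)
 also have "\<dots> \<le> (norm A * norm x) * norm B" by (intro mult_right_mono norm_blinfun_compose) auto
 finally show ?thesis by (simp add: mult_ac)
qed

lemma norm_compose3_diff:
 "norm ((A oL x oL B) - (A0 oL x oL B0)) \<le> (norm (A - A0) * norm B + norm A0 * norm (B - B0)) * norm x" for A x B :: "'a \<Rightarrow>\<^sub>L 'a"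
proof -
 have "(A oL x oL B) - (A0 oL x oL B0) = ((A - A0) oL x oL B) + (A0 oL x oL (B - B0))"
  by (rule blinfun_eqI) (simp add: ap_diff)
 then show ?thesis
  using norm_triangle_ineq[of "(A - A0) oL x oL B" "A0 oL x oL (B - B0)"] norm_compose3[of "A - A0" x B] norm_compose3[of A0 x "B - B0"]
  by (simp add: algebra_simps)
qed

context
 fixes E1 E2
 assumes E1: "E1 \<in> Gr" and E2: "E2 \<in> Gr"
begin

lemma TA_OP: "w \<in> VV E1 \<inter> VV E2 ==> TA E1 E2 w \<in> OP" "w \<in> VV E1 \<inter> VV E2 ==> TA E2 E1 w \<in> OP"
 unfolding TA_def using NN(1)[OF E1] NN(1)[OF E2] by auto

lemma Thi_Th_eq: "w \<in> VV E1 \<inter> VV E2 ==> x \<in> Fib E1 ==> Thi E2 (Th E1 (w, x)) = TA E1 E2 w oL x oL TA E2 E1 w"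
 using Thi_Th(2)[OF E1, of w x] by (intro blinfun_eqI) (simp add: Thi_def TA_def Th_def)

lemma transition_eq:
 assumes "w \<in> VV E1 \<inter> VV E2"
 shows "transition (mtop IM) rg VV Th E1 E2 w = (\<lambda>x\<in>Fib E1. TA E1 E2 w oL x oL TA E2 E1 w)"
proof -
 have "snd (inv_into (VV E2 \<times> Fib E2) (Th E2) (Th E1 (w, x))) = TA E1 E2 w oL x oL TA E2 E1 w" if x: "x \<in> Fib E1" for x
 proof -
  have "Th E1 (w, x) \<in> I" "rg (Th E1 (w, x)) = w" using Th_Fib[OF E1, of w x] assms x by (auto simp: Fib_def)
  then show ?thesis using inv_Th[OF E2, of "Th E1 (w, x)"] assms Thi_Th_eq[OF assms x] by simp
 qed
 then show ?thesis unfolding transition_def fiber_IM by (auto simp: restrict_def fun_eq_iff)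
qed

lemma TA_Fib: "w \<in> VV E1 \<inter> VV E2 ==> x \<in> Fib E1 ==> TA E1 E2 w oL x oL TA E2 E1 w \<in> Fib E2"
 using Thi_Th_eq Thi_Fib(1)[OF E2] Th_Fib[OF E1] by (metis IntE)

lemma continuous_TA:
 "continuous_map (subtopology TG (VV E1 \<inter> VV E2)) euclidean (TA E1 E2)"
 "continuous_map (subtopology TG (VV E1 \<inter> VV E2)) euclidean (TA E2 E1)"
 unfolding TA_def[abs_def]
 by (intro continuous_map_blinfun_compose continuous_map_add continuous_map_diff
    continuous_map_from_subtopology_mono[OF continuous_NN[OF E1]] continuous_map_from_subtopology_mono[OF continuous_NN[OF E2]]; auto)+

lemma continuous_TA_bound:
 fixes K :: real
 assumes "w0 \<in> VV E1 \<inter> VV E2"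
 defines "r \<equiv> \<lambda>w. K * (norm (TA E1 E2 w - TA E1 E2 w0) * norm (TA E2 E1 w) + norm (TA E1 E2 w0) * norm (TA E2 E1 w - TA E2 E1 w0))"
 shows "continuous_map (subtopology TG (VV E1 \<inter> VV E2)) euclideanreal r" "r w0 = 0"
 unfolding r_def
 by (intro continuous_map_real_mult continuous_map_add continuous_map_norm continuous_map_diff continuous_TA; simp)
   (simp add: r_def)

lemma analytic_TA:
 assumes E: "E \<in> Gr" and F: "F \<in> Cpl E" and T: "T \<in> car (SO E F)" "graph_of E T \<in> VV E1 \<inter> VV E2"
 shows "analytic_at (SO E F) op T (\<lambda>T. TA E1 E2 (graph_of E T))"
  "analytic_at (SO E F) op T (\<lambda>T. TA E2 E1 (graph_of E T))"
 unfolding TA_def using T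
 by (intro analytic_at_op_mult analytic_at_op_add analytic_at_op_diff analytic_at_op_const normed_sub_ops[OF E F]
   analytic_NN[OF E1 E F] analytic_NN[OF E2 E F]; auto)+

context
 fixes a0 assumes a0: "a0 \<in> Fib E1"
begin

abbreviation "BF \<equiv> baff op (Fib E1) a0 op"
abbreviation "AM \<equiv> affine_maps op (Fib E1) op (Fib E2)"

lemma A1: "affine_dir op (Fib E1) (Dir E1)" by (rule Fib_affine[OF E1 a0])
lemma A2: "affine_dir op (Fib E2) (Dir E2)" by (rule Fib_affine[OF E2 pE_Fib[OF E2]])

lemmas BF_carrier = baff_carrier[OF normed_op normed_op A1 a0]
lemmas BF_simps = baff_simps[OF normed_op normed_op A1 a0]
lemmas BF_diff = bdiff_baff_eq[OF normed_op normed_op A1 a0]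
lemmas normed_BF = normed_baff[OF normed_op normed_op A1 a0]

lemma Fib_OP: "x \<in> Fib E1 ==> x \<in> OP" "x \<in> Fib E2 ==> x \<in> OP" "h \<in> Dir E1 ==> h \<in> OP" "h \<in> Dir E1 ==> h + a0 \<in> Fib E1"
 using affine_dirD(1,3)[OF A1 normed_op] affine_dirD(1)[OF A2 normed_op] affine_dirD(6)[OF A1 normed_op a0] by auto

lemma lin_part_sandwich:
 assumes "h \<in> Dir E1"
 shows "lin_part op op a0 (\<lambda>x\<in>Fib E1. A oL x oL B) h = A oL h oL B"
 using a0 Fib_OP(4)[OF assms] unfolding lin_part_def by (simp, intro blinfun_eqI) (simp add: ap_diff)

lemma sandwich_BF:
 assumes "A \<in> OP" "B \<in> OP" shows "(\<lambda>x\<in>Fib E1. A oL x oL B) \<in> car BF"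
proof -
 have "is_linear (bsub op (Dir E1)) op (lin_part op op a0 (\<lambda>x\<in>Fib E1. A oL x oL B))"
  by (rule is_linear_cong[where T = "\<lambda>h. A oL h oL B", OF _ nspace.normed_bsub[OF normed_op Dir_lin[OF E1]]])
    (use assms lin_part_sandwich Fib_OP in \<open>auto intro!: is_linearI blinfun_eqI simp: ap_diff OP_D\<close>)
 moreover have "\<forall>h\<in>car (bsub op (Dir E1)). bnorm op (lin_part op op a0 (\<lambda>x\<in>Fib E1. A oL x oL B) h) \<le> norm A * norm B * bnorm (bsub op (Dir E1)) h"
  using norm_compose3 by (auto simp: lin_part_sandwich)
 ultimately show ?thesis unfolding BF_carrier bounded_lin_def using assms Fib_OP(1) by auto
qed

lemma AM_iff: "S \<in> AM \<longleftrightarrow> S \<in> car BF \<and> S ` Fib E1 \<subseteq> Fib E2"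
 using Fib_OP(2) unfolding affine_maps_def baff_def by (auto simp: affine_map_def)

text \<open>The direction of the affine space \<open>AM\<close>: differences of two maps into
  \<open>Fib E2\<close> take values in \<open>Dir E2\<close>.\<close>

definition DM :: "(('a \<Rightarrow>\<^sub>L 'a) => ('a \<Rightarrow>\<^sub>L 'a)) set" where
 "DM = {S \<in> car BF. S ` Fib E1 \<subseteq> Dir E2}"

lemma DM_lin: "lin_subspace BF DM"
proof -
 interpret B: nspace BF by (rule normed_BF)
 have z: "bzero BF \<in> car BF" and s: "bscale BF c S \<in> car BF" and a: "badd BF S T \<in> car BF"
  if "S \<in> car BF" "T \<in> car BF" for S T c using that by auto
 note B.zero_closed
 then show ?thesis
  using Dir_lin[OF E2] B.add_closed B.scale_closed unfolding lin_subspace_def DM_def BF_simps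
  by (auto simp: image_subset_iff)
qed

lemma AM_affine: assumes S0: "S0 \<in> AM" shows "affine_dir BF AM DM"
proof (rule affine_dirI[OF normed_BF DM_lin])
 interpret B: nspace BF by (rule normed_BF)
 have S0B: "S0 \<in> car BF" "\<And>x. x \<in> Fib E1 ==> S0 x \<in> Fib E2" using S0 AM_iff by auto
 then show "S0 \<in> car BF" by simp
 show "AM = (\<lambda>h. badd BF h S0) ` DM"
 proof (intro equalityI subsetI)
  fix S assume "S \<in> AM"
  then have S: "S \<in> car BF" "\<And>x. x \<in> Fib E1 ==> S x \<in> Fib E2" using AM_iff by auto
  have "bdiff BF S S0 \<in> DM"
   using B.diff_closed[OF S(1) S0B(1)] affine_dirD(5)[OF A2 normed_op S(2) S0B(2)] unfolding DM_def BF_diff by auto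
  moreover have "S = badd BF (bdiff BF S S0) S0" using S S0B by simp
  ultimately show "S \<in> (\<lambda>h. badd BF h S0) ` DM" by blast
 next
  fix S assume "S \<in> (\<lambda>h. badd BF h S0) ` DM"
  then obtain h where h: "h \<in> DM" "S = badd BF h S0" by blast
  have hB: "h \<in> car BF" "\<And>x. x \<in> Fib E1 ==> h x \<in> Dir E2" using h(1) by (auto simp: DM_def)
  have "badd op (h x) (S0 x) \<in> Fib E2" if "x \<in> Fib E1" for x
   using affine_dirD(6)[OF A2 normed_op S0B(2)[OF that] hB(2)[OF that]] .
  moreover have "S \<in> car BF" unfolding h(2) using B.add_closed[OF hB(1) S0B(1)] .
  ultimately show "S \<in> AM" unfolding AM_iff unfolding h(2) BF_simps by auto
 qed
qed

abbreviation "tr \<equiv> transition (mtop IM) rg VV Th E1 E2"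

lemma tr_AM: "w \<in> VV E1 \<inter> VV E2 ==> tr w \<in> AM"
 unfolding AM_iff transition_eq using sandwich_BF[OF TA_OP] TA_Fib by auto

text \<open>Transition maps have the form \<open>x \<mapsto> A x B\<close>. The difference of two of
  them is bounded by \<open>\<rho> w * norm x\<close>, both for the linear part and for the value at
  \<open>a0\<close>, so in the norm of \<open>baff\<close> by
  \<open>(1 + norm a0) * \<rho> w\<close>, which is continuous and vanishes at
  \<open>w0\<close>.\<close>

lemma continuous_tr: "continuous_map (subtopology TG (VV E1 \<inter> VV E2)) (subtopology (btop BF) AM) tr"
 unfolding continuous_map_in_subtopology
proof
 interpret B: nspace BF by (rule normed_BF)
 have top: "topspace (subtopology TG (VV E1 \<inter> VV E2)) = VV E1 \<inter> VV E2" using VV(3)[OF E1] by auto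
 show "tr \<in> topspace (subtopology TG (VV E1 \<inter> VV E2)) \<rightarrow> AM" unfolding top using tr_AM by blast
 show "continuous_map (subtopology TG (VV E1 \<inter> VV E2)) (btop BF) tr"
 proof (rule B.continuous_map_by_bound, unfold top)
  show "tr ` (VV E1 \<inter> VV E2) \<subseteq> car BF" using tr_AM AM_iff by blast
  fix w0 assume w0: "w0 \<in> VV E1 \<inter> VV E2"
  define \<rho> where "\<rho> w = norm (TA E1 E2 w - TA E1 E2 w0) * norm (TA E2 E1 w) + norm (TA E1 E2 w0) * norm (TA E2 E1 w - TA E2 E1 w0)" for w
  have "bnorm BF (bdiff BF (tr w) (tr w0)) \<le> (1 + norm a0) * \<rho> w" if w: "w \<in> VV E1 \<inter> VV E2" for w
  proof -
   have d: "bdiff BF (tr w) (tr w0) = (\<lambda>x\<in>Fib E1. (TA E1 E2 w oL x oL TA E2 E1 w) - (TA E1 E2 w0 oL x oL TA E2 E1 w0))"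
    unfolding BF_diff transition_eq[OF w] transition_eq[OF w0] by (auto simp: restrict_def fun_eq_iff)
   have "bnorm BF (bdiff BF (tr w) (tr w0)) \<le> \<rho> w + \<rho> w * norm a0"
   proof (rule baff_norm_le[OF normed_op normed_op A1 a0])
    show "bnorm op (lin_part op op a0 (bdiff BF (tr w) (tr w0)) h) \<le> \<rho> w * bnorm op h" if h: "h \<in> Dir E1" for h
    proof -
     have "lin_part op op a0 (bdiff BF (tr w) (tr w0)) h = (TA E1 E2 w oL h oL TA E2 E1 w) - (TA E1 E2 w0 oL h oL TA E2 E1 w0)"
      unfolding d lin_part_def using a0 Fib_OP(4)[OF h] by (simp, intro blinfun_eqI) (simp add: ap_diff)
     then show ?thesis using norm_compose3_diff[of "TA E1 E2 w" h "TA E2 E1 w"] by (simp add: \<rho>_def)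
    qed
    show "bnorm op (bdiff BF (tr w) (tr w0) a0) \<le> \<rho> w * norm a0"
     unfolding d using norm_compose3_diff[of "TA E1 E2 w" a0 "TA E2 E1 w"] a0 by (simp add: \<rho>_def)
   qed (simp add: \<rho>_def)
   then show ?thesis by (simp add: algebra_simps)
  qed
  then show "\<exists>r. continuous_map (subtopology TG (VV E1 \<inter> VV E2)) euclideanreal r \<and> r w0 = 0 \<and>
    (\<forall>w\<in>VV E1 \<inter> VV E2. bnorm BF (bdiff BF (tr w) (tr w0)) \<le> r w)"
   using continuous_TA_bound[OF w0, of "1 + norm a0"] unfolding \<rho>_def by blast
 qed
qed

text \<open>The direction space of the affine maps has no obvious complement, so the coefficients of the expansion
 are moved into it by composing with a projection of \<open>OP\<close> onto \<open>Dir E2\<close>.\<close>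

lemma analytic_tr:
 assumes E: "E \<in> Gr" and F: "F \<in> Cpl E" and T: "T \<in> car (SO E F)" "graph_of E T \<in> VV E1 \<inter> VV E2"
  and S0: "S0 \<in> AM" and d: "d > 0" "\<And>h. h \<in> car (SO E F) ==> bnorm (SO E F) h < d ==>
   graph_of E (badd (SO E F) T h) \<in> VV E1 \<inter> VV E2"
 shows "analytic_at (SO E F) (bsub BF DM) T (\<lambda>T. bdiff BF (tr (graph_of E T)) S0)"
proof -
 interpret B: nspace BF by (rule normed_BF)
 note nS = normed_sub_ops[OF E F]
 note nW = B.normed_bsub[OF DM_lin]
 define P where "P = proj E2 (cE E2)"
 note p = isprojD[OF grassmannianD(5)[OF E2 cE[OF E2]], folded P_def]
 define Q where "Q = idb - P"
 have Q: "Q \<in> OP" using p(1) by (simp add: Q_def)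
 define b where "b A B = (\<lambda>x\<in>Fib E1. (P oL A) oL x oL (B oL Q))" for A B
 have PQ: "P oL H oL Q \<in> Dir E2" if "H \<in> OP" for H
  unfolding Dir_def using that p(1-3) Q by (auto simp: Q_def) (simp add: ap_diff)
 have PQ2: "P oL H oL Q = H" if "H \<in> Dir E2" for H
  using that p(2,3) by (intro blinfun_eqI) (auto simp: Dir_def Q_def ap_diff)
 have bDM: "b A B \<in> DM" if "A \<in> OP" "B \<in> OP" for A B
 proof -
  have "(P oL A) oL x oL (B oL Q) \<in> Dir E2" if x: "x \<in> Fib E1" for x
  proof -
   have "(P oL A) oL x oL (B oL Q) = P oL (A oL x oL B) oL Q" by (rule blinfun_eqI) simp
   then show ?thesis using PQ[of "A oL x oL B"] \<open>A \<in> OP\<close> \<open>B \<in> OP\<close> Fib_OP(1)[OF x] by auto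
  qed
  moreover have "b A B \<in> car BF" unfolding b_def using that p(1) Q by (intro sandwich_BF) auto
  ultimately show ?thesis unfolding DM_def by (auto simp: b_def)
 qed
 have ab: "analytic_at (SO E F) (bsub BF DM) T (\<lambda>T. b (TA E1 E2 (graph_of E T)) (TA E2 E1 (graph_of E T)))"
 proof (rule analytic_at_bilinear[where K = "norm P * norm Q * (1 + norm a0)", OF nS normed_op normed_op nW _ _ _ analytic_TA[OF E F T]])
  show "is_linear op (bsub BF DM) (\<lambda>A. b A B)" if "B \<in> car op" for B
   using that bDM p(1) by (intro is_linearI) (auto simp: BF_simps b_def restrict_def fun_eq_iff ap_diff OP_D intro!: blinfun_eqI)
  show "is_linear op (bsub BF DM) (b A)" if "A \<in> car op" for A
   using that bDM p(1) Fib_OP(1) by (intro is_linearI) (auto simp: BF_simps b_def restrict_def fun_eq_iff ap_diff OP_D intro!: blinfun_eqI)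
  show "bnorm (bsub BF DM) (b A B) \<le> norm P * norm Q * (1 + norm a0) * (bnorm op A * bnorm op B)" for A B
  proof -
   define C where "C = norm P * norm A * (norm B * norm Q)"
   have le: "norm ((P oL A) oL x oL (B oL Q)) \<le> C * norm x" for x
   proof -
    have "norm (P oL A) * norm (B oL Q) \<le> C" unfolding C_def by (intro mult_mono norm_blinfun_compose) auto
    then show ?thesis using norm_compose3[of "P oL A" x "B oL Q"] mult_right_mono[of _ C "norm x"] by (meson norm_ge_zero order_trans)
   qed
   have "bnorm BF (b A B) \<le> C + C * norm a0"
    unfolding b_def by (rule baff_norm_le[OF normed_op normed_op A1 a0]) (use le a0 in \<open>auto simp: lin_part_sandwich C_def\<close>)
   then show ?thesis by (simp add: C_def algebra_simps)
  qed
 qed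
 \<comment> \<open>Compressing by \<open>P\<close> and \<open>Q\<close> changes the transition map
   only by something independent of the base point, because differences of transition maps have
   values in \<open>Dir E2\<close> and are left fixed. The constant \<open>c\<close> accounts for
   this and for \<open>S0\<close>.\<close>
 define c where "c = bdiff BF (bdiff BF (tr (graph_of E T)) S0) (b (TA E1 E2 (graph_of E T)) (TA E2 E1 (graph_of E T)))"
 note M = AM_affine[OF S0]
 have trS: "bdiff BF (tr (graph_of E T)) S0 \<in> DM" by (rule affine_dirD(5)[OF M normed_BF tr_AM[OF T(2)] S0])
 have c: "c \<in> DM" unfolding c_def
  by (rule B.lin_subspace_diff[OF DM_lin trS]) (use bDM TA_OP[OF T(2)] in auto)
 have "analytic_at (SO E F) (bsub BF DM) T (\<lambda>T. badd (bsub BF DM) (b (TA E1 E2 (graph_of E T)) (TA E2 E1 (graph_of E T))) c)"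
  by (intro analytic_at_add nS nW ab analytic_at_const T(1)) (use c in simp)
 then show ?thesis
 proof (rule analytic_at_cong[OF _ nW d(1)])
  fix h assume h: "h \<in> car (SO E F)" "bnorm (SO E F) h < d"
  define \<omega> where "\<omega> = graph_of E (badd (SO E F) T h)"
  define \<omega>0 where "\<omega>0 = graph_of E T"
  have \<omega>: "\<omega> \<in> VV E1 \<inter> VV E2" "\<omega>0 \<in> VV E1 \<inter> VV E2" using d(2)[OF h] T(2) by (auto simp: \<omega>_def \<omega>0_def)
  have "b (TA E1 E2 \<omega>) (TA E2 E1 \<omega>) x + (tr \<omega>0 x - S0 x - b (TA E1 E2 \<omega>0) (TA E2 E1 \<omega>0) x) = tr \<omega> x - S0 x" if x: "x \<in> Fib E1" for x
  proof -
   define y where "y = TA E1 E2 \<omega> oL x oL TA E2 E1 \<omega>"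
   define y0 where "y0 = TA E1 E2 \<omega>0 oL x oL TA E2 E1 \<omega>0"
   have "y - y0 \<in> Dir E2"
    using affine_dirD(5)[OF A2 normed_op TA_Fib[OF \<omega>(1) x] TA_Fib[OF \<omega>(2) x]] by (simp add: y_def y0_def)
   then have "P oL (y - y0) oL Q = y - y0" by (rule PQ2)
   moreover have "P oL (y - y0) oL Q = b (TA E1 E2 \<omega>) (TA E2 E1 \<omega>) x - b (TA E1 E2 \<omega>0) (TA E2 E1 \<omega>0) x"
    using x by (intro blinfun_eqI) (simp add: b_def y_def y0_def ap_diff)
   ultimately have e: "b (TA E1 E2 \<omega>) (TA E2 E1 \<omega>) x - b (TA E1 E2 \<omega>0) (TA E2 E1 \<omega>0) x = y - y0" by simp
   have "tr \<omega> x = y" "tr \<omega>0 x = y0" unfolding transition_eq[OF \<omega>(1)] transition_eq[OF \<omega>(2)] y_def y0_def using x by simp_all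
   then show ?thesis using e by (simp add: algebra_simps)
  qed
  then show "badd (bsub BF DM) (b (TA E1 E2 (graph_of E (badd (SO E F) T h))) (TA E2 E1 (graph_of E (badd (SO E F) T h)))) c
    = bdiff BF (tr (graph_of E (badd (SO E F) T h))) S0"
   unfolding \<omega>_def[symmetric] c_def \<omega>0_def[symmetric] by (auto simp: BF_simps BF_diff restrict_def fun_eq_iff)
 qed
qed

lemma analytic_map_tr:
 assumes ne: "VV E1 \<inter> VV E2 \<noteq> {}"
 shows "analytic_map (open_submanifold GM (VV E1 \<inter> VV E2)) (affine_manifold BF AM) tr"
proof (rule analytic_mapI)
 obtain w where "w \<in> VV E1 \<inter> VV E2" using ne by blast
 then have "affine_dir BF AM DM" by (rule AM_affine[OF tr_AM])
 note M = this
 have S: "openin TG (VV E1 \<inter> VV E2)" using VV(1)[OF E1] VV(1)[OF E2] by blast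
 note nW = nspace.normed_bsub[OF normed_BF DM_lin]
 show "continuous_map (mtop (open_submanifold GM (VV E1 \<inter> VV E2))) (mtop (affine_manifold BF AM)) tr"
  unfolding mtop_sub mtop_affine by (rule continuous_tr)
 show "wchart (mtop (open_submanifold GM (VV E1 \<inter> VV E2))) U p V" if "(U, p, V) \<in> atlas (open_submanifold GM (VV E1 \<inter> VV E2))" for U p V
  using that wchart_sub_GM(1)[OF _ _ S] unfolding atlas_sub_GM mtop_sub by auto
 show "openin (mtop (affine_manifold BF AM)) U \<and> nspace V" if "(U, p, V) \<in> atlas (affine_manifold BF AM)" for U p V
 proof -
  have "U = AM" "V = bsub BF DM" using that unfolding atlas_affine[OF M normed_BF] by auto
  moreover have "topspace (subtopology (btop BF) AM) = AM"
   using affine_dirD(1)[OF M normed_BF] nspace.topspace_btop[OF normed_BF] by auto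
  ultimately show ?thesis unfolding mtop_affine using nW openin_topspace by metis
 qed
 fix U p V U' p' V' w
 assume c: "(U, p, V) \<in> atlas (open_submanifold GM (VV E1 \<inter> VV E2))" and c': "(U', p', V') \<in> atlas (affine_manifold BF AM)"
  and w: "w \<in> U"
 obtain E F where 1: "U = Cpl F \<inter> (VV E1 \<inter> VV E2)" "p = gchart E F" "V = SO E F" "E \<in> Gr" "F \<in> Cpl E"
  using c unfolding atlas_sub_GM by blast
 obtain S0 where 2: "S0 \<in> AM" "p' = (\<lambda>S. bdiff BF S S0)" "V' = bsub BF DM" using c' unfolding atlas_affine[OF M normed_BF] by blast
 note s = wchart_sub_GM[OF 1(4,5) S, folded 1(1-3)]
 have T: "p w \<in> p ` U" using w by blast
 obtain r where r: "r > 0" "\<And>h. h \<in> car V ==> bnorm V h < r ==> badd V (p w) h \<in> p ` U"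
  using wchart_near[OF s(1) w] by blast
 have "analytic_at V V' (p w) (\<lambda>T. bdiff BF (tr (graph_of E T)) S0)"
  unfolding 1(3) 2(3)
 proof (rule analytic_tr[OF 1(4,5) _ _ 2(1) r(1)])
  show "p w \<in> car (SO E F)" using s(2)[OF T] 1(3) by simp
  show "graph_of E (p w) \<in> VV E1 \<inter> VV E2" using s(4)[OF T] 1(1) by blast
  fix h assume "h \<in> car (SO E F)" "bnorm (SO E F) h < r"
  then have "badd (SO E F) (p w) h \<in> p ` U" using r(2) 1(3) by simp
  then show "graph_of E (badd (SO E F) (p w) h) \<in> VV E1 \<inter> VV E2" using s(4) 1(1) by blast
 qed
 then show "analytic_at V V' (p w) (\<lambda>y. p' (tr (inv_into U p y)))"
  unfolding 2(2) by (rule wchart_cong[OF s(1) w]) (use nW s(3) 2(3) in auto)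
qed

end

end

lemma range_map_onto: "rg ` I = Gr"
proof
 show "Gr \<subseteq> rg ` I"
 proof
  fix E assume "E \<in> Gr"
  then have "proj E (cE E) \<in> Fib E" by (rule pE_Fib)
  then show "E \<in> rg ` I" by (auto simp: Fib_def)
 qed
qed (use idempotentsD(5) in auto)

theorem analytic_affine_banach_bundle_IM: "analytic_affine_banach_bundle IM GM rg (\<lambda>E. op)"
 unfolding analytic_affine_banach_bundle_def
proof (intro conjI)
 show "\<exists>V \<Theta>. (\<forall>w0\<in>topspace TG. analytic_trivialization IM GM rg (\<lambda>E. op) w0 (V w0) (\<Theta> w0) \<and>
   fiberwise_affine (mtop IM) rg (\<lambda>E. op) w0 (V w0) (\<Theta> w0)) \<and> analytic_transitions IM GM rg (\<lambda>E. op) V \<Theta>"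
 proof (intro exI conjI ballI)
  show "analytic_trivialization IM GM rg (\<lambda>E. op) E (VV E) (Th E)"
   "fiberwise_affine (mtop IM) rg (\<lambda>E. op) E (VV E) (Th E)" if "E \<in> topspace TG" for E
   using that analytic_trivialization_Th fiberwise_affine_IM by auto
  show "analytic_transitions IM GM rg (\<lambda>E. op) VV Th"
   unfolding analytic_transitions_def fiber_IM using analytic_map_tr by auto
 qed
qed (use banach_manifold_IM banach_manifold_GM analytic_range_map affine_fibers_IM range_map_onto in auto)

end

context K_banach
begin

subsection \<open>A global continuous section\<close>

abbreviation "gap E E' \<equiv> dist (gap_fun E) (gap_fun E')"

text \<open>For a unit vector the normalisation \<open>1 + norm z\<close> equals 2, so its distance
  to \<open>E\<close> is at most twice the gap. General \<open>y\<close> follow by scaling.\<close>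

lemma gap_approx:
 assumes E: "E \<in> Gr" and E': "E' \<in> Gr" and t: "2 * gap E E' < t" and y: "y \<in> E'"
 shows "\<exists>e\<in>E. norm (y - e) \<le> t * norm y"
proof (cases "y = 0")
 case True
 then show ?thesis using grassmannian_zero(1)[OF E] by (intro bexI[of _ 0]) auto
next
 case False
 have scale: "r *\<^sub>R x \<in> W" if "W \<in> Gr" "x \<in> W" for r x W
  using grassmannianD(1)[OF that(1)] that(2) unfolding closed_lin_whole lin_subspace_whole scale_of_real[symmetric] by blast
 define z where "z = (1 / norm y) *\<^sub>R y"
 have z: "z \<in> E'" "norm z = 1" using scale[OF E' y] False by (auto simp: z_def)
 have "infdist z E' = 0" using z(1) by simp
 then have "infdist z E / 2 \<le> gap E E'"
  using dist_bounded[of "gap_fun E" z "gap_fun E'"] z(2) infdist_nonneg[of z E] grassmannian_zero(1)[OF E] grassmannian_zero(1)[OF E']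
  by (simp add: gap_fun_apply dist_real_def)
 then have "infdist z E < t" using t by simp
 then have "(INF a\<in>E. dist z a) < t" using grassmannian_zero(1)[OF E] infdist_notempty[of E z] by force
 then obtain e where e: "e \<in> E" "dist z e < t" using grassmannian_zero(1)[OF E] by (subst (asm) cINF_less_iff) auto
 have "y - norm y *\<^sub>R e = norm y *\<^sub>R (z - e)" using False by (simp add: z_def algebra_simps)
 then have "norm (y - norm y *\<^sub>R e) = norm y * dist z e" by (simp add: dist_norm)
 also have "\<dots> \<le> t * norm y" using mult_left_mono[of "dist z e" t "norm y"] e(2) by (simp add: mult.commute)
 finally show ?thesis using scale[OF E e(1)] by blast
qed

text \<open>If \<open>E'\<close> is near \<open>E\<close>, then \<open>P\<close> is bounded below on
  \<open>E'\<close>, so it is injective there with closed image in \<open>E\<close>. The image is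
  all of \<open>E\<close>: from any of its points the distance to \<open>e\<close> can be halved by
  approximating the difference in \<open>E'\<close>. So \<open>P\<close> maps \<open>E'\<close>
  bijectively onto \<open>E\<close>, and \<open>E'\<close> is a complement of the kernel
  \<open>F\<close>.\<close>

lemma complements_gap_open:
 assumes E: "E \<in> Gr" and F: "F \<in> Cpl E"
 shows "\<exists>r>0. \<forall>E'\<in>Gr. gap E E' < r --> E' \<in> Cpl F"
proof -
 define P where "P = proj E F"
 note p = isprojD[OF grassmannianD(5)[OF E F], folded P_def]
 note lE = grassmannianD(1)[OF E, unfolded closed_lin_whole lin_subspace_whole]
 have Ediff: "x - y \<in> E" if "x \<in> E" "y \<in> E" for x y
  using that lE p(3) p(2)[of "x - y"] by (metis ap_diff(5))
 define K where "K = norm P + norm (idb - P) + 1"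
 have K: "K > 0" by (simp add: K_def add_nonneg_pos)
 \<comment> \<open>Chosen so that \<open>norm P * t\<close> and \<open>norm (I - P) * t\<close> are
   at most 1/2, for the halving step and for the lower bound respectively.\<close>
 define t where "t = 1 / (2 * K)"
 have t: "t > 0" "norm P * t \<le> 1 / 2" "norm (idb - P) * t \<le> 1 / 2" using K by (auto simp: t_def K_def field_simps)
 have "E' \<in> Cpl F" if E': "E' \<in> Gr" and g: "gap E E' < t / 2" for E'
 proof -
  have g1: "2 * gap E E' < t" and g2: "2 * gap E' E < t" using g by (auto simp: dist_commute)
  note lE' = grassmannianD(1)[OF E', unfolded closed_lin_whole lin_subspace_whole]
  have half: "norm (ap (idb - P) y) \<le> norm y / 2" if y: "y \<in> E'" for y
  proof -
   obtain e where e: "e \<in> E" "norm (y - e) \<le> t * norm y" using gap_approx[OF E E' g1 y] by blast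
   have "ap (idb - P) y = ap (idb - P) (y - e)" using p(3)[OF e(1)] by (simp add: ap_diff)
   then have "norm (ap (idb - P) y) \<le> norm (idb - P) * norm (y - e)" using norm_blinfun by metis
   also have "\<dots> \<le> norm (idb - P) * (t * norm y)" using e(2) by (intro mult_left_mono) auto
   also have "\<dots> \<le> (1 / 2) * norm y" using t(3) by (simp only: mult.assoc[symmetric]) (intro mult_right_mono, auto)
   finally show ?thesis by simp
  qed
  have low: "norm (ap P y) \<ge> (1 / 2) * norm y" if y: "y \<in> E'" for y
   using half[OF y] norm_triangle_ineq[of "ap P y" "y - ap P y"] by (simp add: ap_diff)
  have "complete (ap P ` E')"
  proof (rule complete_isometric_image[where e = "1 / 2"])
   show "Real_Vector_Spaces.subspace E'" by (rule real_vector.subspaceI) (use lE' in \<open>auto simp: scale_of_real[symmetric]\<close>)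
   show "complete E'" using lE' by (simp add: complete_eq_closed)
  qed (use low blinfun.bounded_linear_right in auto)
  then have cl: "closed (ap P ` E')" by (simp add: complete_eq_closed)
  have onto: "e \<in> ap P ` E'" if e: "e \<in> E" for e
  proof -
   define \<delta> where "\<delta> = infdist e (ap P ` E')"
   have ne: "ap P ` E' \<noteq> {}" using lE' by auto
   \<comment> \<open>The improved point \<open>w + P y\<close> is again in the image, at most half
     as far from \<open>e\<close>. As \<open>w\<close> is arbitrary, the infimum satisfies
     \<open>2 * \<delta> \<le> \<delta>\<close>.\<close>
   have "2 * \<delta> \<le> dist e w" if w: "w \<in> ap P ` E'" for w
   proof -
    have ew: "e - w \<in> E" using Ediff[OF e] w p(2) by auto
    obtain y where y: "y \<in> E'" "norm (e - w - y) \<le> t * norm (e - w)" using gap_approx[OF E' E g2 ew] by blast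
    have "e - w - ap P y = ap P (e - w - y)" using p(3)[OF ew] by (simp add: ap_diff)
    then have "norm (e - w - ap P y) \<le> norm P * norm (e - w - y)" using norm_blinfun by metis
    also have "\<dots> \<le> norm P * (t * norm (e - w))" using y(2) by (intro mult_left_mono) auto
    also have "\<dots> \<le> (1 / 2) * norm (e - w)" using t(2) by (simp only: mult.assoc[symmetric]) (intro mult_right_mono, auto)
    finally have "dist e (w + ap P y) \<le> dist e w / 2" by (simp add: dist_norm algebra_simps)
    moreover have "w + ap P y \<in> ap P ` E'"
    proof -
     obtain y' where "y' \<in> E'" "w = ap P y'" using w by blast
     then show ?thesis using y(1) lE' by (intro image_eqI[of _ _ "y' + y"]) (auto simp: ap_diff)
    qed
    ultimately show ?thesis using infdist_le[of "w + ap P y" "ap P ` E'" e] by (simp add: \<delta>_def)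
   qed
   then have "2 * \<delta> \<le> \<delta>" unfolding \<delta>_def infdist_notempty[OF ne] by (intro cINF_greatest[OF ne]) (simp add: infdist_notempty[OF ne])
   then have "\<delta> = 0" using infdist_nonneg[of e "ap P ` E'"] by (simp add: \<delta>_def)
   then show ?thesis using in_closed_iff_infdist_zero[OF cl ne] by (simp add: \<delta>_def)
  qed
  have F0: "F = {x. ap P x = 0}" unfolding P_def by (rule isproj_sets(2)[OF grassmannianD(5)[OF E F]])
  have "F \<inter> E' = {0}"
   using low lE' by (auto simp: F0 ap_diff) (use low in fastforce)
  moreover have "\<exists>f y. v = f + y \<and> f \<in> F \<and> y \<in> E'" for v
  proof -
   obtain y where y: "y \<in> E'" "ap P v = ap P y" using onto[OF p(2)[of v]] by auto
   then show ?thesis by (intro exI[of _ "v - y"] exI[of _ y]) (simp add: F0 ap_diff)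
  qed
  then have "{badd X x y | x y. x \<in> F \<and> y \<in> E'} = car X" by auto
  ultimately show ?thesis using grassmannianD(1)[OF E'] by (simp add: complements_of_def closed_complements_def)
 qed
 then show ?thesis using t(1) by (intro exI[of _ "t / 2"]) auto
qed

lemma TG_limit_continuous:
 fixes f :: "'a set => 'z::real_normed_vector"
 assumes "\<And>E. E \<in> Gr ==> \<exists>U g. openin TG U \<and> E \<in> U \<and> continuous_map (subtopology TG U) euclidean g \<and> (\<forall>E'\<in>U. g E' = f E')"
 shows "continuous_map TG euclidean f"
 unfolding continuous_map_def
proof (intro conjI allI impI)
 fix S :: "'z set" assume S: "openin euclidean S"
 have "\<exists>T. openin TG T \<and> E \<in> T \<and> T \<subseteq> {E \<in> topspace TG. f E \<in> S}" if "E \<in> {E \<in> topspace TG. f E \<in> S}" for E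
 proof -
  have E: "E \<in> Gr" "f E \<in> S" using that by auto
  obtain U g where U: "openin TG U" "E \<in> U" "continuous_map (subtopology TG U) euclidean g" "\<forall>E'\<in>U. g E' = f E'"
   using assms[OF E(1)] by blast
  have "openin (subtopology TG U) {x \<in> topspace (subtopology TG U). g x \<in> S}" by (rule openin_continuous_map_preimage[OF U(3) S])
  then have "openin TG {x \<in> topspace (subtopology TG U). g x \<in> S}" using U(1) openin_trans_full by blast
  moreover have "U \<subseteq> Gr" using openin_subset[OF U(1)] by simp
  ultimately show ?thesis using U E by (intro exI[of _ "{x \<in> topspace (subtopology TG U). g x \<in> S}"]) auto
 qed
 then show "openin TG {E \<in> topspace TG. f E \<in> S}" using openin_subopen by blast
qed auto

text \<open>
 Stone's argument. Well-order the subspaces \<open>b\<close>; the sets \<open>D n b\<close> of those \<open>E\<close> whose first chart domain is \<open>VV b\<close> and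
 whose ball of radius \<open>1 / (n + 1)\<close> is contained in \<open>VV b\<close> are \<open>1 / (n + 1)\<close>-separated for different \<open>b\<close>. Bump functions around
 them glue the local sections \<open>E \<mapsto> proj E (cE b)\<close> for each \<open>n\<close>, and the results are averaged over \<open>n\<close> by a uniformly
 convergent series, so that no local finiteness is needed.
\<close>

lemma local_sections:
 "\<exists>u v. continuous_map TG euclideanreal u \<and> continuous_map TG euclidean v \<and>
   (\<forall>E\<in>Gr. 0 \<le> u E \<and> v E \<in> OP \<and> (\<forall>x. ap (v E) x \<in> E) \<and> (\<forall>x\<in>E. ap (v E) x = u E *\<^sub>R x)) \<and>
   (\<forall>E\<in>Gr. (\<exists>b\<in>Gr. E \<in> VV b \<and> (\<forall>c\<in>Gr. E \<in> VV c --> (b, c) \<in> r) \<and>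
    (\<forall>E'\<in>Gr. gap E E' < e --> E' \<in> VV b)) --> 0 < u E)"
 if wo: "well_order_on (Gr) r" and e: "e > 0"
proof -
 define D where "D b = {E \<in> Gr. E \<in> VV b \<and> (\<forall>c\<in>Gr. E \<in> VV c --> (b, c) \<in> r) \<and>
    (\<forall>E'\<in>Gr. gap E E' < e --> E' \<in> VV b)}" for b
 define DD where "DD = (\<Union>b\<in>Gr. D b)"
 have tot: "(b, c) \<in> r \<or> (c, b) \<in> r" if "b \<in> Gr" "c \<in> Gr" "b \<noteq> c" for b c
  using wo that unfolding well_order_on_def linear_order_on_def total_on_def by blast
 have anti: "b = c" if "(b, c) \<in> r" "(c, b) \<in> r" for b c
  using wo that unfolding well_order_on_def linear_order_on_def partial_order_on_def antisym_def by blast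
 have sep: "b = c" if "E \<in> D b" "E' \<in> D c" "b \<in> Gr" "c \<in> Gr" "gap E E' < e" for b c E E'
 proof -
  have "E' \<in> VV b" "E \<in> VV c" using that by (auto simp: D_def dist_commute)
  then show ?thesis using that anti by (auto simp: D_def)
 qed
 \<comment> \<open>\<open>infdist\<close> to the empty set is 0, which would make the bump positive
   everywhere; hence the case distinction.\<close>
 define u where "u E = (if DD = {} then 0 else max 0 (e / 3 - infdist (gap_fun E) (gap_fun ` DD)))" for E
 have cu: "continuous_map TG euclideanreal u"
 proof (cases "DD = {}")
  case False
  have "continuous_map TG euclideanreal (\<lambda>E. infdist (gap_fun E) (gap_fun ` DD))"
   using continuous_map_compose[OF continuous_gap_fun, of euclideanreal "\<lambda>z. infdist z (gap_fun ` DD)"]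
    continuous_on_infdist[OF continuous_on_id, of UNIV "gap_fun ` DD"] by (simp add: comp_def)
  then show ?thesis unfolding u_def using False
   by (simp only: if_False) (intro continuous_map_real_max continuous_map_diff; simp)
 qed (simp add: u_def[abs_def])
 have u0: "0 \<le> u E" for E by (simp add: u_def)
 have near: "\<exists>b\<in>Gr. \<exists>E'\<in>D b. gap E E' < e / 3" if "u E > 0" for E
 proof -
  have "DD \<noteq> {}" and "infdist (gap_fun E) (gap_fun ` DD) < e / 3" using that by (auto simp: u_def split: if_splits)
  then have "(INF g\<in>gap_fun ` DD. dist (gap_fun E) g) < e / 3" "gap_fun ` DD \<noteq> {}" by (simp_all add: infdist_notempty)
  then obtain E' where "E' \<in> DD" "gap E E' < e / 3" by (subst (asm) cINF_less_iff) auto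
  then show ?thesis by (auto simp: DD_def)
 qed
 define a where "a E = (SOME b. b \<in> Gr \<and> (\<exists>E'\<in>D b. gap E E' < e / 3))" for E
 have a: "a E \<in> Gr" "\<exists>E'\<in>D (a E). gap E E' < e / 3" if "u E > 0" for E
  using someI_ex[of "\<lambda>b. b \<in> Gr \<and> (\<exists>E'\<in>D b. gap E E' < e / 3)"] near[OF that] unfolding a_def by blast+
 have aV: "E' \<in> VV (a E)" if ug: "u E > 0" "E' \<in> Gr" "gap E E' < e / 6" for E E'
 proof -
  obtain E'' where E'': "E'' \<in> D (a E)" "gap E E'' < e / 3" using a(2)[OF ug(1)] by blast
  have "gap E'' E' < e" using dist_triangle[of "gap_fun E''" "gap_fun E'" "gap_fun E"] E''(2) ug(3) e by (simp add: dist_commute)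
  then show ?thesis using E''(1) ug(2) by (auto simp: D_def)
 qed
 \<comment> \<open>The factor \<open>u E\<close> makes the choice of \<open>a E\<close> harmless
   where it is arbitrary: there \<open>v E\<close> is zero.\<close>
 define v where "v E = u E *\<^sub>R proj E (cE (a E))" for E
 have pa: "isproj (proj E (cE (a E))) E (cE (a E))" if "u E > 0" "E \<in> Gr" for E
  using complement_sym(1)[OF a(1)[OF that(1)] cE[OF a(1)[OF that(1)]]] aV[OF that(1,2)] e by (simp add: VV_def)
 have cv: "continuous_map TG euclidean v"
 proof (rule TG_limit_continuous)
  fix E assume E: "E \<in> Gr"
  \<comment> \<open>Points of \<open>U\<close> are within \<open>e / 6\<close> of each other. Two of
    them with positive bump have pieces at distance below \<open>e / 3 + e / 6 + e / 3 < e\<close>,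
    hence the same index, so a single complement serves on all of \<open>U\<close>.\<close>
  define U where "U = {E' \<in> topspace TG. gap_fun E' \<in> ball (gap_fun E) (e / 12)}"
  have U: "openin TG U" unfolding U_def by (rule openin_continuous_map_preimage[OF continuous_gap_fun]) simp
  have EU: "E \<in> U" using E e by (simp add: U_def)
  have UU: "gap E1 E2 < e / 6" if "E1 \<in> U" "E2 \<in> U" for E1 E2
   using that dist_triangle[of "gap_fun E1" "gap_fun E2" "gap_fun E"] by (simp add: U_def dist_commute)
  show "\<exists>U g. openin TG U \<and> E \<in> U \<and> continuous_map (subtopology TG U) euclidean g \<and> (\<forall>E'\<in>U. g E' = v E')"
  proof (cases "\<exists>E1\<in>U. u E1 > 0")
   case False
   then have "u E' = 0" if "E' \<in> U" for E' using u0[of E'] that by force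
   then have "\<forall>E'\<in>U. 0 = v E'" by (simp add: v_def)
   then show ?thesis using U EU by (intro exI[of _ U] exI[of _ "\<lambda>_. 0"]) auto
  next
   case True
   then obtain E1 where E1: "E1 \<in> U" "u E1 > 0" by blast
   have sub: "U \<subseteq> VV (a E1)" using aV[OF E1(2)] UU[OF E1(1)] by (auto simp: U_def)
   have "a E' = a E1" if E': "E' \<in> U" "u E' > 0" for E'
   proof -
    obtain W where W: "W \<in> D (a E')" "gap E' W < e / 3" using a(2)[OF E'(2)] by blast
    obtain W1 where W1: "W1 \<in> D (a E1)" "gap E1 W1 < e / 3" using a(2)[OF E1(2)] by blast
    have "gap W W1 < e"
     using dist_triangle[of "gap_fun W" "gap_fun W1" "gap_fun E'"] dist_triangle[of "gap_fun E'" "gap_fun W1" "gap_fun E1"]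
      W(2) W1(2) UU[OF E'(1) E1(1)] e by (simp add: dist_commute)
    then show ?thesis using sep[OF W(1) W1(1) a(1)[OF E'(2)] a(1)[OF E1(2)]] by simp
   qed
   then have "\<forall>E'\<in>U. u E' *\<^sub>R proj E' (cE (a E1)) = v E'"
    using u0 unfolding v_def by (metis less_eq_real_def scaleR_zero_left)
   moreover have "continuous_map (subtopology TG U) euclidean (\<lambda>E'. u E' *\<^sub>R proj E' (cE (a E1)))"
   proof -
    have "continuous_map (subtopology TG U) euclidean (\<lambda>E'. proj E' (cE (a E1)))"
     using continuous_map_from_subtopology_mono[OF continuous_proj[OF a(1)[OF E1(2)] cE[OF a(1)[OF E1(2)]]]] sub
     unfolding VV_def by blast
    then show ?thesis
     using continuous_map_from_subtopology[OF cu] unfolding continuous_map_atin by (auto intro: tendsto_scaleR)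
   qed
   ultimately show ?thesis using U EU by blast
  qed
 qed
 have scale: "r *\<^sub>R x \<in> W" if "W \<in> Gr" "x \<in> W" for r x W
  using grassmannianD(1)[OF that(1)] that(2) unfolding closed_lin_whole lin_subspace_whole scale_of_real[symmetric] by blast
 have vp: "v E \<in> OP \<and> (\<forall>x. ap (v E) x \<in> E) \<and> (\<forall>x\<in>E. ap (v E) x = u E *\<^sub>R x)" if E: "E \<in> Gr" for E
 proof (cases "u E > 0")
  case True
  note q = isprojD[OF pa[OF True E]]
  have "v E = bscale op (of_real (u E)) (proj E (cE (a E)))"
   by (rule blinfun_eqI) (simp add: v_def blinfun.scaleR_left scale_of_real)
  then have "v E \<in> OP" using q(1) by simp
  then show ?thesis using q(2,3) scale[OF E] by (simp add: v_def blinfun.scaleR_left)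
 next
  case False
  then have "u E = 0" using u0[of E] by simp
  then show ?thesis using grassmannian_zero(1)[OF E] by (simp add: v_def ap_diff)
 qed
 have pos: "0 < u E" if "E \<in> D b" "b \<in> Gr" for E b
 proof -
  have "E \<in> DD" using that by (auto simp: DD_def)
  then have "infdist (gap_fun E) (gap_fun ` DD) = 0" "DD \<noteq> {}" by auto
  then show ?thesis using e by (simp add: u_def)
 qed
 show ?thesis
  by (intro exI[of _ u] exI[of _ v] conjI cu cv) (use u0 vp pos in \<open>auto simp: D_def\<close>)
qed

lemma continuous_map_series:
 fixes f :: "nat => 'a set => 'z::banach"
 assumes c: "\<And>n. continuous_map TG euclidean (f n)" and le: "\<And>n E. norm (f n E) \<le> (1 / 2) ^ n"
 shows "continuous_map TG euclidean (\<lambda>E. \<Sum>n. f n E)" "summable (\<lambda>n. f n E)"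
proof -
 have geo: "summable (\<lambda>n. (1 / 2 :: real) ^ n)" by (rule summable_geometric) simp
 show s: "summable (\<lambda>n. f n E)" for E by (rule summable_comparison_test'[OF geo, of 0]) (use le in auto)
 have u: "uniform_limit UNIV (\<lambda>n E. \<Sum>i<n. f i E) (\<lambda>E. \<Sum>n. f n E) sequentially"
  by (rule Weierstrass_m_test[OF _ geo]) (use le in auto)
 have "continuous_map TG Met_TC.mtopology (\<lambda>E. \<Sum>n. f n E)"
 proof (rule Met_TC.continuous_map_uniform_limit[where F = sequentially and f = "\<lambda>n E. \<Sum>i<n. f i E"])
  show "\<forall>\<^sub>F n in sequentially. continuous_map TG Met_TC.mtopology (\<lambda>E. \<Sum>i<n. f i E)"
   unfolding mtopology_is_euclidean by (intro always_eventually allI continuous_map_sum c) auto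
  show "\<forall>\<^sub>F n in sequentially. \<forall>x\<in>topspace TG. (\<Sum>n. f n x) \<in> UNIV \<and> dist (\<Sum>i<n. f i x) (\<Sum>n. f n x) < e" if "e > 0" for e
   using uniform_limitD[OF u that] by eventually_elim auto
 qed simp
 then show "continuous_map TG euclidean (\<lambda>E. \<Sum>n. f n E)" unfolding mtopology_is_euclidean .
qed

lemma continuous_section: "\<exists>s. continuous_map TG euclidean s \<and> (\<forall>E\<in>Gr. s E \<in> Fib E)"
proof -
 obtain r where wo: "well_order_on (Gr) r" using well_order_on by blast
 have "\<forall>n. \<exists>u v. continuous_map TG euclideanreal u \<and> continuous_map TG euclidean v \<and>
   (\<forall>E\<in>Gr. 0 \<le> u E \<and> v E \<in> OP \<and> (\<forall>x. ap (v E) x \<in> E) \<and> (\<forall>x\<in>E. ap (v E) x = u E *\<^sub>R x)) \<and>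
   (\<forall>E\<in>Gr. (\<exists>\<alpha>\<in>Gr. E \<in> VV \<alpha> \<and> (\<forall>b\<in>Gr. E \<in> VV b --> (\<alpha>, b) \<in> r) \<and>
    (\<forall>E'\<in>Gr. gap E E' < 1 / (real n + 1) --> E' \<in> VV \<alpha>)) --> 0 < u E)"
  by (intro allI local_sections[OF wo]) simp
 then obtain u v where uv: "\<And>n. continuous_map TG euclideanreal (u n)" "\<And>n. continuous_map TG euclidean (v n)"
  "\<And>n E. E \<in> Gr ==> 0 \<le> u n E \<and> v n E \<in> OP \<and> (\<forall>x. ap (v n E) x \<in> E) \<and> (\<forall>x\<in>E. ap (v n E) x = u n E *\<^sub>R x)"
  "\<And>n E \<alpha>. E \<in> Gr ==> \<alpha> \<in> Gr ==> E \<in> VV \<alpha> ==>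
   (\<forall>b\<in>Gr. E \<in> VV b --> (\<alpha>, b) \<in> r) ==>
   (\<forall>E'\<in>Gr. gap E E' < 1 / (real n + 1) --> E' \<in> VV \<alpha>) ==> 0 < u n E"
  by (metis (no_types, lifting))
 \<comment> \<open>The denominator bounds both \<open>c n E * u n E\<close> and the norm of the
   scaled \<open>v n E\<close> by \<open>(1 / 2) ^ n\<close>, so that the two series whose quotient
   is the section converge uniformly.\<close>
 define c where "c n E = (1 / 2) ^ n / (1 + \<bar>u n E\<bar> + norm (v n E))" for n E
 have c: "c n E > 0" "\<bar>c n E * u n E\<bar> \<le> (1 / 2) ^ n" "norm (c n E *\<^sub>R v n E) \<le> (1 / 2) ^ n" for n E
 proof -
  have p: "1 + \<bar>u n E\<bar> + norm (v n E) > 0" by (simp add: add_pos_nonneg)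
  show "c n E > 0" using p by (simp add: c_def)
  show "\<bar>c n E * u n E\<bar> \<le> (1 / 2) ^ n" "norm (c n E *\<^sub>R v n E) \<le> (1 / 2) ^ n"
   using p by (auto simp: c_def abs_mult divide_le_eq intro!: mult_left_mono)
 qed
 have cc: "continuous_map TG euclideanreal (c n)" for n
  unfolding c_def
 proof (intro continuous_map_real_divide continuous_map_add continuous_map_real_abs continuous_map_norm uv)
  show "1 + \<bar>u n E\<bar> + norm (v n E) \<noteq> 0" for E using norm_ge_zero[of "v n E"] by linarith
 qed simp_all
 have c1: "continuous_map TG euclideanreal (\<lambda>E. c n E * u n E)" for n by (intro continuous_map_real_mult cc uv)
 have c2: "continuous_map TG euclidean (\<lambda>E. c n E *\<^sub>R v n E)" for n
  using cc[of n] uv(2)[of n] unfolding continuous_map_atin by (auto intro: tendsto_scaleR)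
 define \<sigma> where "\<sigma> E = (\<Sum>n. c n E * u n E)" for E
 define \<tau> where "\<tau> E = (\<Sum>n. c n E *\<^sub>R v n E)" for E
 have cs: "continuous_map TG euclideanreal \<sigma>" unfolding \<sigma>_def by (rule continuous_map_series(1)[OF c1]) (use c(2) in simp)
 have ss: "summable (\<lambda>n. c n E * u n E)" for E by (rule continuous_map_series(2)[OF c1]) (use c(2) in simp)
 have ct: "continuous_map TG euclidean \<tau>" unfolding \<tau>_def by (rule continuous_map_series(1)[OF c2 c(3)])
 have st: "summable (\<lambda>n. c n E *\<^sub>R v n E)" for E by (rule continuous_map_series(2)[OF c2 c(3)])
 have pos: "\<sigma> E > 0" if E: "E \<in> Gr" for E
 proof -
  \<comment> \<open>The least index whose chart domain contains \<open>E\<close>, together with a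
    ball of radius \<open>1 / (n + 1)\<close> around \<open>E\<close> inside that domain, makes the
    bump of stage \<open>n\<close> positive at \<open>E\<close>; one positive summand suffices for
    \<open>\<sigma> E > 0\<close>.\<close>
  define A where "A = {\<alpha> \<in> Gr. E \<in> VV \<alpha>}"
  have "E \<in> A" using E VV(2)[OF E] by (simp add: A_def)
  have "wf (r - Id)" using wo by (simp add: well_order_on_def)
  then obtain \<alpha> where \<alpha>: "\<alpha> \<in> A" "\<And>b. (b, \<alpha>) \<in> r - Id ==> b \<notin> A" using wfE_min[OF _ \<open>E \<in> A\<close>] by blast
  have min: "\<forall>b\<in>Gr. E \<in> VV b --> (\<alpha>, b) \<in> r"
  proof (intro ballI impI)
   fix b assume b: "b \<in> Gr" "E \<in> VV b"
   have *: "total_on (Gr) r" "refl_on (Gr) r"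
    using wo by (auto simp: order_on_defs)
   have "\<alpha> \<in> Gr" "(b, \<alpha>) \<notin> r - Id" using \<alpha> b by (auto simp: A_def)
   then show "(\<alpha>, b) \<in> r"
    using * b(1) by (cases "\<alpha> = b") (auto simp: total_on_def refl_on_def)
  qed
  have \<alpha>G: "\<alpha> \<in> Gr" "E \<in> VV \<alpha>" using \<alpha>(1) by (auto simp: A_def)
  have F: "cE \<alpha> \<in> Cpl E"
   using isproj_complement(1)[OF complement_sym(1)[OF \<alpha>G(1) cE[OF \<alpha>G(1)]]] \<alpha>G(2) by (simp add: VV_def)
  obtain d where d: "d > 0" "\<forall>E'\<in>Gr. gap E E' < d --> E' \<in> VV \<alpha>"
   using complements_gap_open[OF E F] unfolding VV_def by blast
  obtain n :: nat where n: "1 / (real n + 1) < d" using d(1) by (metis add.commute nat_approx_posE of_nat_Suc)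
  have "0 < u n E" using uv(4)[OF E \<alpha>G min] d(2) n by force
  then show ?thesis unfolding \<sigma>_def using c(1) uv(3)[OF E] by (intro suminf_pos2[OF ss, of _ n] mult_nonneg_nonneg) (auto intro: less_imp_le)
 qed
 \<comment> \<open>\<open>\<tau> E\<close> maps into \<open>E\<close> and acts on \<open>E\<close>
   as the scalar \<open>\<sigma> E\<close>, so the quotient fixes \<open>E\<close>
   pointwise.\<close>
 define s where "s E = (1 / \<sigma> E) *\<^sub>R \<tau> E" for E
 have "continuous_map TG euclideanreal (\<lambda>E. 1 / \<sigma> E)"
  using pos by (intro continuous_map_real_divide cs) (auto, force)
 then have "continuous_map TG euclidean s"
  using ct unfolding s_def[abs_def] continuous_map_atin by (auto intro: tendsto_scaleR)
 moreover have "s E \<in> Fib E" if E: "E \<in> Gr" for E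
 proof -
  note lE = grassmannianD(1)[OF E, unfolded closed_lin_whole lin_subspace_whole]
  have scale: "k *\<^sub>R x \<in> E" if "x \<in> E" for k x using lE that unfolding scale_of_real[symmetric] by blast
  have sc_OP: "k *\<^sub>R A \<in> OP" if "A \<in> OP" for k A
  proof -
   have "k *\<^sub>R A = bscale op (of_real k) A" by (rule blinfun_eqI) (simp add: blinfun.scaleR_left scale_of_real)
   then show ?thesis using that by simp
  qed
  have lim: "(\<lambda>N. \<Sum>n<N. c n E *\<^sub>R v n E) \<longlonglongrightarrow> \<tau> E" unfolding \<tau>_def using st summable_LIMSEQ by blast
  have "(\<Sum>n<N. c n E *\<^sub>R v n E) \<in> OP" for N by (induction N) (use uv(3)[OF E] sc_OP in auto)
  then have "\<tau> E \<in> OP" using closed_sequentially[OF closed_OP _ lim] by blast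
  moreover have limx: "(\<lambda>N. ap (\<Sum>n<N. c n E *\<^sub>R v n E) x) \<longlonglongrightarrow> ap (\<tau> E) x" for x by (intro tendsto_intros lim)
  have "ap (\<Sum>n<N. c n E *\<^sub>R v n E) x \<in> E" for N x
   by (induction N) (use uv(3)[OF E] scale lE in \<open>auto simp: ap_diff blinfun.scaleR_left\<close>)
  then have "ap (\<tau> E) x \<in> E" for x using closed_sequentially[OF grassmannian_zero(2)[OF E] _ limx] by blast
  moreover have "ap (\<tau> E) x = \<sigma> E *\<^sub>R x" if x: "x \<in> E" for x
  proof -
   have "ap (\<Sum>n<N. c n E *\<^sub>R v n E) x = (\<Sum>n<N. c n E * u n E) *\<^sub>R x" for N
    by (induction N) (use uv(3)[OF E] x in \<open>auto simp: ap_diff blinfun.scaleR_left algebra_simps\<close>)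
   moreover have "(\<lambda>N. (\<Sum>n<N. c n E * u n E) *\<^sub>R x) \<longlonglongrightarrow> \<sigma> E *\<^sub>R x"
    unfolding \<sigma>_def by (intro tendsto_intros summable_LIMSEQ ss)
   ultimately show ?thesis using limx[of x] LIMSEQ_unique by auto
  qed
  ultimately show ?thesis
   unfolding Fib_iff[OF E] s_def using sc_OP scale pos[OF E] by (auto simp: blinfun.scaleR_left)
 qed
 ultimately show ?thesis by blast
qed

subsection \<open>The continuous Banach bundle\<close>

text \<open>The operations and the norm of \<open>Dir E\<close>, pulled back along
  \<open>x \<mapsto> x - s E\<close>. Distances remain those of \<open>op\<close>, which gives the
  isometry with the affine structure.\<close>

definition Zs :: "('a set => 'a \<Rightarrow>\<^sub>L 'a) => 'a set => ('k, 'a \<Rightarrow>\<^sub>L 'a) bspace" where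
 "Zs s E = \<lparr>bcarrier = Fib E, bzero = s E, badd = (\<lambda>x y. x + y - s E), bscale = (\<lambda>c x. bscale op c (x - s E) + s E),
   bnorm = (\<lambda>x. norm (x - s E))\<rparr>"

context
 fixes s assumes cs: "continuous_map TG euclidean s" and sF: "\<And>E. E \<in> Gr ==> s E \<in> Fib E"
begin

abbreviation "Z \<equiv> Zs s"

lemma Z_simps [simp]: "car (Z E) = Fib E" "bzero (Z E) = s E" "badd (Z E) x y = x + y - s E"
 "bscale (Z E) c x = bscale op c (x - s E) + s E" "bnorm (Z E) x = norm (x - s E)" "bdiff (Z E) x y = x - y + s E"
proof -
 have "bscale op (- 1) A = - A" for A by (rule blinfun_eqI) (simp add: ap_diff)
 then show "bdiff (Z E) x y = x - y + s E" by (simp add: bdiff_def Zs_def)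
qed (simp_all add: Zs_def)

lemma FA: "E \<in> Gr ==> affine_dir op (Fib E) (Dir E)"
 using Fib_affine sF by blast

lemma Fib_comb:
 assumes "E \<in> Gr"
 shows "x \<in> Fib E ==> y \<in> Fib E ==> z \<in> Fib E ==> x - y + z \<in> Fib E" "x \<in> Fib E ==> x \<in> OP"
  "x \<in> Fib E ==> bscale op c (x - s E) + s E \<in> Fib E"
proof -
 note d = affine_dirD[OF FA[OF assms] normed_op]
 show "x - y + z \<in> Fib E" if "x \<in> Fib E" "y \<in> Fib E" "z \<in> Fib E" using d(6)[OF that(3) d(5)[OF that(1,2)]] by simp
 show "x \<in> Fib E ==> x \<in> OP" using d(1) by auto
 show "bscale op c (x - s E) + s E \<in> Fib E" if "x \<in> Fib E"
  using d(6)[OF sF[OF assms], of "bscale op c (x - s E)"] d(2) d(5)[OF that sF[OF assms]] by (simp add: lin_subspace_def)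
qed

lemma normed_Z: assumes E: "E \<in> Gr" shows "nspace (Z E)"
proof
 note S = Fib_comb[OF E] sF[OF E]
 show "badd (Z E) x y \<in> car (Z E)" if "x \<in> car (Z E)" "y \<in> car (Z E)" for x y
  using S(1)[of x "s E" y] that S(4) by (simp add: algebra_simps)
 show "bnorm (Z E) (badd (Z E) x y) \<le> bnorm (Z E) x + bnorm (Z E) y" for x y
  using norm_triangle_ineq[of "x - s E" "y - s E"] by (simp add: algebra_simps)
qed (use Fib_comb(3)[OF E] sF[OF E] in \<open>auto simp: norm_op_scale algebra_simps intro!: blinfun_eqI simp: ap_diff scale_right_distrib scale_left_distrib scale_right_diff_distrib\<close>)

lemma Z_top: assumes E: "E \<in> Gr" shows "btop (Z E) = top_of_set (Fib E)" "banach_space (Z E)"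
proof -
 have d: "bnorm (Z E) (bdiff (Z E) x y) = dist x y" for x y by (simp add: dist_norm)
 show "btop (Z E) = top_of_set (Fib E)" using typed_bspace(1)[OF normed_Z[OF E] d] by simp
 have eq: "Fib E = OP \<inter> (\<Inter>x. (\<lambda>H. ap H x) -` E) \<inter> (\<Inter>x\<in>E. {H. ap H x = x})" using Fib_iff[OF E] by blast
 have 1: "closed ((\<lambda>H. ap H x) -` E)" for x
  by (intro continuous_closed_vimage grassmannian_zero(2)[OF E] continuous_intros)
 have 2: "closed {H. ap H x = x}" for x by (intro closed_Collect_eq continuous_intros)
 have "closed (Fib E)" unfolding eq by (intro closed_Int closed_INT ballI closed_OP 1 2)
 then show "banach_space (Z E)" using typed_bspace(2)[OF normed_Z[OF E] d] by (simp add: complete_eq_closed)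
qed

lemma Z_affine: assumes E: "E \<in> Gr" shows "affine_dir (Z E) (Fib E) (Fib E)"
proof (rule affine_dirI[OF normed_Z[OF E] _ _ , where ?a0.0 = "s E"])
 interpret N: nspace "Z E" by (rule normed_Z[OF E])
 show "lin_subspace (Z E) (Fib E)" using N.zero_closed N.add_closed N.scale_closed unfolding lin_subspace_def by simp
qed (use sF[OF E] in auto)

lemma equivalent_Z: assumes E: "E \<in> Gr" shows "equivalent_banach_structure (Z E) op {Q \<in> I. rg Q = E}"
 unfolding equivalent_banach_structure_def Fib_def[symmetric]
proof (intro conjI ballI)
 show "affine_subspace op (Fib E)" using affine_fibers_IM E unfolding affine_fibers_def fiber_IM by simp
 show "affine_map (Z E) (Fib E) op (Fib E) (\<lambda>x. x)"
  unfolding affine_map_def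
 proof (intro conjI ballI)
  fix a0 assume a0: "a0 \<in> Fib E"
  have lp: "lin_part (Z E) op a0 (\<lambda>x. x) h = h - s E" for h by (simp add: lin_part_def)
  show "is_linear (bsub (Z E) (translate (Z E) (Fib E) a0)) op (lin_part (Z E) op a0 (\<lambda>x. x))"
   unfolding affine_dirD(4)[OF Z_affine[OF E] normed_Z[OF E] a0]
   by (rule is_linearI) (use Fib_comb(2)[OF E] sF[OF E] in \<open>auto simp: lp algebra_simps\<close>)
 qed simp
 show "bdist (Z E) x y = bdist op x y" if "x \<in> Fib E" "y \<in> Fib E" for x y
  using that Fib_comb(2)[OF E] by (simp add: bdist_def)
qed (use Z_top[OF E] in simp_all)

definition Tz :: "'a set => 'a set \<times> ('a \<Rightarrow>\<^sub>L 'a) => ('a \<Rightarrow>\<^sub>L 'a)" where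
 "Tz E z = ((idb + NN E (fst z)) oL (snd z - s E) oL (idb - NN E (fst z))) + s (fst z)"
definition Tzi :: "'a set => ('a \<Rightarrow>\<^sub>L 'a) => ('a \<Rightarrow>\<^sub>L 'a)" where
 "Tzi E R = ((idb - NN E (rg R)) oL (R - s (rg R)) oL (idb + NN E (rg R))) + s E"

text \<open>The linear trivialisation is the affine one, translated so that origins correspond;
  membership in the fibres then follows from their closure under \<open>x - y + z\<close>.\<close>

lemma Tz_Th:
 shows "Tz E (w, x) = Th E (w, x) - Th E (w, s E) + s w"
  "rg R = w ==> w \<in> Gr ==> Tzi E R = Thi E R - Thi E (s w) + s E"
 using sF[of w] by (auto simp: Tz_def Th_def Tzi_def Thi_def Fib_def ap_diff intro!: blinfun_eqI)

context
 fixes E assumes E: "E \<in> Gr"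
begin

lemma Tz: assumes \<omega>: "\<omega> \<in> VV E"
 shows "x \<in> Fib E ==> Tz E (\<omega>, x) \<in> Fib \<omega>" "R \<in> Fib \<omega> ==> Tzi E R \<in> Fib E"
  "R \<in> Fib \<omega> ==> Tz E (\<omega>, Tzi E R) = R" "x \<in> Fib E ==> Tzi E (Tz E (\<omega>, x)) = x"
proof -
 have \<omega>G: "\<omega> \<in> Gr" using VV(3)[OF E] \<omega> by blast
 note s\<omega> = sF[OF \<omega>G] and sE = sF[OF E]
 note N2 = NN(2)[OF E \<omega>]
 show 1: "Tz E (\<omega>, x) \<in> Fib \<omega>" if "x \<in> Fib E"
  unfolding Tz_Th(1) by (intro Fib_comb(1)[OF \<omega>G] Th_Fib[OF E \<omega>] that s\<omega> sE)
 have rm: "rg R = \<omega>" if "R \<in> Fib \<omega>" for R using that by (simp add: Fib_def)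
 show "Tzi E R \<in> Fib E" if "R \<in> Fib \<omega>"
  unfolding Tz_Th(2)[OF rm[OF that] \<omega>G] by (intro Fib_comb(1)[OF E] Thi_Fib(1)[OF E \<omega>] that s\<omega> sE)
 show "Tz E (\<omega>, Tzi E R) = R" if "R \<in> Fib \<omega>"
  using rm[OF that] by (intro blinfun_eqI) (simp add: Tz_def Tzi_def ap_diff N2)
 show "Tzi E (Tz E (\<omega>, x)) = x" if "x \<in> Fib E"
  unfolding Tzi_def rm[OF 1[OF that]] by (intro blinfun_eqI) (simp add: Tz_def ap_diff N2)
qed

lemma Tz_homeo:
 "homeomorphic_maps (prod_topology (subtopology TG (VV E)) (top_of_set (Fib E))) (top_of_set (I \<inter> rg -` VV E))
   (Tz E) (\<lambda>R. (rg R, Tzi E R))"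
 unfolding homeomorphic_maps_def
proof (intro conjI)
 let ?P = "prod_topology (subtopology TG (VV E)) (top_of_set (Fib E))"
 have topP: "topspace ?P = VV E \<times> Fib E" using VV(3)[OF E] by auto
 have cN1: "continuous_map ?P euclidean (\<lambda>z. NN E (fst z))" "continuous_map ?P euclidean (\<lambda>z. s (fst z))"
  using continuous_map_compose[OF continuous_map_fst continuous_NN[OF E]]
   continuous_map_compose[OF continuous_map_fst continuous_map_from_subtopology[OF cs]] by (simp_all add: comp_def)
 show "continuous_map ?P (top_of_set (I \<inter> rg -` VV E)) (Tz E)"
  unfolding continuous_map_in_subtopology
 proof
  show "continuous_map ?P euclidean (Tz E)"
   unfolding Tz_def[abs_def] using continuous_map_into_fulltopology[OF continuous_map_snd]
   by (intro continuous_map_blinfun_compose continuous_map_add continuous_map_diff cN1) auto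
  show "Tz E \<in> topspace ?P \<rightarrow> I \<inter> rg -` VV E"
   unfolding topP using Tz(1) by (auto simp: Fib_def)
 qed
 have cr: "continuous_map (top_of_set (I \<inter> rg -` VV E)) (subtopology TG (VV E)) rg"
  using continuous_map_from_subtopology_mono[OF continuous_range_map, of "I \<inter> rg -` VV E"]
  by (auto simp: continuous_map_in_subtopology)
 have cN2: "continuous_map (top_of_set (I \<inter> rg -` VV E)) euclidean (\<lambda>R. NN E (rg R))"
  "continuous_map (top_of_set (I \<inter> rg -` VV E)) euclidean (\<lambda>R. s (rg R))"
  using continuous_map_compose[OF cr continuous_NN[OF E]] continuous_map_compose[OF cr continuous_map_from_subtopology[OF cs]]
  by (simp_all add: comp_def)
 have ct: "continuous_map (top_of_set (I \<inter> rg -` VV E)) euclidean (Tzi E)"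
  unfolding Tzi_def[abs_def]
  by (intro continuous_map_blinfun_compose continuous_map_add continuous_map_diff cN2)
    (auto intro: continuous_map_from_subtopology)
 have im: "Tzi E R \<in> Fib E" if "R \<in> I" "rg R \<in> VV E" for R using Tz(2)[OF that(2), of R] that by (simp add: Fib_def)
 show "continuous_map (top_of_set (I \<inter> rg -` VV E)) ?P (\<lambda>R. (rg R, Tzi E R))"
  unfolding continuous_map_pairwise using cr ct im by (auto simp: comp_def continuous_map_in_subtopology)
 show "\<forall>z\<in>topspace ?P. (rg (Tz E z), Tzi E (Tz E z)) = z"
  unfolding topP using Tz(1,4) by (auto simp: Fib_def)
 show "\<forall>R\<in>topspace (top_of_set (I \<inter> rg -` VV E)). Tz E (rg R, Tzi E R) = R"
  using Tz(3) by (auto simp: Fib_def)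
qed

lemma Tz_trivialization:
 "continuous_trivialization (mtop IM) TG rg Z E (VV E) (Tz E)" "fiberwise_linear (mtop IM) rg Z E (VV E) (Tz E)"
proof -
 have top: "subtopology (btop (Z E)) (Fib E) = top_of_set (Fib E)" unfolding Z_top(1)[OF E] by (simp add: subtopology_subtopology)
 then show "continuous_trivialization (mtop IM) TG rg Z E (VV E) (Tz E)"
  unfolding continuous_trivialization_def fiber_IM
  unfolding mtop_IM sub_IM_top top
  using VV(1,2)[OF E] homeomorphic_maps_imp_map[OF Tz_homeo] by (intro conjI)
 show "fiberwise_linear (mtop IM) rg Z E (VV E) (Tz E)"
  unfolding fiberwise_linear_def fiber_IM
 proof (intro ballI conjI)
  fix w assume w: "w \<in> VV E"
  show "is_linear (Z E) (Z w) (\<lambda>x. Tz E (w, x))"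
   using Tz(1)[OF w] NN(1)[OF E w]
   by (intro is_linearI) (auto simp: Tz_def ap_diff OP_D scale_right_distrib scale_right_diff_distrib intro!: blinfun_eqI)
  show "(\<lambda>x. Tz E (w, x)) ` Fib E = Fib w"
   using Tz(1-3)[OF w] by (metis (no_types, lifting) image_eqI image_subsetI subsetI subset_antisym)
 qed
qed

end

text \<open>In \<open>Tzi E2 (Tz E1 (w, x))\<close> the moving origin \<open>s w\<close> is added
  and removed again, leaving \<open>x - s E1\<close> between the two operators \<open>TA\<close>,
  with \<open>s E2\<close> added. The estimate is then that of the affine bundle, with
  \<open>a0 - s E1\<close> in place of \<open>a0\<close>.\<close>

lemma continuous_transitions_Z: "continuous_transitions (mtop IM) TG rg Z VV Tz"
 unfolding continuous_transitions_def fiber_IM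
proof (intro ballI impI)
 fix E1 E2 a0 assume "E1 \<in> topspace TG" "E2 \<in> topspace TG" and a0: "a0 \<in> Fib E1"
 then have E1: "E1 \<in> Gr" and E2: "E2 \<in> Gr" by auto
 note nZ = normed_Z[OF E1] normed_Z[OF E2]
 note A = Z_affine[OF E1]
 let ?BF = "baff (Z E1) (Fib E1) a0 (Z E2)"
 interpret B: nspace ?BF by (rule normed_baff[OF nZ A a0])
 define tr where "tr = transition (mtop IM) rg VV Tz E1 E2"
 define R where "R w h = TA E1 E2 w oL (h - s E1) oL TA E2 E1 w" for w h
 have tr: "tr w = (\<lambda>x\<in>Fib E1. R w x + s E2)" and trF: "x \<in> Fib E1 ==> R w x + s E2 \<in> Fib E2"
  if w: "w \<in> VV E1 \<inter> VV E2" for w x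
 proof -
  have *: "snd (inv_into (VV E2 \<times> Fib E2) (Tz E2) (Tz E1 (w, x))) = R w x + s E2 \<and> R w x + s E2 \<in> Fib E2" if x: "x \<in> Fib E1" for x
  proof -
   define y where "y = Tzi E2 (Tz E1 (w, x))"
   have T: "Tz E1 (w, x) \<in> Fib w" using Tz(1)[OF E1 _ x] w by blast
   have y: "y \<in> Fib E2" "Tz E2 (w, y) = Tz E1 (w, x)" using Tz(2,3)[OF E2 _ T] w by (auto simp: y_def)
   have inj: "inj_on (Tz E2) (VV E2 \<times> Fib E2)"
    by (rule inj_on_inverseI[where g = "\<lambda>R. (rg R, Tzi E2 R)"]) (use Tz(1,4)[OF E2] in \<open>auto simp: Fib_def\<close>)
   have "inv_into (VV E2 \<times> Fib E2) (Tz E2) (Tz E1 (w, x)) = (w, y)"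
    by (rule inv_into_f_eq[OF inj]) (use y w in auto)
   moreover have "y = R w x + s E2"
    using T by (intro blinfun_eqI) (simp add: y_def Tzi_def Fib_def, simp add: Tz_def R_def TA_def ap_diff)
   ultimately show ?thesis using y by simp
  qed
  show "tr w = (\<lambda>x\<in>Fib E1. R w x + s E2)" unfolding tr_def transition_def fiber_IM using * by (auto simp: restrict_def fun_eq_iff)
  show "x \<in> Fib E1 ==> R w x + s E2 \<in> Fib E2" using * by blast
 qed
 have hA: "h + a0 - s E1 \<in> Fib E1" if "h \<in> Fib E1" for h using affine_dirD(6)[OF A nZ(1) a0 that] by simp
 have trB: "tr w \<in> car ?BF" if w: "w \<in> VV E1 \<inter> VV E2" for w
  unfolding baff_carrier[OF nZ A a0]
 proof (intro conjI)
  show "tr w \<in> extensional (Fib E1)" "tr w ` Fib E1 \<subseteq> car (Z E2)" using tr[OF w] trF[OF w] by auto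
  have lp: "lin_part (Z E1) (Z E2) a0 (tr w) h = R w h + s E2" if h: "h \<in> Fib E1" for h
   unfolding lin_part_def tr[OF w] using hA[OF h] a0 by (simp add: R_def, intro blinfun_eqI) (simp add: ap_diff)
  have "is_linear (bsub (Z E1) (Fib E1)) (Z E2) (lin_part (Z E1) (Z E2) a0 (tr w))"
  proof (rule is_linear_cong[where T = "\<lambda>h. R w h + s E2"])
   show "is_linear (bsub (Z E1) (Fib E1)) (Z E2) (\<lambda>h. R w h + s E2)"
    using trF[OF w] TA_OP[OF E1 E2 w]
    by (intro is_linearI) (auto simp: R_def ap_diff OP_D scale_right_distrib scale_right_diff_distrib intro!: blinfun_eqI)
  qed (use lp nspace.normed_bsub[OF nZ(1) affine_dirD(2)[OF A nZ(1)]] in auto)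
  moreover have "\<forall>h\<in>Fib E1. norm (lin_part (Z E1) (Z E2) a0 (tr w) h - s E2) \<le> norm (TA E1 E2 w) * norm (TA E2 E1 w) * norm (h - s E1)"
   using norm_compose3 by (auto simp: lp R_def)
  ultimately show "bounded_lin (bsub (Z E1) (Fib E1)) (Z E2) (lin_part (Z E1) (Z E2) a0 (tr w))"
   unfolding bounded_lin_def by auto
 qed
 have top: "topspace (subtopology TG (VV E1 \<inter> VV E2)) = VV E1 \<inter> VV E2" using VV(3)[OF E1] by auto
 have AMi: "S \<in> affine_maps (Z E1) (Fib E1) (Z E2) (Fib E2) \<longleftrightarrow> S \<in> car ?BF" for S
  by (auto simp: affine_maps_def baff_def)
 show "continuous_map (subtopology TG (VV E1 \<inter> VV E2))
   (subtopology (btop ?BF) (affine_maps (Z E1) (Fib E1) (Z E2) (Fib E2))) (transition (mtop IM) rg VV Tz E1 E2)"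
  unfolding continuous_map_in_subtopology tr_def[symmetric]
 proof
  show "tr \<in> topspace (subtopology TG (VV E1 \<inter> VV E2)) \<rightarrow> affine_maps (Z E1) (Fib E1) (Z E2) (Fib E2)"
   unfolding top using trB AMi by blast
  show "continuous_map (subtopology TG (VV E1 \<inter> VV E2)) (btop ?BF) tr"
  proof (rule B.continuous_map_by_bound, unfold top)
   show "tr ` (VV E1 \<inter> VV E2) \<subseteq> car ?BF" using trB by blast
   fix w0 assume w0: "w0 \<in> VV E1 \<inter> VV E2"
   define \<rho> where "\<rho> w = norm (TA E1 E2 w - TA E1 E2 w0) * norm (TA E2 E1 w) + norm (TA E1 E2 w0) * norm (TA E2 E1 w - TA E2 E1 w0)" for w
   have "bnorm ?BF (bdiff ?BF (tr w) (tr w0)) \<le> (1 + norm (a0 - s E1)) * \<rho> w" if w: "w \<in> VV E1 \<inter> VV E2" for w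
   proof -
    have d: "bdiff ?BF (tr w) (tr w0) = (\<lambda>x\<in>Fib E1. R w x - R w0 x + s E2)"
     unfolding bdiff_baff_eq[OF nZ A a0] tr[OF w] tr[OF w0] by (auto simp: restrict_def fun_eq_iff)
    have le: "norm (R w h - R w0 h) \<le> \<rho> w * norm (h - s E1)" for h
     using norm_compose3_diff[of "TA E1 E2 w" "h - s E1" "TA E2 E1 w"] by (simp add: R_def \<rho>_def)
    have "bnorm ?BF (bdiff ?BF (tr w) (tr w0)) \<le> \<rho> w + \<rho> w * norm (a0 - s E1)"
    proof (rule baff_norm_le[OF nZ A a0])
     show "bnorm (Z E2) (lin_part (Z E1) (Z E2) a0 (bdiff ?BF (tr w) (tr w0)) h) \<le> \<rho> w * bnorm (Z E1) h" if h: "h \<in> Fib E1" for h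
     proof -
      have "lin_part (Z E1) (Z E2) a0 (bdiff ?BF (tr w) (tr w0)) h = R w h - R w0 h + s E2"
       unfolding d lin_part_def using hA[OF h] a0 by (simp add: R_def, intro blinfun_eqI) (simp add: ap_diff)
      then show ?thesis using le[of h] by simp
     qed
     show "bnorm (Z E2) (bdiff ?BF (tr w) (tr w0) a0) \<le> \<rho> w * norm (a0 - s E1)" unfolding d using le[of a0] a0 by simp
    qed (simp add: \<rho>_def)
    then show ?thesis by (simp add: algebra_simps)
   qed
   then show "\<exists>r. continuous_map (subtopology TG (VV E1 \<inter> VV E2)) euclideanreal r \<and> r w0 = 0 \<and>
     (\<forall>w\<in>VV E1 \<inter> VV E2. bnorm ?BF (bdiff ?BF (tr w) (tr w0)) \<le> r w)"
    using continuous_TA_bound[OF E1 E2 w0, of "1 + norm (a0 - s E1)"] unfolding \<rho>_def by blast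
  qed
 qed
qed

lemma continuous_bundle_Z: "continuous_banach_bundle (mtop IM) TG rg Z"
 unfolding continuous_banach_bundle_def
proof (intro conjI)
 show "Hausdorff_space (mtop IM)" by (simp add: Hausdorff_space_subtopology)
 show "Hausdorff_space TG" by (rule Hausdorff_TG)
 show "continuous_map (mtop IM) TG rg" using continuous_range_map by simp
 show "rg ` topspace (mtop IM) = topspace TG" using range_map_onto by simp
 show "banach_fibers (mtop IM) TG rg Z"
  unfolding banach_fibers_def fiber_IM
 proof (intro ballI conjI)
  fix E assume "E \<in> topspace TG"
  then have E: "E \<in> Gr" by simp
  show "banach_space (Z E)" "car (Z E) = Fib E" using Z_top[OF E] by auto
  have "Fib E \<subseteq> I" by (auto simp: Fib_def)
  then show "subtopology (mtop IM) (Fib E) = btop (Z E)"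
   unfolding Z_top(1)[OF E] by (simp add: subtopology_subtopology Int_absorb1)
 qed
 show "\<exists>V \<Theta>. (\<forall>w0\<in>topspace TG. continuous_trivialization (mtop IM) TG rg Z w0 (V w0) (\<Theta> w0) \<and>
   fiberwise_linear (mtop IM) rg Z w0 (V w0) (\<Theta> w0)) \<and> continuous_transitions (mtop IM) TG rg Z V \<Theta>"
  using Tz_trivialization continuous_transitions_Z by (intro exI[of _ VV] exI[of _ Tz]) auto
qed

end

theorem continuous_banach_bundle_IM:
 "\<exists>Z. (\<forall>E\<in>Gr. equivalent_banach_structure (Z E) op {Q \<in> I. rg Q = E}) \<and>
   continuous_banach_bundle (mtop IM) TG rg Z"
proof -
 obtain s where s: "continuous_map TG euclidean s" "\<And>E. E \<in> Gr ==> s E \<in> Fib E"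
  using continuous_section by blast
 have "\<forall>E\<in>Gr. equivalent_banach_structure (Zs s E) op {Q \<in> I. rg Q = E}"
  using equivalent_Z[OF s] by blast
 moreover have "continuous_banach_bundle (mtop IM) TG rg (Zs s)" by (rule continuous_bundle_Z[OF s])
 ultimately show ?thesis by (intro exI[of _ "Zs s"] conjI)
qed

end

subsection \<open>Hahn--Banach functionals\<close>

text \<open>Domination by the norm is part of the notion: it keeps the infima of such functionals
  finite and bounds the resulting linear functional by 1.\<close>

definition sublinear :: "('a::real_normed_vector => real) => bool" where
 "sublinear p \<longleftrightarrow> (\<forall>x y. p (x + y) \<le> p x + p y) \<and> (\<forall>r>0. \<forall>x. p (r *\<^sub>R x) \<le> r * p x) \<and> (\<forall>x. p x \<le> norm x)"

lemma sublinearD: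
 assumes "sublinear p"
 shows "p (x + y) \<le> p x + p y" "p x \<le> norm x" "p 0 = 0" "- norm x \<le> p x" "0 \<le> r ==> p (r *\<^sub>R x) = r * p x"
proof -
 show a: "p (x + y) \<le> p x + p y" "p x \<le> norm x" for x y using assms by (auto simp: sublinear_def)
 show z: "p 0 = 0" using a(1)[of 0 0] a(2)[of 0] by simp
 show "- norm x \<le> p x" using a(1)[of x "- x"] a(2)[of "- x"] z by simp
 show "p (r *\<^sub>R x) = r * p x" if r: "0 \<le> r"
 proof (cases "r = 0")
  case False
  then have "p (r *\<^sub>R x) \<le> r * p x" "p ((1 / r) *\<^sub>R (r *\<^sub>R x)) \<le> (1 / r) * p (r *\<^sub>R x)"
   using assms r unfolding sublinear_def by (simp, metis less_eq_real_def zero_less_divide_1_iff)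
  then show ?thesis using False r by (simp add: field_simps)
 qed (simp add: z)
qed

text \<open>The standard lowering of \<open>p\<close> along \<open>y\<close>, by the infimum of
  \<open>p (x + t y) - t p y\<close> over nonnegative \<open>t\<close>. Taking \<open>t = 0\<close>
  shows \<open>q \<le> p\<close>, and \<open>t = 1\<close> at \<open>- y\<close> gives the last
  inequality.\<close>

lemma sublinear_shift:
 assumes p: "sublinear p"
 shows "\<exists>q. sublinear q \<and> (\<forall>x. q x \<le> p x) \<and> q (- y) \<le> - p y"
proof -
 note d = sublinearD[OF p]
 define q where "q x = (INF t\<in>{0..}. p (x + t *\<^sub>R y) - t * p y)" for x
 have bdd: "bdd_below ((\<lambda>t. p (x + t *\<^sub>R y) - t * p y) ` {0..})" for x
 proof (rule bdd_belowI2)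
  fix t :: real assume "t \<in> {0..}"
  then show "- norm x \<le> p (x + t *\<^sub>R y) - t * p y"
   using d(1)[of "x + t *\<^sub>R y" "- x"] d(2)[of "- x"] d(5)[of t y] by simp
 qed
 have le: "q x \<le> p (x + t *\<^sub>R y) - t * p y" if "t \<ge> 0" for x t
  unfolding q_def using that by (intro cINF_lower bdd) auto
 have ge: "c \<le> q x" if "\<And>t. t \<ge> 0 ==> c \<le> p (x + t *\<^sub>R y) - t * p y" for x c
  unfolding q_def using that by (intro cINF_greatest) auto
 have qp: "q x \<le> p x" for x using le[of 0 x] by simp
 have "q (x + x') \<le> q x + q x'" for x x'
 proof -
  have "q (x + x') - q x' \<le> q x"
  proof (rule ge)
   fix t :: real assume t: "t \<ge> 0"
   have "q (x + x') - (p (x + t *\<^sub>R y) - t * p y) \<le> q x'"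
   proof (rule ge)
    fix t' :: real assume t': "t' \<ge> 0"
    show "q (x + x') - (p (x + t *\<^sub>R y) - t * p y) \<le> p (x' + t' *\<^sub>R y) - t' * p y"
     using le[of "t + t'" "x + x'"] d(1)[of "x + t *\<^sub>R y" "x' + t' *\<^sub>R y"] t t' by (simp add: algebra_simps)
   qed
   then show "q (x + x') - q x' \<le> p (x + t *\<^sub>R y) - t * p y" by simp
  qed
  then show ?thesis by simp
 qed
 moreover have "q (r *\<^sub>R x) \<le> r * q x" if r: "r > 0" for r x
 proof -
  have "q (r *\<^sub>R x) / r \<le> q x"
  proof (rule ge)
   fix t :: real assume t: "t \<ge> 0"
   have "q (r *\<^sub>R x) \<le> p (r *\<^sub>R x + (r * t) *\<^sub>R y) - r * t * p y" using r t by (intro le) simp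
   also have "\<dots> = r * (p (x + t *\<^sub>R y) - t * p y)"
    using d(5)[of r "x + t *\<^sub>R y"] r by (simp add: scaleR_add_right algebra_simps)
   finally show "q (r *\<^sub>R x) / r \<le> p (x + t *\<^sub>R y) - t * p y" using r by (simp add: divide_le_eq mult.commute)
  qed
  then show ?thesis using r by (simp add: divide_le_eq mult.commute)
 qed
 ultimately have "sublinear q" using qp d(2) unfolding sublinear_def by (meson order_trans)
 moreover have "q (- y) \<le> - p y" using le[of 1 "- y"] d(3) by simp
 ultimately show ?thesis using qp by blast
qed

text \<open>A minimal sublinear functional below \<open>p\<close> is odd by \<open>sublinear_shift\<close>, hence linear.\<close>

lemma sublinear_minimal:
 assumes p: "sublinear p"
 shows "\<exists>g. bounded_linear g \<and> (\<forall>x. g x \<le> p x)"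
proof -
 define A where "A = {q. sublinear q \<and> (\<forall>x. q x \<le> p x)}"
 \<comment> \<open>The pointwise order reversed, so that Zorn's lemma returns a minimal
   functional.\<close>
 define P where "P q q' \<longleftrightarrow> (\<forall>x. q' x \<le> q x)" for q q' :: "'a => real"
 have "\<exists>m\<in>A. \<forall>a\<in>A. P m a --> a = m"
 proof (rule predicate_Zorn)
  show "partial_order_on A (relation_of P A)"
   by (auto simp: partial_order_on_def preorder_on_def refl_on_def trans_def antisym_def relation_of_def P_def fun_eq_iff
    intro: order_trans order_antisym)
  fix C assume "C \<in> Chains (relation_of P A)"
  then have CA: "C \<subseteq> A" and tot: "\<And>q q'. q \<in> C ==> q' \<in> C ==> P q q' \<or> P q' q"
   by (auto simp: Chains_def relation_of_def)
  show "\<exists>u\<in>A. \<forall>a\<in>C. P a u"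
  proof (cases "C = {}")
   case True
   then show ?thesis using p by (auto simp: A_def)
  next
   case False
   have s: "q \<in> C ==> sublinear q" for q using CA by (auto simp: A_def)
   define u where "u x = (INF q\<in>C. q x)" for x
   have le: "u x \<le> q x" if "q \<in> C" for q x
    unfolding u_def using that sublinearD(4)[OF s] by (intro cINF_lower bdd_belowI2[where m = "- norm x"])
   have ge: "c \<le> u x" if "\<And>q. q \<in> C ==> c \<le> q x" for c x
    unfolding u_def using that False by (intro cINF_greatest)
   have "u (x + y) \<le> u x + u y" for x y
   proof -
    \<comment> \<open>The chain is totally ordered, so the smaller of \<open>q\<close> and
      \<open>q'\<close> may be used in both slots of subadditivity.\<close>
    have *: "u (x + y) \<le> q x + q' y" if q: "q \<in> C" "q' \<in> C" for q q'
     using tot[OF q] sublinearD(1)[OF s[OF q(1)], of x y] sublinearD(1)[OF s[OF q(2)], of x y] le[OF q(1), of "x + y"]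
      le[OF q(2), of "x + y"] unfolding P_def by (meson add_left_mono add_right_mono order_trans)
    have "u (x + y) - u y \<le> u x"
    proof (rule ge)
     fix q assume q: "q \<in> C"
     have "u (x + y) - q x \<le> u y" by (rule ge) (use *[OF q] in \<open>simp add: diff_le_eq add.commute\<close>)
     then show "u (x + y) - u y \<le> q x" by simp
    qed
    then show ?thesis by simp
   qed
   moreover have "u (r *\<^sub>R x) \<le> r * u x" if r: "r > 0" for r x
   proof -
    have "u (r *\<^sub>R x) / r \<le> u x"
    proof (rule ge)
     fix q assume q: "q \<in> C"
     show "u (r *\<^sub>R x) / r \<le> q x" using le[OF q, of "r *\<^sub>R x"] sublinearD(5)[OF s[OF q], of r x] r
      by (simp add: divide_le_eq mult.commute)
    qed
    then show ?thesis using r by (simp add: divide_le_eq mult.commute)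
   qed
   moreover obtain q where q: "q \<in> C" using False by blast
   have up: "u x \<le> p x" for x using le[OF q, of x] q CA by (auto simp: A_def intro: order_trans)
   ultimately have "sublinear u" using sublinearD(2)[OF p] unfolding sublinear_def by (meson order_trans)
   then show ?thesis using up le by (auto simp: A_def P_def)
  qed
 qed
 then obtain g where g: "g \<in> A" "\<And>q. q \<in> A ==> \<forall>x. q x \<le> g x ==> q = g" by (auto simp: P_def)
 have sg: "sublinear g" and gp: "g x \<le> p x" for x using g(1) by (auto simp: A_def)
 note d = sublinearD[OF sg]
 have odd: "g (- y) = - g y" for y
 proof -
  obtain q where q: "sublinear q" "\<forall>x. q x \<le> g x" "q (- y) \<le> - g y" using sublinear_shift[OF sg] by blast
  then have "q \<in> A" using gp unfolding A_def by (blast intro: order_trans)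
  then have "q = g" using g(2) q(2) by blast
  then show ?thesis using q(3) d(1)[of y "- y"] d(3) by simp
 qed
 have "bounded_linear g"
 proof (rule bounded_linear_intro[where K = 1])
  show "g (x + y) = g x + g y" for x y
   using d(1)[of x y] d(1)[of "x + y" "- y"] odd[of y] by simp
  show "g (r *\<^sub>R x) = r *\<^sub>R g x" for r x
   using d(5)[of r x] d(5)[of "- r" x] odd[of "r *\<^sub>R x"] by (cases "r \<ge> 0") auto
  show "norm (g x) \<le> norm x * 1" for x using d(2)[of x] d(4)[of x] by simp
 qed
 then show ?thesis using gp by blast
qed

text \<open>Shifting the norm along \<open>e\<close> gives \<open>p (- e) \<le> - norm e\<close>. A
  linear \<open>g\<close> below \<open>p\<close> then satisfies
  \<open>g e = - g (- e) \<ge> norm e\<close>.\<close>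

lemma real_functional_exists:
 fixes e :: "'a::real_normed_vector"
 assumes "e \<noteq> 0"
 shows "\<exists>g. bounded_linear g \<and> g e > (0 :: real)"
proof -
 have "sublinear (norm :: 'a => real)" by (auto simp: sublinear_def norm_triangle_ineq)
 from sublinear_shift[OF this, of e] obtain p :: "'a => real" where p: "sublinear p" "p (- e) \<le> - norm e" by blast
 obtain g where g: "bounded_linear g" "\<And>x. g x \<le> p x" using sublinear_minimal[OF p(1)] by blast
 have "g e \<ge> norm e" using g(2)[of "- e"] p(2) linear_simps[OF g(1)] by simp
 then have "g e > 0" using assms by (meson less_le_trans zero_less_norm_iff)
 then show ?thesis using g(1) by blast
qed

section \<open>Complex functionals and biorthogonal vectors\<close>

locale C_banach = K_banach sc for sc :: "complex => 'a::banach => 'a"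
begin

definition functional :: "('a => complex) => bool" where
 "functional f \<longleftrightarrow> bounded_linear f \<and> (\<forall>c x. f (sc c x) = c * f x)"

lemma functionalD:
 assumes "functional f"
 shows "f (x + y) = f x + f y" "f (x - y) = f x - f y" "f (sc c x) = c * f x" "f 0 = 0" "f (- x) = - f x"
 using assms by (auto simp: functional_def linear_simps)

lemma functional_scale: "functional f ==> functional (\<lambda>x. c * f x)"
 by (auto simp: functional_def intro: bounded_linear_const_mult)

lemma functional_diff: "functional f ==> functional g ==> functional (\<lambda>x. f x - g x)"
 by (auto simp: functional_def algebra_simps intro: bounded_linear_sub)

text \<open>A real functional \<open>g\<close> is complexified to \<open>g x - i g (i x)\<close>,
  whose real part at \<open>e\<close> is positive, and then rescaled.\<close>

lemma functional_exists:
 assumes "e \<noteq> 0" shows "\<exists>f. functional f \<and> f e = 1"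
proof -
 obtain g :: "'a => real" where g: "bounded_linear g" "g e > 0" using real_functional_exists[OF assms] by blast
 define f where "f x = complex_of_real (g x) - \<i> * complex_of_real (g (sc \<i> x))" for x
 note l = linear_simps[OF g(1)]
 have r: "g (sc (complex_of_real a) x) = a * g x" for a x by (simp add: l scale_of_real)
 have c: "f (sc c x) = c * f x" for c x
 proof -
  have 1: "sc c x = sc (complex_of_real (Re c)) x + sc (complex_of_real (Im c)) (sc \<i> x)" for x
   by (metis complex_eq scale_left_distrib scale_scale mult.commute)
  have 2: "sc \<i> (sc c x) = sc (complex_of_real (Re c)) (sc \<i> x) - sc (complex_of_real (Im c)) x"
   unfolding 1[of x] by (simp add: scale_right_distrib scale_left_commute[of \<i>]) (simp add: mult.commute)
  have "g (sc c x) = Re c * g x + Im c * g (sc \<i> x)" "g (sc \<i> (sc c x)) = Re c * g (sc \<i> x) - Im c * g x"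
   unfolding 2 by (simp_all add: 1[of x] l r del: scale_scale)
  then show ?thesis by (simp add: f_def complex_eq_iff)
 qed
 have "bounded_linear f"
  unfolding f_def using bounded_linear_compose[OF bounded_linear_of_real g(1)]
   bounded_linear_compose[OF bounded_linear_const_mult[OF bounded_linear_ident]
    bounded_linear_compose[OF bounded_linear_of_real bounded_linear_compose[OF g(1) bounded_linear_sc]]]
  by (intro bounded_linear_sub)
 then have f: "functional f" using c by (simp add: functional_def)
 have "f e \<noteq> 0" using g(2) by (auto simp: f_def complex_eq_iff)
 then show ?thesis using functional_scale[OF f, of "1 / f e"] by (intro exI[of _ "\<lambda>x. 1 / f e * f x"]) simp
qed

text \<open>Take \<open>u\<close>, \<open>v\<close> from a basis and \<open>f2\<close> with
  \<open>f2 u = 1\<close>. Then \<open>e = v - sc (f2 v) u\<close> lies in the kernel of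
  \<open>f2\<close> and is nonzero by independence. A functional \<open>f\<close> with
  \<open>f e = 1\<close> is corrected by \<open>f u\<close> times \<open>f2\<close> to vanish at
  \<open>u\<close>.\<close>

lemma biorthogonal_exists:
 assumes "dim_gt_one sc"
 shows "\<exists>e u f1 f2. functional f1 \<and> functional f2 \<and> f1 e = 1 \<and> f1 u = 0 \<and> f2 e = 0 \<and> f2 u = 1"
proof -
 obtain B where B: "independent B" "infinite B \<or> card B > 1" using assms by (auto simp: dim_gt_one_def)
 have "\<exists>u v. u \<in> B \<and> v \<in> B \<and> u \<noteq> v"
 proof (rule ccontr)
  assume *: "\<nexists>u v. u \<in> B \<and> v \<in> B \<and> u \<noteq> v"
  then have "\<exists>u. B \<subseteq> {u}" by blast
  then show False using B(2) card_mono[of "{u}" B for u] by (metis card.empty card_insert_if empty_iff finite.simps finite_subset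
   less_numeral_extra(3) not_less One_nat_def card_mono)
 qed
 then obtain u v where uv: "u \<in> B" "v \<in> B" "u \<noteq> v" by blast
 have "u \<noteq> 0" using dependent_zero B(1) uv by blast
 then obtain f2 where f2: "functional f2" "f2 u = 1" using functional_exists by blast
 define e where "e = v - sc (f2 v) u"
 have "e \<noteq> 0"
 proof
  assume "e = 0"
  then have "v \<in> span (B - {v})" using uv span_scale[OF span_base, of u "B - {v}" "f2 v"] by (auto simp: e_def)
  then show False using B(1) uv(2) by (auto simp: dependent_def)
 qed
 then obtain f where f: "functional f" "f e = 1" using functional_exists by blast
 have e2: "f2 e = 0" using functionalD[OF f2(1)] f2(2) by (simp add: e_def)
 have "functional (\<lambda>x. f x - f u * f2 x)" by (intro functional_diff functional_scale f f2)
 then show ?thesis using f f2 e2 by (intro exI[of _ e] exI[of _ u] exI[of _ "\<lambda>x. f x - f u * f2 x"] exI[of _ f2]) auto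
qed

end

subsection \<open>Analytic functions of one complex variable\<close>

abbreviation "CC \<equiv> whole_space ((*) :: complex => complex => complex)"

lemma K_banach_complex: "K_banach ((*) :: complex => complex => complex)"
 by unfold_locales (auto simp: algebra_simps norm_mult scaleR_conv_of_real)

lemmas normed_CC = K_banach.normed_whole[OF K_banach_complex]

lemma CC_simps [simp]:
 "car CC = UNIV" "bzero CC = 0" "badd CC = (+)" "bscale CC = (*)" "bnorm CC = norm"
 by (simp_all add: whole_space_def)

text \<open>Over the complex scalars multilinearity gives
  \<open>m n (h, ..., h) = h ^ n * m n (1, ..., 1)\<close>, so the expansion is an ordinary power
  series.\<close>

lemma analytic_at_CC_holomorphic:
 assumes "analytic_at CC CC z f"
 shows "\<exists>r>0. f holomorphic_on ball z r"
proof -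
 obtain m r C where m: "bounded_family CC CC m r C"
  "\<And>h. norm h < r ==> bsums CC (\<lambda>n. m n (replicate n h)) (f (z + h))"
  using assms by (auto simp: analytic_at_def)
 have r: "r > 0" using m(1) by (simp add: bounded_family_def)
 have mul: "m n (replicate n h) = h ^ n * m n (replicate n 1)" for n h
 proof -
  have "m n (replicate k h @ replicate (n - k) 1) = h ^ k * m n (replicate n 1)" if "k \<le> n" for k
   using that
  proof (induction k)
   case (Suc k)
   let ?xs = "replicate k h @ replicate (n - k) (1::complex)"
   have "multilinear_on CC CC n (m n)" using m(1) by (simp add: bounded_family_def)
   then have "is_linear CC CC (\<lambda>x. m n (?xs[k := x]))" using Suc by (intro multilinear_on_linear) auto
   from is_linearD(3)[OF this, of 1 h] have "m n (?xs[k := h]) = h * m n (?xs[k := 1])" by simp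
   moreover have "n - k = Suc (n - Suc k)" using Suc by simp
   then have "?xs[k := h] = replicate (Suc k) h @ replicate (n - Suc k) 1" "?xs[k := 1] = ?xs"
    by (simp_all add: list_update_append replicate_app_Cons_same)
   ultimately show ?case using Suc by simp
  qed simp
  from this[of n] show ?thesis by simp
 qed
 have ps: "psum CC u = (\<lambda>n. \<Sum>i<n. u i)" for u by (rule ext, rename_tac n, induct_tac n) auto
 have "f holomorphic_on ball z r"
 proof (rule power_series_holomorphic)
  fix w assume "w \<in> ball z r"
  then have "bsums CC (\<lambda>n. m n (replicate n (w - z))) (f w)" using m(2)[of "w - z"] by (simp add: dist_norm norm_minus_commute)
  then have "bsums CC (\<lambda>n. m n (replicate n 1) * (w - z) ^ n) (f w)" by (subst (asm) mul) (simp add: mult.commute)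
  then show "(\<lambda>n. m n (replicate n 1) * (w - z) ^ n) sums f w"
   unfolding bsums_def K_banach.btop_whole[OF K_banach_complex] ps sums_def by simp
 qed
 then show ?thesis using r by blast
qed

subsection \<open>The zero section of an analytic Banach bundle\<close>

text \<open>Fibrewise linear trivialisations send the origin of the fibre over \<open>E\<close> to
  the origin of each neighbouring fibre: \<open>\<Theta> E (w, s E) = s w\<close>. In charts
  \<open>s\<close> is thus \<open>T \<mapsto> (T, 0)\<close> followed by an analytic map. Each
  \<open>E\<close> uses its own trivialisation, so the expansion is stated at the centre of the
  charts based at \<open>E\<close>.\<close>

lemma (in K_banach) analytic_zero_section:
 assumes "analytic_banach_bundle IM GM rg Y"
 shows "\<exists>s. \<forall>E\<in>Gr. s E \<in> Fib E \<and> (\<forall>F\<in>Cpl E.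
  analytic_at (SO E F) op (gchart E F E) (\<lambda>T. s (graph_of E T)))"
proof -
 obtain V \<Theta> where fib: "banach_fibers (mtop IM) TG rg Y"
  and tr: "\<And>w. w \<in> topspace TG ==> analytic_trivialization IM GM rg Y w (V w) (\<Theta> w)"
  and li: "\<And>w. w \<in> topspace TG ==> fiberwise_linear (mtop IM) rg Y w (V w) (\<Theta> w)"
  using assms unfolding analytic_banach_bundle_def by blast
 define s where "s w = bzero (Y w)" for w
 have nZ: "nspace (Y E)" and cZ: "car (Y E) = Fib E" if "E \<in> Gr" for E
  using fib that banach_space_imp_normed unfolding banach_fibers_def fiber_IM by auto
 have sF: "s E \<in> Fib E" if "E \<in> Gr" for E
  using nspace.zero_closed[OF nZ[OF that]] cZ[OF that] by (simp add: s_def)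
 have "analytic_at (SO E F) op (gchart E F E) (\<lambda>T. s (graph_of E T))"
  if E: "E \<in> Gr" and F: "F \<in> Cpl E" for E F
 proof -
  interpret Z: nspace "Y E" by (rule nZ[OF E])
  interpret S: nspace "SO E F" by (rule normed_sub_ops[OF E F])
  have ET: "E \<in> topspace TG" using E by simp
  have V: "openin TG (V E)" "E \<in> V E" using tr[OF ET] by (auto simp: analytic_trivialization_def)
  have VG: "V E \<subseteq> Gr" using openin_subset[OF V(1)] by simp
  have zero: "\<Theta> E (w, s E) = s w" if "w \<in> V E" for w
   unfolding s_def using li[OF ET] that VG by (intro is_linear_zero[OF _ nZ[OF E] nZ]) (auto simp: fiberwise_linear_def)
  let ?PM = "prod_manifold (open_submanifold GM (V E)) (affine_manifold (Y E) (Fib E))"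
  let ?SM = "open_submanifold IM (rg -` V E)"
  have an: "analytic_map ?PM ?SM (\<Theta> E)"
   using tr[OF ET] unfolding analytic_trivialization_def bianalytic_map_def fiber_IM by blast
  have EF: "E \<in> Cpl F" by (rule complements_sym[OF E F])
  have sI: "s E \<in> I" "rg (s E) = E" using sF[OF E] by (auto simp: Fib_def)
  have "s E \<in> \<Union> (fst ` atlas IM)" using banach_manifold_IM sI(1) unfolding banach_manifold_def by simp
  then obtain c where c: "c \<in> atlas IM" "s E \<in> fst c" by blast
  obtain U p W V1 where m: "mchart U p V1 W" and c': "c = (U \<inter> I, p, bsub V1 W)" using c(1) unfolding atlas_IM by blast
  have sU: "s E \<in> U" using c(2) c' by simp
  let ?U1 = "(Cpl F \<inter> V E) \<times> Fib E" and ?U2 = "U \<inter> I \<inter> rg -` V E"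
  let ?p = "map_prod (gchart E F) (\<lambda>a. bdiff (Y E) a (s E))" and ?P = "prod_bspace (SO E F) (Y E)"
  \<comment> \<open>Subtracting the origin is the identity, so the chart of the fibre based at
    \<open>s E\<close> has all of \<open>Y E\<close> as its model.\<close>
  have "(\<lambda>a. bdiff (Y E) a (s E)) ` car (Y E) = (\<lambda>a. a) ` car (Y E)"
   by (intro image_cong refl) (simp add: s_def)
  then have "(Fib E, \<lambda>a. bdiff (Y E) a (s E), Y E) \<in> atlas (affine_manifold (Y E) (Fib E))"
   using sF[OF E] cZ[OF E] by (auto simp: affine_manifold_def translate_def intro!: bexI[of _ "s E"])
  moreover have "(Cpl F \<inter> V E, gchart E F, SO E F) \<in> atlas (open_submanifold GM (V E))"
   using E F unfolding atlas_sub_GM by blast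
  ultimately have 1: "(?U1, ?p, ?P) \<in> atlas ?PM" unfolding prod_manifold_def by simp blast
  have 2: "(?U2, p, bsub V1 W) \<in> atlas ?SM" using m unfolding atlas_sub_IM by blast
  have nP: "nspace ?P" by (rule normed_prod[OF normed_sub_ops[OF E F] nZ[OF E]])
  have nY: "nspace (bsub V1 W)" by (rule mchartD(13)[OF m])
  have "banach_analytic_on ?P (bsub V1 W) (?p ` (?U1 \<inter> \<Theta> E -` ?U2)) (p \<circ> \<Theta> E \<circ> inv_into ?U1 ?p)"
   using an 1 2 unfolding analytic_map_def by fast
  note this[unfolded banach_analytic_on_iff[OF nP nY]]
  note op = this[THEN conjunct1] and aa = this[THEN conjunct2, THEN bspec]
  let ?T = "gchart E F E"
  have Tc: "?T \<in> car (SO E F)" by (rule gchart_closed[OF E F EF])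
  have "?p (E, s E) = (?T, bzero (Y E))" using Z.diff_self Z.zero_closed by (simp add: s_def)
  moreover have "(E, s E) \<in> ?U1 \<inter> \<Theta> E -` ?U2" using EF V(2) sF[OF E] zero[OF V(2)] sU sI by auto
  ultimately have in1: "(?T, bzero (Y E)) \<in> ?p ` (?U1 \<inter> \<Theta> E -` ?U2)" by (metis image_eqI)
  have inj: "inj_on ?p ?U1"
  proof (rule map_prod_inj_on)
   show "inj_on (gchart E F) (Cpl F \<inter> V E)" by (rule inj_on_subset[OF inj_gchart[OF E F]]) simp
   show "inj_on (\<lambda>a. bdiff (Y E) a (s E)) (Fib E)"
    by (rule inj_on_inverseI[where g = "\<lambda>a. a"]) (use cZ[OF E] in \<open>auto simp: s_def\<close>)
  qed
  have val: "(p \<circ> \<Theta> E \<circ> inv_into ?U1 ?p) (T, bzero (Y E)) = p (s (graph_of E T)) \<and> s (graph_of E T) \<in> U \<inter> I"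
   if TU: "(T, bzero (Y E)) \<in> ?p ` (?U1 \<inter> \<Theta> E -` ?U2)" for T
  proof -
   obtain w a where wa: "(w, a) \<in> ?U1" "\<Theta> E (w, a) \<in> ?U2" "T = gchart E F w" "bzero (Y E) = bdiff (Y E) a (s E)"
    using TU by auto
   have "a = s E" using wa(1,4) cZ[OF E] by (simp add: s_def)
   moreover have "w = graph_of E T" using graph_gchart[OF E F] wa(1,3) by simp
   moreover have "inv_into ?U1 ?p (?p (w, a)) = (w, a)" by (rule inv_into_f_f[OF inj wa(1)])
   ultimately show ?thesis using wa zero[of w] by simp
  qed
  have "analytic_at (SO E F) ?P ?T (\<lambda>T. (T, bzero (Y E)))"
   by (intro analytic_at_pair analytic_at_const analytic_at_linear[where K = 1] nZ[OF E] normed_sub_ops[OF E F] Tc)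
    (auto simp: is_linear_def)
  then have a1: "analytic_at (SO E F) (bsub V1 W) ?T (\<lambda>T. (p \<circ> \<Theta> E \<circ> inv_into ?U1 ?p) (T, bzero (Y E)))"
   by (rule analytic_at_compose[where f = "\<lambda>T. (T, bzero (Y E))" and g = "p \<circ> \<Theta> E \<circ> inv_into ?U1 ?p"])
    (rule aa[OF in1] normed_sub_ops[OF E F] nP nY)+
  have a2: "analytic_at (bsub V1 W) op ((p \<circ> \<Theta> E \<circ> inv_into ?U1 ?p) (?T, bzero (Y E))) (inv_into (U \<inter> I) p)"
   unfolding val[OF in1, THEN conjunct1] by (rule mchart_inv[OF m]) (use val[OF in1, THEN conjunct2] in blast)+
  obtain r where r: "r > 0" "\<And>h. h \<in> car ?P ==> bnorm ?P h < r ==> badd ?P (?T, bzero (Y E)) h \<in> ?p ` (?U1 \<inter> \<Theta> E -` ?U2)"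
   using op[unfolded nspace.openin_btop[OF nP], THEN conjunct2, THEN bspec, OF in1] by (elim exE conjE) (rule that, assumption, drule (1) bspec, erule (1) mp)
  show ?thesis
  proof (rule analytic_at_cong[OF _ normed_op r(1)])
   show "analytic_at (SO E F) op ?T (\<lambda>T. inv_into (U \<inter> I) p ((p \<circ> \<Theta> E \<circ> inv_into ?U1 ?p) (T, bzero (Y E))))"
    by (rule analytic_at_compose[where f = "\<lambda>T. (p \<circ> \<Theta> E \<circ> inv_into ?U1 ?p) (T, bzero (Y E))" and g = "inv_into (U \<inter> I) p"])
     (rule a1 a2 normed_sub_ops[OF E F] nY normed_op)+
  next
   fix h assume h: "h \<in> car (SO E F)" "bnorm (SO E F) h < r"
   have "badd ?P (?T, bzero (Y E)) (h, bzero (Y E)) = (badd (SO E F) ?T h, bzero (Y E))"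
    using Z.zero_add[OF Z.zero_closed] by simp
   with r(2)[of "(h, bzero (Y E))"] h r(1) Z.zero_closed S.norm_nonneg[OF h(1)]
   have *: "(badd (SO E F) ?T h, bzero (Y E)) \<in> ?p ` (?U1 \<inter> \<Theta> E -` ?U2)" by simp
   show "inv_into (U \<inter> I) p ((p \<circ> \<Theta> E \<circ> inv_into ?U1 ?p) (badd (SO E F) ?T h, bzero (Y E)))
     = s (graph_of E (badd (SO E F) ?T h))"
    unfolding val[OF *, THEN conjunct1]
    by (rule inv_into_f_f[OF inj_on_subset[OF mchartD(3)[OF m] Int_lower1] val[OF *, THEN conjunct2]])
  qed
 qed
 then show ?thesis using sF by blast
qed

section \<open>Projective lines in the Grassmannian and the Liouville argument\<close>

context C_banach
begin

definition rank_one :: "'a => ('a => complex) => ('a \<Rightarrow>\<^sub>L 'a)" where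
 "rank_one b f = Blinfun (\<lambda>x. sc (f x) b)"

lemma rank_one: assumes f: "functional f" shows "ap (rank_one b f) x = sc (f x) b" "rank_one b f \<in> OP"
proof -
 have "bounded_linear (\<lambda>c. sc c b)"
  by (rule bounded_linear_intro[where K = "norm b"])
   (auto simp: scale_left_distrib norm_scale scaleR_conv_of_real simp flip: scale_scale scale_of_real)
 then have "bounded_linear (\<lambda>x. sc (f x) b)" using f bounded_linear_compose by (auto simp: functional_def)
 then show *: "ap (rank_one b f) x = sc (f x) b" for x by (simp add: rank_one_def bounded_linear_Blinfun_apply)
 show "rank_one b f \<in> OP" using functionalD(3)[OF f] by (simp add: OP_def *)
qed

text \<open>For independent \<open>a\<close> and \<open>b\<close> these are the lines in their plane
  other than the span of \<open>b\<close>, i.e. the affine part of a projective line.\<close>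

definition line :: "'a => 'a => complex => 'a set" where "line a b z = range (\<lambda>c. sc c (a + sc z b))"

text \<open>The change of coordinate at infinity: multiplying the spanning vector by
  \<open>z\<close> exchanges the roles of \<open>a\<close> and \<open>b\<close>.\<close>

lemma line_inverse: assumes "z \<noteq> 0" shows "line a b (inverse z) = line b a z"
proof -
 have "b + sc z a = sc z (a + sc (inverse z) b)" using assms by (simp add: scale_right_distrib add.commute)
 then have "sc c (b + sc z a) = sc (c * z) (a + sc (inverse z) b)" for c by (simp only: scale_scale)
 moreover have "sc c (a + sc (inverse z) b) = sc (c / z) (b + sc z a)" for c
  using assms by (simp add: scale_right_distrib divide_inverse add.commute)
 ultimately show ?thesis unfolding line_def by blast
qed

context
 fixes a b f
 assumes f: "functional f" and fa: "f a = 1" and fb: "f b = 0" and b: "b \<noteq> 0"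
begin

text \<open>The projection along the kernel of \<open>f\<close> multiplies \<open>a + z b\<close> by
  \<open>f x\<close>, hence it is affine in \<open>z\<close>.\<close>

lemma isproj_line:
 "isproj (rank_one a f + bscale op z (rank_one b f)) (line a b z) {x. f x = 0}"
proof -
 have ap: "ap (rank_one a f + bscale op z (rank_one b f)) x = sc (f x) (a + sc z b)" for x
  by (simp add: ap_diff rank_one[OF f] scale_right_distrib mult.commute)
 show ?thesis unfolding isproj_def ap line_def
  using rank_one(2)[OF f] functionalD[OF f] fa fb by auto
qed

lemma line_grassmannian: "line a b z \<in> Gr"
proof (rule grassmannianI[OF isproj_line])
 have "f (a + sc z b) = 1" "a + sc z b \<in> line a b z"
  using functionalD[OF f] fa fb by (auto simp: line_def intro!: image_eqI[of _ _ 1])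
 then have "a + sc z b \<noteq> 0" using functionalD(4)[OF f] by (metis zero_neq_one)
 then show "line a b z \<noteq> {0}" using \<open>a + sc z b \<in> line a b z\<close> by blast
 have "x = 0" if "x \<in> line a b z" "f x = 0" for x
  using that functionalD[OF f] fa fb by (auto simp: line_def)
 then show "line a b z \<noteq> UNIV" using fb b by blast
qed

text \<open>In the chart whose complement is the kernel of \<open>f\<close> the line depends
  affinely on \<open>w\<close>. The chart is based at the line for \<open>z\<close>, which is where
  \<open>s\<close> is known to have an expansion.\<close>

lemma analytic_on_line:
 assumes s: "\<And>E F. E \<in> Gr ==> F \<in> Cpl E ==> analytic_at (SO E F) op (gchart E F E) (\<lambda>T. s (graph_of E T))"
  and g: "functional g"
 shows "\<exists>r>0. (\<lambda>w. g (ap (s (line a b w)) x)) holomorphic_on ball z r"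
proof -
 define E F where "E = line a b z" and "F = {x. f x = 0}"
 have p: "isproj (rank_one a f + bscale op w (rank_one b f)) (line a b w) F" for w unfolding F_def by (rule isproj_line)
 have E: "E \<in> Gr" unfolding E_def by (rule line_grassmannian)
 have F: "F \<in> Cpl E" and lF: "\<And>w. line a b w \<in> Cpl F"
  using isproj_complement[OF p] unfolding E_def by auto
 note nS = normed_sub_ops[OF E F] and OPs = rank_one(2)[OF f]
 have "analytic_at CC op z (\<lambda>w. bscale op w (rank_one b f))"
  by (rule analytic_at_linear[OF normed_CC normed_op, where K = "norm (rank_one b f)"])
   (use OPs in \<open>auto simp: is_linear_def norm_op_scale scale_left_distrib ap_diff mult.commute intro!: blinfun_eqI\<close>)
 then have "analytic_at CC op z (\<lambda>w. badd op (rank_one a f) (bscale op w (rank_one b f)))"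
  by (intro analytic_at_add analytic_at_const normed_CC normed_op) (use OPs in auto)
 then have "analytic_at CC op z (\<lambda>w. proj (line a b w) F)" by (simp add: proj_eq[OF p])
 then have 1: "analytic_at CC (SO E F) z (\<lambda>w. gchart E F (line a b w))"
  by (rule analytic_at_gchart[OF normed_CC E F _ zero_less_one]) (rule lF)
 have "analytic_at CC op z (\<lambda>w. s (graph_of E (gchart E F (line a b w))))"
  by (rule analytic_at_compose[OF 1 _ normed_CC nS normed_op]) (use s[OF E F] in \<open>simp add: E_def\<close>)
 then have 2: "analytic_at CC op z (\<lambda>w. s (line a b w))" by (simp add: graph_gchart[OF E F lF])
 obtain K where K: "\<And>x. norm (g x) \<le> norm x * K" "K \<ge> 0" using g bounded_linear.nonneg_bounded unfolding functional_def by blast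
 have "analytic_at CC CC z (\<lambda>w. g (ap (s (line a b w)) x))"
 proof (rule analytic_at_linear_compose[OF normed_CC normed_op normed_CC 2, where K = "K * norm x"])
  show "is_linear op CC (\<lambda>A. g (ap A x))" by (auto simp: is_linear_def functionalD[OF g] ap_diff)
  fix A :: "'a \<Rightarrow>\<^sub>L 'a"
  have "norm (g (ap A x)) \<le> (norm A * norm x) * K"
   using K(1)[of "ap A x"] mult_right_mono[OF norm_blinfun[of A x] K(2)] by linarith
  then show "bnorm CC (g (ap A x)) \<le> K * norm x * bnorm op A" by (simp add: mult_ac)
 qed
 then show ?thesis by (rule analytic_at_CC_holomorphic)
qed

end

theorem no_analytic_banach_bundle:
 assumes dim: "dim_gt_one sc"
 shows "\<not> analytic_banach_bundle IM GM rg Y"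
proof
 assume "analytic_banach_bundle IM GM rg Y"
 from analytic_zero_section[OF this] obtain s where s: "\<forall>E\<in>Gr. s E \<in> Fib E \<and> (\<forall>F\<in>Cpl E.
  analytic_at (SO E F) op (gchart E F E) (\<lambda>T. s (graph_of E T)))" by (elim exE)
 have sF: "s E \<in> Fib E" if "E \<in> Gr" for E by (rule s[rule_format, THEN conjunct1, OF that])
 have sa: "analytic_at (SO E F) op (gchart E F E) (\<lambda>T. s (graph_of E T))"
  if "E \<in> Gr" "F \<in> Cpl E" for E F
  by (rule s[rule_format, THEN conjunct2, rule_format, OF that])
 obtain e u f1 f2 where f: "functional f1" "functional f2" "f1 e = 1" "f1 u = 0" "f2 e = 0" "f2 u = 1"
  using biorthogonal_exists[OF dim] by blast
 note D1 = functionalD[OF f(1)] and D2 = functionalD[OF f(2)]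
 have ne: "e \<noteq> 0" "u \<noteq> 0" using f D1(4) D2(4) by auto
 define F where "F z = f1 (ap (s (line e u z)) e)" for z
 define H where "H w = f2 (ap (s (line u e w)) e)" for w
 have "F holomorphic_on UNIV"
 proof (rule holomorphic_onI)
  fix z
  obtain r where r: "r > 0" "F holomorphic_on ball z r"
   using analytic_on_line[OF f(1,3,4) ne(2) sa f(1), of e z] unfolding F_def by blast
  then have "F field_differentiable at z" by (auto simp: holomorphic_on_open field_differentiable_def)
  then show "F field_differentiable (at z within UNIV)" by simp
 qed
 moreover have "(F \<longlongrightarrow> 0) at_infinity"
 proof -
  obtain r where r: "r > 0" "H holomorphic_on ball 0 r"
   using analytic_on_line[OF f(2,6,5) ne(1) sa f(2), of e 0] unfolding H_def by blast
  have "isCont H 0"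
   using holomorphic_on_imp_continuous_on[OF r(2)] r(1) continuous_on_interior[of "ball 0 r" H 0] by simp
  then have "(H \<longlongrightarrow> H 0) (at 0)" by (simp add: isCont_def)
  then have "((\<lambda>w. w * H w) \<longlongrightarrow> 0 * H 0) (at 0)" by (intro tendsto_intros)
  then have lim: "((\<lambda>w. w * H w) \<longlongrightarrow> 0) (at 0)" by simp
  \<comment> \<open>The value of the section at \<open>e\<close> is a multiple of
    \<open>u + w e\<close>, by \<open>c\<close> say; \<open>f1\<close> reads off \<open>c w\<close>
    and \<open>f2\<close> reads off \<open>c\<close>.\<close>
  have "F (inverse w) = w * H w" if w: "w \<noteq> 0" for w
  proof -
   have L: "line e u (inverse w) = line u e w" by (rule line_inverse[OF w])
   have "ap (s (line u e w)) e \<in> line u e w"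
    using sF[OF line_grassmannian[OF f(2,6,5) ne(1)]] by (auto simp: Fib_def range_map_def)
   then show ?thesis unfolding F_def H_def L using f by (auto simp: line_def D1 D2)
  qed
  then have "((F \<circ> inverse) \<longlongrightarrow> 0) (at 0)"
   using lim by (subst tendsto_cong[where g = "\<lambda>w. w * H w"]) (auto simp: eventually_at_filter)
  then show ?thesis by (simp add: lim_at_infinity_0)
 qed
 ultimately have "F 0 = 0" by (rule Liouville_weak_0)
 moreover have "line e u 0 \<in> Gr" by (rule line_grassmannian[OF f(1,3,4) ne(2)])
 note sF[OF this, unfolded Fib_iff[OF this]]
 moreover have "e \<in> line e u 0" unfolding line_def by (rule range_eqI[of _ _ 1]) simp
 ultimately show False using f(3) by (auto simp: F_def)
qed

end

theorem theorem1:
  fixes sR :: "real \<Rightarrow> 'a::banach \<Rightarrow> 'a"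
    and sC :: "complex \<Rightarrow> 'b::banach \<Rightarrow> 'b"
  shows
    "(K_banach sR \<and> dim_gt_one sR \<longrightarrow>
        analytic_affine_banach_bundle (idempotent_manifold sR) (grassmann_manifold sR) range_map
          (\<lambda>E. op_space sR) \<and>
        (\<exists>Z. (\<forall>E\<in>grassmannian sR.
                 equivalent_banach_structure (Z E) (op_space sR) {Q \<in> idempotents sR. range_map Q = E}) \<and>
             continuous_banach_bundle (mtop (idempotent_manifold sR)) (mtop (grassmann_manifold sR))
               range_map Z)) \<and>
     (K_banach sC \<and> dim_gt_one sC \<longrightarrow>
        analytic_affine_banach_bundle (idempotent_manifold sC) (grassmann_manifold sC) range_map
          (\<lambda>E. op_space sC) \<and>
        (\<exists>Z. (\<forall>E\<in>grassmannian sC.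
                 equivalent_banach_structure (Z E) (op_space sC) {Q \<in> idempotents sC. range_map Q = E}) \<and>
             continuous_banach_bundle (mtop (idempotent_manifold sC)) (mtop (grassmann_manifold sC))
               range_map Z) \<and>
        \<not> (\<exists>Z. analytic_banach_bundle (idempotent_manifold sC) (grassmann_manifold sC) range_map Z))"
proof (intro conjI impI; elim conjE)
  assume "K_banach sR" "dim_gt_one sR"
  interpret K_banach sR by fact
  show "analytic_affine_banach_bundle (idempotent_manifold sR) (grassmann_manifold sR) range_map (\<lambda>E. op_space sR)"
    by (rule analytic_affine_banach_bundle_IM)
  show "\<exists>Z. (\<forall>E\<in>grassmannian sR. equivalent_banach_structure (Z E) (op_space sR) {Q \<in> idempotents sR. range_map Q = E}) \<and>
      continuous_banach_bundle (mtop (idempotent_manifold sR)) (mtop (grassmann_manifold sR)) range_map Z"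
    by (rule continuous_banach_bundle_IM)
next
  assume "K_banach sC" and dim: "dim_gt_one sC"
  interpret C_banach sC by (rule C_banach.intro) fact
  show "analytic_affine_banach_bundle (idempotent_manifold sC) (grassmann_manifold sC) range_map (\<lambda>E. op_space sC)"
    by (rule analytic_affine_banach_bundle_IM)
  show "\<exists>Z. (\<forall>E\<in>grassmannian sC. equivalent_banach_structure (Z E) (op_space sC) {Q \<in> idempotents sC. range_map Q = E}) \<and>
      continuous_banach_bundle (mtop (idempotent_manifold sC)) (mtop (grassmann_manifold sC)) range_map Z"
    by (rule continuous_banach_bundle_IM)
  show "\<not> (\<exists>Z. analytic_banach_bundle (idempotent_manifold sC) (grassmann_manifold sC) range_map Z)"
    using no_analytic_banach_bundle[OF dim] by blast
qed

end
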